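(* There exists $\delta>0$ such that if $(c_{1},a_{1})$ and $(c_{2},a_{2})$ belong to $\mathcal{P}_{\lambda}$ and $0<|a_{i}|<\delta$ for $i=1,2$, then $J_{c_{1},a_{1}}$ is homeomorphic to $J_{c_{2},a_{2}}$ and $(H_{c_{1},a_{1}},J_{c_{1},a_{1}})$ is conjugate to $(H_{c_{2},a_{2}},J_{c_{2},a_{2}})$, i.e. there is a homeomorphism $h:J_{c_1,a_1}\to J_{c_2,a_2}$ with $h\circ H_{c_1,a_1}=H_{c_2,a_2}\circ h$ on $J_{c_1,a_1}$. The same is true for $J^{+}$ instead of $J$: $J^{+}_{c_1,a_1}$ and $J^{+}_{c_2,a_2}$ are homeomorphic by a homeomorphism conjugating $H_{c_1,a_1}|_{J^+_{c_1,a_1}}$ to $H_{c_2,a_2}|_{J^+_{c_2,a_2}}$.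
   Context: Let $p/q$ be a rational number in lowest terms ($q\ge 1$) and $\lambda=e^{2\pi i p/q}$. For $c,a\in\mathbb{C}$, $a\neq 0$, the complex Hénon map is $H_{c,a}(x,y)=(x^{2}+c+ay,\ ax)$, an automorphism of $\mathbb{C}^{2}$. $K^{+}_{c,a}$ (resp. $K^{-}_{c,a}$) is the set of points of $\mathbb{C}^{2}$ with bounded forward (resp. backward) orbit under $H_{c,a}$, $J^{\pm}_{c,a}=\partial K^{\pm}_{c,a}$ and $J_{c,a}=J^{+}_{c,a}\cap J^{-}_{c,a}$. The curve $\mathcal{P}_{\lambda}\subset\mathbb{C}^{2}$ is the set of parameters $(c,a)$ for which $H_{c,a}$ has a fixed point at which the derivative has an eigenvalue $\lambda$; explicitly $$\mathcal{P}_{\lambda}=\left\{(c,a)\in\mathbb{C}^2:\ c=(1-a^{2})\left(\tfrac{\lambda}{2}-\tfrac{a^{2}}{2\lambda}\right)-\left(\tfrac{\lambda}{2}-\tfrac{a^{2}}{2\lambda}\right)^{2}\right\}.$$ *)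

theory Defs
  imports "HOL-Analysis.Analysis"
begin

definition henon :: "complex \<Rightarrow> complex \<Rightarrow> complex \<times> complex \<Rightarrow> complex \<times> complex" where
  "henon c a = (\<lambda>(x, y). (x\<^sup>2 + c + a * y, a * x))"

definition henon_K_plus :: "complex \<Rightarrow> complex \<Rightarrow> (complex \<times> complex) set" where
  "henon_K_plus c a = {z. bounded (range (\<lambda>n. (henon c a ^^ n) z))}"

text \<open>Backward orbits are taken with \<open>inv\<close>, which is the two-sided inverse for \<open>a \<noteq> 0\<close>
  (see \<open>bij_henon\<close> and \<open>inv_henon\<close> below); the set is not meaningful for \<open>a = 0\<close>.\<close>

definition henon_K_minus :: "complex \<Rightarrow> complex \<Rightarrow> (complex \<times> complex) set" where
  "henon_K_minus c a = {z. bounded (range (\<lambda>n. (inv (henon c a) ^^ n) z))}"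

definition henon_J_plus :: "complex \<Rightarrow> complex \<Rightarrow> (complex \<times> complex) set" where
  "henon_J_plus c a = frontier (henon_K_plus c a)"

definition henon_J_minus :: "complex \<Rightarrow> complex \<Rightarrow> (complex \<times> complex) set" where
  "henon_J_minus c a = frontier (henon_K_minus c a)"

definition henon_J :: "complex \<Rightarrow> complex \<Rightarrow> (complex \<times> complex) set" where
  "henon_J c a = henon_J_plus c a \<inter> henon_J_minus c a"

text \<open>The type \<open>complex \<times> complex\<close> carries only a real scalar multiplication, so multiplication
  of an eigenvector by the complex scalar is written out componentwise.\<close>

definition eigenvalue_C2 :: "(complex \<times> complex \<Rightarrow> complex \<times> complex) \<Rightarrow> complex \<Rightarrow> bool" where
  "eigenvalue_C2 D \<mu> \<longleftrightarrow> (\<exists>v. v \<noteq> 0 \<and> D v = (\<mu> * fst v, \<mu> * snd v))"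

definition henon_param_curve :: "complex \<Rightarrow> (complex \<times> complex) set" where
  "henon_param_curve \<mu> = {(c, a). \<exists>z D. henon c a z = z \<and>
     (henon c a has_derivative D) (at z) \<and> eigenvalue_C2 D \<mu>}"

definition conjugate_on ::
  "('a::topological_space \<Rightarrow> 'a) \<Rightarrow> 'a set \<Rightarrow> ('b::topological_space \<Rightarrow> 'b) \<Rightarrow> 'b set \<Rightarrow> bool" where
  "conjugate_on f S g T \<longleftrightarrow>
     (\<exists>h k. homeomorphism S T h k \<and> (\<forall>z\<in>S. h (f z) = g (h z)))"

lemma bij_henon:
  assumes "a \<noteq> 0"
  shows "bij (henon c a)"
proof (rule bij_betw_byWitness[where f' = "\<lambda>(x, y). (y / a, (x - (y / a)\<^sup>2 - c) / a)"])
qed (use assms in \<open>auto simp: henon_def\<close>)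

lemma inv_henon:
  assumes "a \<noteq> 0"
  shows "inv (henon c a) = (\<lambda>(x, y). (y / a, (x - (y / a)\<^sup>2 - c) / a))"
  by (rule inv_unique_comp) (use assms in \<open>auto simp: henon_def fun_eq_iff\<close>)

lemma henon_has_derivative:
  "(henon c a has_derivative (\<lambda>v. (2 * fst z * fst v + a * snd v, a * fst v))) (at z)"
proof -
  have eq: "henon c a = (\<lambda>z. ((fst z)\<^sup>2 + c + a * snd z, a * fst z))"
    by (auto simp: henon_def)
  show ?thesis
    unfolding eq by (auto intro!: derivative_eq_intros simp: fun_eq_iff)
qed

text \<open>The explicit equation of the curve.\<close>

lemma henon_param_curve_eq:
  assumes "\<mu> \<noteq> 0"
  shows "henon_param_curve \<mu> = {(c, a). c =
    (1 - a\<^sup>2) * (\<mu> / 2 - a\<^sup>2 / (2 * \<mu>)) - (\<mu> / 2 - a\<^sup>2 / (2 * \<mu>))\<^sup>2}"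
proof -
  have eig: "eigenvalue_C2 (\<lambda>v. (2 * x * fst v + a * snd v, a * fst v)) \<mu> \<longleftrightarrow>
      x = \<mu> / 2 - a\<^sup>2 / (2 * \<mu>)" for x a
  proof
    assume "eigenvalue_C2 (\<lambda>v. (2 * x * fst v + a * snd v, a * fst v)) \<mu>"
    then obtain u w where uw: "u \<noteq> 0 \<or> w \<noteq> 0" and 1: "2 * x * u + a * w = \<mu> * u"
      and 2: "a * u = \<mu> * w"
      by (auto simp: eigenvalue_C2_def zero_prod_def)
    have w: "w = a * u / \<mu>" using 2 assms by (simp add: field_simps)
    then have "u \<noteq> 0" using uw by auto
    have "u * (2 * x * \<mu> + a\<^sup>2) = u * (\<mu> * \<mu>)"
      using 1 assms unfolding w by (simp add: field_simps power2_eq_square)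
    then have "2 * x * \<mu> + a\<^sup>2 = \<mu> * \<mu>" using \<open>u \<noteq> 0\<close> by simp
    then have "x * (2 * \<mu>) = \<mu> * \<mu> - a\<^sup>2" by (simp add: algebra_simps eq_diff_eq)
    then have "x = (\<mu> * \<mu> - a\<^sup>2) / (2 * \<mu>)" using assms by (simp add: eq_divide_eq)
    then show "x = \<mu> / 2 - a\<^sup>2 / (2 * \<mu>)" using assms by (simp add: diff_divide_distrib)
  next
    assume "x = \<mu> / 2 - a\<^sup>2 / (2 * \<mu>)"
    then show "eigenvalue_C2 (\<lambda>v. (2 * x * fst v + a * snd v, a * fst v)) \<mu>"
      unfolding eigenvalue_C2_def using assms
      by (intro exI[of _ "(1, a / \<mu>)"]) (simp add: zero_prod_def field_simps power2_eq_square)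
  qed
  have fixed: "henon c a (x, y) = (x, y) \<longleftrightarrow> y = a * x \<and> c = (1 - a\<^sup>2) * x - x\<^sup>2" for c a x y
    by (auto simp: henon_def algebra_simps power2_eq_square)
  have deriv: "(henon c a has_derivative D) (at z) \<longleftrightarrow>
      D = (\<lambda>v. (2 * fst z * fst v + a * snd v, a * fst v))" for c a D z
    using henon_has_derivative has_derivative_unique by blast
  show ?thesis
    unfolding henon_param_curve_def deriv
    by (auto simp: eig fixed)
qed

end

theory Submission imports Defs "HOL-Complex_Analysis.Complex_Analysis" begin

text \<open>Put \<open>b = a\<^sup>2\<close> and replace \<open>y\<close> by \<open>w = y / a\<close>. The maps become \<open>G b (x, w) = (x\<^sup>2 + c + b w, x)\<close>,
  where \<open>c\<close> depends holomorphically on \<open>b\<close>, and degenerate at \<open>b = 0\<close> to the quadratic polynomial \<open>p0\<close>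
  with a parabolic fixed point of multiplier \<open>\<lambda>\<close>.

  The critical orbit of \<open>p0\<close> enters an attracting petal, and a normal form at the semi-parabolic fixed
  point shows that the petal persists as a trap for all small \<open>b\<close>. Hence a whole neighbourhood of the
  critical line \<open>x = 0\<close> has bounded forward orbits. Escaping points therefore avoid the critical line,
  so they move holomorphically with \<open>(w, b)\<close>, and Harnack's inequality extends this motion to the
  Julia set of \<open>p0\<close>. In a vertical strip \<open>J\<^sup>+\<close> is thus a family of graphs over that Julia set, on which
  \<open>G b\<close> acts as an injective skew product contracting the fibres.

  For nearby nonzero \<open>b, b'\<close> the two skew products are conjugate: a homeomorphism between fundamental
  domains, obtained by a cut-off from the motion, extends by iteration. Since the punctured disc of
  parameters is connected, all parameters in it are conjugate. The conjugacy extends to \<open>J\<^sup>+\<close> because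
  every orbit in \<open>J\<^sup>+\<close> enters the strip. Finally \<open>K\<^sup>-\<close> is closed with empty interior, so \<open>J = J\<^sup>+ \<inter> K\<^sup>-\<close>
  consists of the points of \<open>J\<^sup>+\<close> whose backward orbit stays in the strip.\<close>

section \<open>Estimates for holomorphic functions\<close>

text \<open>The obstacle is the lack of hyperbolicity: at the parabolic point the expansion of
  \<open>p0\<close> on \<open>J0\<close> is not uniform, so no estimate below relies on expansion
  along the Julia set. What is used is only that escaping orbits keep a distance
  \<open>\<epsilon>\<close> from the critical line. This makes the roots that define escaping points
  simple, hence a covering, and bounds the slope of the graphs by \<open>\<epsilon> / 2\<close>. The
  base of the skew product is \<open>p0\<close> on \<open>J0\<close> for every \<open>b\<close>, so
  only fibres have to be matched, and there a contraction is available. The map for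
  \<open>b = 0\<close> cannot serve as a common model: it forgets \<open>w\<close>, so it is not
  injective, and the fibre inverse \<open>W b\<close> has a Lipschitz constant of order 1/|b|. Hence
  the comparison of nearby nonzero parameters. Radii: beyond 3 the modulus at least doubles; 6 = 2 *
  3 bounds \<open>w\<close> and the annulus in which escape is recorded; the skew product lives over
  |w| \<le> 5, and the radii between 5 and 6 leave room for the cut-off.\<close>

lemma half_plane_harnack:
  assumes hol: "h holomorphic_on ball 0 r" and "r > 0"
    and neg: "\<And>z. z \<in> ball 0 r \<Longrightarrow> Re (h z) < 0"
    and z: "norm z \<le> r / 3"
  shows "Re (h z) \<le> Re (h 0) / 2" "2 * Re (h 0) \<le> Re (h z)"
proof -
  have zr: "z \<in> ball 0 r" using z \<open>r > 0\<close> by simp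
  \<comment> \<open>The Cayley transform of the left half-plane to the unit disc that sends
    \<open>h 0\<close> to 0. The Schwarz lemma bounds \<open>g\<close> by 1/3 for |z| \<le> r/3, and
    (1 + 1/3) / (1 - 1/3) = 2 is the resulting ratio of real parts.\<close>
  define g where "g = (\<lambda>w. (h (of_real r * w) - h 0) / (h (of_real r * w) + cnj (h 0)))"
  have in_ball: "of_real r * w \<in> ball 0 r" if "norm w < 1" for w :: complex
    using that \<open>r > 0\<close> by (simp add: norm_mult)
  have nz: "h (of_real r * w) + cnj (h 0) \<noteq> 0" if "norm w < 1" for w
  proof -
    have "Re (h (of_real r * w) + cnj (h 0)) < 0"
      using neg[OF in_ball[OF that]] neg[of 0] \<open>r > 0\<close> by simp
    thus ?thesis by force
  qed
  have "(\<lambda>w. h (of_real r * w)) holomorphic_on ball 0 1"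
  proof -
    have "(\<lambda>w. of_real r * w) holomorphic_on ball 0 1" by (intro holomorphic_intros)
    moreover have "(\<lambda>w. of_real r * w) ` ball 0 1 \<subseteq> ball (0::complex) r" using in_ball by (simp add: image_subset_iff)
    ultimately show ?thesis using holomorphic_on_compose_gen[OF _ hol] by (simp add: o_def)
  qed
  hence holg: "g holomorphic_on ball 0 1"
    unfolding g_def using nz by (auto intro!: holomorphic_intros)
  have key: "(norm (a - c))\<^sup>2 < (norm (a + cnj c))\<^sup>2" if "Re a < 0" "Re c < 0" for a c :: complex
  proof -
    have "(norm (a + cnj c))\<^sup>2 - (norm (a - c))\<^sup>2 = 4 * (Re a * Re c)"
      unfolding cmod_power2 by (simp add: power2_eq_square algebra_simps)
    thus ?thesis using mult_neg_neg[OF that] by linarith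
  qed
  have less1: "norm (g w) < 1" if "norm w < 1" for w
  proof -
    have "(norm (h (of_real r * w) - h 0))\<^sup>2 < (norm (h (of_real r * w) + cnj (h 0)))\<^sup>2"
      using neg[OF in_ball[OF that]] neg[of 0] \<open>r > 0\<close> by (intro key) auto
    hence "norm (h (of_real r * w) - h 0) < norm (h (of_real r * w) + cnj (h 0))"
      using power2_less_imp_less norm_ge_zero by blast
    thus ?thesis using nz[OF that] by (simp add: g_def norm_divide)
  qed
  have wlt: "norm (z / of_real r) \<le> 1/3" using z \<open>r > 0\<close> by (simp add: norm_divide field_simps)
  have "norm (g (z / of_real r)) \<le> norm (z / of_real r)"
    by (rule Schwarz_Lemma(1)[OF holg _ less1]) (use wlt in \<open>auto simp: g_def\<close>)
  hence le: "norm (g (z / of_real r)) \<le> 1/3" using wlt by linarith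
  have gz: "g (z / of_real r) = (h z - h 0) / (h z + cnj (h 0))"
    using \<open>r > 0\<close> by (simp add: g_def)
  have nzz: "h z + cnj (h 0) \<noteq> 0" using nz[of "z / of_real r"] wlt \<open>r > 0\<close> by simp
  have "3 * norm (h z - h 0) \<le> norm (h z + cnj (h 0))"
    using le nzz by (simp add: gz norm_divide field_simps)
  hence "(3 * norm (h z - h 0))\<^sup>2 \<le> (norm (h z + cnj (h 0)))\<^sup>2"
    by (intro power_mono) auto
  hence "9 * (Re (h z) - Re (h 0))\<^sup>2 + 9 * (Im (h z) - Im (h 0))\<^sup>2
      \<le> (Re (h z) + Re (h 0))\<^sup>2 + (Im (h z) - Im (h 0))\<^sup>2"
    unfolding power_mult_distrib cmod_power2 by simp
  hence "9 * (Re (h z) - Re (h 0))\<^sup>2 \<le> (Re (h z) + Re (h 0))\<^sup>2"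
    using zero_le_power2[of "Im (h z) - Im (h 0)"] by linarith
  hence "(3 * (Re (h z) - Re (h 0)))\<^sup>2 \<le> (Re (h z) + Re (h 0))\<^sup>2"
    by (simp only: power_mult_distrib) simp
  hence "\<bar>3 * (Re (h z) - Re (h 0))\<bar> \<le> \<bar>Re (h z) + Re (h 0)\<bar>"
    by (simp add: abs_le_square_iff)
  moreover have "Re (h z) < 0" "Re (h 0) < 0" using neg zr \<open>r > 0\<close> by auto
  ultimately show "Re (h z) \<le> Re (h 0) / 2" "2 * Re (h 0) \<le> Re (h z)" by (simp_all add: abs_if split: if_splits)
qed

text \<open>A substitute for the \<open>\<lambda>\<close>-lemma: a bounded zero-free function, such as the difference of two
  disjoint holomorphic sections, is comparable on a smaller disc with its value at the centre.\<close>

lemma nonvanishing_comparison: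
  assumes hol: "d holomorphic_on ball 0 r" and "r > 0"
    and nz: "\<And>z. z \<in> ball 0 r \<Longrightarrow> d z \<noteq> 0"
    and bd: "\<And>z. z \<in> ball 0 r \<Longrightarrow> norm (d z) < M"
    and z: "norm z \<le> r / 3"
  shows "(norm (d z))\<^sup>2 \<le> M * norm (d 0)" "(norm (d 0))\<^sup>2 \<le> M * norm (d z)"
proof -
  have z0: "0 \<in> ball 0 r" and zr: "z \<in> ball 0 r" using z \<open>r > 0\<close> by auto
  have M: "M > 0" using bd[OF z0] norm_ge_zero le_less_trans by blast
  have "(\<lambda>z. d z / of_real M) holomorphic_on ball 0 r"
    using hol M by (intro holomorphic_intros) auto
  then obtain h where h: "h holomorphic_on ball 0 r" "\<And>z. z \<in> ball 0 r \<Longrightarrow> d z / of_real M = exp (h z)"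
    using contractible_imp_holomorphic_log[of "\<lambda>z. d z / of_real M" "ball 0 r"] nz M
      convex_imp_contractible[OF convex_ball]
    by (metis divide_eq_0_iff of_real_eq_0_iff less_irrefl)
  have nd: "norm (d w) = M * exp (Re (h w))" if "w \<in> ball 0 r" for w
  proof -
    have "norm (d w / of_real M) = exp (Re (h w))" using h(2)[OF that] by (simp add: norm_exp_eq_Re)
    thus ?thesis using M by (simp add: norm_divide field_simps)
  qed
  have neg: "Re (h w) < 0" if "w \<in> ball 0 r" for w
    using bd[OF that] M unfolding nd[OF that] by simp
  note H = half_plane_harnack[OF h(1) \<open>r > 0\<close> neg z]
  \<comment> \<open>A factor 2 between the real parts of logarithms is an exponent 2 between moduli;
    this is the origin of the squares in the conclusion.\<close>
  have "exp (Re (h z)) ^ 2 \<le> exp (Re (h 0))" "exp (Re (h 0)) ^ 2 \<le> exp (Re (h z))"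
    using H by (simp_all flip: exp_of_nat_mult)
  thus "(norm (d z))\<^sup>2 \<le> M * norm (d 0)" "(norm (d 0))\<^sup>2 \<le> M * norm (d z)"
    unfolding nd[OF z0] nd[OF zr] using M by (simp_all add: power2_eq_square)
qed

text \<open>The Schwarz lemma for the increment, which is at most 2m; division by 3m makes it
  strictly less than 1. It serves to turn boundedness in the parameter into a Lipschitz bound in the
  parameter.\<close>

lemma holomorphic_bounded_increment:
  assumes hol: "f holomorphic_on ball a r" and "r > 0"
    and bd: "\<And>z. z \<in> ball a r \<Longrightarrow> norm (f z) \<le> m"
    and z: "norm (z - a) < r"
  shows "norm (f z - f a) \<le> 3 * m * norm (z - a) / r"
proof (cases "m = 0")
  case True
  have "f z = 0" "f a = 0" using bd[of z] bd[of a] z \<open>r > 0\<close> True by (auto simp: dist_norm norm_minus_commute)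
  thus ?thesis using True by simp
next
  case False
  have "m \<ge> 0" using bd[of a] \<open>r > 0\<close> norm_ge_zero order_trans by (metis centre_in_ball)
  hence m: "m > 0" using False by simp
  define g where "g = (\<lambda>w. (f (a + of_real r * w) - f a) / of_real (3 * m))"
  have in_ball: "a + of_real r * w \<in> ball a r" if "norm w < 1" for w :: complex
    using that \<open>r > 0\<close> by (simp add: norm_mult dist_norm)
  have "(\<lambda>w. f (a + of_real r * w)) holomorphic_on ball 0 1"
  proof -
    have "(\<lambda>w. a + of_real r * w) holomorphic_on ball 0 1" by (intro holomorphic_intros)
    moreover have "(\<lambda>w. a + of_real r * w) ` ball 0 1 \<subseteq> ball a r" using in_ball by (simp add: image_subset_iff)
    ultimately show ?thesis using holomorphic_on_compose_gen[OF _ hol] by (simp add: o_def)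
  qed
  hence holg: "g holomorphic_on ball 0 1"
    unfolding g_def using m by (auto intro!: holomorphic_intros)
  have less1: "norm (g w) < 1" if "norm w < 1" for w
  proof -
    have "norm (f (a + of_real r * w) - f a) \<le> m + m"
      by (rule order_trans[OF norm_triangle_ineq4 add_mono]) (use bd in_ball[OF that] \<open>r > 0\<close> in auto)
    also have "\<dots> < 3 * m" using m by simp
    finally show ?thesis using m by (simp add: g_def norm_divide)
  qed
  have wlt: "norm ((z - a) / of_real r) < 1" using z \<open>r > 0\<close> by (simp add: norm_divide)
  have "norm (g ((z - a) / of_real r)) \<le> norm ((z - a) / of_real r)"
    by (rule Schwarz_Lemma(1)[OF holg _ less1 wlt]) (auto simp: g_def)
  thus ?thesis using m \<open>r > 0\<close> by (simp add: g_def norm_divide field_simps)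
qed

text \<open>The local hypothesis compares only with the centre \<open>x\<close>, on a radius
  depending on \<open>x\<close>. Bisection of the segment copes with this, because a short interval
  around \<open>t\<close> can be split at \<open>t\<close>.\<close>

lemma lipschitz_locally_imp_globally:
  fixes f :: "'a::real_normed_vector \<Rightarrow> 'b::real_normed_vector"
  assumes "convex S"
    and loc: "\<And>x. x \<in> S \<Longrightarrow> \<exists>r>0. \<forall>y\<in>S. norm (y - x) < r \<longrightarrow> norm (f y - f x) \<le> L * norm (y - x)"
    and "x \<in> S" "y \<in> S"
  shows "norm (f y - f x) \<le> L * norm (y - x)"
proof (cases "x = y")
  case False
  define p where "p = (\<lambda>t. x + t *\<^sub>R (y - x))"
  have pS: "p t \<in> S" if "0 \<le> t" "t \<le> 1" for t
  proof -
    have "p t = (1 - t) *\<^sub>R x + t *\<^sub>R y" by (simp add: p_def algebra_simps)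
    thus ?thesis using assms that by (simp add: convexD_alt)
  qed
  have pd: "norm (p s - p t) = \<bar>s - t\<bar> * norm (y - x)" for s t
    unfolding p_def by (simp flip: scaleR_left_diff_distrib)
  define Q where "Q = (\<lambda>a b. 0 \<le> a \<and> b \<le> 1 \<longrightarrow> norm (f (p b) - f (p a)) \<le> L * norm (y - x) * (b - a))"
  have "(0::real) \<le> 1" by simp
  hence "Q 0 1"
  proof (induction rule: Bolzano)
    case (trans a b c)
    show ?case unfolding Q_def
    proof
      assume "0 \<le> a \<and> c \<le> 1"
      hence "norm (f (p b) - f (p a)) \<le> L * norm (y - x) * (b - a)"
        "norm (f (p c) - f (p b)) \<le> L * norm (y - x) * (c - b)"
        using trans by (auto simp: Q_def)
      thus "norm (f (p c) - f (p a)) \<le> L * norm (y - x) * (c - a)"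
        using norm_triangle_ineq[of "f (p c) - f (p b)" "f (p b) - f (p a)"]
        by (simp add: algebra_simps)
    qed
  next
    case (local t)
    obtain r where r: "r > 0" "\<And>z. z \<in> S \<Longrightarrow> norm (z - p t) < r \<Longrightarrow> norm (f z - f (p t)) \<le> L * norm (z - p t)"
      using loc[OF pS[OF local]] by blast
    have n: "norm (y - x) > 0" using False by simp
    show ?case unfolding Q_def
    proof (intro exI[of _ "r / norm (y - x)"] conjI allI impI)
      show "r / norm (y - x) > 0" using r n by simp
      fix a b assume ab: "a \<le> t \<and> t \<le> b \<and> b - a < r / norm (y - x)" and ab': "0 \<le> a \<and> b \<le> 1"
      hence l: "(b - a) * norm (y - x) < r" using n by (simp add: field_simps)
      have "norm (f (p s) - f (p t)) \<le> L * (\<bar>s - t\<bar> * norm (y - x))" if "a \<le> s" "s \<le> b" for s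
      proof -
        have "\<bar>s - t\<bar> * norm (y - x) \<le> (b - a) * norm (y - x)"
          using that ab by (intro mult_right_mono) auto
        hence "norm (p s - p t) < r" unfolding pd using l by linarith
        thus ?thesis using r(2)[of "p s"] pS[of s] that ab' by (simp add: pd)
      qed
      from this[of a] this[of b] ab
      show "norm (f (p b) - f (p a)) \<le> L * norm (y - x) * (b - a)"
        using norm_triangle_ineq4[of "f (p b) - f (p t)" "f (p a) - f (p t)"]
        by (simp add: algebra_simps abs_if split: if_splits)
    qed
  qed
  thus ?thesis by (simp add: p_def Q_def)
qed simp

section \<open>Roots depending on a parameter\<close>

text \<open>A Rouche argument through the minimum modulus: \<open>F t0\<close> is at least
  \<open>m\<close> on the circle, so a perturbation by \<open>m / 3\<close> keeps the value at the
  centre below all values on the circle, which forces a zero inside.\<close>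

lemma root_persists:
  fixes F :: "'a::metric_space \<Rightarrow> complex \<Rightarrow> complex"
  assumes cont: "continuous_on (B \<times> UNIV) (\<lambda>p. F (fst p) (snd p))"
    and hol: "\<And>t. t \<in> B \<Longrightarrow> F t holomorphic_on UNIV"
    and t0: "t0 \<in> B" and x0: "F t0 x0 = 0" and "\<eta> > 0"
    and nz: "\<And>y. dist x0 y = \<eta> \<Longrightarrow> F t0 y \<noteq> 0"
  shows "\<exists>T. open T \<and> t0 \<in> T \<and> (\<forall>t\<in>B \<inter> T. \<exists>y\<in>ball x0 \<eta>. F t y = 0)"
proof -
  have cF: "continuous_on S (F t)" if "t \<in> B" for S t
    using holomorphic_on_imp_continuous_on[OF hol[OF that]] continuous_on_subset by blast
  have "sphere x0 \<eta> \<noteq> {}" using \<open>\<eta> > 0\<close> by simp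
  then obtain y0 where y0: "y0 \<in> sphere x0 \<eta>" "\<And>y. y \<in> sphere x0 \<eta> \<Longrightarrow> norm (F t0 y0) \<le> norm (F t0 y)"
    using continuous_attains_inf[OF compact_sphere _ continuous_on_norm[OF cF[OF t0]]] by blast
  define m where "m = norm (F t0 y0)"
  have m: "m > 0" using nz y0(1) by (simp add: m_def)
  have "continuous_on (B \<times> cball x0 \<eta>) (\<lambda>p. F (fst p) (snd p))"
    by (rule continuous_on_subset[OF cont]) auto
  then obtain T where T: "t0 \<in> T" "open T"
    "\<forall>t\<in>T \<inter> B. \<forall>y\<in>cball x0 \<eta>. dist ((\<lambda>p. F (fst p) (snd p)) (t, y)) ((\<lambda>p. F (fst p) (snd p)) (t0, y)) \<le> m / 3"
    by (rule continuous_on_prod_compactE[where e = "m / 3", OF _ compact_cball t0]) (use m in \<open>auto simp: Int_commute\<close>)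
  show ?thesis
  proof (intro exI[of _ T] conjI ballI T(1,2))
    fix t assume t: "t \<in> B \<inter> T"
    have d: "norm (F t y - F t0 y) \<le> m / 3" if "y \<in> cball x0 \<eta>" for y
      using T(3) t that by (auto simp: dist_norm)
    have less: "norm (F t x0) < norm (F t z)" if z: "norm (x0 - z) = \<eta>" for z
    proof -
      have "norm (F t x0) \<le> m / 3" using d[of x0] x0 \<open>\<eta> > 0\<close> by simp
      moreover have "m \<le> norm (F t0 z)" using y0(2)[of z] z by (simp add: m_def dist_norm)
      moreover have "norm (F t z - F t0 z) \<le> m / 3" using d[of z] z by (simp add: dist_norm)
      moreover have "norm (F t0 z) \<le> norm (F t z) + norm (F t z - F t0 z)"
        by (metis add.commute norm_minus_commute norm_triangle_sub)
      ultimately show ?thesis using m by linarith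
    qed
    have tB: "t \<in> B" using t by blast
    have "F t holomorphic_on ball x0 \<eta>" using hol[OF tB] holomorphic_on_subset by blast
    then obtain z where "z \<in> ball x0 \<eta>" "F t z = 0"
      using holomorphic_contract_to_zero[of x0 \<eta> "F t"] cF[OF tB] \<open>\<eta> > 0\<close> less by metis
    thus "\<exists>y\<in>ball x0 \<eta>. F t y = 0" by blast
  qed
qed

text \<open>Since the number of distinct roots is constant, roots can neither merge nor arrive from
  infinity: the \<open>d\<close> roots found in disjoint discs around the roots at \<open>t0\<close>
  are all the roots at a nearby parameter.\<close>

lemma roots_covering_space:
  fixes F :: "'a::real_normed_vector \<Rightarrow> complex \<Rightarrow> complex"
  assumes cont: "continuous_on (B \<times> UNIV) (\<lambda>p. F (fst p) (snd p))"
    and hol: "\<And>t. t \<in> B \<Longrightarrow> F t holomorphic_on UNIV"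
    and fin: "\<And>t. t \<in> B \<Longrightarrow> finite {x. F t x = 0}"
    and card: "\<And>t. t \<in> B \<Longrightarrow> card {x. F t x = 0} = d" and "d > 0"
  shows "covering_space {(t, x). t \<in> B \<and> F t x = 0} fst B"
proof -
  define Z where "Z = {(t, x). t \<in> B \<and> F t x = 0}"
  have ev: "\<exists>T. x \<in> T \<and> openin (top_of_set B) T \<and> (\<exists>v. \<Union>v = Z \<inter> fst -` T \<and>
      (\<forall>u \<in> v. openin (top_of_set Z) u) \<and> pairwise disjnt v \<and> (\<forall>u \<in> v. \<exists>q. homeomorphism u T fst q))"
    if "x \<in> B" for x
  proof -
    have sep: "\<exists>\<eta>>0. \<forall>x y. F t x = 0 \<longrightarrow> F t y = 0 \<longrightarrow> x \<noteq> y \<longrightarrow> \<eta> \<le> dist x y" if "t \<in> B" for t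
    proof -
      have "uniform_discrete {x. F t x = 0}" using fin[OF that] by (induction rule: finite_induct) (simp_all add: uniform_discrete_insert)
      then obtain e where e: "e > 0" "\<And>x y. F t x = 0 \<Longrightarrow> F t y = 0 \<Longrightarrow> dist x y < e \<Longrightarrow> x = y"
        unfolding uniform_discrete_def by (auto simp: dist_commute)
      thus ?thesis by (meson leI)
    qed
    define t0 where "t0 = x"
    have t0: "t0 \<in> B" using that by (simp add: t0_def)
    define R where "R = {x. F t0 x = 0}"
    have R: "finite R" "card R = d" using fin[OF t0] card[OF t0] by (simp_all add: R_def)
    obtain e where e: "e > 0" "\<And>x y. x \<in> R \<Longrightarrow> y \<in> R \<Longrightarrow> x \<noteq> y \<Longrightarrow> e \<le> dist x y"
      using sep[OF t0] unfolding R_def by blast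
    define \<eta> where "\<eta> = e / 2"
    have \<eta>: "\<eta> > 0" using e by (simp add: \<eta>_def)
    have "\<exists>T. open T \<and> t0 \<in> T \<and> (\<forall>t\<in>B \<inter> T. \<exists>y\<in>ball x \<eta>. F t y = 0)" if "x \<in> R" for x
    proof -
      have "F t0 y \<noteq> 0" if "dist x y = \<eta>" for y
        using e(2)[of x y] that \<open>x \<in> R\<close> e(1) by (auto simp: R_def \<eta>_def)
      with that show ?thesis
        by (intro root_persists[of B F] cont hol t0 \<eta>) (auto simp: R_def)
    qed
    then obtain TT where TT: "\<And>x. x \<in> R \<Longrightarrow> open (TT x) \<and> t0 \<in> TT x \<and> (\<forall>t\<in>B \<inter> TT x. \<exists>y\<in>ball x \<eta>. F t y = 0)"
      by metis
    define T where "T = B \<inter> (\<Inter>x\<in>R. TT x)"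
    have oT: "openin (top_of_set B) T" unfolding T_def using R(1) TT by (intro openin_open_Int open_INT) auto
    have t0T: "t0 \<in> T" using t0 TT by (auto simp: T_def)
    have TB: "T \<subseteq> B" by (auto simp: T_def)
    have "\<exists>y\<in>ball x \<eta>. F t y = 0" if "t \<in> T" "x \<in> R" for t x using TT[of x] that by (auto simp: T_def)
    then obtain r where r: "\<And>t x. t \<in> T \<Longrightarrow> x \<in> R \<Longrightarrow> r t x \<in> ball x \<eta> \<and> F t (r t x) = 0" by metis
    have disj: "x = y" if "x \<in> R" "y \<in> R" "z \<in> ball x \<eta>" "z \<in> ball y \<eta>" for x y z
    proof (rule ccontr)
      assume "x \<noteq> y"
      hence "e \<le> dist x y" using e(2) that by blast
      moreover have "dist x y \<le> dist x z + dist y z" by (rule dist_triangle2)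
      ultimately show False using that by (auto simp: \<eta>_def)
    qed
    have all: "{x. F t x = 0} = r t ` R" if "t \<in> T" for t
    proof (rule sym, rule card_subset_eq)
      have "inj_on (r t) R"
        by (rule inj_onI) (metis disj r that)
      thus "card (r t ` R) = card {x. F t x = 0}" using card[of t] TB that R(2) by (auto simp: card_image)
      show "finite {x. F t x = 0}" using fin TB that by blast
    qed (use r that in auto)
    have uniq: "y = r t x" if "t \<in> T" "x \<in> R" "y \<in> ball x \<eta>" "F t y = 0" for t x y
    proof -
      have "y \<in> r t ` R" using all[OF that(1)] that(4) by blast
      then obtain x' where "x' \<in> R" "y = r t x'" by blast
      thus ?thesis using disj[of x x' y] r[OF that(1), of x'] that by blast
    qed
    have cr: "continuous_on T (\<lambda>t. r t x)" if x: "x \<in> R" for x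
    proof (rule continuous_on_iff[THEN iffD2], intro ballI allI impI)
      fix t1 and \<epsilon> :: real assume t1: "t1 \<in> T" and \<epsilon>: "\<epsilon> > 0"
      have t1B: "t1 \<in> B" using t1 TB by blast
      obtain e1 where e1: "e1 > 0" "\<And>x y. F t1 x = 0 \<Longrightarrow> F t1 y = 0 \<Longrightarrow> x \<noteq> y \<Longrightarrow> e1 \<le> dist x y"
        using sep[OF t1B] by blast
      \<comment> \<open>Three demands: no root at \<open>t1\<close> on the new circle, distance
        below the given bound, and the new disc inside the old one, where the root is
        unique.\<close>
      define \<eta>1 where "\<eta>1 = min (e1 / 2) (min \<epsilon> (\<eta> - dist x (r t1 x)))"
      have \<eta>1: "\<eta>1 > 0" using e1 \<epsilon> r[OF t1 x] by (auto simp: \<eta>1_def)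
      have "F t1 y \<noteq> 0" if "dist (r t1 x) y = \<eta>1" for y
      proof
        assume y: "F t1 y = 0"
        have "r t1 x \<noteq> y" using that \<eta>1 by auto
        hence "e1 \<le> \<eta>1" using e1(2)[of "r t1 x" y] y that r[OF t1 x] by simp
        moreover have "\<eta>1 \<le> e1 / 2" unfolding \<eta>1_def by (rule min.cobounded1)
        ultimately show False using e1(1) by simp
      qed
      hence "\<exists>U. open U \<and> t1 \<in> U \<and> (\<forall>t\<in>B \<inter> U. \<exists>y\<in>ball (r t1 x) \<eta>1. F t y = 0)"
        using r[OF t1 x] by (intro root_persists[of B F] cont hol t1B \<eta>1) auto
      then obtain U where
        U: "open U" "t1 \<in> U" "\<And>t. t \<in> B \<inter> U \<Longrightarrow> \<exists>y\<in>ball (r t1 x) \<eta>1. F t y = 0" by blast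
      obtain \<delta> where \<delta>: "\<delta> > 0" "ball t1 \<delta> \<subseteq> U" using U openE by blast
      show "\<exists>\<delta>>0. \<forall>x'\<in>T. dist x' t1 < \<delta> \<longrightarrow> dist (r x' x) (r t1 x) < \<epsilon>"
      proof (intro exI[of _ \<delta>] conjI ballI impI \<delta>(1))
        fix t assume t: "t \<in> T" "dist t t1 < \<delta>"
        have "t \<in> U" using t(2) \<delta>(2) by (auto simp: dist_commute)
        then obtain y where y: "y \<in> ball (r t1 x) \<eta>1" "F t y = 0"
          using U(3)[of t] t(1) TB by blast
        have "dist x y \<le> dist x (r t1 x) + dist (r t1 x) y" by (rule dist_triangle)
        hence "y \<in> ball x \<eta>" using y by (auto simp: \<eta>1_def)
        hence "y = r t x" using uniq t x y by blast
        thus "dist (r t x) (r t1 x) < \<epsilon>" using y by (auto simp: \<eta>1_def dist_commute)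
      qed
    qed
    define v where "v = (\<lambda>x. Z \<inter> (T \<times> ball x \<eta>)) ` R"
    show ?thesis
    proof (intro exI[of _ T] exI[of _ v] conjI)
      show "x \<in> T" "openin (top_of_set B) T" using t0T oT by (simp_all add: t0_def)
      show "\<Union>v = Z \<inter> fst -` T"
      proof -
        have "\<exists>x\<in>R. y \<in> ball x \<eta>" if "t \<in> T" "F t y = 0" for t y
        proof -
          have "y \<in> r t ` R" using all[OF that(1)] that(2) by blast
          thus ?thesis using r[OF that(1)] by blast
        qed
        thus ?thesis unfolding v_def Z_def by auto
      qed
      obtain G where G: "open G" "T = B \<inter> G" using oT by (auto simp: openin_open)
      have "Z \<inter> (T \<times> ball x \<eta>) = Z \<inter> (G \<times> ball x \<eta>)" for x using G by (auto simp: Z_def)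
      thus "\<forall>u\<in>v. openin (top_of_set Z) u" unfolding v_def
        using G by (auto intro!: openin_open_Int open_Times)
      show "pairwise disjnt v" unfolding v_def pairwise_image
        by (auto simp: pairwise_def disjnt_def) (use disj in auto)
      show "\<forall>u\<in>v. \<exists>q. homeomorphism u T fst q"
      proof
        fix u assume "u \<in> v"
        then obtain x where x: "x \<in> R" "u = Z \<inter> (T \<times> ball x \<eta>)" by (auto simp: v_def)
        have u: "u = (\<lambda>t. (t, r t x)) ` T"
        proof (intro equalityI subsetI)
          fix p assume "p \<in> u"
          then obtain t y where p: "p = (t, y)" "t \<in> T" "y \<in> ball x \<eta>" "F t y = 0"
            by (auto simp: x(2) Z_def)
          thus "p \<in> (\<lambda>t. (t, r t x)) ` T" using uniq[OF p(2) x(1) p(3,4)] by blast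
        next
          fix p assume "p \<in> (\<lambda>t. (t, r t x)) ` T"
          thus "p \<in> u" using r[OF _ x(1)] TB by (auto simp: x(2) Z_def)
        qed
        show "\<exists>q. homeomorphism u T fst q"
          by (intro exI[of _ "\<lambda>t. (t, r t x)"])
            (auto simp: homeomorphism_def u image_image intro!: continuous_intros cr[OF x(1)])
      qed
    qed
  qed
  have img: "fst ` Z = B"
  proof -
    have "\<exists>x. F t x = 0" if "t \<in> B" for t
    proof -
      have "{x. F t x = 0} \<noteq> {}"
      proof
        assume "{x. F t x = 0} = {}"
        thus False using card[OF that] \<open>d > 0\<close> by simp
      qed
      thus ?thesis by blast
    qed
    thus ?thesis unfolding Z_def by force
  qed
  show ?thesis
    unfolding covering_space_def Z_def[symmetric]
  proof (intro conjI ballI)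
    show "continuous_on Z fst" by (intro continuous_intros)
  qed (fact img, rule ev)
qed

text \<open>A continuous choice of roots is a lift of the identity of \<open>B\<close>, and convex
  sets are simply connected.\<close>

lemma root_section_exists:
  fixes F :: "'a::real_normed_vector \<Rightarrow> complex \<Rightarrow> complex"
  assumes cov: "covering_space {(t, x). t \<in> B \<and> F t x = 0} fst B" and "convex B"
    and t0: "t0 \<in> B" "F t0 x0 = 0"
  obtains s where "continuous_on B s" "s t0 = x0" "\<And>t. t \<in> B \<Longrightarrow> F t (s t) = 0"
proof -
  obtain g where g: "continuous_on B g" "g \<in> B \<rightarrow> {(t, x). t \<in> B \<and> F t x = 0}" "g t0 = (t0, x0)"
    "\<And>y. y \<in> B \<Longrightarrow> fst (g y) = y"
    using covering_space_lift_strong[OF cov, of "(t0, x0)" t0 B "\<lambda>x. x"] assms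
    by (auto simp: convex_imp_simply_connected convex_imp_locally_path_connected)
  show ?thesis
  proof (rule that[of "\<lambda>t. snd (g t)"])
    show "F t (snd (g t)) = 0" if "t \<in> B" for t using g(2,4) that by (fastforce simp: Pi_iff)
  qed (use g in \<open>auto intro!: continuous_intros\<close>)
qed

lemma root_section_unique:
  fixes F :: "'a::real_normed_vector \<Rightarrow> complex \<Rightarrow> complex"
  assumes cov: "covering_space {(t, x). t \<in> B \<and> F t x = 0} fst B"
    and S: "connected S" "S \<subseteq> B" "a \<in> S" "t \<in> S"
    and s1: "continuous_on S s1" "\<And>t. t \<in> S \<Longrightarrow> F t (s1 t) = 0"
    and s2: "continuous_on S s2" "\<And>t. t \<in> S \<Longrightarrow> F t (s2 t) = 0"
    and eq: "s1 a = s2 a"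
  shows "s1 t = s2 t"
proof -
  have "(\<lambda>t. (t, s1 t)) t = (\<lambda>t. (t, s2 t)) t"
    by (rule covering_space_lift_unique[OF cov, of "\<lambda>t. (t, s1 t)" a "\<lambda>t. (t, s2 t)" S "\<lambda>x. x"])
      (use assms in \<open>auto intro!: continuous_intros\<close>)
  thus ?thesis by simp
qed

text \<open>Continuity of \<open>s\<close> is known beforehand, so only a difference quotient has to
  be computed: \<open>part\<close> gives an exact quotient in the parameter, and Caratheodory's form
  of the derivative an exact one in \<open>x\<close>. No joint differentiability enters.\<close>

lemma implicit_holomorphic:
  fixes F :: "complex \<Rightarrow> complex \<Rightarrow> complex"
  assumes "open D" and cs: "continuous_on D s" and zero: "\<And>b. b \<in> D \<Longrightarrow> F b (s b) = 0"
    and part: "\<And>b. b \<in> D \<Longrightarrow> \<exists>r. (\<forall>b' x. F b' x - F b x = (b' - b) * r b' x) \<and>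
        isCont (\<lambda>p. r (fst p) (snd p)) (b, s b)"
    and der: "\<And>b. b \<in> D \<Longrightarrow> \<exists>D'. (F b has_field_derivative D') (at (s b)) \<and> D' \<noteq> 0"
  shows "s holomorphic_on D"
proof (rule holomorphic_onI)
  fix b assume b: "b \<in> D"
  obtain r where r: "\<And>b' x. F b' x - F b x = (b' - b) * r b' x"
    "isCont (\<lambda>p. r (fst p) (snd p)) (b, s b)" using part[OF b] by blast
  obtain D' where D': "(F b has_field_derivative D') (at (s b))" "D' \<noteq> 0" using der[OF b] by blast
  obtain g where g: "\<And>z. F b z - F b (s b) = g z * (z - s b)" "isCont g (s b)" "g (s b) = D'"
    using CARAT_DERIV[THEN iffD1, OF D'(1)] by blast
  have sc: "isCont s b" using cs b \<open>open D\<close> by (simp add: continuous_on_eq_continuous_at)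
  have gs: "((\<lambda>b'. g (s b')) \<longlongrightarrow> D') (at b)"
    using isCont_o2[OF sc g(2)] g(3) by (simp add: isCont_def)
  have "isCont (\<lambda>b'. (b', s b')) b" by (intro continuous_intros sc)
  hence rs: "((\<lambda>b'. r b' (s b')) \<longlongrightarrow> r b (s b)) (at b)"
    using isCont_o2[of b "\<lambda>b'. (b', s b')" "\<lambda>p. r (fst p) (snd p)"] r(2) by (simp add: isCont_def)
  have lim: "((\<lambda>b'. - r b' (s b') / g (s b')) \<longlongrightarrow> - r b (s b) / D') (at b)"
    by (intro tendsto_intros gs rs D')
  have "\<forall>\<^sub>F b' in at b. g (s b') \<noteq> 0" using gs D'(2) tendsto_imp_eventually_ne by blast
  moreover have "\<forall>\<^sub>F b' in at b. b' \<in> D" using \<open>open D\<close> b by (simp add: eventually_at_in_open')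
  moreover have "\<forall>\<^sub>F b' in at b. b' \<noteq> b" by (simp add: eventually_neq_at_within)
  ultimately have "\<forall>\<^sub>F b' in at b. - r b' (s b') / g (s b') = (s b' - s b) / (b' - b)"
  proof eventually_elim
    case (elim b')
    have "0 = (F b' (s b') - F b (s b')) + (F b (s b') - F b (s b))"
      using zero[OF elim(2)] zero[OF b] by simp
    also have "\<dots> = (b' - b) * r b' (s b') + g (s b') * (s b' - s b)" unfolding r(1) g(1) ..
    finally have "g (s b') * (s b' - s b) = - (b' - b) * r b' (s b')" by algebra
    thus ?case using elim by (simp add: field_simps)
  qed
  from Lim_transform_eventually[OF lim this]
  have "(s has_field_derivative (- r b (s b) / D')) (at b)"
    by (simp add: has_field_derivative_iff)
  thus "s field_differentiable at b within D"
    using field_differentiable_at_within field_differentiable_def by blast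
qed

section \<open>The parabolic quadratic polynomial\<close>

text \<open>The polynomial \<open>p0\<close> after the translation that moves its parabolic fixed
  point to 0, where the multiplier is \<open>l\<close>. The critical point becomes -l/2 and the
  critical value -l^2/4.\<close>

definition qmap :: "complex \<Rightarrow> complex \<Rightarrow> complex" where "qmap l z = l * z + z\<^sup>2"

lemma qmap_0 [simp]: "qmap l 0 = 0" by (simp add: qmap_def)

lemma qmap_funpow_0 [simp]: "(qmap l ^^ n) 0 = 0" by (induction n) simp_all

text \<open>Each backward step needs a square root of g + l^2/4. This vanishes only where
  \<open>g\<close> takes the critical value, that is, where a forward image of the critical point
  lies in the ball.\<close>

lemma qmap_funpow_inverse_branch:
  assumes "\<rho> > 0" "\<And>j. 1 \<le> j \<Longrightarrow> j \<le> m \<Longrightarrow> (qmap l ^^ j) (- l / 2) \<notin> ball ((qmap l ^^ m) v) \<rho>"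
  shows "\<exists>g. g holomorphic_on ball ((qmap l ^^ m) v) \<rho> \<and> g ((qmap l ^^ m) v) = v \<and>
    (\<forall>z\<in>ball ((qmap l ^^ m) v) \<rho>. (qmap l ^^ m) (g z) = z)"
  using assms
proof (induction m arbitrary: v)
  case 0
  show ?case by (intro exI[of _ "\<lambda>z. z"]) auto
next
  case (Suc m)
  define c where "c = (qmap l ^^ Suc m) v"
  have c: "(qmap l ^^ m) (qmap l v) = c" by (simp add: c_def funpow_swap1)
  have "\<exists>g. g holomorphic_on ball c \<rho> \<and> g c = qmap l v \<and> (\<forall>z\<in>ball c \<rho>. (qmap l ^^ m) (g z) = z)"
    using Suc.IH[of "qmap l v", unfolded c] Suc.prems unfolding c_def by auto
  then obtain g where g: "g holomorphic_on ball c \<rho>" "g c = qmap l v"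
    "\<And>z. z \<in> ball c \<rho> \<Longrightarrow> (qmap l ^^ m) (g z) = z" by blast
  have nz: "g z + l\<^sup>2 / 4 \<noteq> 0" if z: "z \<in> ball c \<rho>" for z
  proof
    assume "g z + l\<^sup>2 / 4 = 0"
    hence "g z = qmap l (- l / 2)" by (simp add: qmap_def power2_eq_square field_simps add_eq_0_iff2)
    hence "(qmap l ^^ Suc m) (- l / 2) = z" using g(3)[OF z] by (simp add: funpow_swap1)
    thus False using Suc.prems(2)[of "Suc m"] z by (simp add: c_def)
  qed
  have "(\<lambda>z. g z + l\<^sup>2 / 4) holomorphic_on ball c \<rho>" using g(1) by (intro holomorphic_intros)
  then obtain s where s: "s holomorphic_on ball c \<rho>" "\<And>z. z \<in> ball c \<rho> \<Longrightarrow> g z + l\<^sup>2 / 4 = (s z)\<^sup>2"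
    using contractible_imp_holomorphic_sqrt[OF _ convex_imp_contractible[OF convex_ball], of _ c \<rho>] nz by blast
  have "(s c)\<^sup>2 = (v + l / 2)\<^sup>2"
    using s(2)[of c] \<open>\<rho> > 0\<close> g(2) by (simp add: qmap_def power2_eq_square field_simps)
  \<comment> \<open>A sign, chosen so that the branch passes through \<open>v\<close>.\<close>
  then obtain \<sigma> :: complex where \<sigma>: "\<sigma> * s c = v + l / 2" "\<sigma>\<^sup>2 = 1"
    by (metis mult_1 mult_minus1 power2_eq_iff power2_minus power_one)
  show ?case unfolding c_def[symmetric]
  proof (intro exI[of _ "\<lambda>z. \<sigma> * s z - l / 2"] conjI ballI)
    show "(\<lambda>z. \<sigma> * s z - l / 2) holomorphic_on ball c \<rho>" using s(1) by (intro holomorphic_intros)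
    show "\<sigma> * s c - l / 2 = v" using \<sigma> by simp
    fix z assume z: "z \<in> ball c \<rho>"
    have "qmap l (\<sigma> * s z - l / 2) = \<sigma>\<^sup>2 * (s z)\<^sup>2 - l\<^sup>2 / 4"
      by (simp add: qmap_def power2_eq_square field_simps)
    also have "\<dots> = g z" using s(2)[OF z] \<sigma>(2) by (simp add: algebra_simps)
    finally show "(qmap l ^^ Suc m) (\<sigma> * s z - l / 2) = z"
      using g(3)[OF z] by (simp add: funpow_swap1)
  qed
qed

lemma qmap_escape:
  assumes "norm l = 1" "norm z \<ge> 3"
  shows "norm ((qmap l ^^ m) z) \<ge> 3"
proof (induction m)
  case (Suc m)
  have e: "qmap l w = w * (w + l)" for w by (simp add: qmap_def power2_eq_square algebra_simps)
  have "norm (qmap l w) \<ge> 3" if "norm w \<ge> 3" for w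
  proof -
    have "norm w - norm l \<le> norm (w + l)" by (metis norm_diff_ineq)
    hence "2 \<le> norm (w + l)" using that assms by linarith
    hence "3 * 2 \<le> norm w * norm (w + l)" using that by (intro mult_mono) auto
    thus ?thesis by (simp add: e norm_mult)
  qed
  thus ?case using Suc by simp
qed (use assms in simp)

lemma qmap_funpow_has_derivative_0:
  "((qmap l ^^ n) has_field_derivative l ^ n) (at 0)"
proof (induction n)
  case (Suc n)
  have "(qmap l has_field_derivative l) (at ((qmap l ^^ n) 0))"
    unfolding qmap_funpow_0 by (auto simp: qmap_def[abs_def] intro!: derivative_eq_intros)
  from DERIV_chain[OF this Suc] show ?case by (simp add: o_def)
qed (simp add: id_def)

lemma qmap_funpow_poly:
  "\<exists>p. degree p = 2 ^ n \<and> (\<forall>z. (qmap l ^^ n) z = poly p z)"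
proof (induction n)
  case 0
  show ?case by (intro exI[of _ "[:0, 1:]"]) auto
next
  case (Suc n)
  then obtain p where p: "degree p = 2 ^ n" "\<And>z. (qmap l ^^ n) z = poly p z" by blast
  show ?case
    by (intro exI[of _ "pcompose [:0, l, 1:] p"])
      (simp add: degree_pcompose p poly_pcompose, simp add: qmap_def power2_eq_square algebra_simps)
qed

lemma qmap_funpow_expansion:
  assumes "l ^ q = 1" "q > 0"
  obtains k h where "k \<ge> 1" "poly h 0 \<noteq> (0::complex)" "\<And>z. (qmap l ^^ q) z = z + z ^ (k + 1) * poly h z"
proof -
  obtain p where p: "degree p = 2 ^ q" "\<And>z. (qmap l ^^ q) z = poly p z" using qmap_funpow_poly by blast
  define d where "d = p - [:0, 1:]"
  \<comment> \<open>The degree 2^q exceeds 1, so the iterate is not the identity and its difference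
    from the identity has a finite order at 0. Orders 0 and 1 are excluded below by the value 0 and
    the derivative \<open>l ^ q = 1\<close> at 0.\<close>
  have "degree p \<noteq> 1" using p(1) assms(2) by (simp add: power_eq_1_iff)
  hence "d \<noteq> 0" unfolding d_def by auto
  from order_decomp[OF this, of 0] obtain h where
    h: "d = [:0, 1:] ^ order 0 d * h" "\<not> [:0, 1:] dvd h" by auto
  have h0: "poly h 0 \<noteq> 0" using h(2) poly_eq_0_iff_dvd[of h 0] by simp
  have eq: "(qmap l ^^ q) z = z + z ^ order 0 d * poly h z" for z
  proof -
    have "poly d z = z ^ order 0 d * poly h z" by (subst h(1)) (simp add: poly_power)
    moreover have "poly p z = z + poly d z" by (simp add: d_def)
    ultimately show ?thesis by (simp add: p(2))
  qed
  have "order 0 d \<noteq> 0"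
  proof
    assume "order 0 d = 0"
    thus False using eq[of 0] h0 by simp
  qed
  moreover have "order 0 d \<noteq> 1"
  proof
    assume "order 0 d = 1"
    hence e: "(qmap l ^^ q) = (\<lambda>z. z + z * poly h z)" using eq by auto
    have "((\<lambda>z. z + z * poly h z) has_field_derivative 1 + poly h 0) (at 0)"
      by (auto intro!: derivative_eq_intros)
    from DERIV_unique[OF this[folded e] qmap_funpow_has_derivative_0] show False using assms h0 by simp
  qed
  ultimately have "order 0 d - 1 \<ge> 1" "order 0 d = (order 0 d - 1) + 1" by auto
  thus ?thesis using that[of "order 0 d - 1" h] h0 eq by metis
qed

text \<open>Factors exp(-c/n) multiply to about n^(-c), because the harmonic series diverges. At a
  parabolic point this slow decay takes the place of geometric decay.\<close>

lemma harmonic_decay: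
  fixes A :: "nat \<Rightarrow> real"
  assumes A0: "\<And>n. A n \<ge> 0" and "c > 0" and step: "\<And>n. A (Suc n) \<le> A n * exp (- c / real (Suc n))"
  shows "A \<longlonglongrightarrow> 0"
proof -
  have bd: "A n \<le> A 0 * exp (- c * harm n)" for n
  proof (induction n)
    case (Suc n)
    have "A (Suc n) \<le> A n * exp (- c / real (Suc n))" by (rule step)
    also have "\<dots> \<le> (A 0 * exp (- c * harm n)) * exp (- c / real (Suc n))"
      using Suc by (intro mult_right_mono) auto
    also have "\<dots> = A 0 * exp (- c * harm (Suc n))"
      by (simp add: harm_Suc mult_exp_exp[symmetric] algebra_simps flip: exp_add) (simp add: field_simps)
    finally show ?case .
  qed (simp add: harm_def)
  have "filterlim (\<lambda>n. c * harm n) at_top sequentially"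
    using filterlim_tendsto_pos_mult_at_top[OF tendsto_const \<open>c > 0\<close> harm_at_top] .
  hence "(\<lambda>n. exp (- (c * harm n))) \<longlonglongrightarrow> 0"
    by (intro filterlim_compose[OF exp_at_bot]) (simp add: filterlim_uminus_at_bot)
  hence "(\<lambda>n. A 0 * exp (- c * harm n)) \<longlonglongrightarrow> A 0 * 0" by (intro tendsto_intros) auto
  thus ?thesis using tendsto_sandwich[of "\<lambda>_. 0" A sequentially "\<lambda>n. A 0 * exp (- c * harm n)" 0] A0 bd by auto
qed

lemma ex_nth_root:
  assumes "k \<ge> 1"
  shows "\<exists>z::complex. z ^ k = w"
proof (cases "w = 0")
  case False
  have "exp (Ln w / of_nat k) ^ k = w"
    using assms False by (simp flip: exp_of_nat_mult)
  thus ?thesis by blast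
qed (use assms in \<open>auto intro!: exI[of _ 0]\<close>)

text \<open>\<open>M\<close> is the Caratheodory slope at 0. It makes the change of a coordinate of
  the form const/z^k an exact expression with a continuous factor instead of an asymptotic
  one.\<close>

lemma inverse_power_quotient:
  "\<exists>M :: complex \<Rightarrow> complex. (\<forall>s. inverse ((1 + s) ^ k) - 1 = M s * s) \<and> isCont M 0 \<and> M 0 = - of_nat k"
proof -
  have "((\<lambda>s::complex. inverse ((1 + s) ^ k)) has_field_derivative - of_nat k) (at 0)"
    by (auto intro!: derivative_eq_intros)
  from CARAT_DERIV[THEN iffD1, OF this] show ?thesis by auto
qed

section \<open>Local dynamics near a parabolic fixed point\<close>

locale parabolic =
  fixes f :: "complex \<Rightarrow> complex" and k :: nat and h :: "complex poly"
  assumes k: "k \<ge> 1" and h0: "poly h 0 \<noteq> 0" and f: "\<And>z. f z = z + z ^ (k + 1) * poly h z"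
begin

text \<open>An approximate Fatou coordinate: with this normalisation \<open>f\<close> becomes the
  translation by 1 up to a small error, and the attracting directions are those with
  \<open>U\<close> real and positive.\<close>

definition U :: "complex \<Rightarrow> complex" where
  "U z = - 1 / (of_nat k * poly h 0 * z ^ k)"

definition f' :: "complex \<Rightarrow> complex" where
  "f' z = 1 + of_nat (k + 1) * z ^ k * poly h z + z ^ (k + 1) * poly (pderiv h) z"

lemma f_has_derivative: "(f has_field_derivative f' z) (at z)"
proof -
  have "((\<lambda>z. z ^ Suc k) has_field_derivative of_nat (Suc k) * z ^ k) (at z)"
    by (auto intro!: derivative_eq_intros simp del: power_Suc)
  from DERIV_add[OF DERIV_ident DERIV_mult[OF this poly_DERIV]] show ?thesis
    unfolding f[abs_def] f'_def by (simp add: algebra_simps)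
qed

text \<open>All three estimates are continuity at 0, of the auxiliary functions \<open>A\<close>,
  \<open>B\<close>, \<open>s\<close> with values 1, -1, 0 there. The second one says that in the
  metric |dz|/|z| the derivative of \<open>f\<close> is 1 - 1/U up to smaller terms.\<close>

lemma near_zero:
  assumes e: "e > 0"
  obtains r where "r > 0" "\<And>z. z \<noteq> 0 \<Longrightarrow> norm z < r \<Longrightarrow> f z \<noteq> 0 \<and> norm (U (f z) - U z - 1) \<le> e \<and>
    norm (U z * (f' z * z / f z - 1) + 1) \<le> e \<and> norm (f z / z - 1) \<le> e"
proof -
  define s where "s = (\<lambda>z. z ^ k * poly h z)"
  have s: "isCont s 0" "s 0 = 0" using k by (auto simp: s_def intro!: continuous_intros)
  obtain M :: "complex \<Rightarrow> complex" where M: "\<And>s. inverse ((1 + s) ^ k) - 1 = M s * s" "isCont M 0" "M 0 = - of_nat k"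
    using inverse_power_quotient[of k] by blast
  define c where "c = - 1 / (of_nat k * poly h 0)"
  define A where "A = (\<lambda>z. c * poly h z * M (s z))"
  define B where "B = (\<lambda>z. c * (of_nat k * poly h z + z * poly (pderiv h) z) / (1 + s z))"
  have "isCont (\<lambda>z. M (s z)) 0" using isCont_o2[OF s(1), of M] s(2) M(2) by simp
  hence A: "isCont A 0" "A 0 = 1"
    using s(2) M(3) h0 k by (auto simp: A_def c_def intro!: continuous_intros)
  have B: "isCont B 0" "B 0 = - 1"
    using s h0 k by (auto simp: B_def c_def intro!: continuous_intros)
  have ev: "\<forall>\<^sub>F z in at 0. dist (g z) (g 0) < d" if "isCont g 0" "d > 0" for g :: "complex \<Rightarrow> complex" and d
    using that by (simp add: isCont_def tendsto_iff)
  have "\<forall>\<^sub>F z in at 0. dist (A z) 1 < e" "\<forall>\<^sub>F z in at 0. dist (B z) (-1) < e"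
    "\<forall>\<^sub>F z in at 0. dist (s z) 0 < min e 1"
    using ev[OF A(1) e] ev[OF B(1) e] ev[OF s(1), of "min e 1"] A(2) B(2) s(2) e by simp_all
  hence "\<forall>\<^sub>F z in at 0. dist (A z) 1 < e \<and> dist (B z) (-1) < e \<and> dist (s z) 0 < min e 1"
    by eventually_elim blast
  then obtain r where r: "r > 0" "\<And>z. z \<noteq> 0 \<Longrightarrow> norm z < r \<Longrightarrow>
    dist (A z) 1 < e \<and> dist (B z) (-1) < e \<and> dist (s z) 0 < min e 1"
    unfolding eventually_at dist_0_norm by (metis UNIV_I dist_0_norm dist_commute)
  show ?thesis
  proof (rule that[OF r(1)])
    fix z :: complex assume z: "z \<noteq> 0" "norm z < r"
    note rz = r(2)[OF z]
    have fz: "f z = z * (1 + s z)" by (simp add: f s_def algebra_simps)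
    have s1: "1 + s z \<noteq> 0"
    proof
      assume "1 + s z = 0"
      hence "s z = - 1" by (simp add: add_eq_0_iff)
      thus False using rz by simp
    qed
    have Uz: "U z = c * inverse (z ^ k)" by (simp add: U_def c_def field_simps)
    have "U (f z) - U z = c * inverse (z ^ k) * (inverse ((1 + s z) ^ k) - 1)"
    proof -
      have "U (f z) = c * inverse (z ^ k) * inverse ((1 + s z) ^ k)"
        unfolding U_def c_def fz power_mult_distrib by (simp add: divide_inverse mult_ac)
      thus ?thesis unfolding Uz by (simp add: right_diff_distrib)
    qed
    also have "\<dots> = A z" unfolding M(1) A_def using z by (simp add: s_def field_simps)
    finally have 1: "U (f z) - U z = A z" .
    have "f' z * z / f z - 1 = (f' z - (1 + s z)) / (1 + s z)"
    proof -
      have "f' z * z / f z = f' z / (1 + s z)" using z unfolding fz by (simp add: mult.commute)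
      thus ?thesis using s1 by (simp add: diff_divide_distrib)
    qed
    also have "f' z - (1 + s z) = z ^ k * (of_nat k * poly h z + z * poly (pderiv h) z)"
      by (simp add: f'_def s_def algebra_simps)
    finally have *: "f' z * z / f z - 1 = z ^ k * (of_nat k * poly h z + z * poly (pderiv h) z) / (1 + s z)" .
    have 2: "U z * (f' z * z / f z - 1) = B z"
    proof -
      have cancel: "c * inverse y * (y * X / w) = c * X / w" if "y \<noteq> 0" for y X w :: complex
        using that by (simp add: divide_inverse)
      show ?thesis unfolding * B_def Uz using z by (intro cancel) simp
    qed
    have "f z / z - 1 = s z" using z by (simp add: fz)
    thus "f z \<noteq> 0 \<and> norm (U (f z) - U z - 1) \<le> e \<and>
        norm (U z * (f' z * z / f z - 1) + 1) \<le> e \<and> norm (f z / z - 1) \<le> e"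
      using 1 2 rz z s1 by (auto simp: dist_norm fz)
  qed
qed

lemma U_scale: "t \<noteq> 0 \<Longrightarrow> U (t * z) = U z / t ^ k"
  by (simp add: U_def power_mult_distrib field_simps)

lemma U_nonzero: "z \<noteq> 0 \<Longrightarrow> U z \<noteq> 0"
  using k h0 by (simp add: U_def)

lemma norm_less_if_U_large:
  assumes "r > 0"
  obtains M where "M > 0" "\<And>z. norm (U z) \<ge> M \<Longrightarrow> norm z < r"
proof -
  define M where "M = 2 / (of_nat k * norm (poly h 0) * r ^ k)"
  have kc: "of_nat k * norm (poly h 0) > (0::real)" using k h0 by simp
  have M: "M > 0" using kc assms by (simp add: M_def)
  show ?thesis
  proof (rule that[OF M])
    fix z assume z: "norm (U z) \<ge> M"
    show "norm z < r"
    proof (cases "z = 0")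
      case False
      hence p: "norm z ^ k > 0" by simp
      have "norm (U z) = 1 / (of_nat k * norm (poly h 0) * norm z ^ k)"
        by (simp add: U_def norm_divide norm_mult norm_power)
      hence "2 / (of_nat k * norm (poly h 0) * r ^ k) \<le> 1 / (of_nat k * norm (poly h 0) * norm z ^ k)"
        using z by (simp add: M_def)
      moreover have "2 * p \<le> R" if "2 / (a * R) \<le> 1 / (a * p)" "a > 0" "p > 0" "R > 0" for a p R :: real
        using that by (simp add: field_simps)
      ultimately have "2 * norm z ^ k \<le> r ^ k" using kc p zero_less_power[OF assms, of k] by blast
      hence "norm z ^ k < r ^ k" using p by linarith
      thus ?thesis using assms power_less_imp_less_base by (metis less_imp_le)
    qed (use assms in simp)
  qed
qed

text \<open>\<open>label\<close> recovers the attracting direction: it is one of the \<open>k\<close> solutions \<open>e\<close> of \<open>U e = 1\<close>.\<close>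

definition label :: "complex \<Rightarrow> complex" where
  "label z = z * exp (Ln (U z) / of_nat k)"

lemma label_power: "z \<noteq> 0 \<Longrightarrow> label z ^ k = - 1 / (of_nat k * poly h 0)"
  using k U_nonzero[of z] by (simp add: label_def power_mult_distrib flip: exp_of_nat_mult)
    (simp add: U_def)

lemma label_nonzero: "z \<noteq> 0 \<Longrightarrow> label z \<noteq> 0"
  by (simp add: label_def)

text \<open>The ratio of two labels is a k-th root of unity that depends continuously on
  \<open>y / x\<close>, so it is 1 as soon as it is close to 1. The right half-plane makes the
  principal logarithms of \<open>U x\<close> and \<open>U y\<close> subtract without a jump.\<close>

lemma label_locally_constant:
  obtains \<kappa> where "\<kappa> > 0" "\<kappa> \<le> 1/2"
    "\<And>x y. \<lbrakk>x \<noteq> 0; y \<noteq> 0; Re (U x) > 0; Re (U y) > 0; norm (y / x - 1) \<le> \<kappa>\<rbrakk> \<Longrightarrow> label y = label x"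
proof -
  have fin: "finite {z::complex. z ^ k = 1}" using k by (simp add: finite_roots_unity)
  obtain d where d: "d > 0" "\<And>t::complex. t ^ k = 1 \<Longrightarrow> t \<noteq> 1 \<Longrightarrow> d \<le> dist 1 t"
    using finite_set_avoid[OF fin, of 1] by auto
  define \<psi> where "\<psi> = (\<lambda>t::complex. t * exp (Ln (1 / t ^ k) / of_nat k))"
  have "isCont \<psi> 1" unfolding \<psi>_def using k by (intro continuous_intros) (auto simp: complex_nonpos_Reals_iff)
  hence "(\<psi> \<longlongrightarrow> 1) (at 1)" by (simp add: isCont_def \<psi>_def)
  hence "\<forall>\<^sub>F t in at 1. dist (\<psi> t) 1 < d" using d(1) by (simp add: tendsto_iff)
  then obtain e where e: "e > 0" "\<And>t. t \<noteq> 1 \<Longrightarrow> dist t 1 < e \<Longrightarrow> dist (\<psi> t) 1 < d"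
    unfolding eventually_at by auto
  have e': "dist (\<psi> t) 1 < d" if "dist t 1 < e" for t
    using e(2)[OF _ that] d(1) by (cases "t = 1") (auto simp: \<psi>_def)
  show ?thesis
  proof (rule that[of "min (e/2) (1/2)"])
    fix x y assume A: "x \<noteq> 0" "y \<noteq> 0" "Re (U x) > 0" "Re (U y) > 0" "norm (y / x - 1) \<le> min (e / 2) (1/2)"
    define t where "t = y / x"
    have "U y / U x = 1 / t ^ k" using A k h0 by (simp add: U_def t_def field_simps power_divide)
    have ux: "U x \<noteq> 0" "U y \<noteq> 0" using A U_nonzero by auto
    have im: "\<bar>Im (Ln u)\<bar> < pi / 2" if "Re u > 0" for u by (rule Re_Ln_pos_lt_imp[OF that])
    have "exp (Ln (U y) - Ln (U x)) = 1 / t ^ k"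
      using ux \<open>U y / U x = 1 / t ^ k\<close> by (simp add: exp_diff)
    moreover have "Ln (exp (Ln (U y) - Ln (U x))) = Ln (U y) - Ln (U x)"
      using im[OF A(3)] im[OF A(4)] by (intro Ln_exp) auto
    ultimately have L: "Ln (1 / t ^ k) = Ln (U y) - Ln (U x)" by simp
    have q: "label y / label x = \<psi> t"
    proof -
      have "label y / label x = t * (exp (Ln (U y) / of_nat k) / exp (Ln (U x) / of_nat k))"
        by (simp add: label_def t_def)
      thus ?thesis by (simp only: exp_diff[symmetric] diff_divide_distrib[symmetric] \<psi>_def L)
    qed
    have "(label y / label x) ^ k = 1"
      using label_power[OF A(1)] label_power[OF A(2)] label_nonzero[OF A(1)] k h0 by (simp add: power_divide)
    moreover have "dist (\<psi> t) 1 < d" using e' A(5) e(1) by (intro e') (auto simp: t_def dist_norm)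
    ultimately have "label y / label x = 1" using d(2)[of "\<psi> t"] q by (auto simp: dist_commute)
    thus "label y = label x" using label_nonzero[OF A(1)] by simp
  qed (use e in auto)
qed

end

text \<open>One choice of constants for all local estimates: \<open>r\<close> is the range of
  \<open>near_zero\<close>, \<open>M\<close> is the size of \<open>U\<close> that forces |z| < r,
  and \<open>\<kappa>\<close> is the relative displacement that \<open>U\<close> and
  \<open>label\<close> tolerate.\<close>

locale parabolic_nbhd = parabolic +
  fixes r M \<kappa> :: real
  assumes r: "0 < r" "r \<le> 1" and M: "M \<ge> 8" and kap: "0 < \<kappa>" "\<kappa> \<le> 1/2"
    and step: "\<And>z. z \<noteq> 0 \<Longrightarrow> norm z < r \<Longrightarrow> f z \<noteq> 0 \<and> norm (U (f z) - U z - 1) \<le> 1/4 \<and>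
      norm (U z * (f' z * z / f z - 1) + 1) \<le> 1/4 \<and> norm (f z / z - 1) \<le> \<kappa>"
    and large: "\<And>z. norm (U z) \<ge> M \<Longrightarrow> norm z < r"
    and label_eq: "\<And>x y. \<lbrakk>x \<noteq> 0; y \<noteq> 0; Re (U x) > 0; Re (U y) > 0; norm (y / x - 1) \<le> \<kappa>\<rbrakk> \<Longrightarrow> label y = label x"
    and U_near: "\<And>x y. \<lbrakk>x \<noteq> 0; norm (y / x - 1) \<le> \<kappa>\<rbrakk> \<Longrightarrow> norm (U y - U x) \<le> norm (U x) / 20"
begin

text \<open>The union of the attracting petals, one for each value of \<open>label\<close>. Slope
  1/3 is used for reference orbits and slope 1/2 for points relatively close to them.\<close>

definition sector :: "real \<Rightarrow> complex set" where
  "sector \<sigma> = {z. Re (U z) \<ge> M \<and> \<bar>Im (U z)\<bar> \<le> \<sigma> * Re (U z)}"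

lemma sectorD:
  assumes "z \<in> sector \<sigma>"
  shows "Re (U z) \<ge> M" "\<bar>Im (U z)\<bar> \<le> \<sigma> * Re (U z)" "z \<noteq> 0" "norm z < r" "Re (U z) > 0"
    "norm (U z) \<ge> M"
proof -
  show 1: "Re (U z) \<ge> M" "\<bar>Im (U z)\<bar> \<le> \<sigma> * Re (U z)" using assms by (auto simp: sector_def)
  show 2: "norm (U z) \<ge> M" using 1(1) complex_Re_le_cmod[of "U z"] by linarith
  show "Re (U z) > 0" using 1(1) M by linarith
  thus "z \<noteq> 0" using k by (auto simp: U_def power_0_left)
  show "norm z < r" by (rule large[OF 2])
qed

text \<open>A step changes \<open>U\<close> by 1 with an error of at most 1/4: the real part gains
  at least 3/4 while the imaginary part moves by at most 1/4. Their quotient is the threshold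
  1/3.\<close>

lemma sector_step:
  assumes z: "z \<in> sector \<sigma>" and \<sigma>: "1/3 \<le> \<sigma>"
  shows "f z \<in> sector \<sigma>" "Re (U (f z)) \<ge> Re (U z) + 3/4" "norm (U (f z)) \<le> norm (U z) + 5/4"
    "label (f z) = label z"
proof -
  note s = sectorD[OF z]
  note st = step[OF s(3,4)]
  have re: "\<bar>Re (U (f z) - U z - 1)\<bar> \<le> 1/4" and im: "\<bar>Im (U (f z) - U z - 1)\<bar> \<le> 1/4"
    using st abs_Re_le_cmod[of "U (f z) - U z - 1"] abs_Im_le_cmod[of "U (f z) - U z - 1"] by linarith+
  show R: "Re (U (f z)) \<ge> Re (U z) + 3/4" using re by (simp only: abs_le_iff minus_complex.simps one_complex.simps) linarith
  have "\<bar>Im (U (f z))\<bar> \<le> \<sigma> * Re (U z) + 1/4" using im s(2) by (simp only: abs_le_iff minus_complex.simps one_complex.simps) linarith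
  also have "\<dots> \<le> \<sigma> * Re (U z) + \<sigma> * (3/4)" using \<sigma> by simp
  also have "\<dots> \<le> \<sigma> * Re (U (f z))" using mult_left_mono[OF R, of \<sigma>] \<sigma> by (simp add: distrib_left)
  finally show S: "f z \<in> sector \<sigma>" using R s(1) by (simp add: sector_def)
  have "U (f z) = (U (f z) - U z - 1) + (U z + 1)" by simp
  hence "norm (U (f z)) \<le> norm (U (f z) - U z - 1) + norm (U z + 1)" by (metis norm_triangle_ineq)
  thus "norm (U (f z)) \<le> norm (U z) + 5/4" using st norm_triangle_ineq[of "U z" 1] by simp
  show "label (f z) = label z" using sectorD[OF S] s st by (intro label_eq) auto
qed

lemma sector_funpow:
  assumes z: "z \<in> sector \<sigma>" and \<sigma>: "1/3 \<le> \<sigma>"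
  shows "(f ^^ n) z \<in> sector \<sigma> \<and> Re (U ((f ^^ n) z)) \<ge> M + 3/4 * real n \<and>
    norm (U ((f ^^ n) z)) \<le> norm (U z) + 5/4 * real n \<and> label ((f ^^ n) z) = label z"
proof (induction n)
  case 0
  show ?case using z sectorD[OF z] by simp
next
  case (Suc n)
  hence w: "(f ^^ n) z \<in> sector \<sigma>" by blast
  note st = sector_step[OF w \<sigma>]
  have e: "real (Suc n) = real n + 1" "(f ^^ Suc n) z = f ((f ^^ n) z)" by simp_all
  show ?case unfolding e using st(1) Suc
    by (intro conjI) (use st Suc in \<open>simp_all add: distrib_left\<close>)
qed

lemma funpow_has_derivative:
  "((f ^^ n) has_field_derivative (\<Prod>j<n. f' ((f ^^ j) z))) (at z)"
proof (induction n)
  case (Suc n)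
  have "((f \<circ> (f ^^ n)) has_field_derivative f' ((f ^^ n) z) * (\<Prod>j<n. f' ((f ^^ j) z))) (at z)"
    by (rule DERIV_chain[OF f_has_derivative Suc])
  thus ?case by (simp add: mult.commute o_def)
qed (simp add: id_def)

text \<open>Up to the constant |z| this is the derivative of the n-th iterate in the metric
  |dz|/|z|. Each step multiplies it by at most 1 - 1/(2|U|), and |U| grows at most linearly along
  the orbit, so \<open>harmonic_decay\<close> applies.\<close>

lemma derivative_decay:
  assumes z: "z \<in> sector (1/2)"
  shows "(\<lambda>n. norm (\<Prod>j<n. f' ((f ^^ j) z)) / norm ((f ^^ n) z)) \<longlonglongrightarrow> 0"
proof -
  define c where "c = 1 / (2 * (norm (U z) + 5/4))"
  have c: "c > 0" unfolding c_def using norm_ge_zero[of "U z"] by (intro divide_pos_pos mult_pos_pos add_nonneg_pos) auto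
  show ?thesis
  proof (rule harmonic_decay[OF _ c])
    fix n
    define w where "w = (f ^^ n) z"
    define D where "D = (\<Prod>j<n. f' ((f ^^ j) z))"
    have w: "w \<in> sector (1/2)" "norm (U w) \<le> norm (U z) + 5/4 * real n"
      using sector_funpow[OF z, of n] by (auto simp: w_def)
    note s = sectorD[OF w(1)]
    define u where "u = U w"
    have u: "norm u \<ge> 8" "Re u \<ge> 8" "\<bar>Im u\<bar> \<le> 1/2 * Re u" using s M by (auto simp: u_def)
    \<comment> \<open>Slope 1/2 gives |u| \<le> (9/8) Re u, since 5/4 \<le> (9/8)^2; therefore
      subtracting 1 lowers the modulus by at least 3/4. The error 1/4 of \<open>near_zero\<close>
      leaves a net loss of 1/2.\<close>
    have "(norm (u - 1))\<^sup>2 \<le> (norm u - 3/4)\<^sup>2"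
    proof -
      have "(norm u)\<^sup>2 \<le> (9/8 * Re u)\<^sup>2"
      proof -
        have "(Im u)\<^sup>2 \<le> (1/2 * Re u)\<^sup>2" using u(3) by (metis abs_ge_zero power2_abs power_mono)
        hence "(norm u)\<^sup>2 \<le> (5/4) * (Re u)\<^sup>2" unfolding cmod_power2 by (simp add: power2_eq_square)
        also have "\<dots> \<le> (9/8 * Re u)\<^sup>2" unfolding power_mult_distrib by (simp add: power2_eq_square)
        finally show ?thesis .
      qed
      hence "norm u \<le> 9/8 * Re u" by (rule power2_le_imp_le) (use u(2) in linarith)
      hence "3/2 * norm u + 7/16 \<le> 2 * Re u" using u by linarith
      moreover have "(norm (u - 1))\<^sup>2 = (norm u)\<^sup>2 - 2 * Re u + 1"
        unfolding cmod_power2 by (simp add: power2_eq_square algebra_simps)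
      moreover have "(norm u - 3/4)\<^sup>2 = (norm u)\<^sup>2 - 3/2 * norm u + 9/16"
        by (simp add: power2_eq_square algebra_simps)
      ultimately show ?thesis by linarith
    qed
    hence u1: "norm (u - 1) \<le> norm u - 3/4" by (rule power2_le_imp_le) (use u(1) in linarith)
    define X where "X = f' w * w / f w - 1"
    have X: "norm (u * X + 1) \<le> 1/4" using step[OF s(3,4)] by (simp add: X_def u_def)
    have "u * (1 + X) = (u - 1) + (u * X + 1)" by (simp add: algebra_simps)
    hence "norm u * norm (1 + X) \<le> norm (u - 1) + norm (u * X + 1)"
      by (metis norm_mult norm_triangle_ineq)
    hence "norm u * norm (1 + X) \<le> norm u - 1/2" using u1 X by linarith
    moreover have up: "norm u > 0" using u(1) by linarith
    ultimately have "norm (1 + X) \<le> (norm u - 1/2) / norm u" by (simp only: pos_le_divide_eq mult.commute)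
    hence "norm (1 + X) \<le> 1 + (- 1 / (2 * norm u))"
      using up by (simp add: diff_divide_distrib)
    also have "\<dots> \<le> exp (- 1 / (2 * norm u))" by (rule exp_ge_add_one_self)
    also have "\<dots> \<le> exp (- c / real (Suc n))"
    proof -
      have "norm u \<le> (norm (U z) + 5/4) * real (Suc n)"
      proof -
        have "0 \<le> norm (U z) * real n" by simp
        thus ?thesis using w(2) unfolding u_def of_nat_Suc distrib_left distrib_right by linarith
      qed
      hence "1 / (2 * ((norm (U z) + 5/4) * real (Suc n))) \<le> 1 / (2 * norm u)"
        using u(1) by (intro divide_left_mono mult_pos_pos) (auto intro!: mult_pos_pos add_nonneg_pos)
      moreover have "c / real (Suc n) = 1 / (2 * ((norm (U z) + 5/4) * real (Suc n)))"
        by (simp only: c_def divide_divide_eq_left mult.assoc)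
      ultimately show ?thesis by simp
    qed
    finally have fin: "norm (f' w * w / f w) \<le> exp (- c / real (Suc n))" by (simp add: X_def)
    have "norm (\<Prod>j<Suc n. f' ((f ^^ j) z)) / norm ((f ^^ Suc n) z) = norm D / norm w * norm (f' w * w / f w)"
      using s(3) by (simp add: D_def w_def norm_mult norm_divide)
    also have "\<dots> \<le> norm D / norm w * exp (- c / real (Suc n))"
      using fin by (intro mult_left_mono) auto
    finally show "norm (\<Prod>j<Suc n. f' ((f ^^ j) z)) / norm ((f ^^ Suc n) z)
        \<le> norm (\<Prod>j<n. f' ((f ^^ j) z)) / norm ((f ^^ n) z) * exp (- c / real (Suc n))"
      by (simp only: D_def w_def)
  qed auto
qed

lemma orbit_tendsto_0:
  assumes z: "z \<in> sector \<sigma>" and \<sigma>: "1/3 \<le> \<sigma>"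
  shows "(\<lambda>n. (f ^^ n) z) \<longlonglongrightarrow> 0"
proof (rule LIMSEQ_I)
  fix e :: real assume "e > 0"
  then obtain L where L: "L > 0" "\<And>w. norm (U w) \<ge> L \<Longrightarrow> norm w < e" using norm_less_if_U_large by blast
  obtain N :: nat where N: "real N > L * 4/3" using reals_Archimedean2 by blast
  show "\<exists>no. \<forall>n\<ge>no. norm ((f ^^ n) z - 0) < e"
  proof (intro exI[of _ N] allI impI)
    fix n assume "n \<ge> N"
    hence "L \<le> M + 3/4 * real n" using N M by linarith
    also have "\<dots> \<le> Re (U ((f ^^ n) z))" using sector_funpow[OF z \<sigma>] by blast
    also have "\<dots> \<le> norm (U ((f ^^ n) z))" by (rule complex_Re_le_cmod)
    finally show "norm ((f ^^ n) z - 0) < e" using L(2) by simp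
  qed
qed

text \<open>A relative displacement by \<open>\<kappa>\<close> changes \<open>U\<close> by at most
  |U|/20. The smaller slope and the doubled threshold in the hypotheses leave room for this.\<close>

lemma near_sector:
  assumes x: "x \<in> sector (1/3)" "Re (U x) \<ge> 2 * M" and y: "norm (y / x - 1) \<le> \<kappa>"
  shows "y \<in> sector (1/2)" "label y = label x"
proof -
  note s = sectorD[OF x(1)]
  have "norm (U x) \<le> \<bar>Re (U x)\<bar> + \<bar>Im (U x)\<bar>" by (rule cmod_le)
  hence n: "norm (U x) \<le> 4/3 * Re (U x)" using s by linarith
  have d: "norm (U y - U x) \<le> Re (U x) / 15" using U_near[OF s(3) y] n by linarith
  have re: "\<bar>Re (U y - U x)\<bar> \<le> Re (U x) / 15" and im: "\<bar>Im (U y - U x)\<bar> \<le> Re (U x) / 15"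
    using d abs_Re_le_cmod[of "U y - U x"] abs_Im_le_cmod[of "U y - U x"] by linarith+
  have R: "Re (U y) \<ge> 14/15 * Re (U x)" using re by (simp only: abs_le_iff minus_complex.simps one_complex.simps) linarith
  have "Re (U y) \<ge> M" using R x(2) M by linarith
  moreover have "\<bar>Im (U y)\<bar> \<le> 1/2 * Re (U y)" using im R s(2,5) by (simp only: abs_le_iff minus_complex.simps) linarith
  ultimately show S: "y \<in> sector (1/2)" by (simp add: sector_def)
  show "label y = label x" using sectorD[OF S] s y by (intro label_eq) auto
qed

lemma near_label:
  assumes x: "x \<in> sector (1/2)" and y: "norm (y / x - 1) \<le> \<kappa>"
  shows "label y = label x"
proof -
  note s = sectorD[OF x(1)]
  have "norm (U x) \<le> \<bar>Re (U x)\<bar> + \<bar>Im (U x)\<bar>" by (rule cmod_le)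
  hence n: "norm (U x) \<le> 2 * Re (U x)" using s by linarith
  have d: "norm (U y - U x) \<le> Re (U x) / 10" using U_near[OF s(3) y] n by linarith
  have re: "\<bar>Re (U y - U x)\<bar> \<le> Re (U x) / 10" using d abs_Re_le_cmod[of "U y - U x"] by linarith
  have R: "Re (U y) > 0" using re s(5) by (simp only: abs_le_iff minus_complex.simps) linarith
  hence "y \<noteq> 0" using k by (auto simp: U_def power_0_left)
  thus ?thesis using s y R by (intro label_eq) auto
qed

end

lemma (in parabolic) U_relatively_continuous:
  obtains \<kappa> where "\<kappa> > 0" "\<kappa> \<le> 1/2"
    "\<And>x y. \<lbrakk>x \<noteq> 0; norm (y / x - 1) \<le> \<kappa>\<rbrakk> \<Longrightarrow> norm (U y - U x) \<le> norm (U x) / 20"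
proof -
  have "isCont (\<lambda>t::complex. 1 / t ^ k) 1" by (intro continuous_intros) auto
  hence "\<forall>\<^sub>F t in at (1::complex). dist (1 / t ^ k) 1 < 1/20"
    using tendstoD[of "\<lambda>t::complex. 1 / t ^ k" 1 "at 1" "1/20"] by (simp add: isCont_def)
  then obtain d where d: "d > 0" "\<And>t::complex. t \<noteq> 1 \<Longrightarrow> dist t 1 < d \<Longrightarrow> dist (1 / t ^ k) 1 < 1/20"
    unfolding eventually_at by auto
  show ?thesis
  proof (rule that[of "min (d/2) (1/2)"])
    fix x y :: complex assume x: "x \<noteq> 0" and y: "norm (y / x - 1) \<le> min (d/2) (1/2)"
    define t where "t = y / x"
    have "dist t 1 < d" using y d(1) by (simp add: t_def dist_norm)
    hence "norm (1 / t ^ k - 1) \<le> 1/20"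
      using d(2)[of t] by (cases "t = 1") (auto simp: dist_norm)
    moreover have "U y = U x / t ^ k"
    proof -
      have "t \<noteq> 0" using y by (auto simp: t_def)
      moreover have "y = t * x" using x by (simp add: t_def)
      ultimately show ?thesis using U_scale by simp
    qed
    hence "U y - U x = U x * (1 / t ^ k - 1)" by (simp add: algebra_simps)
    hence "norm (U y - U x) = norm (U x) * norm (1 / t ^ k - 1)" by (simp add: norm_mult)
    ultimately show "norm (U y - U x) \<le> norm (U x) / 20"
      using mult_left_mono[of "norm (1 / t ^ k - 1)" "1/20" "norm (U x)"] by simp
  qed (use d in auto)
qed

lemma (in parabolic) parabolic_nbhd_exists:
  fixes \<kappa>1 r1 :: real
  assumes \<kappa>1: "\<kappa>1 > 0" and r1: "r1 > 0"
  obtains r M \<kappa> where "parabolic_nbhd f k h r M \<kappa>" "\<kappa> \<le> \<kappa>1" "r \<le> r1"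
proof -
  obtain a where a: "a > 0" "a \<le> 1/2"
    "\<And>x y. \<lbrakk>x \<noteq> 0; norm (y / x - 1) \<le> a\<rbrakk> \<Longrightarrow> norm (U y - U x) \<le> norm (U x) / 20"
    using U_relatively_continuous by blast
  obtain b where b: "b > 0" "b \<le> 1/2"
    "\<And>x y. \<lbrakk>x \<noteq> 0; y \<noteq> 0; Re (U x) > 0; Re (U y) > 0; norm (y / x - 1) \<le> b\<rbrakk> \<Longrightarrow> label y = label x"
    using label_locally_constant by blast
  define \<kappa> where "\<kappa> = min \<kappa>1 (min a b)"
  have \<kappa>: "\<kappa> > 0" "\<kappa> \<le> 1/2" "\<kappa> \<le> \<kappa>1" "\<kappa> \<le> a" "\<kappa> \<le> b" using a b \<kappa>1 by (auto simp: \<kappa>_def)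
  obtain r where r: "r > 0" "\<And>z. z \<noteq> 0 \<Longrightarrow> norm z < r \<Longrightarrow> f z \<noteq> 0 \<and> norm (U (f z) - U z - 1) \<le> min \<kappa> (1/4) \<and>
    norm (U z * (f' z * z / f z - 1) + 1) \<le> min \<kappa> (1/4) \<and> norm (f z / z - 1) \<le> min \<kappa> (1/4)"
    using near_zero[of "min \<kappa> (1/4)"] \<kappa>(1) by (metis less_divide_eq_numeral1(1) min_less_iff_conj mult_zero_left zero_less_one)
  define r' where "r' = min r (min r1 1)"
  have r': "r' > 0" "r' \<le> 1" "r' \<le> r" "r' \<le> r1" using r r1 by (auto simp: r'_def)
  obtain M where M: "M > 0" "\<And>z. norm (U z) \<ge> M \<Longrightarrow> norm z < r'"
    using norm_less_if_U_large[OF r'(1)] by blast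
  have "parabolic_nbhd f k h r' (max M 8) \<kappa>"
  proof unfold_locales
    fix z :: complex assume z: "z \<noteq> 0" "norm z < r'"
    from r(2)[OF z(1)] z(2) r'(3) show "f z \<noteq> 0 \<and> norm (U (f z) - U z - 1) \<le> 1/4 \<and>
      norm (U z * (f' z * z / f z - 1) + 1) \<le> 1/4 \<and> norm (f z / z - 1) \<le> \<kappa>" by auto
  next
    fix z assume "norm (U z) \<ge> max M 8"
    thus "norm z < r'" by (intro M(2)) auto
  next
    fix x y assume "x \<noteq> 0" "y \<noteq> 0" "Re (U x) > 0" "Re (U y) > 0" "norm (y / x - 1) \<le> \<kappa>"
    thus "label y = label x" using \<kappa>(5) by (intro b(3)) auto
  next
    fix x y :: complex assume "x \<noteq> 0" "norm (y / x - 1) \<le> \<kappa>"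
    thus "norm (U y - U x) \<le> norm (U x) / 20" using \<kappa>(4) by (intro a(3)) auto
  qed (use r' \<kappa> in auto)
  thus ?thesis using that \<kappa>(3) r'(4) by blast
qed

section \<open>The critical orbit and the number of petals\<close>

lemma norm_root_of_unity: "l ^ q = 1 \<Longrightarrow> q > 0 \<Longrightarrow> norm (l::complex) = 1"
  by (metis norm_ge_zero norm_one norm_power power_eq_1_iff less_numeral_extra(3) abs_norm_cancel power_eq_imp_eq_base power_one zero_le_one)

text \<open>\<open>qmap l\<close> commutes with its iterate; comparing the coefficients of z^(k+1)
  in both compositions gives l h(0) = l^(k+1) h(0).\<close>

lemma parabolic_order_resonant:
  assumes l: "l \<noteq> 0" and h0: "poly h 0 \<noteq> (0::complex)"
    and f: "\<And>z. (qmap l ^^ q) z = z + z ^ (k + 1) * poly h z"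
  shows "l ^ k = 1"
proof -
  define F1 where "F1 = (\<lambda>z. poly h z * (l + (z + z ^ (k + 1) * poly h z) + z))"
  define F2 where "F2 = (\<lambda>z. (l + z) ^ (k + 1) * poly h (qmap l z))"
  have eq: "F1 z = F2 z" if "z \<noteq> 0" for z
  proof -
    have A: "qmap l ((qmap l ^^ q) z) - qmap l z = z ^ (k + 1) * F1 z"
      unfolding f F1_def by (simp add: qmap_def power2_eq_square algebra_simps)
    have "(qmap l ^^ q) (qmap l z) - qmap l z = (z * (l + z)) ^ (k + 1) * poly h (qmap l z)"
      unfolding f by (simp add: qmap_def power2_eq_square algebra_simps)
    hence B: "(qmap l ^^ q) (qmap l z) - qmap l z = z ^ (k + 1) * F2 z"
      unfolding F2_def power_mult_distrib by (simp only: mult.assoc)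
    have "z ^ (k + 1) * F1 z = z ^ (k + 1) * F2 z"
      by (simp only: A[symmetric] B[symmetric] funpow_swap1)
    moreover have "z ^ (k + 1) \<noteq> 0" using that by simp
    ultimately show ?thesis by (metis mult_left_cancel)
  qed
  have "isCont F1 0" "isCont F2 0"
    unfolding F1_def F2_def qmap_def by (intro continuous_intros)+
  hence "F1 \<midarrow>0\<rightarrow> F1 0" "F2 \<midarrow>0\<rightarrow> F2 0" by (simp_all add: isCont_def)
  moreover have "F1 \<midarrow>0\<rightarrow> F2 0 \<longleftrightarrow> F2 \<midarrow>0\<rightarrow> F2 0" by (intro LIM_cong) (use eq in auto)
  ultimately have "F1 0 = F2 0" using LIM_unique by blast
  thus ?thesis using l h0 by (simp add: F1_def F2_def)
qed

text \<open>If the critical orbit missed the discs around a point orbit in an attracting petal, inverse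
  branches along that orbit would violate Cauchy's estimate.\<close>

lemma critical_orbit_visits:
  assumes "parabolic_nbhd (qmap l ^^ q) k h r M \<kappa>" and l: "norm l = 1"
    and x: "x \<in> parabolic_nbhd.sector k h M (1/3)" and e: "e > 0"
  shows "\<exists>j\<ge>J. (qmap l ^^ j) (- l / 2) \<in> parabolic_nbhd.sector k h M (1/2) \<and>
    parabolic.label k h ((qmap l ^^ j) (- l / 2)) = parabolic.label k h x \<and>
    norm ((qmap l ^^ j) (- l / 2)) < e"
proof -
  interpret parabolic_nbhd "qmap l ^^ q" k h r M \<kappa> by fact
  define Y where "Y j = (qmap l ^^ j) (- l / 2)" for j
  define X where "X n = ((qmap l ^^ q) ^^ n) x" for n
  define D where "D n = (\<Prod>j<n. f' (((qmap l ^^ q) ^^ j) x))" for n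
  have Xq: "X n = (qmap l ^^ (q * n)) x" for n by (simp add: X_def funpow_mult)
  have x2: "x \<in> sector (1/2)" using x by (auto simp: sector_def)
  \<comment> \<open>A nonzero point closer to 0 than \<open>d\<close> cannot be among the first
    \<open>J\<close> points of the critical orbit. This is how visits at late times are
    enforced.\<close>
  obtain d where d: "d > 0" "\<And>j. j < J \<Longrightarrow> Y j \<noteq> 0 \<Longrightarrow> d \<le> norm (Y j)"
    using finite_set_avoid[of "Y ` {..<J}" 0] by auto
  have "\<forall>\<^sub>F n in sequentially. norm (D n) / norm (X n) < \<kappa> / 6"
    using order_tendstoD(2)[OF derivative_decay[OF x2], of "\<kappa> / 6"] kap by (simp add: D_def X_def)
  moreover have "\<forall>\<^sub>F n in sequentially. norm (X n) < min d e / 2"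
    using tendstoD[OF orbit_tendsto_0[OF x], of "min d e / 2"] d e by (simp add: X_def)
  moreover have "\<forall>\<^sub>F n in sequentially. real n \<ge> M * 4/3"
    using eventually_ge_at_top[of "nat \<lceil>M * 4/3\<rceil>"] by eventually_elim linarith
  ultimately have "\<forall>\<^sub>F n in sequentially. norm (D n) / norm (X n) < \<kappa> / 6 \<and> norm (X n) < min d e / 2 \<and> real n \<ge> M * 4/3"
    by eventually_elim blast
  then obtain n where n: "norm (D n) / norm (X n) < \<kappa> / 6" "norm (X n) < min d e / 2" "real n \<ge> M * 4/3"
    using eventually_happens trivial_limit_sequentially by blast
  have Xs: "X n \<in> sector (1/3)" "label (X n) = label x" "Re (U (X n)) \<ge> M + 3/4 * real n"
    using sector_funpow[OF x, of n] by (auto simp: X_def)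
  note s = sectorD[OF Xs(1)]
  \<comment> \<open>Proportional to |X n|, so that a visit to the disc is within relative distance
    \<open>\<kappa>\<close> of \<open>X n\<close>, as \<open>near_sector\<close> requires.\<close>
  define \<rho> where "\<rho> = \<kappa> * norm (X n)"
  have \<rho>: "\<rho> > 0" using kap s by (simp add: \<rho>_def)
  have "\<exists>j. 1 \<le> j \<and> j \<le> q * n \<and> Y j \<in> ball (X n) \<rho>"
  proof (rule ccontr)
    assume "\<not> ?thesis"
    hence "\<exists>g. g holomorphic_on ball (X n) \<rho> \<and> g (X n) = x \<and> (\<forall>z\<in>ball (X n) \<rho>. (qmap l ^^ (q * n)) (g z) = z)"
      unfolding Xq Y_def by (intro qmap_funpow_inverse_branch \<rho>) blast
    then obtain g where g: "g holomorphic_on ball (X n) \<rho>" "g (X n) = x"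
      "\<And>z. z \<in> ball (X n) \<rho> \<Longrightarrow> (qmap l ^^ (q * n)) (g z) = z" by blast
    \<comment> \<open>Points of modulus at least 3 never come back below 3, whereas the forward
      image of \<open>g z\<close> is the small point \<open>z\<close>.\<close>
    have bound: "norm (g z) \<le> 3" if z: "z \<in> ball (X n) \<rho>" for z
    proof (rule ccontr)
      assume "\<not> ?thesis"
      hence "norm ((qmap l ^^ (q * n)) (g z)) \<ge> 3" by (intro qmap_escape l) auto
      moreover have "norm z \<le> norm (X n) + \<rho>"
        using z norm_triangle_sub[of z "X n"] by (auto simp: dist_norm norm_minus_commute)
      moreover have "\<rho> \<le> 1/2 * norm (X n)" unfolding \<rho>_def using kap by (intro mult_right_mono) auto
      ultimately show False using g(3)[OF z] s(4) r by auto
    qed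
    have sub: "ball (X n) (\<rho>/2) \<subseteq> ball (X n) \<rho>" "cball (X n) (\<rho>/2) \<subseteq> ball (X n) \<rho>" using \<rho> by auto
    \<comment> \<open>Cauchy's estimate bounds the derivative of \<open>g\<close> by 6/\<rho>, and
      its product with \<open>D n\<close> is 1 by the chain rule. The bound \<kappa>/6 in the choice
      of \<open>n\<close> is made to contradict this.\<close>
    have "norm ((deriv ^^ 1) g (X n)) \<le> fact 1 * 3 / (\<rho>/2) ^ 1"
    proof (rule Cauchy_inequality)
      show "g holomorphic_on ball (X n) (\<rho>/2)" by (rule holomorphic_on_subset[OF g(1) sub(1)])
      show "continuous_on (cball (X n) (\<rho>/2)) g"
        by (rule continuous_on_subset[OF holomorphic_on_imp_continuous_on[OF g(1)] sub(2)])
      show "norm (g z) \<le> 3" if "norm (X n - z) = \<rho> / 2" for z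
        using that \<rho> by (intro bound) (auto simp: dist_norm)
    qed (use \<rho> in simp)
    hence b: "norm (deriv g (X n)) \<le> 6 / \<rho>" by simp
    have dg: "(g has_field_derivative deriv g (X n)) (at (X n))"
      using g(1) \<rho> by (intro holomorphic_derivI[of _ "ball (X n) \<rho>"]) auto
    have "((qmap l ^^ (q * n)) has_field_derivative D n) (at (g (X n)))"
      using funpow_has_derivative[of n x] by (simp add: D_def funpow_mult g(2))
    from DERIV_chain[OF this dg]
    have "(((qmap l ^^ (q * n)) \<circ> g) has_field_derivative D n * deriv g (X n)) (at (X n))" .
    hence "((\<lambda>z. z) has_field_derivative D n * deriv g (X n)) (at (X n))"
      by (rule has_field_derivative_transform_within_open[of _ _ _ "ball (X n) \<rho>"]) (use g \<rho> in auto)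
    hence "D n * deriv g (X n) = 1" using DERIV_unique DERIV_ident by blast
    hence "1 = norm (D n) * norm (deriv g (X n))" by (metis norm_mult norm_one)
    also have "\<dots> \<le> norm (D n) * (6 / \<rho>)" using b by (intro mult_left_mono) auto
    also have "\<dots> = norm (D n) / norm (X n) * (6 / \<kappa>)" by (simp add: \<rho>_def)
    also have "\<dots> < \<kappa> / 6 * (6 / \<kappa>)" using n(1) kap by (intro mult_strict_right_mono) auto
    finally show False using kap by simp
  qed
  then obtain j where j: "Y j \<in> ball (X n) \<rho>" by blast
  have dj: "norm (Y j - X n) \<le> \<kappa> * norm (X n)" using j by (simp add: \<rho>_def dist_norm norm_minus_commute)
  have "Y j / X n - 1 = (Y j - X n) / X n" using s(3) by (simp add: field_simps)
  hence nr: "norm (Y j / X n - 1) \<le> \<kappa>" using dj s(3) by (simp add: norm_divide field_simps)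
  have "Re (U (X n)) \<ge> 2 * M" using Xs(3) n(3) by linarith
  note ns = near_sector[OF Xs(1) this nr]
  have "norm (Y j) \<le> norm (X n) + 1/2 * norm (X n)"
    using dj norm_triangle_sub[of "Y j" "X n"] mult_right_mono[OF kap(2) norm_ge_zero[of "X n"]] by linarith
  moreover have "norm (X n) < d / 2" "norm (X n) < e / 2" using n(2) by auto
  ultimately have small: "norm (Y j) < min d e" using norm_ge_zero[of "X n"] by (simp only: min_less_iff_conj) linarith
  have "Y j \<noteq> 0" using sectorD[OF ns(1)] by simp
  hence "J \<le> j" using d(2)[of j] small by (meson leI min_less_iff_conj not_le)
  thus ?thesis using ns small Xs(2) unfolding Y_def by (intro exI[of _ j]) auto
qed

lemma funpow_ratio_near:
  fixes l :: complex
  assumes "norm l = 1" "\<kappa> > 0"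
  shows "\<forall>\<^sub>F z in at 0. \<forall>s<q. norm ((qmap l ^^ s) z / (l ^ s * z) - 1) \<le> \<kappa>"
proof -
  have "\<forall>\<^sub>F z in at 0. norm ((qmap l ^^ s) z / (l ^ s * z) - 1) \<le> \<kappa>" for s
  proof -
    have ls: "l ^ s \<noteq> 0" "norm (l ^ s) = 1" using assms(1) by (auto simp: norm_power)
    have "((\<lambda>z. (qmap l ^^ s) z / z) \<longlongrightarrow> l ^ s) (at 0)"
      using qmap_funpow_has_derivative_0[of s l] by (simp add: has_field_derivative_iff)
    from tendstoD[OF this assms(2)] eventually_neq_at_within[of 0 0 UNIV] show ?thesis
    proof eventually_elim
      case (elim z)
      have "(qmap l ^^ s) z / (l ^ s * z) - 1 = ((qmap l ^^ s) z / z - l ^ s) / l ^ s"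
        using ls elim by (simp add: field_simps)
      thus ?case using elim ls by (simp add: norm_divide dist_norm)
    qed
  qed
  hence "\<forall>\<^sub>F z in at 0. \<forall>s\<in>{..<q}. norm ((qmap l ^^ s) z / (l ^ s * z) - 1) \<le> \<kappa>"
    by (intro eventually_ball_finite) auto
  thus ?thesis by (simp add: lessThan_def)
qed

text \<open>The point is that the number \<open>k\<close> of petals equals \<open>q\<close>. The
  critical orbit visits every petal, but once captured it passes only through petals with labels
  \<open>l ^ s * label x\<close>, which share their q-th power. Applied to the petal of
  \<open>\<omega> * x\<close> with a primitive k-th root of unity \<open>\<omega>\<close>, this
  gives \<open>k dvd q\<close>; resonance gives the converse.\<close>

theorem parabolic_critical_orbit:
  assumes q: "q > 0" and prim: "\<And>i. l ^ i = (1::complex) \<longleftrightarrow> q dvd i"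
  obtains h where "poly h 0 \<noteq> 0" "\<And>z. (qmap l ^^ q) z = z + z ^ (q + 1) * poly h z"
    "\<And>e. e > 0 \<Longrightarrow> \<exists>j. norm ((qmap l ^^ j) (- l / 2)) < e \<and>
      (let u = - 1 / (of_nat q * poly h 0 * ((qmap l ^^ j) (- l / 2)) ^ q) in
        Re u > 0 \<and> \<bar>Im u\<bar> \<le> 1/2 * Re u)"
proof -
  have lq: "l ^ q = 1" using prim by simp
  have l: "norm l = 1" using norm_root_of_unity lq q by blast
  hence l0: "l \<noteq> 0" by auto
  obtain k h where k: "k \<ge> 1" and h0: "poly h 0 \<noteq> 0"
    and f: "\<And>z. (qmap l ^^ q) z = z + z ^ (k + 1) * poly h z"
    using qmap_funpow_expansion[OF lq q] by blast
  have lk: "l ^ k = 1" by (rule parabolic_order_resonant[OF l0 h0 f])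
  interpret parabolic "qmap l ^^ q" k h by unfold_locales (fact k h0 f)+
  obtain r M \<kappa> where "parabolic_nbhd (qmap l ^^ q) k h r M \<kappa>"
    using parabolic_nbhd_exists[of 1 1] zero_less_one by blast
  then interpret parabolic_nbhd "qmap l ^^ q" k h r M \<kappa> .
  define Y where "Y j = (qmap l ^^ j) (- l / 2)" for j
  have scale: "U (t * z) = U z" "label (t * z) = t * label z" if "t ^ k = 1" for t z :: complex
  proof -
    have "t \<noteq> 0" using that k by (auto simp: power_0_left)
    thus "U (t * z) = U z" using U_scale that by simp
    thus "label (t * z) = t * label z" by (simp add: label_def)
  qed
  obtain x where x: "x ^ k = - 1 / (of_nat k * poly h 0 * of_real M)" using ex_nth_root[OF k] by blast
  have Ux: "U x = of_real M" unfolding U_def x using k h0 M by simp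
  have xs: "x \<in> sector (1/3)" using M by (simp add: sector_def Ux)
  define \<omega> where "\<omega> = exp (2 * of_real pi * \<i> * of_nat 1 / of_nat k)"
  have \<omega>: "\<omega> ^ k = 1" unfolding \<omega>_def using complex_root_unity[of k 1] k by simp
  have \<omega>xs: "\<omega> * x \<in> sector (1/3)" using M by (simp add: sector_def scale(1)[OF \<omega>] Ux)
  note nb = \<open>parabolic_nbhd (qmap l ^^ q) k h r M \<kappa>\<close>
  obtain j0 where j0: "Y j0 \<in> sector (1/2)" "label (Y j0) = label x"
    using critical_orbit_visits[OF nb l xs, of 1 0] by (auto simp: Y_def)
  have "\<exists>e>0. \<forall>z. z \<noteq> 0 \<and> norm z < e \<longrightarrow> (\<forall>s<q. norm ((qmap l ^^ s) z / (l ^ s * z) - 1) \<le> \<kappa>)"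
    using funpow_ratio_near[OF l kap(1), of q] by (simp add: eventually_at)
  then obtain e where e: "e > 0" "\<And>z s. z \<noteq> 0 \<Longrightarrow> norm z < e \<Longrightarrow> s < q \<Longrightarrow> norm ((qmap l ^^ s) z / (l ^ s * z) - 1) \<le> \<kappa>"
    by blast
  obtain n0 where n0: "\<And>n. n \<ge> n0 \<Longrightarrow> norm (((qmap l ^^ q) ^^ n) (Y j0)) < e"
    using LIMSEQ_D[OF orbit_tendsto_0[OF j0(1)] e(1)] by auto
  \<comment> \<open>Between returns, \<open>s < q\<close> steps of \<open>qmap\<close> act on small
    points almost as multiplication by \<open>l ^ s\<close>, which preserves \<open>U\<close>
    because \<open>l ^ k = 1\<close> and multiplies the label by \<open>l ^ s\<close>.\<close>
  have late: "label (Y j) ^ q = label x ^ q" if j: "j \<ge> j0 + q * n0" for j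
  proof -
    define i where "i = j - (j0 + q * n0)"
    define s where "s = i mod q"
    define w where "w = ((qmap l ^^ q) ^^ (n0 + i div q)) (Y j0)"
    have "j = s + (q * (n0 + i div q) + j0)"
      using j by (simp add: s_def i_def distrib_left)
    hence Yj: "Y j = (qmap l ^^ s) w"
      by (simp add: Y_def w_def funpow_mult funpow_add)
    have w: "w \<in> sector (1/2)" "label w = label x"
      using sector_funpow[OF j0(1)] j0(2) by (auto simp: w_def)
    have "norm w < e" unfolding w_def by (rule n0) simp
    have ls: "(l ^ s) ^ k = 1" by (metis lk power_mult mult.commute power_one)
    have "l ^ s * w \<in> sector (1/2)" using w(1) by (simp add: sector_def scale(1)[OF ls])
    moreover have "norm (Y j / (l ^ s * w) - 1) \<le> \<kappa>"
      unfolding Yj using sectorD[OF w(1)] \<open>norm w < e\<close> q by (intro e(2)) (auto simp: s_def)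
    ultimately have "label (Y j) = label (l ^ s * w)" by (rule near_label)
    also have "\<dots> = l ^ s * label x" by (simp add: scale(2)[OF ls] w)
    finally show ?thesis by (simp add: power_mult_distrib) (metis lq power_mult mult.commute power_one)
  qed
  obtain j1 where j1: "j1 \<ge> j0 + q * n0" "label (Y j1) = label (\<omega> * x)"
    using critical_orbit_visits[OF nb l \<omega>xs, of 1 "j0 + q * n0"] by (auto simp: Y_def)
  have "label x \<noteq> 0" using sectorD[OF xs] label_nonzero by simp
  moreover have "(\<omega> * label x) ^ q = label x ^ q" using late[OF j1(1)] j1(2) scale(2)[OF \<omega>] by simp
  ultimately have "\<omega> ^ q = 1" by (simp add: power_mult_distrib)
  moreover have "\<omega> ^ q = exp (2 * of_real pi * \<i> * of_nat q / of_nat k)"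
    by (simp add: \<omega>_def flip: exp_of_nat_mult) (simp add: mult_ac)
  ultimately have "k dvd q" using complex_root_unity_eq_1[OF k] by metis
  hence kq: "k = q" using lk prim by (simp add: dvd_antisym)
  show ?thesis
  proof (rule that[of h])
    show "\<exists>j. norm ((qmap l ^^ j) (- l / 2)) < e \<and>
      (let u = - 1 / (of_nat q * poly h 0 * ((qmap l ^^ j) (- l / 2)) ^ q) in
        Re u > 0 \<and> \<bar>Im u\<bar> \<le> 1/2 * Re u)" if e: "e > 0" for e
    proof -
      obtain j where j: "Y j \<in> sector (1/2)" "norm (Y j) < e"
        using critical_orbit_visits[OF nb l xs e, of 0] by (auto simp: Y_def)
      have "Re (U (Y j)) > 0 \<and> \<bar>Im (U (Y j))\<bar> \<le> 1/2 * Re (U (Y j))" using sectorD[OF j(1)] by blast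
      thus ?thesis using j(2) unfolding U_def Y_def Let_def unfolding kq by blast
    qed
  qed (use f h0 kq in auto)
qed

section \<open>The semi-parabolic fixed point\<close>

text \<open>Polynomials in \<open>u\<close>, \<open>v\<close> of order at least \<open>d\<close>,
  with coefficients continuous in \<open>b\<close>. Finite sums avoid all convergence questions in
  the normal form; the radius 1/2 keeps 1 + b/l^2 and the small divisors away from 0.\<close>

inductive jet :: "nat \<Rightarrow> (complex \<Rightarrow> complex \<Rightarrow> complex \<Rightarrow> complex) \<Rightarrow> bool" where
  jet_monom: "d \<le> i + j \<Longrightarrow> continuous_on (cball 0 (1/2)) c \<Longrightarrow> jet d (\<lambda>b u v. c b * u ^ i * v ^ j)"
| jet_add: "jet d g \<Longrightarrow> jet d h \<Longrightarrow> jet d (\<lambda>b u v. g b u v + h b u v)"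

lemma jet_eq: "jet d g \<Longrightarrow> (\<And>b u v. h b u v = g b u v) \<Longrightarrow> jet d h"
  by (metis ext)

lemma jet_const: "continuous_on (cball 0 (1/2)) c \<Longrightarrow> jet 0 (\<lambda>b u v. c b)"
  by (rule jet_eq[OF jet_monom[of 0 0 0 c]]) auto

lemma jet_zero: "jet d (\<lambda>b u v. 0)"
  by (rule jet_eq[OF jet_monom[of d d 0 "\<lambda>_. 0"]]) auto

lemma jet_u: "jet 1 (\<lambda>b u v. u)"
  by (rule jet_eq[OF jet_monom[of 1 1 0 "\<lambda>_. 1"]]) auto

lemma jet_v: "jet 1 (\<lambda>b u v. v)"
  by (rule jet_eq[OF jet_monom[of 1 0 1 "\<lambda>_. 1"]]) auto

lemma jet_weaken: "jet d g \<Longrightarrow> e \<le> d \<Longrightarrow> jet e g"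
  by (induction rule: jet.induct) (auto intro: jet.intros)

lemma jet_mult:
  assumes "jet d g" "jet e h"
  shows "jet (d + e) (\<lambda>b u v. g b u v * h b u v)"
  using assms
proof (induction rule: jet.induct)
  case (jet_monom d i j c)
  from jet_monom(3,1,2) show ?case
  proof (induction rule: jet.induct)
    case (jet_monom e i' j' c')
    show ?case
      by (rule jet_eq[OF jet.jet_monom[of "d + e" "i + i'" "j + j'" "\<lambda>b. c b * c' b"]])
        (use jet_monom in \<open>auto intro!: continuous_intros simp: power_add mult_ac\<close>)
  next
    case (jet_add e g h)
    show ?case by (rule jet_eq[OF jet.jet_add[OF jet_add(3)[OF jet_add(5,6)] jet_add(4)[OF jet_add(5,6)]]])
        (simp add: distrib_left)
  qed
next
  case (jet_add d g g')
  show ?case by (rule jet_eq[OF jet.jet_add[OF jet_add(3)[OF jet_add(5)] jet_add(4)[OF jet_add(5)]]])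
      (simp add: distrib_right)
qed

lemma jet_cmult: "continuous_on (cball 0 (1/2)) c \<Longrightarrow> jet d g \<Longrightarrow> jet d (\<lambda>b u v. c b * g b u v)"
  using jet_mult[OF jet_const] by simp

lemma jet_power: "jet d g \<Longrightarrow> jet (d * n) (\<lambda>b u v. g b u v ^ n)"
proof (induction n)
  case (Suc n)
  from jet_mult[OF Suc(2) Suc(1)[OF Suc(2)]] show ?case by simp
qed (use jet_const[of "\<lambda>_. 1"] in auto)

lemma jet_sum: "finite I \<Longrightarrow> (\<And>i. i \<in> I \<Longrightarrow> jet d (g i)) \<Longrightarrow> jet d (\<lambda>b u v. \<Sum>i\<in>I. g i b u v)"
  by (induction rule: finite_induct) (auto intro: jet_zero jet_add)

text \<open>In the cone |v| \<le> |u|, where the trap will lie, the order in both variables is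
  measured by |u| alone.\<close>

lemma jet_bound:
  assumes "jet d h"
  shows "\<exists>K\<ge>0. \<forall>b u v. norm b \<le> 1/2 \<longrightarrow> norm u \<le> 1 \<longrightarrow> norm v \<le> norm u \<longrightarrow> norm (h b u v) \<le> K * norm u ^ d"
  using assms
proof (induction rule: jet.induct)
  case (jet_monom d i j c)
  have "bounded (c ` cball 0 (1/2))"
    using compact_continuous_image[OF jet_monom(2) compact_cball] compact_imp_bounded by blast
  then obtain K where K: "\<And>b. norm b \<le> 1/2 \<Longrightarrow> norm (c b) \<le> K" unfolding bounded_iff by (metis imageI mem_cball_0)
  have K0: "K \<ge> 0" using K[of 0] norm_ge_zero order_trans by (metis norm_zero zero_le_divide_1_iff zero_le_numeral)
  show ?case
  proof (intro exI[of _ K] conjI allI impI K0)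
    fix b u v :: complex assume a: "norm b \<le> 1/2" "norm u \<le> 1" "norm v \<le> norm u"
    have "norm v ^ j \<le> norm u ^ j" using a by (intro power_mono) auto
    hence "norm u ^ i * norm v ^ j \<le> norm u ^ (i + j)" by (simp add: power_add mult_left_mono)
    also have "\<dots> \<le> norm u ^ d" using jet_monom(1) a by (intro power_decreasing) auto
    finally have "norm (c b) * (norm u ^ i * norm v ^ j) \<le> K * norm u ^ d"
      using K[OF a(1)] K0 by (intro mult_mono) auto
    thus "norm (c b * u ^ i * v ^ j) \<le> K * norm u ^ d" by (simp add: norm_mult norm_power mult_ac)
  qed
next
  case (jet_add d g h)
  obtain K L where KL: "K \<ge> 0" "L \<ge> 0"
    "\<And>b u v. norm b \<le> 1/2 \<Longrightarrow> norm u \<le> 1 \<Longrightarrow> norm v \<le> norm u \<Longrightarrow> norm (g b u v) \<le> K * norm u ^ d"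
    "\<And>b u v. norm b \<le> 1/2 \<Longrightarrow> norm u \<le> 1 \<Longrightarrow> norm v \<le> norm u \<Longrightarrow> norm (h b u v) \<le> L * norm u ^ d"
    using jet_add.IH by metis
  show ?case
  proof (intro exI[of _ "K + L"] conjI allI impI)
    fix b u v :: complex assume a: "norm b \<le> 1/2" "norm u \<le> 1" "norm v \<le> norm u"
    show "norm (g b u v + h b u v) \<le> (K + L) * norm u ^ d"
      using KL(3)[OF a] KL(4)[OF a] norm_triangle_ineq[of "g b u v" "h b u v"] by (simp add: distrib_right)
  qed (use KL in simp)
qed

lemma jet_continuous:
  assumes "jet d h"
  shows "continuous_on (cball 0 (1/2) \<times> UNIV) (\<lambda>(b, u, v). h b u v)"
  using assms
proof (induction rule: jet.induct)
  case (jet_monom d i j c)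
  have "continuous_on (cball 0 (1/2) \<times> UNIV) (\<lambda>p::complex \<times> complex \<times> complex. c (fst p))"
    by (rule continuous_on_compose2[OF jet_monom(2) continuous_on_fst[OF continuous_on_id]]) auto
  thus ?case by (auto simp: case_prod_unfold intro!: continuous_intros)
qed (auto simp: case_prod_unfold intro!: continuous_intros)

lemma jet_split:
  assumes "jet d h"
  shows "\<exists>c. (\<forall>i. continuous_on (cball 0 (1/2)) (c i)) \<and>
    jet (Suc d) (\<lambda>b u v. h b u v - (\<Sum>i\<le>d. c i b * u ^ i * v ^ (d - i)))"
  using assms
proof (induction rule: jet.induct)
  case (jet_monom d i j c)
  show ?case
  proof (cases "i + j = d")
    case True
    define c' where "c' = (\<lambda>k b. if k = i then c b else 0)"
    have "continuous_on (cball 0 (1/2)) (c' k)" for k using jet_monom by (cases "k = i") (auto simp: c'_def)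
    moreover have "(\<Sum>k\<le>d. c' k b * u ^ k * v ^ (d - k)) = c b * u ^ i * v ^ j" for b u v
    proof -
      have "(\<Sum>k\<le>d. c' k b * u ^ k * v ^ (d - k)) = (\<Sum>k\<in>{i}. c' k b * u ^ k * v ^ (d - k))"
        using True by (intro sum.mono_neutral_right) (auto simp: c'_def)
      thus ?thesis using True by (auto simp: c'_def)
    qed
    ultimately show ?thesis by (intro exI[of _ c']) (auto simp: jet_zero)
  next
    case False
    thus ?thesis using jet_monom by (intro exI[of _ "\<lambda>_ _. 0"]) (auto intro: jet.jet_monom)
  qed
next
  case (jet_add d g h)
  obtain c where c1: "\<And>i. continuous_on (cball 0 (1/2)) (c i)"
    "jet (Suc d) (\<lambda>b u v. g b u v - (\<Sum>i\<le>d. c i b * u ^ i * v ^ (d - i)))"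
    using jet_add.IH(1) by blast
  obtain c' where c2: "\<And>i. continuous_on (cball 0 (1/2)) (c' i)"
    "jet (Suc d) (\<lambda>b u v. h b u v - (\<Sum>i\<le>d. c' i b * u ^ i * v ^ (d - i)))"
    using jet_add.IH(2) by blast
  note c = c1 c2
  show ?case
  proof (intro exI[of _ "\<lambda>i b. c i b + c' i b"] conjI allI)
    show "jet (Suc d) (\<lambda>b u v. g b u v + h b u v - (\<Sum>i\<le>d. (c i b + c' i b) * u ^ i * v ^ (d - i)))"
      by (rule jet_eq[OF jet.jet_add[OF c(2,4)]]) (simp add: distrib_right sum.distrib)
  qed (use c in \<open>auto intro!: continuous_intros\<close>)
qed

text \<open>The shifted Henon map in coordinates \<open>u, v\<close> that diagonalise its linear part at the fixed
  point; \<open>uv_z\<close> is the original first coordinate.\<close>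

definition uv_z :: "complex \<Rightarrow> complex \<Rightarrow> complex \<Rightarrow> complex \<Rightarrow> complex" where
  "uv_z l b u v = (u + b / l\<^sup>2 * v) / (1 + b / l\<^sup>2)"

definition uv_pull :: "complex \<Rightarrow> (complex \<Rightarrow> complex \<Rightarrow> complex \<Rightarrow> complex) \<Rightarrow> complex \<Rightarrow> complex \<Rightarrow> complex \<Rightarrow> complex" where
  "uv_pull l h b u v = h b (l * u + (uv_z l b u v)\<^sup>2) (- b / l * v + (uv_z l b u v)\<^sup>2)"

section \<open>Normal form at the semi-parabolic point\<close>

lemma uv_denominator: "norm (l::complex) = 1 \<Longrightarrow> norm b \<le> 1/2 \<Longrightarrow> 1 + b / l\<^sup>2 \<noteq> 0"
proof
  assume a: "norm l = 1" "norm b \<le> 1/2" "1 + b / l\<^sup>2 = 0"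
  hence "b / l\<^sup>2 = - 1" by (simp add: add_eq_0_iff)
  hence "norm (b / l\<^sup>2) = 1" by simp
  thus False using a by (simp add: norm_divide norm_power)
qed

context
  fixes l :: complex
  assumes l: "norm l = 1"
begin

lemma jet_uv_z: "jet 1 (uv_z l)"
proof -
  have c: "continuous_on (cball 0 (1/2)) (\<lambda>b. 1 / (1 + b / l\<^sup>2))" "continuous_on (cball 0 (1/2)) (\<lambda>b. b / l\<^sup>2)"
    using uv_denominator[OF l] l by (auto intro!: continuous_intros)
  show ?thesis
    by (rule jet_eq[OF jet_cmult[OF c(1) jet_add[OF jet_u jet_cmult[OF c(2) jet_v]]]]) (simp add: uv_z_def)
qed

lemma jet_uv_z2: "jet 2 (\<lambda>b u v. (uv_z l b u v)\<^sup>2)"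
  using jet_power[OF jet_uv_z, of 2] by simp

lemma jet_lu: "jet 1 (\<lambda>b u v. l * u)"
  by (rule jet_cmult[OF _ jet_u]) auto

lemma jet_mv: "jet 1 (\<lambda>b u v. - b / l * v)"
  by (rule jet_cmult[OF _ jet_v]) (use l in \<open>auto intro!: continuous_intros\<close>)

lemma jet_perturbed_power:
  assumes a: "jet 1 a" and z: "jet 2 z"
  shows "jet (Suc i) (\<lambda>b u v. (a b u v + z b u v) ^ i - a b u v ^ i)"
proof (induction i)
  case 0
  show ?case by (simp add: jet_zero)
next
  case (Suc i)
  have az: "jet 1 (\<lambda>b u v. a b u v + z b u v)" by (intro jet_add a jet_weaken[OF z]) auto
  have "jet (Suc (Suc i)) (\<lambda>b u v. (a b u v + z b u v) * ((a b u v + z b u v) ^ i - a b u v ^ i))"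
    using jet_mult[OF az Suc] by simp
  moreover have "jet (Suc (Suc i)) (\<lambda>b u v. z b u v * a b u v ^ i)"
    using jet_mult[OF z jet_power[OF a, of i]] by simp
  ultimately show ?case by (rule jet_eq[OF jet_add]) (simp add: algebra_simps)
qed

text \<open>The nonlinear part of the map has order 2, so replacing the map by its linear part
  alters a term of order \<open>d\<close> only from order \<open>d + 1\<close> on.\<close>

lemma jet_pull_diff:
  assumes "jet d h"
  shows "jet (Suc d) (\<lambda>b u v. uv_pull l h b u v - h b (l * u) (- b / l * v))"
  using assms
proof (induction rule: jet.induct)
  case (jet_monom d i j c)
  define Z where "Z = (\<lambda>b u v. (uv_z l b u v)\<^sup>2)"
  have Z: "jet 2 Z" unfolding Z_def by (rule jet_uv_z2)
  have vz: "jet 1 (\<lambda>b u v. - b / l * v + Z b u v)" by (intro jet_add jet_mv jet_weaken[OF Z]) auto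
  have "jet (Suc (i + j)) (\<lambda>b u v. ((l * u + Z b u v) ^ i - (l * u) ^ i) * (- b / l * v + Z b u v) ^ j)"
    using jet_mult[OF jet_perturbed_power[OF jet_lu Z, of i] jet_power[OF vz, of j]] by simp
  moreover have "jet (Suc (i + j)) (\<lambda>b u v. (l * u) ^ i * ((- b / l * v + Z b u v) ^ j - (- b / l * v) ^ j))"
    using jet_mult[OF jet_power[OF jet_lu, of i] jet_perturbed_power[OF jet_mv Z, of j]] by simp
  ultimately have "jet (Suc (i + j)) (\<lambda>b u v. c b *
     (((l * u + Z b u v) ^ i - (l * u) ^ i) * (- b / l * v + Z b u v) ^ j +
      (l * u) ^ i * ((- b / l * v + Z b u v) ^ j - (- b / l * v) ^ j)))"
    by (rule jet_cmult[OF jet_monom(2) jet_add])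
  hence "jet (Suc (i + j)) (\<lambda>b u v. uv_pull l (\<lambda>b u v. c b * u ^ i * v ^ j) b u v - c b * (l * u) ^ i * (- b / l * v) ^ j)"
    by (rule jet_eq) (simp add: uv_pull_def Z_def algebra_simps)
  thus ?case by (rule jet_weaken) (use jet_monom(1) in simp)
next
  case (jet_add d g h)
  show ?case by (rule jet_eq[OF jet.jet_add[OF jet_add(3,4)]]) (simp add: uv_pull_def)
qed

text \<open>The homological equation. On u^i v^(d-i) the operator that composes with the linear part
  and subtracts \<open>l\<close> times the argument is multiplication by \<open>e i b\<close>. For
  |b| \<le> 1/2 this vanishes only if \<open>i = d\<close> and \<open>l ^ d = l\<close>; that single
  coefficient is kept in \<open>c\<close>.\<close>

lemma normal_form_step:
  assumes D: "jet d D" and d: "d \<ge> 2"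
  shows "\<exists>S c R. jet d S \<and> continuous_on (cball 0 (1/2)) c \<and> (l ^ d \<noteq> l \<longrightarrow> c = (\<lambda>_. 0)) \<and>
    jet (Suc d) R \<and> (\<forall>b u v. norm b \<le> 1/2 \<longrightarrow> D b u v + uv_pull l S b u v - l * S b u v - c b * u ^ d = R b u v)"
proof -
  obtain a where a: "\<And>i. continuous_on (cball 0 (1/2)) (a i)"
    "jet (Suc d) (\<lambda>b u v. D b u v - (\<Sum>i\<le>d. a i b * u ^ i * v ^ (d - i)))"
    using jet_split[OF D] by blast
  define e where "e = (\<lambda>i b. l ^ i * (- b / l) ^ (d - i) - l)"
  define s where "s = (\<lambda>i b. if i = d \<and> l ^ d = l then 0 else - a i b / e i b)"
  define c where "c = (\<lambda>b. if l ^ d = l then a d b else 0)"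
  have e0: "e i b \<noteq> 0" if "\<not> (i = d \<and> l ^ d = l)" "i \<le> d" "norm b \<le> 1/2" for i b
  proof (cases "i = d")
    case False
    have "norm (l ^ i * (- b / l) ^ (d - i)) = norm b ^ (d - i)"
      using l by (simp add: norm_mult norm_power norm_divide)
    also have "\<dots> \<le> norm b ^ 1" using False that by (intro power_decreasing) auto
    also have "\<dots> < norm l" using that l by simp
    finally show ?thesis by (auto simp: e_def)
  qed (use that in \<open>auto simp: e_def\<close>)
  have cs: "continuous_on (cball 0 (1/2)) (s i)" if "i \<le> d" for i
  proof (cases "i = d \<and> l ^ d = l")
    case False
    hence "s i = (\<lambda>b. - a i b / e i b)" by (auto simp: s_def)
    moreover have "continuous_on (cball 0 (1/2)) (e i)" using l unfolding e_def by (auto intro!: continuous_intros)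
    ultimately show ?thesis using e0[OF False that] a(1) by (auto intro!: continuous_intros)
  qed (auto simp: s_def)
  define S where "S = (\<lambda>b u v. \<Sum>i\<le>d. s i b * u ^ i * v ^ (d - i))"
  have jS: "jet d S" unfolding S_def by (intro jet_sum jet.jet_monom cs) auto
  have cc: "continuous_on (cball 0 (1/2)) c" using a(1) by (cases "l ^ d = l") (auto simp: c_def)
  define E where "E = (\<lambda>b u v. (\<Sum>i\<le>d. (a i b + s i b * e i b) * u ^ i * v ^ (d - i)) - c b * u ^ d)"
  have E0: "E b u v = 0" if "norm b \<le> 1/2" for b u v
  proof -
    have "a i b + s i b * e i b = (if i = d then c b else 0)" if "i \<le> d" for i
      using e0[of i b] \<open>norm b \<le> 1/2\<close> that by (auto simp: s_def c_def e_def)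
    hence "(\<Sum>i\<le>d. (a i b + s i b * e i b) * u ^ i * v ^ (d - i)) = (\<Sum>i\<le>d. (if i = d then c b else 0) * u ^ i * v ^ (d - i))"
      by (intro sum.cong) auto
    also have "\<dots> = c b * u ^ d" by (simp add: if_distrib[of "\<lambda>x. x * _"] cong: if_cong)
    finally show ?thesis by (simp add: E_def)
  qed
  define R where "R = (\<lambda>b u v. (D b u v - (\<Sum>i\<le>d. a i b * u ^ i * v ^ (d - i))) +
    (uv_pull l S b u v - S b (l * u) (- b / l * v)))"
  have jR: "jet (Suc d) R" unfolding R_def by (intro jet_add a(2) jet_pull_diff jS)
  have "D b u v + uv_pull l S b u v - l * S b u v - c b * u ^ d = R b u v" if b: "norm b \<le> 1/2" for b u v
  proof -
    have "(\<Sum>i\<le>d. (a i b + s i b * e i b) * u ^ i * v ^ (d - i)) =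
        (\<Sum>i\<le>d. a i b * u ^ i * v ^ (d - i)) + S b (l * u) (- b / l * v) - l * S b u v"
      unfolding S_def e_def sum_distrib_left sum.distrib[symmetric] sum_subtractf[symmetric]
      by (intro sum.cong refl, simp only: power_mult_distrib, simp add: algebra_simps)
    hence "D b u v + uv_pull l S b u v - l * S b u v - c b * u ^ d = R b u v + E b u v"
      by (simp add: R_def E_def)
    thus ?thesis by (simp add: E0[OF b])
  qed
  moreover have "l ^ d \<noteq> l \<longrightarrow> c = (\<lambda>_. 0)" by (auto simp: c_def)
  ultimately show ?thesis using jS cc jR by blast
qed

text \<open>Only the one function \<open>u + h\<close> is normalised, not the pair of coordinates:
  the map multiplies it by \<open>l\<close> up to the resonant term. Primitivity of \<open>l\<close>
  excludes resonance in the degrees 2 to \<open>q\<close>, and degree \<open>q + 1\<close> is the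
  first resonant one.\<close>

theorem resonant_normal_form:
  assumes q: "q > 0" and prim: "\<And>i. l ^ i = 1 \<longleftrightarrow> q dvd i"
  obtains h R c where "jet 2 h" "jet (q + 2) R" "continuous_on (cball 0 (1/2)) c"
    "\<And>b u v. norm b \<le> 1/2 \<Longrightarrow> uv_pull l (\<lambda>b u v. u + h b u v) b u v
       = l * (u + h b u v) + c b * u ^ (q + 1) + R b u v"
proof -
  have nres: "l ^ d \<noteq> l" if "2 \<le> d" "d \<le> q" for d
  proof
    assume "l ^ d = l"
    moreover have "l ^ d = l * l ^ (d - 1)" using that by (metis Suc_diff_1 less_le_trans pos2 power_Suc)
    ultimately have "l ^ (d - 1) = 1" using l by (metis mult_cancel_left1 norm_zero zero_neq_one)
    thus False using prim that by (auto dest: dvd_imp_le)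
  qed
  have "\<exists>h R. jet 2 h \<and> jet (n + 2) R \<and> (\<forall>b u v. norm b \<le> 1/2 \<longrightarrow>
      uv_pull l (\<lambda>b u v. u + h b u v) b u v - l * (u + h b u v) = R b u v)" if "n + 1 \<le> q" for n
    using that
  proof (induction n)
    case 0
    show ?case
      by (rule exI[of _ "\<lambda>_ _ _. 0"], rule exI[of _ "\<lambda>b u v. (uv_z l b u v)\<^sup>2"])
        (use jet_uv_z2 in \<open>simp add: jet_zero uv_pull_def numeral_2_eq_2\<close>)
  next
    case (Suc n)
    define d where "d = n + 2"
    have d: "d \<ge> 2" "d \<le> q" using Suc.prems by (auto simp: d_def)
    obtain h D where hD: "jet 2 h" "jet d D"
      "\<And>b u v. norm b \<le> 1/2 \<Longrightarrow> uv_pull l (\<lambda>b u v. u + h b u v) b u v - l * (u + h b u v) = D b u v"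
      using Suc unfolding d_def by auto
    obtain S c R where S: "jet d S" "l ^ d \<noteq> l \<longrightarrow> c = (\<lambda>_. 0)" "jet (Suc d) R"
      "\<And>b u v. norm b \<le> 1/2 \<Longrightarrow> D b u v + uv_pull l S b u v - l * S b u v - c b * u ^ d = R b u v"
      using normal_form_step[OF hD(2) d(1)] by blast
    have "c = (\<lambda>_. 0)" using S(2) nres[OF d] by simp
    show ?case
    proof (rule exI[of _ "\<lambda>b u v. h b u v + S b u v"], rule exI[of _ R], intro conjI allI impI)
      show "jet (Suc n + 2) R" using S(3) by (simp add: d_def)
      show "jet 2 (\<lambda>b u v. h b u v + S b u v)" by (intro jet_add hD(1) jet_weaken[OF S(1)] d(1))
      fix b u v :: complex assume b: "norm b \<le> 1/2"
      show "uv_pull l (\<lambda>b u v. u + (h b u v + S b u v)) b u v - l * (u + (h b u v + S b u v)) = R b u v"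
      proof -
        have pa: "uv_pull l (\<lambda>b u v. u + (h b u v + S b u v)) b u v
            = uv_pull l (\<lambda>b u v. u + h b u v) b u v + uv_pull l S b u v"
          by (simp add: uv_pull_def)
        have 1: "uv_pull l (\<lambda>b u v. u + h b u v) b u v = D b u v + l * (u + h b u v)"
          using hD(3)[OF b, of u v] by (simp add: diff_eq_eq)
        have 2: "R b u v = D b u v + uv_pull l S b u v - l * S b u v"
          using S(4)[OF b, of u v] \<open>c = _\<close> by simp
        show ?thesis unfolding pa 1 2 by (simp add: algebra_simps)
      qed
    qed
  qed
  from this[of "q - 1"] q obtain h D where hD: "jet 2 h" "jet (q + 1) D"
    "\<And>b u v. norm b \<le> 1/2 \<Longrightarrow> uv_pull l (\<lambda>b u v. u + h b u v) b u v - l * (u + h b u v) = D b u v"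
    by auto
  have q2: "q + 1 \<ge> 2" using q by simp
  obtain S c R where S: "jet (q + 1) S" "continuous_on (cball 0 (1/2)) c" "jet (Suc (q + 1)) R"
    "\<And>b u v. norm b \<le> 1/2 \<Longrightarrow> D b u v + uv_pull l S b u v - l * S b u v - c b * u ^ (q + 1) = R b u v"
    using normal_form_step[OF hD(2) q2] by blast
  show ?thesis
  proof (rule that[of "\<lambda>b u v. h b u v + S b u v" R c])
    show "jet 2 (\<lambda>b u v. h b u v + S b u v)" by (intro jet_add hD(1) jet_weaken[OF S(1)] q2)
    show "jet (q + 2) R" using S(3) by simp
    fix b u v :: complex assume b: "norm b \<le> 1/2"
    have pa: "uv_pull l (\<lambda>b u v. u + (h b u v + S b u v)) b u v
        = uv_pull l (\<lambda>b u v. u + h b u v) b u v + uv_pull l S b u v"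
      by (simp add: uv_pull_def)
    have 1: "uv_pull l (\<lambda>b u v. u + h b u v) b u v = D b u v + l * (u + h b u v)"
      using hD(3)[OF b, of u v] by (simp add: diff_eq_eq)
    have 2: "R b u v = D b u v + uv_pull l S b u v - l * S b u v - c b * u ^ (q + 1)"
      using S(4)[OF b, of u v] by simp
    show "uv_pull l (\<lambda>b u v. u + (h b u v + S b u v)) b u v
       = l * (u + (h b u v + S b u v)) + c b * u ^ (q + 1) + R b u v"
      unfolding pa 1 2 by (simp add: algebra_simps)
  qed (fact S(2))
qed

end

section \<open>From the normal form to an invariant trap\<close>

lemma uv_z_le:
  assumes "norm l = 1" "norm b \<le> 1/2" "norm v \<le> norm u"
  shows "norm (uv_z l b u v) \<le> 3 * norm u"
proof -
  have nb: "norm (b / l\<^sup>2) \<le> 1/2" using assms by (simp add: norm_divide norm_power)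
  have "1 - norm (b / l\<^sup>2) \<le> norm (1 + b / l\<^sup>2)" by (metis norm_diff_ineq norm_one)
  hence d: "norm (1 + b / l\<^sup>2) \<ge> 1/2" using nb by linarith
  have "norm (u + b / l\<^sup>2 * v) \<le> norm u + norm (b / l\<^sup>2) * norm v"
    by (metis norm_mult norm_triangle_ineq)
  also have "\<dots> \<le> norm u + 1/2 * norm u" using nb assms(3) by (intro add_left_mono mult_mono) auto
  finally have n: "norm (u + b / l\<^sup>2 * v) \<le> 3/2 * norm u" by simp
  have "norm (uv_z l b u v) = norm (u + b / l\<^sup>2 * v) / norm (1 + b / l\<^sup>2)"
    by (simp add: uv_z_def norm_divide)
  also have "\<dots> \<le> (3/2 * norm u) / (1/2)" using n d by (intro frac_le) auto
  finally show ?thesis by simp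
qed

lemma tendsto_norm_le_0:
  assumes "\<forall>\<^sub>F x in F. norm (f x) \<le> g x" "(g \<longlongrightarrow> 0) F"
  shows "(f \<longlongrightarrow> 0) F"
  using assms by (rule Lim_null_comparison)

text \<open>For \<open>b = 0\<close> the map preserves the curve of points (qmap l z, z^2) and acts
  on it as \<open>qmap l\<close>. Along this curve \<open>u + h\<close> is a polynomial
  \<open>\<tau>\<close> with derivative \<open>l\<close> at 0, and the leading coefficient of its
  increment under \<open>q\<close> steps is computed twice: from the expansion of the iterate and
  from the normal form. It shows \<open>c 0 \<noteq> 0\<close> and matches the two petal
  coordinates.\<close>

lemma resonant_coefficient:
  assumes l: "norm l = 1" and lq: "l ^ q = 1" and q: "q > 0"
    and f: "\<And>z. (qmap l ^^ q) z = z + z ^ (q + 1) * poly g z"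
    and h: "jet 2 h" and R: "jet (q + 2) R"
    and nf: "\<And>b u v. norm b \<le> 1/2 \<Longrightarrow> uv_pull l (\<lambda>b u v. u + h b u v) b u v
       = l * (u + h b u v) + c b * u ^ (q + 1) + R b u v"
  shows "l * poly g 0 = of_nat q * c 0"
proof -
  have "\<exists>p. \<forall>z. h 0 (qmap l z) (z * z) = poly p z"
    using h
  proof (induction rule: jet.induct)
    case (jet_monom d i j c)
    show ?case
      by (intro exI[of _ "smult (c 0) ([:0, l, 1:] ^ i * [:0, 0, 1:] ^ j)"])
        (simp add: qmap_def power2_eq_square power_mult_distrib algebra_simps)
  next
    case (jet_add d g h)
    then obtain p p' where "\<forall>z. g 0 (qmap l z) (z * z) = poly p z" "\<forall>z. h 0 (qmap l z) (z * z) = poly p' z" by blast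
    thus ?case by (intro exI[of _ "p + p'"]) auto
  qed
  then obtain p where p: "\<And>z. h 0 (qmap l z) (z\<^sup>2) = poly p z" by (auto simp: power2_eq_square)
  define \<tau> where "\<tau> = [:0, l, 1:] + p"
  have \<tau>: "poly \<tau> z = qmap l z + h 0 (qmap l z) (z\<^sup>2)" for z
    unfolding p \<tau>_def by (simp add: qmap_def power2_eq_square algebra_simps)
  have small: "norm (z\<^sup>2) \<le> norm (qmap l z) \<and> norm (qmap l z) \<le> 2 * norm z \<and> norm (qmap l z) \<le> 1" if "norm z \<le> 1/2" for z
  proof -
    have e: "qmap l z = z * (l + z)" by (simp add: qmap_def power2_eq_square algebra_simps)
    have "1/2 \<le> norm (l + z)" "norm (l + z) \<le> 2"
      using that l norm_diff_ineq[of l z] norm_triangle_ineq[of l z] by linarith+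
    hence "norm z * norm z \<le> norm z * norm (l + z)" "norm z * norm (l + z) \<le> norm z * 2"
      using that by (intro mult_left_mono; linarith?; simp)+
    thus ?thesis using that by (simp add: e norm_mult norm_power power2_eq_square)
  qed
  obtain K where K: "K \<ge> 0" "\<And>u v. norm u \<le> 1 \<Longrightarrow> norm v \<le> norm u \<Longrightarrow> norm (h 0 u v) \<le> K * norm u ^ 2"
    using jet_bound[OF h] by (metis norm_zero zero_le_divide_1_iff zero_le_numeral)
  obtain L where L: "L \<ge> 0" "\<And>u v. norm u \<le> 1 \<Longrightarrow> norm v \<le> norm u \<Longrightarrow> norm (R 0 u v) \<le> L * norm u ^ (q + 2)"
    using jet_bound[OF R] by (metis norm_zero zero_le_divide_1_iff zero_le_numeral)
  have half: "\<forall>\<^sub>F z in at (0::complex). norm z \<le> 1/2"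
    unfolding eventually_at by (intro exI[of _ "1/2"]) (auto simp: dist_norm)
  have ne: "\<forall>\<^sub>F z in at (0::complex). z \<noteq> 0" by (simp add: eventually_neq_at_within)
  have p0: "poly p 0 = 0" using K(2)[of 0 0] p[of 0] by simp
  have "((\<lambda>z. poly p z / z) \<longlongrightarrow> 0) (at 0)"
  proof (rule tendsto_norm_le_0)
    show "\<forall>\<^sub>F z in at 0. norm (poly p z / z) \<le> 4 * K * norm z"
      using half ne
    proof eventually_elim
      case (elim z)
      note sm = small[OF elim(1)]
      have "norm (poly p z) \<le> K * norm (qmap l z) ^ 2" using K(2) sm by (simp flip: p)
      also have "\<dots> \<le> K * (2 * norm z) ^ 2" using sm K(1) by (intro mult_left_mono power_mono) auto
      finally show ?case using elim by (simp add: norm_divide power2_eq_square field_simps)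
    qed
    show "((\<lambda>z. 4 * K * norm z) \<longlongrightarrow> 0) (at (0::complex))"
      by (auto intro!: tendsto_eq_intros)
  qed
  hence "(poly p has_field_derivative 0) (at 0)" by (simp add: has_field_derivative_iff p0)
  hence "poly (pderiv p) 0 = 0" using poly_DERIV DERIV_unique by blast
  hence d\<tau>: "poly (pderiv \<tau>) 0 = l" by (simp add: \<tau>_def pderiv_add pderiv_pCons)
  \<comment> \<open>strict differentiability of \<open>\<tau>\<close> at 0\<close>
  have lim1: "((\<lambda>z. (poly \<tau> ((qmap l ^^ q) z) - poly \<tau> z) / z ^ (q + 1)) \<longlongrightarrow> l * poly g 0) (at 0)"
  proof -
    have "((\<lambda>z. (poly \<tau> ((qmap l ^^ q) z) - poly \<tau> z - l * ((qmap l ^^ q) z - z)) / z ^ (q + 1)) \<longlongrightarrow> 0) (at 0)"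
    proof (rule tendstoI)
      fix \<epsilon> :: real assume \<epsilon>: "\<epsilon> > 0"
      define G where "G = norm (poly g 0) + 1"
      have G: "G > 0" using norm_ge_zero[of "poly g 0"] by (simp add: G_def add_nonneg_pos)
      define \<epsilon>' where "\<epsilon>' = \<epsilon> / (2 * G)"
      have \<epsilon>': "\<epsilon>' > 0" using \<epsilon> G by (simp add: \<epsilon>'_def)
      have "isCont (poly (pderiv \<tau>)) 0" by simp
      then obtain d where d: "d > 0" "\<And>z. norm z < d \<Longrightarrow> norm (poly (pderiv \<tau>) z - l) < \<epsilon>'"
        using \<epsilon>' unfolding continuous_at_eps_delta d\<tau> by (metis diff_zero dist_norm)
      have lip: "norm ((poly \<tau> a - l * a) - (poly \<tau> b - l * b)) \<le> \<epsilon>' * norm (a - b)" if "norm a < d" "norm b < d" for a b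
        by (rule field_differentiable_bound[of "ball 0 d" _ "\<lambda>z. poly (pderiv \<tau>) z - l"])
          (use d that in \<open>auto intro!: derivative_eq_intros less_imp_le poly_DERIV[THEN DERIV_subset]\<close>)
      have c1: "isCont (\<lambda>z. (qmap l ^^ q) z) 0" unfolding f by (intro continuous_intros)
      have "\<forall>\<^sub>F z in at 0. norm ((qmap l ^^ q) z) < d"
        using tendstoD[OF c1[unfolded isCont_def] d(1)] by simp
      moreover have "\<forall>\<^sub>F z in at (0::complex). norm z < d"
        unfolding eventually_at by (intro exI[of _ d]) (use d in auto)
      moreover have "isCont (poly g) 0" by simp
      hence "\<forall>\<^sub>F z in at 0. norm (poly g z - poly g 0) < 1"
        using tendstoD[of "poly g" "poly g 0" "at 0" 1] by (simp add: isCont_def dist_norm)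
      ultimately show "\<forall>\<^sub>F z in at 0. dist ((poly \<tau> ((qmap l ^^ q) z) - poly \<tau> z - l * ((qmap l ^^ q) z - z)) / z ^ (q + 1)) 0 < \<epsilon>"
        using ne
      proof eventually_elim
        case (elim z)
        have gz: "norm (poly g z) \<le> G" using elim(3) norm_triangle_sub[of "poly g z" "poly g 0"] by (simp add: G_def)
        have "norm (poly \<tau> ((qmap l ^^ q) z) - poly \<tau> z - l * ((qmap l ^^ q) z - z)) \<le> \<epsilon>' * norm ((qmap l ^^ q) z - z)"
          using lip[OF elim(1,2)] by (simp add: algebra_simps)
        also have "\<dots> = \<epsilon>' * norm (poly g z) * norm (z ^ (q + 1))" by (simp add: f norm_mult)
        also have "\<dots> \<le> \<epsilon>' * G * norm (z ^ (q + 1))" using gz \<epsilon>' by (intro mult_right_mono mult_left_mono) auto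
        also have "\<epsilon>' * G = \<epsilon> / 2" using G by (simp add: \<epsilon>'_def)
        finally have *: "norm (poly \<tau> ((qmap l ^^ q) z) - poly \<tau> z - l * ((qmap l ^^ q) z - z)) \<le> \<epsilon> / 2 * norm (z ^ (q + 1))" .
        have "norm (z ^ (q + 1)) > 0" using elim by simp
        hence "norm ((poly \<tau> ((qmap l ^^ q) z) - poly \<tau> z - l * ((qmap l ^^ q) z - z)) / z ^ (q + 1)) \<le> \<epsilon> / 2"
          using * by (simp only: norm_divide pos_divide_le_eq)
        thus ?case using \<epsilon> by simp
      qed
    qed
    moreover have "((\<lambda>z. l * poly g z) \<longlongrightarrow> l * poly g 0) (at 0)"
    proof -
      have "isCont (\<lambda>z. l * poly g z) 0" by (intro continuous_intros)
      thus ?thesis by (simp add: isCont_def)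
    qed
    ultimately have "((\<lambda>z. (poly \<tau> ((qmap l ^^ q) z) - poly \<tau> z - l * ((qmap l ^^ q) z - z)) / z ^ (q + 1) + l * poly g z)
        \<longlongrightarrow> 0 + l * poly g 0) (at 0)" by (rule tendsto_add)
    moreover have "\<forall>\<^sub>F z in at 0. (poly \<tau> ((qmap l ^^ q) z) - poly \<tau> z - l * ((qmap l ^^ q) z - z)) / z ^ (q + 1) + l * poly g z
       = (poly \<tau> ((qmap l ^^ q) z) - poly \<tau> z) / z ^ (q + 1)"
      using ne
    proof eventually_elim
      case (elim z)
      have "l * ((qmap l ^^ q) z - z) / z ^ (q + 1) = l * poly g z" using elim by (simp add: f)
      thus ?case by (simp add: diff_divide_distrib)
    qed
    ultimately show ?thesis by (simp add: Lim_transform_eventually)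
  qed
  have ratio: "((\<lambda>z. (qmap l ^^ n) z / z) \<longlongrightarrow> l ^ n) (at 0)" for n
    using qmap_funpow_has_derivative_0[of n l] by (simp add: has_field_derivative_iff)
  have lim0: "((\<lambda>z. (qmap l ^^ n) z) \<longlongrightarrow> 0) (at 0)" for n
    using DERIV_isCont[OF qmap_funpow_has_derivative_0[of n l]] by (simp add: isCont_def)
  \<comment> \<open>Every step adds one resonant term. Because \<open>l ^ q = 1\<close>, the factor
    \<open>(l ^ Suc n) ^ (q + 1)\<close> is just \<open>l ^ Suc n\<close>, so the contributions add
    up without cancellation.\<close>
  have lim2: "((\<lambda>z. (poly \<tau> ((qmap l ^^ n) z) - l ^ n * poly \<tau> z) / z ^ (q + 1)) \<longlongrightarrow> of_nat n * l ^ n * c 0) (at 0)" for n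
  proof (induction n)
    case (Suc n)
    define y where "y = (\<lambda>z. (qmap l ^^ n) z)"
    have rec: "poly \<tau> (qmap l z) = l * poly \<tau> z + c 0 * qmap l z ^ (q + 1) + R 0 (qmap l z) (z\<^sup>2)" for z
      using nf[of 0 "qmap l z" "z\<^sup>2"] unfolding \<tau>
      by (simp add: uv_pull_def uv_z_def) (simp add: qmap_def)
    have Rlim: "((\<lambda>z. R 0 (qmap l (y z)) ((y z)\<^sup>2) / z ^ (q + 1)) \<longlongrightarrow> 0) (at 0)"
    proof (rule tendsto_norm_le_0)
      have "\<forall>\<^sub>F z in at 0. norm (y z) \<le> 1/2"
        using tendstoD[OF lim0[of n], of "1/2"] by (auto simp: y_def elim: eventually_mono)
      thus "\<forall>\<^sub>F z in at 0. norm (R 0 (qmap l (y z)) ((y z)\<^sup>2) / z ^ (q + 1)) \<le> L * norm ((qmap l ^^ Suc n) z / z) ^ (q + 1) * norm ((qmap l ^^ Suc n) z)"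
        using ne
      proof eventually_elim
        case (elim z)
        note sm = small[OF elim(1)]
        have e: "(qmap l ^^ Suc n) z = qmap l (y z)" by (simp add: y_def)
        have "norm (R 0 (qmap l (y z)) ((y z)\<^sup>2)) \<le> L * norm (qmap l (y z)) ^ (q + 2)" using L(2) sm by blast
        hence "norm (R 0 (qmap l (y z)) ((y z)\<^sup>2)) / norm (z ^ (q + 1)) \<le> L * norm (qmap l (y z)) ^ (q + 2) / norm (z ^ (q + 1))"
          by (intro divide_right_mono) auto
        also have "\<dots> = L * (norm (qmap l (y z)) / norm z) ^ (q + 1) * norm (qmap l (y z))"
          by (simp add: norm_power power_divide norm_mult mult_ac)
        finally show ?case unfolding e norm_divide .
      qed
      have "((\<lambda>z. L * norm ((qmap l ^^ Suc n) z / z) ^ (q + 1) * norm ((qmap l ^^ Suc n) z)) \<longlongrightarrow> L * norm (l ^ Suc n) ^ (q + 1) * norm (0::complex)) (at 0)"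
        by (intro tendsto_intros ratio lim0)
      thus "((\<lambda>z. L * norm ((qmap l ^^ Suc n) z / z) ^ (q + 1) * norm ((qmap l ^^ Suc n) z)) \<longlongrightarrow> 0) (at 0)" by simp
    qed
    have A: "((\<lambda>z. l * ((poly \<tau> (y z) - l ^ n * poly \<tau> z) / z ^ (q + 1)) + c 0 * ((qmap l ^^ Suc n) z / z) ^ (q + 1)
        + R 0 (qmap l (y z)) ((y z)\<^sup>2) / z ^ (q + 1)) \<longlongrightarrow> l * (of_nat n * l ^ n * c 0) + c 0 * (l ^ Suc n) ^ (q + 1) + 0) (at 0)"
      unfolding y_def by (intro tendsto_intros Suc ratio Rlim[unfolded y_def])
    have B: "(l ^ Suc n) ^ (q + 1) = l ^ Suc n"
      by (metis (no_types, lifting) lq mult.right_neutral power_add power_mult mult.commute power_one power_one_right)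
    have C: "l * ((poly \<tau> (y z) - l ^ n * poly \<tau> z) / z ^ (q + 1)) + c 0 * ((qmap l ^^ Suc n) z / z) ^ (q + 1)
        + R 0 (qmap l (y z)) ((y z)\<^sup>2) / z ^ (q + 1) = (poly \<tau> ((qmap l ^^ Suc n) z) - l ^ Suc n * poly \<tau> z) / z ^ (q + 1)" for z
    proof -
      have e: "(qmap l ^^ Suc n) z = qmap l (y z)" by (simp add: y_def)
      show ?thesis unfolding e rec power_divide
        by (simp add: diff_divide_distrib add_divide_distrib algebra_simps)
    qed
    have "l * (of_nat n * l ^ n * c 0) + c 0 * (l ^ Suc n) ^ (q + 1) + 0 = of_nat (Suc n) * l ^ Suc n * c 0"
      by (simp only: B) (simp add: algebra_simps)
    with A show ?case by (simp only: C)
  qed simp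
  from lim2[of q] lim1 lq have "of_nat q * c 0 = l * poly g 0"
    using tendsto_unique[of "at (0::complex)"] by (simp add: trivial_limit_at)
  thus ?thesis by simp
qed

text \<open>A perturbed attracting petal: in the normalised coordinate \<open>u + h b u v\<close> the reciprocal power \<open>W\<close> lies in
  a sector, where the map is close to \<open>W + 1\<close>.\<close>

definition in_trap where
  "in_trap l q h c r M b u v \<longleftrightarrow> u \<noteq> 0 \<and> norm u < r \<and> norm v \<le> norm u \<and>
    (let W = - l / (of_nat q * c b * (u + h b u v) ^ q) in Re W \<ge> M \<and> \<bar>Im W\<bar> \<le> Re W)"

text \<open>The one-dimensional estimate with constants uniform in \<open>b\<close>. The normal form
  reads T' = l T (1 + s), and as \<open>l ^ q = 1\<close> the increment of \<open>W\<close> is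
  \<open>\<Psi> (t, e, s)\<close>, where t = u/T, e = R/(c T^(q+1)) and s differ from 1, 0, 0 by
  O(|u|).\<close>

lemma trap_invariant:
  assumes l: "norm l = 1" and lq: "l ^ q = 1" and q: "q > 0"
    and h: "jet 2 h" and R: "jet (q + 2) R" and c: "continuous_on (cball 0 (1/2)) c" and c0: "c 0 \<noteq> 0"
    and nf: "\<And>b u v. norm b \<le> 1/2 \<Longrightarrow> uv_pull l (\<lambda>b u v. u + h b u v) b u v
       = l * (u + h b u v) + c b * u ^ (q + 1) + R b u v"
  obtains \<beta> r M where "0 < \<beta>" "\<beta> \<le> 1/4" "0 < r" "r \<le> 1" "M > 0"
    "\<And>b u v. norm b < \<beta> \<Longrightarrow> in_trap l q h c r M b u v \<Longrightarrow>
      in_trap l q h c r M b (l * u + (uv_z l b u v)\<^sup>2) (- b / l * v + (uv_z l b u v)\<^sup>2)"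
proof -
  have l0: "l \<noteq> 0" using l by auto
  obtain K where K: "K \<ge> 0" "\<And>b u v. norm b \<le> 1/2 \<Longrightarrow> norm u \<le> 1 \<Longrightarrow> norm v \<le> norm u \<Longrightarrow> norm (h b u v) \<le> K * norm u ^ 2"
    using jet_bound[OF h] by blast
  obtain L where L: "L \<ge> 0" "\<And>b u v. norm b \<le> 1/2 \<Longrightarrow> norm u \<le> 1 \<Longrightarrow> norm v \<le> norm u \<Longrightarrow> norm (R b u v) \<le> L * norm u ^ (q + 2)"
    using jet_bound[OF R] by blast
  have "isCont c 0" using c by (rule continuous_on_interior) simp
  hence "(c \<longlongrightarrow> c 0) (at 0)" by (simp add: isCont_def)
  from tendstoD[OF this, of "norm (c 0) / 2"] c0 obtain d where
    d: "d > 0" "\<And>b. b \<noteq> 0 \<Longrightarrow> norm b < d \<Longrightarrow> norm (c b - c 0) < norm (c 0) / 2"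
    unfolding eventually_at by (auto simp: dist_norm)
  define \<beta> where "\<beta> = min d (1/4)"
  have \<beta>: "0 < \<beta>" "\<beta> \<le> 1/4" using d by (auto simp: \<beta>_def)
  define cm where "cm = norm (c 0) / 2"
  define cM where "cM = 2 * norm (c 0)"
  have cm: "cm > 0" using c0 by (simp add: cm_def)
  have cM: "cM \<ge> 0" by (simp add: cM_def)
  have cb: "cm \<le> norm (c b)" "norm (c b) \<le> cM" if "norm b < \<beta>" for b
  proof -
    have "norm (c b - c 0) \<le> norm (c 0) / 2"
      using d(2)[of b] that by (cases "b = 0") (auto simp: \<beta>_def)
    thus "cm \<le> norm (c b)" "norm (c b) \<le> cM"
      using norm_triangle_sub[of "c b" "c 0"] norm_triangle_sub[of "c 0" "c b"]
      unfolding cm_def cM_def by (simp_all add: norm_minus_commute)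
  qed
  obtain m :: "complex \<Rightarrow> complex" where m: "\<And>s. inverse ((1 + s) ^ q) - 1 = m s * s" "isCont m 0" "m 0 = - of_nat q"
    using inverse_power_quotient[of q] by blast
  define \<Psi> where "\<Psi> = (\<lambda>p::complex \<times> complex \<times> complex. - (1 / of_nat q) * m (snd (snd p)) * (fst p ^ (q + 1) + fst (snd p)))"
  have "isCont (\<lambda>p::complex \<times> complex \<times> complex. m (snd (snd p))) (1, 0, 0)"
    by (rule isCont_o2[where g = m]) (use m(2) in \<open>auto intro!: continuous_intros\<close>)
  hence "isCont \<Psi> (1, 0, 0)" unfolding \<Psi>_def by (intro continuous_intros)
  moreover have "\<Psi> (1, 0, 0) = 1" using q by (simp add: \<Psi>_def m(3))
  ultimately obtain \<eta>' where \<eta>': "\<eta>' > 0" "\<And>p. dist p (1, 0, 0) < \<eta>' \<Longrightarrow> dist (\<Psi> p) 1 < 1/4"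
    unfolding continuous_at_eps_delta by (metis zero_less_divide_1_iff zero_less_numeral)
  define \<eta> where "\<eta> = \<eta>' / 3"
  have \<eta>: "\<eta> > 0" using \<eta>' by (simp add: \<eta>_def)
  have \<Psi>: "norm (\<Psi> (t, e, s) - 1) \<le> 1/4" if "norm (t - 1) < \<eta>" "norm e < \<eta>" "norm s < \<eta>" for t e s
  proof -
    have "dist (t, e, s) (1, 0, 0) \<le> dist t 1 + dist (e, s) (0, 0)"
      by (subst dist_Pair_Pair, rule sqrt_sum_squares_le_sum) auto
    also have "dist (e, s) (0, 0) \<le> dist e 0 + dist s 0"
      by (subst dist_Pair_Pair, rule sqrt_sum_squares_le_sum) auto
    finally have "dist (t, e, s) (1, 0, 0) < \<eta>'" using that by (simp add: dist_norm \<eta>_def)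
    thus ?thesis using \<eta>'(2) by (simp add: dist_norm less_imp_le)
  qed
  \<comment> \<open>Collects the constants for which |t - 1|, |e| and |s| are at most
    \<open>norm u * B\<close>.\<close>
  define B where "B = 1 + 2 * K + L * 2 ^ (q + 1) / cm + 2 * (cM + L)"
  have B: "B \<ge> 1" using K L cm c0 by (simp add: B_def cM_def)
  \<comment> \<open>1/72 gives |z^2| \<le> 9 |u|^2 \<le> |u|/8; the second bound gives |h| \<le>
    |u|/2 even for |u| up to 2r, which is needed at the image point; the third makes
    \<open>norm u * B\<close> smaller than \<open>\<eta>\<close>.\<close>
  define r where "r = min (1/72) (min (1 / (4 * (K + 1))) (\<eta> / (2 * B)))"
  have r: "0 < r" "r \<le> 1/72" "r \<le> 1 / (4 * (K + 1))" "r \<le> \<eta> / (2 * B)"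
    using K B \<eta> by (auto simp: r_def)
  have rB: "r * B < \<eta>"
  proof -
    have "r * B \<le> \<eta> / (2 * B) * B" using r B by (intro mult_right_mono) auto
    also have "\<dots> = \<eta> / 2" using B by simp
    finally show ?thesis using \<eta> by simp
  qed
  \<comment> \<open>So large that |T'| \<ge> r/2 would force |W'| \<le> M/2. Thus the condition on
    \<open>W\<close> by itself keeps |u| below \<open>r\<close>.\<close>
  define M where "M = 2 * (1 / (of_nat q * cm * (r / 2) ^ q))"
  have M: "M > 0" using cm q r by (simp add: M_def)
  have hu: "norm (h b u v) \<le> norm u / 2" if "norm b < \<beta>" "norm u \<le> 2 * r" "norm v \<le> norm u" for b u v
  proof -
    have "norm (h b u v) \<le> K * norm u ^ 2" using that \<beta> r by (intro K(2)) auto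
    also have "\<dots> = (K * norm u) * norm u" by (simp add: power2_eq_square)
    also have "\<dots> \<le> 1/2 * norm u"
    proof (rule mult_right_mono)
      have "K * norm u \<le> K * (2 * r)" using that K by (intro mult_left_mono) auto
      also have "\<dots> \<le> K * (2 * (1 / (4 * (K + 1))))" using K r(3) by (intro mult_left_mono) auto
      also have "\<dots> \<le> 1/2" using K by (simp add: field_simps)
      finally show "K * norm u \<le> 1/2" .
    qed simp
    finally show ?thesis by simp
  qed
  show ?thesis
  proof (rule that[of \<beta> r M])
    fix b u v :: complex assume b: "norm b < \<beta>"
    assume tr: "in_trap l q h c r M b u v"
    define T where "T = u + h b u v"
    define W where "W = - l / (of_nat q * c b * T ^ q)"
    have u: "u \<noteq> 0" "norm u < r" "norm v \<le> norm u" and W: "Re W \<ge> M" "\<bar>Im W\<bar> \<le> Re W"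
      using tr by (auto simp: in_trap_def W_def T_def Let_def)
    define z where "z = uv_z l b u v"
    define u' where "u' = l * u + z\<^sup>2"
    define v' where "v' = - b / l * v + z\<^sup>2"
    define T' where "T' = u' + h b u' v'"
    define W' where "W' = - l / (of_nat q * c b * T' ^ q)"
    have b2: "norm b \<le> 1/2" "norm b \<le> 1/4" using b \<beta> by auto
    have u1: "norm u \<le> 1" using u r by auto
    have "norm z \<le> 3 * norm u" unfolding z_def by (rule uv_z_le[OF l b2(1) u(3)])
    hence "norm z ^ 2 \<le> (3 * norm u) ^ 2" by (intro power_mono) auto
    also have "\<dots> = 9 * norm u * norm u" by (simp add: power2_eq_square)
    also have "\<dots> \<le> 9 * (1/72) * norm u" using u r by (intro mult_right_mono) auto
    finally have z2: "norm (z\<^sup>2) \<le> norm u / 8" by (simp add: norm_power)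
    have nlu: "norm (l * u) = norm u" using l by (simp add: norm_mult)
    have u'1: "norm u' \<ge> 3/4 * norm u"
      using norm_diff_ineq[of "l * u" "z\<^sup>2"] z2 nlu norm_ge_zero[of u] unfolding u'_def by linarith
    have u'2: "norm u' \<le> 2 * norm u"
      using norm_triangle_ineq[of "l * u" "z\<^sup>2"] z2 nlu norm_ge_zero[of u] unfolding u'_def by linarith
    have "norm (- b / l * v) \<le> 1/4 * norm u"
      using b2 u(3) l by (simp add: norm_mult norm_divide) (metis mult_mono norm_ge_zero divide_inverse_commute inverse_eq_divide mult_1 le_divide_eq_numeral1(1) mult.commute zero_le_numeral zero_le_divide_1_iff)
    hence "norm v' \<le> 1/4 * norm u + norm u / 8"
      using norm_triangle_ineq[of "- b / l * v" "z\<^sup>2"] z2 unfolding v'_def by linarith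
    hence v': "norm v' \<le> norm u'" using u'1 norm_ge_zero[of u] by linarith
    have hT: "norm (h b u v) \<le> norm u / 2" using u b r(1) by (intro hu) auto
    have hT': "norm (h b u' v') \<le> norm u' / 2" using u v' u'2 b r(1) by (intro hu) auto
    have T1: "norm T \<ge> norm u / 2" using norm_diff_ineq[of u "h b u v"] hT unfolding T_def by linarith
    have T0: "T \<noteq> 0" using T1 u by auto
    have T'1: "norm T' \<ge> norm u' / 2" using norm_diff_ineq[of u' "h b u' v'"] hT' unfolding T'_def by linarith
    have u'0: "u' \<noteq> 0" using u'1 u by auto
    define s where "s = (c b * u ^ (q + 1) + R b u v) / (l * T)"
    define t where "t = u / T"
    define e where "e = R b u v / (c b * T ^ (q + 1))"
    have T'e: "T' = l * T * (1 + s)"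
    proof -
      have "T' = l * T + c b * u ^ (q + 1) + R b u v"
        using nf[OF b2(1), of u v] by (simp add: T'_def T_def u'_def v'_def z_def uv_pull_def)
      moreover have "l * T * s = c b * u ^ (q + 1) + R b u v" using T0 l0 by (simp add: s_def)
      moreover have "l * T * (1 + s) = l * T + l * T * s" by (simp add: distrib_left)
      ultimately show ?thesis by simp
    qed
    have cb0: "c b \<noteq> 0" using cb[OF b] cm by auto
    have q0: "of_nat q \<noteq> (0::complex)" using q by simp
    have WW: "W' - W = \<Psi> (t, e, s)"
    proof -
      have "W' = W * inverse ((1 + s) ^ q)"
        unfolding W'_def W_def T'e power_mult_distrib lq by (simp add: divide_inverse mult_ac)
      hence "W' - W = W * (m s * s)" by (simp flip: m(1) add: right_diff_distrib)
      also have "\<dots> = - (1 / of_nat q) * m s * (c b * u ^ (q + 1) + R b u v) / (c b * T ^ (q + 1))"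
        using T0 l0 cb0 q0 by (simp add: W_def s_def field_simps)
      also have "\<dots> = \<Psi> (t, e, s)"
        using cb0 T0 by (simp add: \<Psi>_def t_def e_def power_divide add_divide_distrib distrib_left field_simps)
      finally show ?thesis .
    qed
    have Ru: "norm (R b u v) \<le> L * norm u ^ (q + 2)" by (rule L(2)[OF b2(1) u1 u(3)])
    have ub: "norm u * B < \<eta>" using mult_right_mono[of "norm u" r B] u B rB by linarith
    have "norm (t - 1) < \<eta>"
    proof -
      have "t - 1 = - h b u v / T" using T0 by (simp add: t_def T_def field_simps)
      hence "norm (t - 1) = norm (h b u v) / norm T" by (simp add: norm_divide)
      also have "\<dots> \<le> (K * norm u ^ 2) / (norm u / 2)" using K(2)[OF b2(1) u1 u(3)] K(1) T1 u by (intro frac_le) auto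
      also have "\<dots> = norm u * (2 * K)" using u by (simp add: power2_eq_square)
      also have "\<dots> \<le> norm u * B" using L cm c0 by (intro mult_left_mono) (auto simp: B_def cM_def)
      finally show ?thesis using ub by linarith
    qed
    moreover have "norm e < \<eta>"
    proof -
      have "norm e = norm (R b u v) / (norm (c b) * norm T ^ (q + 1))" by (simp add: e_def norm_divide norm_mult norm_power)
      also have "\<dots> \<le> (L * norm u ^ (q + 2)) / (cm * (norm u / 2) ^ (q + 1))"
        using Ru L(1) cb[OF b] T1 u cm by (intro frac_le mult_mono power_mono mult_pos_pos) auto
      also have "\<dots> = norm u * (L * 2 ^ (q + 1) / cm)" using u cm by (simp add: field_simps power_divide)
      also have "\<dots> \<le> norm u * B" using K L c0 by (intro mult_left_mono) (auto simp: B_def cM_def)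
      finally show ?thesis using ub by linarith
    qed
    moreover have "norm s < \<eta>"
    proof -
      have p: "norm u ^ (q + 1) \<le> norm u ^ 2" "norm u ^ (q + 2) \<le> norm u ^ 2" by (rule power_decreasing; use u1 q in simp)+
      have "norm (c b * u ^ (q + 1) + R b u v) \<le> norm (c b * u ^ (q + 1)) + norm (R b u v)" by (rule norm_triangle_ineq)
      also have "\<dots> \<le> cM * norm u ^ 2 + L * norm u ^ 2"
        unfolding norm_mult norm_power
        using cb[OF b] cM p L Ru order_trans[OF Ru mult_left_mono[OF p(2) L(1)]] by (intro add_mono mult_mono) auto
      finally have "norm (c b * u ^ (q + 1) + R b u v) \<le> (cM + L) * norm u ^ 2" by (simp add: distrib_right)
      moreover have "norm (l * T) \<ge> norm u / 2" using T1 l by (simp add: norm_mult)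
      ultimately have "norm s \<le> ((cM + L) * norm u ^ 2) / (norm u / 2)"
        unfolding s_def norm_divide using u L(1) c0 by (intro frac_le) (auto simp: cM_def)
      also have "\<dots> = norm u * (2 * (cM + L))" using u by (simp add: power2_eq_square)
      also have "\<dots> \<le> norm u * B" using K L cm by (intro mult_left_mono) (auto simp: B_def)
      finally show ?thesis using ub by linarith
    qed
    ultimately have dW: "norm (W' - W - 1) \<le> 1/4" unfolding WW by (rule \<Psi>)
    have re: "\<bar>Re (W' - W - 1)\<bar> \<le> 1/4" and im: "\<bar>Im (W' - W - 1)\<bar> \<le> 1/4"
      using dW abs_Re_le_cmod[of "W' - W - 1"] abs_Im_le_cmod[of "W' - W - 1"] by linarith+
    have W'1: "Re W' \<ge> Re W + 3/4" using re by (simp only: abs_le_iff minus_complex.simps one_complex.simps) linarith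
    have W'2: "\<bar>Im W'\<bar> \<le> Re W'" using im W W'1 by (simp only: abs_le_iff minus_complex.simps one_complex.simps) linarith
    have "norm T' < r / 2"
    proof (rule ccontr)
      assume "\<not> ?thesis"
      hence "cm * (r / 2) ^ q \<le> norm (c b) * norm T' ^ q" using cb[OF b] r cm by (intro mult_mono power_mono) auto
      hence "of_nat q * (cm * (r / 2) ^ q) \<le> of_nat q * (norm (c b) * norm T' ^ q)" by (intro mult_left_mono) auto
      moreover have "0 < of_nat q * (cm * (r / 2) ^ q)" using cm q r by simp
      ultimately have "1 / (of_nat q * (norm (c b) * norm T' ^ q)) \<le> 1 / (of_nat q * (cm * (r / 2) ^ q))"
        by (intro divide_left_mono) (auto intro!: mult_pos_pos)
      hence "norm W' \<le> M / 2" using l by (simp add: W'_def M_def norm_divide norm_mult norm_power mult.assoc)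
      moreover have "norm W' \<ge> M" using W'1 W(1) complex_Re_le_cmod[of W'] by linarith
      ultimately show False using M by linarith
    qed
    hence "norm u' < r" using T'1 by linarith
    moreover have "Re W' \<ge> M" using W'1 W(1) by linarith
    ultimately have "in_trap l q h c r M b u' v'" unfolding in_trap_def Let_def
      using u'0 v' W'2 by (simp add: W'_def T'_def)
    thus "in_trap l q h c r M b (l * u + (uv_z l b u v)\<^sup>2) (- b / l * v + (uv_z l b u v)\<^sup>2)"
      by (simp only: u'_def v'_def z_def)
  qed (use \<beta> r M in auto)
qed

text \<open>First coordinates of the orbit of \<open>(x, w)\<close> under \<open>(x, w) \<mapsto> (x\<^sup>2 + c + b w, x)\<close>, with \<open>w\<close> at index \<open>0\<close>.
  This is the Henon map with \<open>b = a\<^sup>2\<close> after \<open>(x, y) \<mapsto> (x, y / a)\<close>; it makes sense also for \<open>b = 0\<close>.\<close>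

fun horb :: "complex \<Rightarrow> complex \<Rightarrow> complex \<Rightarrow> complex \<Rightarrow> nat \<Rightarrow> complex" where
  "horb c b x w 0 = w"
| "horb c b x w (Suc 0) = x"
| "horb c b x w (Suc (Suc n)) = (horb c b x w (Suc n))\<^sup>2 + c + b * horb c b x w n"

text \<open>The point with both coordinates \<open>par_alpha l b\<close> is fixed. Its multipliers
  have sum 2 alpha = l - b/l and product -b, so they are l and -b/l; \<open>par_c\<close> is the
  fixed point equation solved for the parameter.\<close>

definition par_alpha :: "complex \<Rightarrow> complex \<Rightarrow> complex" where
  "par_alpha l b = l / 2 - b / (2 * l)"

definition par_c :: "complex \<Rightarrow> complex \<Rightarrow> complex" where
  "par_c l b = (1 - b) * par_alpha l b - (par_alpha l b)\<^sup>2"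

lemma continuous_on_horb [continuous_intros]:
  assumes "continuous_on S c" "continuous_on S b" "continuous_on S x" "continuous_on S w"
  shows "continuous_on S (\<lambda>p. horb (c p) (b p) (x p) (w p) n)"
proof -
  have "continuous_on S (\<lambda>p. horb (c p) (b p) (x p) (w p) n) \<and> continuous_on S (\<lambda>p. horb (c p) (b p) (x p) (w p) (Suc n))"
    by (induction n) (auto intro!: continuous_intros assms)
  thus ?thesis ..
qed

lemma continuous_on_par_alpha [continuous_intros]:
  "l \<noteq> 0 \<Longrightarrow> continuous_on S b \<Longrightarrow> continuous_on S (\<lambda>p. par_alpha l (b p))"
  unfolding par_alpha_def by (intro continuous_intros) auto

lemma continuous_on_par_c [continuous_intros]:
  "l \<noteq> 0 \<Longrightarrow> continuous_on S b \<Longrightarrow> continuous_on S (\<lambda>p. par_c l (b p))"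
  unfolding par_c_def by (intro continuous_intros) auto

text \<open>The orbit relative to the fixed point; index \<open>0\<close> is the second coordinate of the initial point.\<close>

definition rel_orb where
  "rel_orb l b x w n = horb (par_c l b) b x w n - par_alpha l b"

lemma rel_orb_rec:
  assumes "l \<noteq> 0"
  shows "rel_orb l b x w (Suc (Suc n)) = qmap l (rel_orb l b x w (Suc n)) +
    b * (rel_orb l b x w n - rel_orb l b x w (Suc n) / l)"
proof -
  define X where "X = rel_orb l b x w (Suc n)"
  define Y where "Y = rel_orb l b x w n"
  have "horb (par_c l b) b x w (Suc n) = X + par_alpha l b" "horb (par_c l b) b x w n = Y + par_alpha l b"
    by (simp_all add: X_def Y_def rel_orb_def)
  hence "rel_orb l b x w (Suc (Suc n)) = (X + par_alpha l b)\<^sup>2 + par_c l b + b * (Y + par_alpha l b) - par_alpha l b"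
    by (simp add: rel_orb_def)
  also have "\<dots> = X\<^sup>2 + 2 * par_alpha l b * X + b * Y"
    by (simp add: par_c_def power2_eq_square algebra_simps)
  also have "2 * par_alpha l b = l - b / l" by (simp add: par_alpha_def diff_divide_distrib)
  finally show ?thesis by (simp add: X_def[symmetric] Y_def[symmetric] qmap_def algebra_simps)
qed

lemma rel_orb_0: "l \<noteq> 0 \<Longrightarrow> rel_orb l 0 0 w (Suc n) = (qmap l ^^ n) (- l / 2)"
proof (induction n)
  case 0
  show ?case by (simp add: rel_orb_def par_alpha_def)
next
  case (Suc n)
  show ?case unfolding rel_orb_rec[OF Suc(2)] Suc(1)[OF Suc(2)] by simp
qed

text \<open>\<open>uorb\<close> and \<open>vorb\<close> are the eigenforms of the linear part at the
  fixed point, with multipliers l and -b/l.\<close>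

definition uorb where "uorb l b x w n = rel_orb l b x w (Suc n) + b / l * rel_orb l b x w n"

definition vorb where "vorb l b x w n = rel_orb l b x w (Suc n) - l * rel_orb l b x w n"

lemma uv_orbit:
  assumes l: "norm l = 1" and b: "norm b \<le> 1/2"
  shows "uv_z l b (uorb l b x w n) (vorb l b x w n) = rel_orb l b x w (Suc n)"
    "uorb l b x w (Suc n) = l * uorb l b x w n + (uv_z l b (uorb l b x w n) (vorb l b x w n))\<^sup>2"
    "vorb l b x w (Suc n) = - b / l * vorb l b x w n + (uv_z l b (uorb l b x w n) (vorb l b x w n))\<^sup>2"
proof -
  have l0: "l \<noteq> 0" using l by auto
  have "uorb l b x w n + b / l\<^sup>2 * vorb l b x w n = (1 + b / l\<^sup>2) * rel_orb l b x w (Suc n)"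
    using l0 by (simp add: uorb_def vorb_def field_simps power2_eq_square)
  thus z: "uv_z l b (uorb l b x w n) (vorb l b x w n) = rel_orb l b x w (Suc n)"
    using uv_denominator[OF l b] by (simp add: uv_z_def)
  show "uorb l b x w (Suc n) = l * uorb l b x w n + (uv_z l b (uorb l b x w n) (vorb l b x w n))\<^sup>2"
    "vorb l b x w (Suc n) = - b / l * vorb l b x w n + (uv_z l b (uorb l b x w n) (vorb l b x w n))\<^sup>2"
    unfolding z using l0
    by (simp_all add: uorb_def vorb_def rel_orb_rec[OF l0] qmap_def field_simps)
qed

lemma in_trap_open:
  assumes c: "continuous_on (cball 0 (1/2)) c" and h: "jet 2 h" and q: "q > 0"
    and W: "W = - l / (of_nat q * c 0 * (u + h 0 u v) ^ q)" "Re W > M" "\<bar>Im W\<bar> < Re W" "M > 0"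
    and u: "u \<noteq> 0" "norm u < r" "norm v < norm u"
  obtains e where "e > 0" "\<And>b u' v'. norm b < e \<Longrightarrow> norm (u' - u) < e \<Longrightarrow> norm (v' - v) < e \<Longrightarrow> in_trap l q h c r M b u' v'"
proof -
  have "isCont c 0" using c by (rule continuous_on_interior) simp
  have cc: "isCont (\<lambda>p::complex \<times> complex \<times> complex. c (fst p)) (0, u, v)"
    by (rule isCont_o2[where g = c]) (use \<open>isCont c 0\<close> in \<open>auto intro!: continuous_intros\<close>)
  have "(0, u, v) \<in> interior (cball (0::complex) (1/2) \<times> UNIV)" by (simp add: interior_Times)
  with jet_continuous[OF h] have ch: "isCont (\<lambda>p. h (fst p) (fst (snd p)) (snd (snd p))) (0, u, v)"
    using continuous_on_interior by (fastforce simp: case_prod_unfold)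
  define F where "F = (\<lambda>p. - l / (of_nat q * c (fst p) * (fst (snd p) + h (fst p) (fst (snd p)) (snd (snd p))) ^ q))"
  have nz: "of_nat q * c 0 * (u + h 0 u v) ^ q \<noteq> 0"
  proof
    assume "of_nat q * c 0 * (u + h 0 u v) ^ q = 0"
    hence "W = 0" unfolding W(1) by (simp only: div_by_0)
    thus False using W(2,4) by simp
  qed
  have cF: "isCont F (0, u, v)" unfolding F_def by (intro continuous_intros cc ch) (use nz in auto)
  have F0: "F (0, u, v) = W" by (simp add: F_def W)
  have ev: "\<forall>\<^sub>F p in nhds (0, u, v). g p > 0" if "isCont g (0, u, v)" "g (0, u, v) > (0::real)" for g
    using that order_tendstoD(1)[of g "g (0,u,v)" "nhds (0,u,v)" 0] by (simp add: isCont_def tendsto_at_iff_tendsto_nhds)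
  have "\<forall>\<^sub>F p in nhds (0, u, v). Re (F p) - M > 0"
    by (rule ev, intro continuous_intros isCont_Re isCont_Im cF) (use W(2) in \<open>simp only: F0 diff_gt_0_iff_gt\<close>)
  moreover have "\<forall>\<^sub>F p in nhds (0, u, v). Re (F p) - \<bar>Im (F p)\<bar> > 0"
    by (rule ev, intro continuous_intros isCont_Re isCont_Im cF) (use W(3) in \<open>simp only: F0 diff_gt_0_iff_gt\<close>)
  moreover have "\<forall>\<^sub>F p in nhds (0::complex, u, v). r - norm (fst (snd p)) > 0" "\<forall>\<^sub>F p in nhds (0::complex, u, v). norm (fst (snd p)) - norm (snd (snd p)) > 0"
    "\<forall>\<^sub>F p in nhds (0::complex, u, v). norm (fst (snd p)) > 0"
    by (rule ev; use u in \<open>auto intro!: continuous_intros\<close>)+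
  ultimately have "\<forall>\<^sub>F p in nhds (0, u, v). in_trap l q h c r M (fst p) (fst (snd p)) (snd (snd p))"
    by eventually_elim (auto simp: in_trap_def F_def)
  then obtain e where e: "e > 0" "\<And>p. dist p (0, u, v) < e \<Longrightarrow> in_trap l q h c r M (fst p) (fst (snd p)) (snd (snd p))"
    unfolding eventually_nhds_metric by blast
  show ?thesis
  proof (rule that[of "e / 3"])
    fix b u' v' :: complex assume a: "norm b < e / 3" "norm (u' - u) < e / 3" "norm (v' - v) < e / 3"
    have "dist (b, u', v') (0, u, v) \<le> dist b 0 + dist (u', v') (u, v)"
      by (subst dist_Pair_Pair, rule sqrt_sum_squares_le_sum) auto
    also have "dist (u', v') (u, v) \<le> dist u' u + dist v' v"
      by (subst dist_Pair_Pair, rule sqrt_sum_squares_le_sum) auto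
    finally have "dist (b, u', v') (0, u, v) < e" using a by (simp add: dist_norm)
    from e(2)[OF this] show "in_trap l q h c r M b u' v'" by simp
  qed (use e in simp)
qed

text \<open>At \<open>b = 0\<close> the orbit of \<open>x = 0\<close> is the critical orbit whatever
  \<open>w\<close> is, so one entry time serves all |w| \<le> 6, and compactness of this disc makes
  the entry into the trap uniform for small \<open>b\<close> and \<open>x\<close>.\<close>

theorem critical_strip_bounded:
  assumes q: "q > 0" and prim: "\<And>i. l ^ i = (1::complex) \<longleftrightarrow> q dvd i"
  obtains \<epsilon> where "\<epsilon> > 0"
    "\<And>b x w. norm b < \<epsilon> \<Longrightarrow> norm x < \<epsilon> \<Longrightarrow> norm w \<le> 6 \<Longrightarrow> bounded (range (horb (par_c l b) b x w))"
proof -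
  have lq: "l ^ q = 1" using prim by simp
  have l: "norm l = 1" using norm_root_of_unity lq q by blast
  hence l0: "l \<noteq> 0" by auto
  obtain g where g0: "poly g 0 \<noteq> 0" and f: "\<And>z. (qmap l ^^ q) z = z + z ^ (q + 1) * poly g z"
    and crit: "\<And>e. e > 0 \<Longrightarrow> \<exists>j. norm ((qmap l ^^ j) (- l / 2)) < e \<and>
      (let u = - 1 / (of_nat q * poly g 0 * ((qmap l ^^ j) (- l / 2)) ^ q) in
        Re u > 0 \<and> \<bar>Im u\<bar> \<le> 1/2 * Re u)"
    using parabolic_critical_orbit[OF q prim] by blast
  obtain h R c where h: "jet 2 h" and R: "jet (q + 2) R" and c: "continuous_on (cball 0 (1/2)) c"
    and nf: "\<And>b u v. norm b \<le> 1/2 \<Longrightarrow> uv_pull l (\<lambda>b u v. u + h b u v) b u v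
       = l * (u + h b u v) + c b * u ^ (q + 1) + R b u v"
    using resonant_normal_form[OF l q prim] by blast
  have lg: "l * poly g 0 = of_nat q * c 0" by (rule resonant_coefficient[OF l lq q f h R nf])
  have c0: "c 0 \<noteq> 0" using lg g0 l0 by auto
  obtain \<beta> r M where tr: "0 < \<beta>" "\<beta> \<le> 1/4" "0 < r" "r \<le> 1" "M > 0"
    "\<And>b u v. norm b < \<beta> \<Longrightarrow> in_trap l q h c r M b u v \<Longrightarrow>
      in_trap l q h c r M b (l * u + (uv_z l b u v)\<^sup>2) (- b / l * v + (uv_z l b u v)\<^sup>2)"
    by (rule trap_invariant[OF l lq q h R c c0 nf], assumption, rule that, assumption+)
  obtain K where K: "K \<ge> 0" "\<And>b u v. norm b \<le> 1/2 \<Longrightarrow> norm u \<le> 1 \<Longrightarrow> norm v \<le> norm u \<Longrightarrow> norm (h b u v) \<le> K * norm u ^ 2"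
    using jet_bound[OF h] by blast
  have "isCont (\<lambda>t::complex. 1 / t ^ q) 1" by (intro continuous_intros) auto
  then obtain \<eta> where "\<eta> > 0" "\<forall>t::complex. dist t 1 < \<eta> \<longrightarrow> dist (1 / t ^ q) (1 / 1 ^ q) < 1/8"
    unfolding continuous_at_eps_delta by (metis zero_less_divide_1_iff zero_less_numeral)
  hence \<eta>: "\<eta> > 0" "\<And>t::complex. dist t 1 < \<eta> \<Longrightarrow> norm (1 / t ^ q - 1) < 1/8"
    by (auto simp: dist_norm)
  define G where "G = norm (poly g 0)"
  have G: "G > 0" using g0 by (simp add: G_def)
  \<comment> \<open>1/4 keeps |l + y| near 1, r/4 keeps |us| below \<open>r\<close>, \<eta>/(2 + 4K)
    brings \<open>T\<close> relatively close to \<open>l * y\<close>, and 1/(4GM) lifts the real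
    part of \<open>W\<close> above \<open>M\<close>.\<close>
  define e where "e = min (min (1/4) (r / 4)) (min (\<eta> / (2 + 4 * K)) (1 / (4 * G * M)))"
  have e: "e > 0" "e \<le> 1/4" "e \<le> r / 4" "e \<le> \<eta> / (2 + 4 * K)" "e \<le> 1 / (4 * G * M)"
  proof -
    show "e > 0" using \<eta>(1) K(1) G tr(3,5) by (simp add: e_def)
  qed (simp_all only: e_def min.coboundedI1 min.coboundedI2 order_refl)
  obtain J where J: "norm ((qmap l ^^ J) (- l / 2)) < e"
      "(let u = - 1 / (of_nat q * poly g 0 * ((qmap l ^^ J) (- l / 2)) ^ q) in
        Re u > 0 \<and> \<bar>Im u\<bar> \<le> 1/2 * Re u)"
    using crit[OF e(1)] by blast
  define y where "y = (qmap l ^^ J) (- l / 2)"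
  define Y where "Y = - 1 / (of_nat q * poly g 0 * y ^ q)"
  have Y: "Re Y > 0" "\<bar>Im Y\<bar> \<le> 1/2 * Re Y" using J(2) by (auto simp: Y_def y_def Let_def)
  have ye: "norm y < e" using J(1) by (simp add: y_def)
  have y0: "y \<noteq> 0" using Y(1) q by (auto simp: Y_def power_0_left)
  define us where "us = qmap l y"
  define vs where "vs = y\<^sup>2"
  have use: "us = y * (l + y)" by (simp add: us_def qmap_def power2_eq_square algebra_simps)
  have ly: "3/4 \<le> norm (l + y)" "norm (l + y) \<le> 5/4"
    using ye e(2) l norm_diff_ineq[of l y] norm_triangle_ineq[of l y] by linarith+
  have us1: "norm us \<ge> 3/4 * norm y" "norm us \<le> 5/4 * norm y"
    using mult_left_mono[OF ly(1) norm_ge_zero[of y]] mult_left_mono[OF ly(2) norm_ge_zero[of y]]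
    by (simp_all add: use norm_mult)
  have vs1: "norm vs < norm us"
  proof -
    have "norm vs = norm y * norm y" by (simp add: vs_def norm_mult power2_eq_square)
    also have "\<dots> \<le> 1/4 * norm y" using ye e(2) by (intro mult_right_mono) auto
    also have "\<dots> < norm us" using us1(1) zero_less_norm_iff[THEN iffD2, OF y0] by linarith
    finally show ?thesis .
  qed
  define T where "T = us + h 0 us vs"
  define W where "W = - l / (of_nat q * c 0 * T ^ q)"
  have hb: "norm (h 0 us vs) \<le> K * norm us ^ 2" using us1 ye e(2) vs1 by (intro K(2)) auto
  define t where "t = T / (l * y)"
  have t1: "norm (t - 1) < \<eta>"
  proof -
    have "t - 1 = (y * y + h 0 us vs) / (l * y)"
      using l0 y0 by (simp add: t_def T_def use field_simps)
    hence "norm (t - 1) = norm (y * y + h 0 us vs) / norm y" using l by (simp add: norm_divide norm_mult)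
    also have "\<dots> \<le> (norm y * norm y + K * (2 * norm y) ^ 2) / norm y"
    proof (rule divide_right_mono)
      have "norm (y * y + h 0 us vs) \<le> norm (y * y) + norm (h 0 us vs)" by (rule norm_triangle_ineq)
      also have "norm (y * y) = norm y * norm y" by (rule norm_mult)
      also have "norm (h 0 us vs) \<le> K * (2 * norm y) ^ 2"
      proof (rule order_trans[OF hb], intro mult_left_mono power_mono K(1))
        show "norm us \<le> 2 * norm y" using us1 norm_ge_zero[of y] by linarith
      qed simp
      finally show "norm (y * y + h 0 us vs) \<le> norm y * norm y + K * (2 * norm y) ^ 2" by simp
    qed simp
    also have "\<dots> = norm y * (1 + 4 * K)" using y0 by (simp add: field_simps power2_eq_square)
    also have "\<dots> \<le> \<eta> / (2 + 4 * K) * (1 + 4 * K)" using ye e(4) K by (intro mult_right_mono) auto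
    also have "\<dots> < \<eta>" using \<eta>(1) K(1) by (simp add: field_simps)
    finally show ?thesis .
  qed
  define \<theta> where "\<theta> = 1 / t ^ q"
  have \<theta>: "norm (\<theta> - 1) < 1/8" unfolding \<theta>_def by (rule \<eta>(2)) (use t1 in \<open>simp add: dist_norm\<close>)
  \<comment> \<open>The factor \<open>q\<close> reflects the two speeds: \<open>Y\<close> advances
    by about 1 in \<open>q\<close> iterations of \<open>qmap\<close>, \<open>W\<close> by about 1 in
    each.\<close>
  have WY: "W = of_nat q * (Y * \<theta>)"
  proof -
    have tT: "T = t * (l * y)" using l0 y0 by (simp add: t_def)
    have "W = - l / (l * poly g 0 * T ^ q)" unfolding W_def lg ..
    also have "\<dots> = - 1 / (poly g 0 * T ^ q)" using l0 by simp
    also have "T ^ q = t ^ q * y ^ q" unfolding tT power_mult_distrib lq by simp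
    finally show ?thesis unfolding Y_def \<theta>_def using q by simp
  qed
  have nY: "norm Y \<le> 3/2 * Re Y" using cmod_le[of Y] Y by linarith
  have "norm (Y * \<theta> - Y) = norm Y * norm (\<theta> - 1)" by (simp add: right_diff_distrib flip: norm_mult)
  also have "\<dots> \<le> 3/2 * Re Y * (1/8)" using nY \<theta> Y by (intro mult_mono) auto
  finally have d: "norm (Y * \<theta> - Y) \<le> 3/16 * Re Y" by simp
  have re: "\<bar>Re (Y * \<theta> - Y)\<bar> \<le> 3/16 * Re Y" and im: "\<bar>Im (Y * \<theta> - Y)\<bar> \<le> 3/16 * Re Y"
    using d abs_Re_le_cmod[of "Y * \<theta> - Y"] abs_Im_le_cmod[of "Y * \<theta> - Y"] by linarith+
  have re': "Re (Y * \<theta>) \<ge> 13/16 * Re Y" using re by (simp only: abs_le_iff minus_complex.simps) linarith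
  have im': "\<bar>Im (Y * \<theta>)\<bar> \<le> 11/16 * Re Y" using im Y(2) by (simp only: abs_le_iff minus_complex.simps) linarith
  have ReW: "Re W = real q * Re (Y * \<theta>)" and ImW: "Im W = real q * Im (Y * \<theta>)" unfolding WY by simp_all
  have W2: "\<bar>Im W\<bar> < Re W"
  proof -
    have "\<bar>Im (Y * \<theta>)\<bar> < Re (Y * \<theta>)" using re' im' Y(1) by linarith
    thus ?thesis unfolding ReW ImW abs_mult using q by simp
  qed
  have W1: "Re W > M"
  proof -
    have "norm y ^ q \<le> norm y" using power_decreasing[of 1 q "norm y"] q ye e(2) by simp
    hence "G * norm y ^ q \<le> G * e" using ye G by (intro mult_left_mono) auto
    also have "\<dots> \<le> G * (1 / (4 * G * M))" using e(5) G by (intro mult_left_mono) auto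
    also have "\<dots> = 1 / (4 * M)" using G by simp
    finally have "4 * M \<le> 1 / (G * norm y ^ q)" using G y0 tr(5) by (simp add: field_simps)
    also have "\<dots> = real q * norm Y" using q by (simp add: Y_def G_def norm_divide norm_mult norm_power)
    also have "\<dots> \<le> real q * (3/2 * Re Y)" using nY by (intro mult_left_mono) auto
    finally have "M < real q * (13/16 * Re Y)" using tr(5) by simp
    also have "\<dots> \<le> Re W" unfolding ReW using re' by (intro mult_left_mono) auto
    finally show ?thesis .
  qed
  have us0: "us \<noteq> 0" using us1 y0 by auto
  have usr: "norm us < r" using us1 ye e(3) tr(3) by linarith
  obtain d where d: "d > 0" "\<And>b u v. norm b < d \<Longrightarrow> norm (u - us) < d \<Longrightarrow> norm (v - vs) < d \<Longrightarrow> in_trap l q h c r M b u v"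
    using in_trap_open[OF c h q W_def[unfolded T_def] W1 W2 tr(5) us0 usr vs1] by blast
  define N where "N = Suc J"
  define F where "F = (\<lambda>p::(complex \<times> complex) \<times> complex. (uorb l (fst (fst p)) (snd (fst p)) (snd p) N, vorb l (fst (fst p)) (snd (fst p)) (snd p) N))"
  have cF: "continuous_on (UNIV \<times> cball 0 6) F"
    unfolding F_def uorb_def vorb_def rel_orb_def using l0 by (intro continuous_intros) auto
  have F0: "F ((0, 0), w) = (us, vs)" for w
  proof -
    have 1: "rel_orb l 0 0 w (Suc N) = us" by (simp only: rel_orb_0[OF l0]) (simp add: N_def us_def y_def)
    have 2: "rel_orb l 0 0 w N = y" unfolding N_def by (simp only: rel_orb_0[OF l0]) (simp add: y_def)
    show ?thesis by (simp add: F_def uorb_def vorb_def 1 2) (simp add: us_def vs_def qmap_def)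
  qed
  obtain X0 where X0: "(0, 0) \<in> X0" "open X0"
    "\<forall>p\<in>X0 \<inter> UNIV. \<forall>w\<in>cball 0 6. dist (F (p, w)) (F ((0, 0), w)) \<le> d / 2"
    by (rule continuous_on_prod_compactE[OF cF compact_cball, of "(0, 0)" "d / 2"]) (use d in auto)
  obtain d' where d': "d' > 0" "ball (0, 0) d' \<subseteq> X0" using X0 openE by blast
  define \<epsilon> where "\<epsilon> = min (min \<beta> d) (d' / 2)"
  show ?thesis
  proof (rule that[of \<epsilon>])
    show "\<epsilon> > 0" using tr d d' by (simp add: \<epsilon>_def)
    fix b x w :: complex assume b: "norm b < \<epsilon>" and x: "norm x < \<epsilon>" and w: "norm w \<le> 6"
    have b': "norm b < \<beta>" "norm b < d" "norm b \<le> 1/2" using b tr by (auto simp: \<epsilon>_def)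
    have "dist (0, 0) (b, x) \<le> dist 0 b + dist 0 x"
      by (subst dist_Pair_Pair, rule sqrt_sum_squares_le_sum) auto
    hence "(b, x) \<in> X0" using b x d'(2) by (auto simp: \<epsilon>_def)
    hence "dist (F ((b, x), w)) (us, vs) \<le> d / 2" using X0(3) w F0 by force
    hence "dist (uorb l b x w N) us \<le> d / 2" "dist (vorb l b x w N) vs \<le> d / 2"
      using dist_fst_le[of "F ((b, x), w)" "(us, vs)"] dist_snd_le[of "F ((b, x), w)" "(us, vs)"] by (auto simp: F_def)
    hence N: "in_trap l q h c r M b (uorb l b x w N) (vorb l b x w N)"
      using d b' by (intro d(2)) (auto simp: dist_norm)
    have trap: "in_trap l q h c r M b (uorb l b x w n) (vorb l b x w n)" if "n \<ge> N" for n
      using that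
    proof (induction n rule: dec_induct)
      case (step n)
      show ?case unfolding uv_orbit(2,3)[OF l b'(3)] by (rule tr(6)[OF b'(1) step(3)])
    qed (rule N)
    have bd: "norm (horb (par_c l b) b x w (Suc n)) \<le> 3 + norm (par_alpha l b)" if "n \<ge> N" for n
    proof -
      have "norm (uorb l b x w n) < r" "norm (vorb l b x w n) \<le> norm (uorb l b x w n)"
        using trap[OF that] by (auto simp: in_trap_def)
      hence "norm (rel_orb l b x w (Suc n)) \<le> 3"
        using uv_z_le[OF l b'(3), of "vorb l b x w n" "uorb l b x w n"] tr(4) unfolding uv_orbit(1)[OF l b'(3)] by linarith
      moreover have "horb (par_c l b) b x w (Suc n) = rel_orb l b x w (Suc n) + par_alpha l b" by (simp add: rel_orb_def)
      ultimately show ?thesis by (metis add_mono_thms_linordered_semiring(3) norm_triangle_ineq order_trans)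
    qed
    have "range (horb (par_c l b) b x w) \<subseteq> horb (par_c l b) b x w ` {..N} \<union> cball 0 (3 + norm (par_alpha l b))"
    proof
      fix z assume "z \<in> range (horb (par_c l b) b x w)"
      then obtain n where n: "z = horb (par_c l b) b x w n" by blast
      show "z \<in> horb (par_c l b) b x w ` {..N} \<union> cball 0 (3 + norm (par_alpha l b))"
      proof (cases "n \<le> N")
        case False
        then obtain m where "n = Suc m" "m \<ge> N" by (metis Suc_le_D not_less_eq_eq Suc_le_mono)
        thus ?thesis using bd n by simp
      qed (use n in auto)
    qed
    thus "bounded (range (horb (par_c l b) b x w))"
      by (rule bounded_subset[rotated]) (simp add: finite_imp_bounded)
  qed
qed

section \<open>The holomorphic motion of escaping points\<close>

lemma horb_shift: "horb c b x w (n + m) = horb c b (horb c b x w (Suc n)) (horb c b x w n) m"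
proof -
  have "horb c b x w (n + m) = horb c b (horb c b x w (Suc n)) (horb c b x w n) m \<and>
    horb c b x w (n + Suc m) = horb c b (horb c b x w (Suc n)) (horb c b x w n) (Suc m)"
    by (induction m) auto
  thus ?thesis ..
qed

lemma bounded_range_shift:
  fixes f :: "nat \<Rightarrow> 'a::metric_space"
  shows "bounded (range f) \<longleftrightarrow> bounded (range (\<lambda>m. f (n + m)))"
proof
  assume "bounded (range (\<lambda>m. f (n + m)))"
  moreover have "range f \<subseteq> f ` {..n} \<union> range (\<lambda>m. f (n + m))"
  proof
    fix y assume "y \<in> range f"
    then obtain k where "y = f k" by blast
    thus "y \<in> f ` {..n} \<union> range (\<lambda>m. f (n + m))"
      by (cases "k \<le> n") (auto simp: image_iff intro: exI[of _ "k - n"])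
  qed
  ultimately show "bounded (range f)" using bounded_subset finite_imp_bounded by (metis bounded_Un finite_atMost finite_imageI)
next
  assume "bounded (range f)"
  thus "bounded (range (\<lambda>m. f (n + m)))" by (rule bounded_subset) auto
qed

lemma horb_escape_step:
  fixes b c x w :: complex
  assumes "norm b \<le> 1/10" "norm c \<le> 2" "norm x \<ge> 3" "norm w \<le> 2 * norm x"
  shows "norm (x\<^sup>2 + c + b * w) \<ge> 2 * norm x"
proof -
  have "norm (c + b * w) \<le> norm c + norm (b * w)" by (rule norm_triangle_ineq)
  also have "norm (b * w) \<le> 1/10 * (2 * norm x)" unfolding norm_mult using assms by (intro mult_mono) auto
  finally have 1: "norm (c + b * w) \<le> 2 + 1/5 * norm x" using assms by simp
  have "norm (x\<^sup>2) - norm (c + b * w) \<le> norm (x\<^sup>2 + (c + b * w))" by (rule norm_diff_ineq)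
  moreover have "norm (x\<^sup>2) = norm x * norm x" by (simp add: power2_eq_square norm_mult)
  moreover have "3 * norm x \<le> norm x * norm x" using assms by (intro mult_right_mono) auto
  ultimately have "norm (x\<^sup>2 + (c + b * w)) \<ge> 2 * norm x" using 1 assms(3) by linarith
  thus ?thesis by (simp add: add.assoc)
qed

lemma horb_escape:
  assumes bc: "norm b \<le> 1/10" "norm c \<le> 2" and "norm x \<ge> 3" "norm w \<le> 2 * norm x"
  shows "norm (horb c b x w (Suc n)) \<ge> 2 ^ n * norm x"
proof -
  have "norm (horb c b x w (Suc n)) \<ge> 2 ^ n * norm x \<and> norm (horb c b x w (Suc n)) \<ge> 3 \<and>
    norm (horb c b x w n) \<le> 2 * norm (horb c b x w (Suc n))"
  proof (induction n)
    case (Suc n)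
    have "norm (horb c b x w (Suc (Suc n))) \<ge> 2 * norm (horb c b x w (Suc n))"
      using horb_escape_step[OF bc, of "horb c b x w (Suc n)" "horb c b x w n"] Suc by simp
    thus ?case using Suc by auto
  qed (use assms in simp)
  thus ?thesis by blast
qed

text \<open>Escape needs the previous coordinate to be at most twice the current one. At the first
  passage beyond 3 the previous coordinate is below 3 or is \<open>w\<close> itself, which is why
  \<open>w\<close> is confined to radius 6 = 2 * 3.\<close>

lemma horb_escape_prev:
  assumes bc: "norm b \<le> 1/10" "norm c \<le> 2" and w: "norm w \<le> 6" and n: "norm (horb c b x w (Suc n)) \<ge> 3"
  shows "norm (horb c b x w n) \<le> 2 * norm (horb c b x w (Suc n))"
  using n
proof (induction n)
  case (Suc n)
  show ?case
  proof (cases "norm (horb c b x w (Suc n)) \<ge> 3")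
    case True
    thus ?thesis using horb_escape_step[OF bc True Suc.IH[OF True]] by simp
  qed (use Suc in linarith)
qed (use w in simp)

lemma horb_escape_from:
  assumes bc: "norm b \<le> 1/10" "norm c \<le> 2" and w: "norm w \<le> 6" and n: "norm (horb c b x w (Suc n)) \<ge> 3"
  shows "norm (horb c b x w (Suc (n + m))) \<ge> 2 ^ m * norm (horb c b x w (Suc n))"
proof -
  have "horb c b x w (Suc (n + m)) = horb c b (horb c b x w (Suc n)) (horb c b x w n) (Suc m)"
    using horb_shift[of c b x w n "Suc m"] by simp
  thus ?thesis using horb_escape[OF bc n horb_escape_prev[OF bc w n], of m] by simp
qed

lemma horb_bounded_iff:
  assumes bc: "norm b \<le> 1/10" "norm c \<le> 2" and w: "norm w \<le> 6"
  shows "bounded (range (horb c b x w)) \<longleftrightarrow> (\<forall>n. norm (horb c b x w (Suc n)) < 3)"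
proof
  assume B: "bounded (range (horb c b x w))"
  then obtain K where K: "\<And>n. norm (horb c b x w n) \<le> K" by (auto simp: bounded_iff)
  show "\<forall>n. norm (horb c b x w (Suc n)) < 3"
  proof (rule ccontr)
    assume "\<not> ?thesis"
    then obtain n where n: "norm (horb c b x w (Suc n)) \<ge> 3" by (auto simp: not_less)
    obtain m :: nat where "K < 2 ^ m" using real_arch_pow[of 2 K] by auto
    moreover have "2 ^ m * 1 \<le> 2 ^ m * norm (horb c b x w (Suc n))" using n by (intro mult_left_mono) auto
    ultimately have "K < 2 ^ m * norm (horb c b x w (Suc n))" by linarith
    thus False using horb_escape_from[OF bc w n, of m] K[of "Suc (n + m)"] by linarith
  qed
next
  assume a: "\<forall>n. norm (horb c b x w (Suc n)) < 3"
  have "norm (horb c b x w n) \<le> 6" for n using a w by (cases n) (auto intro: less_imp_le order_trans[OF less_imp_le])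
  thus "bounded (range (horb c b x w))" by (auto simp: bounded_iff)
qed

section \<open>Escaping points as simple roots of polynomials\<close>

lemma card_simple_roots:
  assumes "p \<noteq> (0 :: complex poly)" "\<And>x. poly p x = 0 \<Longrightarrow> poly (pderiv p) x \<noteq> 0"
  shows "card {x. poly p x = 0} = degree p"
  using assms
proof (induction "degree p" arbitrary: p)
  case 0
  then obtain c where "p = [:c:]" by (metis degree_eq_zeroE)
  thus ?case using 0 by auto
next
  case (Suc n)
  have "\<exists>i\<in>{1..degree p}. coeff p i \<noteq> 0"
    using Suc(2) Suc.prems(1) by (intro bexI[of _ "degree p"]) auto
  then obtain a where "(\<Sum>i\<le>degree p. coeff p i * a ^ i) = 0"
    using fundamental_theorem_of_algebra[of "coeff p" "degree p"] by blast
  hence a: "poly p a = 0" by (simp add: poly_altdef)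
  then obtain r where r: "p = [:- a, 1:] * r" by (metis dvdE poly_eq_0_iff_dvd)
  have r0: "r \<noteq> 0" using Suc.prems(1) r by auto
  have dp: "poly (pderiv p) z = poly r z + (z - a) * poly (pderiv r) z" for z
  proof -
    have e: "pderiv p = [:- a, 1:] * pderiv r + r * pderiv [:- a, 1:]" unfolding r by (rule pderiv_mult)
    show ?thesis unfolding e poly_add poly_mult by (simp add: pderiv_pCons algebra_simps)
  qed
  have "degree p = Suc (degree r)" using r0 unfolding r by (subst degree_mult_eq) auto
  hence d: "n = degree r" using Suc(2) by simp
  have "poly (pderiv r) x \<noteq> 0" if "poly r x = 0" for x
    using Suc.prems(2)[of x] that dp[of x] by (auto simp: r)
  hence "card {x. poly r x = 0} = degree r" using Suc(1)[OF d r0] by blast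
  moreover have "{x. poly p x = 0} = insert a {x. poly r x = 0}" by (auto simp: r algebra_simps)
  moreover have "poly r a \<noteq> 0" using Suc.prems(2)[OF a] dp[of a] by simp
  ultimately show ?case using poly_roots_finite[OF r0] d Suc(2) by simp
qed

text \<open>The orbit as a polynomial in the initial \<open>x\<close>. Its degree does not depend on
  \<open>w\<close> and \<open>b\<close>, hence neither does the number of roots while they are
  simple.\<close>

fun hpoly :: "complex \<Rightarrow> complex \<Rightarrow> complex \<Rightarrow> nat \<Rightarrow> complex poly" where
  "hpoly c b w 0 = [:w:]"
| "hpoly c b w (Suc 0) = [:0, 1:]"
| "hpoly c b w (Suc (Suc n)) = (hpoly c b w (Suc n))\<^sup>2 + ([:c:] + smult b (hpoly c b w n))"

lemma poly_hpoly: "poly (hpoly c b w n) x = horb c b x w n"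
  by (induction c b w n rule: hpoly.induct) auto

lemma degree_hpoly: "degree (hpoly c b w (Suc n)) = 2 ^ n"
proof -
  have "degree (hpoly c b w (Suc n)) = 2 ^ n \<and> degree (hpoly c b w n) \<le> 2 ^ n"
  proof (induction n)
    case (Suc n)
    have d: "degree ((hpoly c b w (Suc n))\<^sup>2) = 2 ^ Suc n"
      using Suc by (subst degree_power_eq) auto
    have "degree ([:c:] + smult b (hpoly c b w n)) \<le> 2 ^ n"
      using Suc by (intro degree_add_le order_trans[OF degree_smult_le]) auto
    also have "\<dots> < degree ((hpoly c b w (Suc n))\<^sup>2)" unfolding d by simp
    finally have "degree (hpoly c b w (Suc (Suc n))) = degree ((hpoly c b w (Suc n))\<^sup>2)"
      by (simp add: degree_add_eq_left)
    thus ?case using d Suc by simp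
  qed simp
  thus ?thesis ..
qed

text \<open>\<open>strip\<close> is all that the rest of the argument keeps of the parabolic
  dynamics, next to |l| = 1 and the smallness of \<open>\<epsilon>\<close>.\<close>

locale henon_family =
  fixes l :: complex and \<epsilon> :: real
  assumes l: "norm l = 1" and eps: "0 < \<epsilon>" "\<epsilon> \<le> 1/10"
    and strip: "\<And>b x w. norm b < \<epsilon> \<Longrightarrow> norm x < \<epsilon> \<Longrightarrow> norm w \<le> 6 \<Longrightarrow> bounded (range (horb (par_c l b) b x w))"
begin

definition X where "X b x w n = horb (par_c l b) b x w n"

lemma X_simps [simp]: "X b x w 0 = w" "X b x w (Suc 0) = x"
  "X b x w (Suc (Suc n)) = (X b x w (Suc n))\<^sup>2 + par_c l b + b * X b x w n"
  by (simp_all add: X_def)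

text \<open>Made for the cone estimates: if |D'| \<ge> (\<epsilon>/2) |D|, then |b D| \<le>
  (\<epsilon>^2/4) |D| \<le> (\<epsilon>/2) |D'|, which cannot cancel a term of size at least
  \<epsilon> |D'|.\<close>

definition \<delta>0 :: real where "\<delta>0 = \<epsilon>\<^sup>2 / 4"

lemma \<delta>0: "0 < \<delta>0" "\<delta>0 \<le> 1/400" "\<delta>0 \<le> \<epsilon>"
proof -
  show "0 < \<delta>0" using eps by (simp add: \<delta>0_def)
  have "\<epsilon> * \<epsilon> \<le> 1/10 * \<epsilon>" using eps by (intro mult_right_mono) auto
  moreover have "1/10 * \<epsilon> \<le> 1/100" using eps by simp
  ultimately have "\<epsilon> * \<epsilon> \<le> 1/100" "\<epsilon> * \<epsilon> \<le> \<epsilon>" using eps by linarith+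
  thus "\<delta>0 \<le> 1/400" "\<delta>0 \<le> \<epsilon>" using eps by (auto simp: \<delta>0_def power2_eq_square)
qed

lemma l0: "l \<noteq> 0" using l by auto

lemma b_bounds:
  assumes "norm b < \<delta>0"
  shows "norm b \<le> 1/10" "norm (par_c l b) \<le> 2" "norm b < \<epsilon>"
proof -
  show b: "norm b \<le> 1/10" "norm b < \<epsilon>" using assms \<delta>0 by linarith+
  have "norm (par_alpha l b) \<le> norm (l / 2) + norm (b / (2 * l))"
    unfolding par_alpha_def by (rule norm_triangle_ineq4)
  also have "\<dots> \<le> 1/2 + 1/10" using b l by (simp add: norm_divide norm_mult)
  finally have a: "norm (par_alpha l b) \<le> 3/5" by simp
  have "norm (par_c l b) \<le> norm ((1 - b) * par_alpha l b) + norm ((par_alpha l b)\<^sup>2)"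
    unfolding par_c_def by (rule norm_triangle_ineq4)
  also have "\<dots> \<le> 11/10 * (3/5) + (3/5)^2"
    unfolding norm_mult norm_power using a b norm_triangle_ineq4[of 1 b]
    by (intro add_mono mult_mono power_mono) auto
  finally show "norm (par_c l b) \<le> 2" by (simp add: power2_eq_square)
qed

lemma X_shift: "X b x w (n + m) = X b (X b x w (Suc n)) (X b x w n) m"
  unfolding X_def by (rule horb_shift)

lemma X_escape:
  assumes "norm b < \<delta>0" "norm w \<le> 6" "norm (X b x w (Suc n)) \<ge> 3"
  shows "norm (X b x w (Suc (n + m))) \<ge> 2 ^ m * norm (X b x w (Suc n))"
  using assms b_bounds unfolding X_def by (intro horb_escape_from) auto

lemma X_bounded_iff:
  assumes "norm b < \<delta>0" "norm w \<le> 6"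
  shows "bounded (range (X b x w)) \<longleftrightarrow> (\<forall>n. norm (X b x w (Suc n)) < 3)"
  using assms b_bounds horb_bounded_iff unfolding X_def by simp

lemma X_before_escape:
  assumes b: "norm b < \<delta>0" and w: "norm w \<le> 6" and N: "3 \<le> norm (X b x w (Suc N))" "norm (X b x w (Suc N)) < 6" and n: "n < N"
  shows "norm (X b x w (Suc n)) < 3"
proof (rule ccontr)
  assume "\<not> ?thesis"
  hence a: "norm (X b x w (Suc n)) \<ge> 3" by simp
  have "2 ^ 1 * 3 \<le> 2 ^ (N - n) * norm (X b x w (Suc n))"
    using n a by (intro mult_mono power_increasing) auto
  also have "\<dots> \<le> norm (X b x w (Suc (n + (N - n))))" by (rule X_escape[OF b w a])
  finally show False using N n by simp
qed

text \<open>Within \<open>\<epsilon>\<close> of the critical line \<open>strip\<close> makes the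
  orbit bounded. It requires the previous coordinate to be at most 6; a previous coordinate beyond 3
  would already have been followed by one beyond 6.\<close>

lemma X_away_from_0:
  assumes b: "norm b < \<delta>0" and w: "norm w \<le> 6" and N: "norm (X b x w (Suc N)) \<ge> 3" and n: "n \<le> N"
  shows "norm (X b x w (Suc n)) \<ge> \<epsilon>"
proof (rule ccontr)
  assume "\<not> ?thesis"
  hence a: "norm (X b x w (Suc n)) < \<epsilon>" by simp
  have "norm (X b x w n) \<le> 6"
  proof (cases n)
    case (Suc k)
    have "norm (X b x w n) < 3"
    proof (rule ccontr)
      assume "\<not> ?thesis"
      hence "norm (X b x w (Suc k)) \<ge> 3" using Suc by simp
      from X_escape[OF b w this, of 1] this have "norm (X b x w (Suc n)) \<ge> 6" by (simp add: Suc)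
      thus False using a eps by linarith
    qed
    thus ?thesis by simp
  qed (use w in simp)
  from strip[OF b_bounds(3)[OF b] a this] have "bounded (range (\<lambda>m. X b x w (n + m)))"
    by (simp add: X_shift) (simp add: X_def)
  hence "bounded (range (X b x w))" by (simp flip: bounded_range_shift)
  thus False using X_bounded_iff[OF b w] N by (auto simp: not_less[symmetric])
qed

text \<open>Beyond radius 3 the modulus at least doubles, so an orbit meets this annulus at most
  once and the time is a well-defined escape level. Orbits may jump over it; \<open>Jp_strip\<close>
  repairs this by an intermediate value argument.\<close>

definition annulus :: "complex set" where "annulus = {z. 3 < norm z \<and> norm z < 6}"

text \<open>The derivative in \<open>x\<close> satisfies the recursion \<open>D\<close> below, in
  which the term with \<open>X\<close> dominates because |X| \<ge> \<epsilon> along an escaping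
  orbit. The cone |D (n+1)| \<ge> (\<epsilon>/2) |D n| is therefore preserved and keeps
  \<open>D\<close> nonzero.\<close>

lemma hpoly_pderiv_nonzero:
  assumes b: "norm b < \<delta>0" and w: "norm w \<le> 6" and x: "norm (X b x w (Suc N)) \<ge> 3"
  shows "poly (pderiv (hpoly (par_c l b) b w (Suc N))) x \<noteq> 0"
proof -
  have away: "norm (X b x w (Suc n)) \<ge> \<epsilon>" if "n \<le> N" for n
    by (rule X_away_from_0[OF b w x that])
  define D where "D n = poly (pderiv (hpoly (par_c l b) b w n)) x" for n
  have D: "D 0 = 0" "D (Suc 0) = 1" "D (Suc (Suc n)) = 2 * X b x w (Suc n) * D (Suc n) + b * D n" for n
    by (simp_all add: D_def pderiv_pCons pderiv_add pderiv_smult power2_eq_square pderiv_mult X_def poly_hpoly)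
  have "D (Suc n) \<noteq> 0 \<and> norm (D (Suc n)) \<ge> \<epsilon> / 2 * norm (D n)" if "n \<le> N" for n
    using that
  proof (induction n)
    case (Suc n)
    hence IH: "D (Suc n) \<noteq> 0" "norm (D (Suc n)) \<ge> \<epsilon> / 2 * norm (D n)" by auto
    have "norm (b * D n) \<le> \<epsilon>\<^sup>2 / 4 * norm (D n)" unfolding norm_mult
      using b by (intro mult_right_mono) (auto simp: \<delta>0_def)
    also have "\<dots> = \<epsilon> / 2 * (\<epsilon> / 2 * norm (D n))" by (simp add: power2_eq_square)
    also have "\<dots> \<le> \<epsilon> / 2 * norm (D (Suc n))" using IH eps by (intro mult_left_mono) auto
    finally have 1: "norm (b * D n) \<le> \<epsilon> / 2 * norm (D (Suc n))" .
    have "norm (2 * X b x w (Suc n) * D (Suc n)) = 2 * norm (X b x w (Suc n)) * norm (D (Suc n))" by (simp add: norm_mult)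
    moreover have "2 * \<epsilon> * norm (D (Suc n)) \<le> 2 * norm (X b x w (Suc n)) * norm (D (Suc n))"
      using away[of n] Suc by (intro mult_right_mono) auto
    ultimately have 2: "norm (D (Suc (Suc n))) \<ge> 2 * \<epsilon> * norm (D (Suc n)) - \<epsilon> / 2 * norm (D (Suc n))"
      using 1 norm_diff_ineq[of "2 * X b x w (Suc n) * D (Suc n)" "b * D n"] unfolding D(3) by linarith
    have "\<epsilon> * norm (D (Suc n)) > 0" using IH eps by simp
    hence "norm (D (Suc (Suc n))) \<ge> \<epsilon> / 2 * norm (D (Suc n)) \<and> norm (D (Suc (Suc n))) > 0" using 2 by linarith
    thus ?case by auto
  qed (simp add: D)
  hence "D (Suc N) \<noteq> 0" by blast
  thus ?thesis by (simp add: D_def)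
qed

text \<open>The base is general because two cases occur: the pairs \<open>(w, b)\<close> themselves,
  and \<open>S_invariant\<close>, where a section takes the place of \<open>w\<close>.\<close>

lemma X_covering:
  fixes B :: "'a::real_normed_vector set"
  assumes \<omega>: "continuous_on B \<omega>" "\<And>t. t \<in> B \<Longrightarrow> norm (\<omega> t) \<le> 6"
    and \<beta>: "continuous_on B \<beta>" "\<And>t. t \<in> B \<Longrightarrow> norm (\<beta> t) < \<delta>0" and \<xi>: "\<xi> \<in> annulus"
  shows "covering_space {(t, x). t \<in> B \<and> X (\<beta> t) x (\<omega> t) (Suc N) - \<xi> = 0} fst B"
proof -
  define F where "F t x = X (\<beta> t) x (\<omega> t) (Suc N) - \<xi>" for t x
  define p where "p t = hpoly (par_c l (\<beta> t)) (\<beta> t) (\<omega> t) (Suc N) - [:\<xi>:]" for t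
  have Fp: "F t x = poly (p t) x" for t x by (simp only: F_def p_def X_def poly_hpoly[symmetric]) simp
  have card: "card {x. F t x = 0} = 2 ^ N" "finite {x. F t x = 0}" if t: "t \<in> B" for t
  proof -
    define b where "b = \<beta> t"
    define w where "w = \<omega> t"
    have b: "norm b < \<delta>0" and w: "norm w \<le> 6" using \<omega> \<beta> t by (auto simp: b_def w_def)
    have deg: "degree (p t) = 2 ^ N"
      unfolding p_def using degree_hpoly[of "par_c l (\<beta> t)" "\<beta> t" "\<omega> t" N]
    proof (cases "N = 0")
      case False
      have "degree (hpoly (par_c l (\<beta> t)) (\<beta> t) (\<omega> t) (Suc N) + - [:\<xi>:]) = degree (hpoly (par_c l (\<beta> t)) (\<beta> t) (\<omega> t) (Suc N))"
        by (rule degree_add_eq_left) (simp add: degree_hpoly)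
      thus "degree (hpoly (par_c l (\<beta> t)) (\<beta> t) (\<omega> t) (Suc N) - [:\<xi>:]) = 2 ^ N"
        by (simp only: diff_conv_add_uminus degree_hpoly)
    qed simp
    hence p0: "p t \<noteq> 0" by (metis degree_0 power_eq_0_iff zero_neq_numeral)
    have "poly (pderiv (p t)) x \<noteq> 0" if "poly (p t) x = 0" for x
    proof
      assume "poly (pderiv (p t)) x = 0"
      with that have x: "poly (p t) x = 0 \<and> poly (pderiv (p t)) x = 0" by simp
      hence Xx: "X b x w (Suc N) = \<xi>" using Fp[of t x] by (simp add: F_def b_def w_def)
      have "norm (X b x w (Suc N)) \<ge> 3" using Xx \<xi> by (auto simp: annulus_def)
      from hpoly_pderiv_nonzero[OF b w this]
      moreover have "pderiv (p t) = pderiv (hpoly (par_c l b) b w (Suc N))"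
        by (simp add: p_def pderiv_diff b_def w_def pderiv_pCons)
      ultimately show False using x by simp
    qed
    hence "card {x. poly (p t) x = 0} = degree (p t)" by (intro card_simple_roots p0)
    thus "card {x. F t x = 0} = 2 ^ N" by (simp add: deg Fp)
    show "finite {x. F t x = 0}" using poly_roots_finite[OF p0] by (simp add: Fp)
  qed
  have "continuous_on (B \<times> UNIV) (\<lambda>p. F (fst p) (snd p))"
  proof -
    have "continuous_on (B \<times> UNIV) (\<lambda>p::'a \<times> complex. \<omega> (fst p))" "continuous_on (B \<times> UNIV) (\<lambda>p::'a \<times> complex. \<beta> (fst p))"
      by (rule continuous_on_compose2[OF \<omega>(1)], auto intro!: continuous_intros)
        (rule continuous_on_compose2[OF \<beta>(1)], auto intro!: continuous_intros)
    thus ?thesis unfolding F_def X_def using l0 by (intro continuous_intros)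
  qed
  moreover have "F t holomorphic_on UNIV" for t unfolding Fp by (intro holomorphic_intros)
  ultimately have "covering_space {(t, x). t \<in> B \<and> F t x = 0} fst B"
    by (rule roots_covering_space) (use card in auto)
  thus ?thesis by (simp add: F_def)
qed

end

text \<open>Divisibility of the increment by \<open>b' - b\<close> with a jointly continuous
  quotient: an algebraic form of differentiability in the parameter, stable under sums and products
  and tailored to \<open>implicit_holomorphic\<close>.\<close>

definition diffquot :: "complex \<Rightarrow> (complex \<Rightarrow> complex \<Rightarrow> complex) \<Rightarrow> bool" where
  "diffquot b \<phi> \<longleftrightarrow> continuous_on UNIV (\<lambda>p. \<phi> (fst p) (snd p)) \<and>
    (\<exists>r. continuous_on UNIV (\<lambda>p. r (fst p) (snd p)) \<and> (\<forall>b' x. \<phi> b' x - \<phi> b x = (b' - b) * r b' x))"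

lemma diffquot_snd: "continuous_on UNIV g \<Longrightarrow> diffquot b (\<lambda>b x. g x)"
  unfolding diffquot_def
  by (intro conjI exI[of _ "\<lambda>_ _. 0"]) (auto intro!: continuous_intros intro: continuous_on_compose2)

lemma diffquot_fst: "diffquot b (\<lambda>b x. b)"
  unfolding diffquot_def by (intro conjI exI[of _ "\<lambda>_ _. 1"]) (auto intro!: continuous_intros)

lemma diffquot_add: "diffquot b f \<Longrightarrow> diffquot b g \<Longrightarrow> diffquot b (\<lambda>b x. f b x + g b x)"
proof -
  assume f: "diffquot b f" and g: "diffquot b g"
  obtain r where r: "continuous_on UNIV (\<lambda>p. r (fst p) (snd p))" "\<And>b' x. f b' x - f b x = (b' - b) * r b' x"
    using f by (auto simp: diffquot_def)
  obtain s where s: "continuous_on UNIV (\<lambda>p. s (fst p) (snd p))" "\<And>b' x. g b' x - g b x = (b' - b) * s b' x"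
    using g by (auto simp: diffquot_def)
  show "diffquot b (\<lambda>b x. f b x + g b x)"
    unfolding diffquot_def
  proof (intro conjI exI[of _ "\<lambda>b' x. r b' x + s b' x"] allI)
    fix b' x
    have "f b' x + g b' x - (f b x + g b x) = (f b' x - f b x) + (g b' x - g b x)" by simp
    thus "f b' x + g b' x - (f b x + g b x) = (b' - b) * (r b' x + s b' x)"
      unfolding r(2) s(2) by (simp add: distrib_left)
  qed (use f g r s in \<open>auto simp: diffquot_def intro!: continuous_intros\<close>)
qed

lemma diffquot_mult: "diffquot b f \<Longrightarrow> diffquot b g \<Longrightarrow> diffquot b (\<lambda>b x. f b x * g b x)"
proof -
  assume f: "diffquot b f" and g: "diffquot b g"
  obtain r where r: "continuous_on UNIV (\<lambda>p. r (fst p) (snd p))" "\<And>b' x. f b' x - f b x = (b' - b) * r b' x"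
    using f by (auto simp: diffquot_def)
  obtain s where s: "continuous_on UNIV (\<lambda>p. s (fst p) (snd p))" "\<And>b' x. g b' x - g b x = (b' - b) * s b' x"
    using g by (auto simp: diffquot_def)
  have cf0: "continuous_on UNIV (\<lambda>p. f (fst p) (snd p))" using f by (simp add: diffquot_def)
  have "continuous_on UNIV (\<lambda>p::complex \<times> complex. (b, snd p))" by (intro continuous_intros)
  from continuous_on_compose2[OF cf0 this] have cf: "continuous_on UNIV (\<lambda>p::complex \<times> complex. f b (snd p))" by simp
  show "diffquot b (\<lambda>b x. f b x * g b x)"
    unfolding diffquot_def
  proof (intro conjI exI[of _ "\<lambda>b' x. r b' x * g b' x + f b x * s b' x"] allI)
    fix b' x
    have "f b' x * g b' x - f b x * g b x = (f b' x - f b x) * g b' x + f b x * (g b' x - g b x)"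
      by (simp add: algebra_simps)
    thus "f b' x * g b' x - f b x * g b x = (b' - b) * (r b' x * g b' x + f b x * s b' x)"
      unfolding r(2) s(2) by (simp add: algebra_simps)
  qed (use f g r s cf in \<open>auto simp: diffquot_def intro!: continuous_intros\<close>)
qed

section \<open>The motion of the escaping points\<close>

context henon_family
begin

lemma diffquot_par_c: "diffquot b (\<lambda>b x. par_c l b)"
proof -
  have "diffquot b (\<lambda>b x. l / 2 + b * (- 1 / (2 * l)))"
    by (intro diffquot_add diffquot_mult diffquot_fst diffquot_snd continuous_intros)
  moreover have "(\<lambda>b x. l / 2 + b * (- 1 / (2 * l))) = (\<lambda>b x::complex. par_alpha l b)"
    by (simp add: par_alpha_def)
  ultimately have a: "diffquot b (\<lambda>b x. par_alpha l b)" by simp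
  have "diffquot b (\<lambda>b x. (1 + b * (-1)) * par_alpha l b + (-1) * (par_alpha l b * par_alpha l b))"
    by (intro diffquot_add diffquot_mult diffquot_fst diffquot_snd continuous_intros a)
  moreover have "(\<lambda>b x::complex. (1 + b * (-1)) * par_alpha l b + (-1) * (par_alpha l b * par_alpha l b)) = (\<lambda>b x. par_c l b)"
    by (simp add: par_c_def power2_eq_square)
  ultimately show ?thesis by simp
qed

lemma diffquot_X: "diffquot b (\<lambda>b x. X b x w n)"
proof -
  have "diffquot b (\<lambda>b x. X b x w n) \<and> diffquot b (\<lambda>b x. X b x w (Suc n))"
  proof (induction n)
    case 0
    show ?case by (auto intro!: diffquot_snd continuous_intros)
  next
    case (Suc n)
    have "diffquot b (\<lambda>b x. X b x w (Suc n) * X b x w (Suc n) + par_c l b + b * X b x w n)"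
      by (intro diffquot_add diffquot_mult diffquot_fst diffquot_par_c) (use Suc in auto)
    thus ?case using Suc by (simp add: power2_eq_square)
  qed
  thus ?thesis ..
qed

lemma continuous_on_X [continuous_intros]:
  assumes "continuous_on S b" "continuous_on S x" "continuous_on S w"
  shows "continuous_on S (\<lambda>p. X (b p) (x p) (w p) n)"
  unfolding X_def using assms l0 by (intro continuous_intros)

definition B :: "(complex \<times> complex) set" where "B = cball 0 6 \<times> ball 0 \<delta>0"

lemma B_iff: "(w, b) \<in> B \<longleftrightarrow> norm w \<le> 6 \<and> norm b < \<delta>0" by (auto simp: B_def)

lemma B_D: "t \<in> B \<Longrightarrow> norm (fst t) \<le> 6 \<and> norm (snd t) < \<delta>0" by (cases t) (simp add: B_iff)

lemma convex_B: "convex B" unfolding B_def by (intro convex_Times) auto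

lemma B_0: "norm w \<le> 6 \<Longrightarrow> (w, 0) \<in> B" using \<delta>0 by (simp add: B_iff)

lemma X_covering_B:
  assumes "\<xi> \<in> annulus"
  shows "covering_space {(t, x). t \<in> B \<and> X (snd t) x (fst t) (Suc N) - \<xi> = 0} fst B"
  using assms B_D by (intro X_covering continuous_intros) auto

lemma section_through:
  assumes t0: "t0 \<in> B" and x: "X (snd t0) x (fst t0) (Suc N) = \<xi>" "\<xi> \<in> annulus"
  obtains s where "continuous_on B s" "s t0 = x" "\<And>t. t \<in> B \<Longrightarrow> X (snd t) (s t) (fst t) (Suc N) = \<xi>"
proof -
  have "X (snd t0) x (fst t0) (Suc N) - \<xi> = 0" using x by simp
  from root_section_exists[OF X_covering_B[OF x(2)] convex_B t0 this] show ?thesis using that by auto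
qed

lemma section_unique:
  assumes "\<xi> \<in> annulus" "connected A" "A \<subseteq> B" "a \<in> A" "t \<in> A"
    and "continuous_on A s" "\<And>t. t \<in> A \<Longrightarrow> X (snd t) (s t) (fst t) (Suc N) = \<xi>"
    and "continuous_on A s'" "\<And>t. t \<in> A \<Longrightarrow> X (snd t) (s' t) (fst t) (Suc N) = \<xi>"
    and "s a = s' a"
  shows "s t = s' t"
  by (rule root_section_unique[OF X_covering_B[OF assms(1)] assms(2,3,4,5,6) _ assms(8) _ assms(10)])
    (use assms(7,9) in auto)

text \<open>Escaping points \<open>\<zeta>\<close> of the quadratic polynomial at \<open>b = 0\<close>, sorted by escape time. As \<open>(w, b)\<close> varies, the
  solutions \<open>x\<close> of \<open>X b x w (Suc N) = X 0 \<zeta> 0 (Suc N)\<close> form a covering, and \<open>S \<zeta>\<close> is its section through \<open>\<zeta>\<close>.\<close>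

definition lam :: "nat \<Rightarrow> complex set" where "lam N = {\<zeta>. X 0 \<zeta> 0 (Suc N) \<in> annulus}"

definition Lam :: "complex set" where "Lam = (\<Union>N. lam N)"

definition is_section where
  "is_section N \<zeta> s \<longleftrightarrow> continuous_on B s \<and> s (0, 0) = \<zeta> \<and>
    (\<forall>t\<in>B. X (snd t) (s t) (fst t) (Suc N) = X 0 \<zeta> 0 (Suc N))"

definition S :: "complex \<Rightarrow> complex \<times> complex \<Rightarrow> complex" where
  "S \<zeta> = (SOME s. \<exists>N. \<zeta> \<in> lam N \<and> is_section N \<zeta> s)"

lemma level_unique:
  assumes "norm b < \<delta>0" "norm w \<le> 6" "X b x w (Suc N) \<in> annulus" "X b x w (Suc M) \<in> annulus"
  shows "N = M"
proof -
  have *: False if "N < M" "X b x w (Suc N) \<in> annulus" "X b x w (Suc M) \<in> annulus" for N M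
  proof -
    have "norm (X b x w (Suc N)) < 3"
      using X_before_escape[OF assms(1,2) _ _ that(1)] that(3) by (auto simp: annulus_def)
    thus False using that(2) by (auto simp: annulus_def)
  qed
  show ?thesis using *[of N M] *[of M N] assms(3,4) by (metis linorder_neqE_nat)
qed

lemma S_section:
  assumes "\<zeta> \<in> lam N"
  shows "is_section N \<zeta> (S \<zeta>)"
proof -
  have "X (snd (0,0)) \<zeta> (fst (0,0)) (Suc N) \<in> annulus" using assms by (simp add: lam_def)
  then obtain s where "continuous_on B s" "s (0, 0) = \<zeta>" "\<And>t. t \<in> B \<Longrightarrow> X (snd t) (s t) (fst t) (Suc N) = X 0 \<zeta> 0 (Suc N)"
    using section_through[of "(0, 0)" \<zeta> N] B_0[of 0] by (metis fst_conv snd_conv norm_zero zero_le_numeral)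
  hence "\<exists>s N. \<zeta> \<in> lam N \<and> is_section N \<zeta> s" using assms unfolding is_section_def by blast
  from someI_ex[OF this] obtain M where M: "\<zeta> \<in> lam M" "is_section M \<zeta> (S \<zeta>)" unfolding S_def by blast
  have "M = N" using level_unique[of 0 0 \<zeta> M N] \<delta>0 assms M(1) by (simp add: lam_def)
  thus ?thesis using M by simp
qed

lemma S_continuous: "\<zeta> \<in> Lam \<Longrightarrow> continuous_on B (S \<zeta>)"
  and S_base: "\<zeta> \<in> Lam \<Longrightarrow> S \<zeta> (0, 0) = \<zeta>"
  using S_section by (auto simp: Lam_def is_section_def)

lemma S_X: "\<zeta> \<in> lam N \<Longrightarrow> norm w \<le> 6 \<Longrightarrow> norm b < \<delta>0 \<Longrightarrow> X b (S \<zeta> (w, b)) w (Suc N) = X 0 \<zeta> 0 (Suc N)"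
  using S_section[of \<zeta> N] B_iff[of w b] unfolding is_section_def by force

lemma S_annulus: "\<zeta> \<in> lam N \<Longrightarrow> norm w \<le> 6 \<Longrightarrow> norm b < \<delta>0 \<Longrightarrow> X b (S \<zeta> (w, b)) w (Suc N) \<in> annulus"
  using S_X by (simp add: lam_def)

text \<open>The section through the given point is followed back to \<open>(0, 0)\<close>; its value
  there is the label, and uniqueness of sections identifies it with
  \<open>S \<zeta>\<close>.\<close>

lemma S_cover:
  assumes t: "norm w \<le> 6" "norm b < \<delta>0" and x: "X b x w (Suc N) \<in> annulus"
  obtains \<zeta> where "\<zeta> \<in> lam N" "S \<zeta> (w, b) = x"
proof -
  have tB: "(w, b) \<in> B" using t by (simp add: B_iff)
  obtain s where s: "continuous_on B s" "s (w, b) = x" "\<And>t. t \<in> B \<Longrightarrow> X (snd t) (s t) (fst t) (Suc N) = X b x w (Suc N)"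
    using section_through[OF tB, of x N] x by auto
  define \<zeta> where "\<zeta> = s (0, 0)"
  have B0: "(0, 0) \<in> B" using B_0[of 0] by simp
  have \<xi>: "X 0 \<zeta> 0 (Suc N) = X b x w (Suc N)" using s(3)[OF B0] by (simp add: \<zeta>_def)
  hence \<zeta>: "\<zeta> \<in> lam N" using x by (simp add: lam_def)
  have sec: "is_section N \<zeta> (S \<zeta>)" by (rule S_section[OF \<zeta>])
  have "S \<zeta> (w, b) = s (w, b)"
  proof (rule section_unique[OF x convex_connected[OF convex_B] subset_refl B0 tB _ _ s(1,3)])
    show "continuous_on B (S \<zeta>)" "S \<zeta> (0, 0) = s (0, 0)" using sec by (auto simp: is_section_def \<zeta>_def)
    show "X (snd t) (S \<zeta> t) (fst t) (Suc N) = X b x w (Suc N)" if "t \<in> B" for t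
      using sec that \<xi> by (simp add: is_section_def)
  qed
  thus ?thesis using that \<zeta> s(2) by simp
qed

lemma S_noncollide:
  assumes "\<zeta> \<in> Lam" "\<zeta>' \<in> Lam" "norm w \<le> 6" "norm b < \<delta>0" "S \<zeta> (w, b) = S \<zeta>' (w, b)"
  shows "\<zeta> = \<zeta>'"
proof -
  obtain N M where N: "\<zeta> \<in> lam N" "\<zeta>' \<in> lam M" using assms by (auto simp: Lam_def)
  have NM: "N = M" using level_unique[OF assms(4,3) S_annulus[OF N(1) assms(3,4)]] S_annulus[OF N(2) assms(3,4)] assms(5) by simp
  have B0: "(0, 0) \<in> B" using B_0[of 0] by simp
  have tB: "(w, b) \<in> B" using assms by (simp add: B_iff)
  have \<xi>: "X 0 \<zeta> 0 (Suc N) = X 0 \<zeta>' 0 (Suc N)" using S_X[OF N(1) assms(3,4)] S_X[OF N(2) assms(3,4)] assms(5) NM by simp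
  have sec: "is_section N \<zeta> (S \<zeta>)" "is_section N \<zeta>' (S \<zeta>')"
    using S_section N NM by auto
  have annulus: "X 0 \<zeta> 0 (Suc N) \<in> annulus" using N by (simp add: lam_def)
  have "S \<zeta> (0, 0) = S \<zeta>' (0, 0)"
  proof (rule section_unique[where s = "S \<zeta>" and s' = "S \<zeta>'" and N = N, OF annulus convex_connected[OF convex_B] subset_refl tB B0])
    show "S \<zeta> (w, b) = S \<zeta>' (w, b)" by (rule assms(5))
    show "continuous_on B (S \<zeta>)" "continuous_on B (S \<zeta>')" using sec by (auto simp: is_section_def)
    show "X (snd t) (S \<zeta> t) (fst t) (Suc N) = X 0 \<zeta> 0 (Suc N)"
      "X (snd t) (S \<zeta>' t) (fst t) (Suc N) = X 0 \<zeta> 0 (Suc N)" if "t \<in> B" for t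
      using sec that \<xi> by (simp_all add: is_section_def)
  qed
  thus ?thesis using S_base assms(1,2) by simp
qed

lemma X_0_indep: "X 0 x w (Suc n) = X 0 x 0 (Suc n)"
  by (induction n) auto

text \<open>For \<open>b = 0\<close> the recursion forgets \<open>w\<close>, so the constant section
  solves the equation.\<close>

lemma S_b0:
  assumes \<zeta>: "\<zeta> \<in> Lam" and w: "norm w \<le> 6"
  shows "S \<zeta> (w, 0) = \<zeta>"
proof -
  obtain N where N: "\<zeta> \<in> lam N" using \<zeta> by (auto simp: Lam_def)
  define A where "A = cball (0::complex) 6 \<times> {0::complex}"
  have A: "connected A" "A \<subseteq> B" using \<delta>0 by (auto simp: A_def B_def intro!: connected_Times)
  have "S \<zeta> (w, 0) = (\<lambda>_. \<zeta>) (w, 0)"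
  proof (rule section_unique[of "X 0 \<zeta> 0 (Suc N)" A "(0, 0)" _ _ N])
    show "continuous_on A (S \<zeta>)" by (rule continuous_on_subset[OF S_continuous[OF \<zeta>] A(2)])
    show "X (snd t) (S \<zeta> t) (fst t) (Suc N) = X 0 \<zeta> 0 (Suc N)" if "t \<in> A" for t
      using S_section[OF N] that A(2) by (auto simp: is_section_def)
    show "X (snd t) \<zeta> (fst t) (Suc N) = X 0 \<zeta> 0 (Suc N)" if "t \<in> A" for t
      using that X_0_indep by (auto simp: A_def)
  qed (use A N w \<zeta> S_base in \<open>auto simp: A_def lam_def\<close>)
  thus ?thesis by simp
qed

lemma S_less:
  assumes "\<zeta> \<in> Lam" "norm w \<le> 6" "norm b < \<delta>0"
  shows "norm (S \<zeta> (w, b)) < 6"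
proof -
  obtain N where N: "\<zeta> \<in> lam N" using assms by (auto simp: Lam_def)
  show ?thesis
  proof (cases N)
    case 0
    thus ?thesis using S_annulus[OF N assms(2,3)] by (simp add: annulus_def)
  next
    case (Suc n)
    thus ?thesis using X_before_escape[OF assms(3,2), of "S \<zeta> (w, b)" N 0] S_annulus[OF N assms(2,3)] by (auto simp: annulus_def)
  qed
qed

lemma S_less_3:
  assumes "\<zeta> \<in> lam N" "n < N" "norm w \<le> 6" "norm b < \<delta>0"
  shows "norm (X b (S \<zeta> (w, b)) w (Suc n)) < 3"
  using X_before_escape[OF assms(4,3), of "S \<zeta> (w, b)" N n] S_annulus[OF assms(1,3,4)] assms(2) by (auto simp: annulus_def)

lemma S_holomorphic:
  assumes \<zeta>: "\<zeta> \<in> Lam" and w: "norm w \<le> 6"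
  shows "(\<lambda>b. S \<zeta> (w, b)) holomorphic_on ball 0 \<delta>0"
proof -
  obtain N where N: "\<zeta> \<in> lam N" using \<zeta> by (auto simp: Lam_def)
  define F where "F b x = X b x w (Suc N) - X 0 \<zeta> 0 (Suc N)" for b x
  show ?thesis
  proof (rule implicit_holomorphic[where F = F])
    show "continuous_on (ball 0 \<delta>0) (\<lambda>b. S \<zeta> (w, b))"
      by (rule continuous_on_compose2[OF S_continuous[OF \<zeta>]]) (use w in \<open>auto simp: B_iff intro!: continuous_intros\<close>)
    fix b :: complex assume b: "b \<in> ball 0 \<delta>0"
    thus "F b (S \<zeta> (w, b)) = 0" using S_X[OF N w] by (simp add: F_def)
    obtain r where "continuous_on UNIV (\<lambda>p. r (fst p) (snd p))" "\<And>b' x. X b' x w (Suc N) - X b x w (Suc N) = (b' - b) * r b' x"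
      using diffquot_X[of b w "Suc N"] unfolding diffquot_def by blast
    thus "\<exists>r. (\<forall>b' x. F b' x - F b x = (b' - b) * r b' x) \<and> isCont (\<lambda>p. r (fst p) (snd p)) (b, S \<zeta> (w, b))"
      by (intro exI[of _ r]) (simp add: F_def continuous_on_eq_continuous_at del: X_simps)
    have "((\<lambda>x. poly (hpoly (par_c l b) b w (Suc N)) x - X 0 \<zeta> 0 (Suc N)) has_field_derivative
        poly (pderiv (hpoly (par_c l b) b w (Suc N))) (S \<zeta> (w, b))) (at (S \<zeta> (w, b)))"
      by (auto intro!: derivative_eq_intros)
    moreover have "F b = (\<lambda>x. poly (hpoly (par_c l b) b w (Suc N)) x - X 0 \<zeta> 0 (Suc N))"
      by (simp only: F_def[abs_def] poly_hpoly) (simp only: X_def)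
    ultimately show "\<exists>D'. (F b has_field_derivative D') (at (S \<zeta> (w, b))) \<and> D' \<noteq> 0"
      using hpoly_pderiv_nonzero[of b w "S \<zeta> (w, b)" N] S_annulus[OF N w, of b] w b
      by (intro exI[of _ "poly (pderiv (hpoly (par_c l b) b w (Suc N))) (S \<zeta> (w, b))"]) (auto simp: annulus_def)
  qed auto
qed

text \<open>Both sides of the second claim are root sections for the same level equation, with
  \<open>S \<zeta>\<close> as second coordinate. They agree at \<open>(0, 0)\<close>, hence
  everywhere.\<close>

lemma S_invariant:
  assumes \<zeta>: "\<zeta> \<in> lam (Suc N)" and w: "norm w \<le> 6" and b: "norm b < \<delta>0"
  shows "\<zeta>\<^sup>2 + par_c l 0 \<in> lam N"
    "S (\<zeta>\<^sup>2 + par_c l 0) (S \<zeta> (w, b), b) = (S \<zeta> (w, b))\<^sup>2 + par_c l b + b * w"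
proof -
  define \<zeta>' where "\<zeta>' = \<zeta>\<^sup>2 + par_c l 0"
  define \<xi> where "\<xi> = X 0 \<zeta> 0 (Suc (Suc N))"
  have \<xi>: "\<xi> \<in> annulus" using \<zeta> by (simp add: lam_def \<xi>_def del: X_simps)
  have sh: "X b (x\<^sup>2 + par_c l b + b * w) x n = X b x w (Suc n)" for b x w n
    using X_shift[of b x w 1 n] by simp
  have z': "X 0 \<zeta>' 0 (Suc N) = \<xi>"
    using sh[of 0 \<zeta> 0 "Suc N"] X_0_indep[of \<zeta>' \<zeta> N] by (simp add: \<zeta>'_def \<xi>_def del: X_simps(3))
  thus l': "\<zeta>\<^sup>2 + par_c l 0 \<in> lam N" using \<xi> by (simp add: lam_def \<zeta>'_def del: X_simps(3))
  have \<zeta>L: "\<zeta> \<in> Lam" and \<zeta>'L: "\<zeta>' \<in> Lam" using \<zeta> l' by (auto simp: Lam_def \<zeta>'_def)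
  have lt: "norm (S \<zeta> t) < 3" if "t \<in> B" for t
    using S_less_3[OF \<zeta>, of 0 "fst t" "snd t"] B_D[OF that] by simp
  have cS: "continuous_on B (S \<zeta>)" by (rule S_continuous[OF \<zeta>L])
  have cov: "covering_space {(t, x). t \<in> B \<and> X (snd t) x (S \<zeta> t) (Suc N) - \<xi> = 0} fst B"
  proof (rule X_covering[OF cS _ _ _ \<xi>])
    show "norm (S \<zeta> t) \<le> 6" if "t \<in> B" for t using lt[OF that] by linarith
    show "norm (snd t) < \<delta>0" if "t \<in> B" for t using B_D[OF that] by blast
  qed (intro continuous_intros)
  define s1 where "s1 t = (S \<zeta> t)\<^sup>2 + par_c l (snd t) + snd t * fst t" for t
  define s2 where "s2 t = S \<zeta>' (S \<zeta> t, snd t)" for t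
  have inB: "(S \<zeta> t, snd t) \<in> B" if "t \<in> B" for t
    using lt[OF that] B_D[OF that] by (auto simp: B_iff)
  have "s1 (w, b) = s2 (w, b)"
  proof (rule root_section_unique[OF cov convex_connected[OF convex_B] subset_refl, of "(0, 0)"])
    show "(0, 0) \<in> B" "(w, b) \<in> B" using B_0[of 0] w b by (auto simp: B_iff)
    show "continuous_on B s1" unfolding s1_def using l0 by (intro continuous_intros cS)
    show "continuous_on B s2" unfolding s2_def
      by (rule continuous_on_compose2[OF S_continuous[OF \<zeta>'L]]) (use inB in \<open>auto intro!: continuous_intros cS\<close>)
    fix t assume t: "t \<in> B"
    have "X (snd t) (s1 t) (S \<zeta> t) (Suc N) = X (snd t) (S \<zeta> t) (fst t) (Suc (Suc N))"
      unfolding s1_def by (rule sh)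
    also have "\<dots> = \<xi>" using S_X[OF \<zeta>, of "fst t" "snd t"] B_D[OF t] by (simp add: \<xi>_def del: X_simps)
    finally show "X (snd t) (s1 t) (S \<zeta> t) (Suc N) - \<xi> = 0" by simp
    have "X (snd t) (s2 t) (S \<zeta> t) (Suc N) = X 0 \<zeta>' 0 (Suc N)"
      unfolding s2_def by (rule S_X) (use l' inB[OF t] in \<open>auto simp: \<zeta>'_def B_iff\<close>)
    thus "X (snd t) (s2 t) (S \<zeta> t) (Suc N) - \<xi> = 0" using z' by simp
  next
    have "S \<zeta> (0, 0) = \<zeta>" by (rule S_base[OF \<zeta>L])
    moreover have "S \<zeta>' (\<zeta>, 0) = \<zeta>'"
      using lt[of "(0, 0)"] B_0[of 0] calculation by (intro S_b0 \<zeta>'L) auto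
    ultimately show "s1 (0, 0) = s2 (0, 0)" by (simp add: s1_def s2_def \<zeta>'_def)
  qed
  thus "S (\<zeta>\<^sup>2 + par_c l 0) (S \<zeta> (w, b), b) = (S \<zeta> (w, b))\<^sup>2 + par_c l b + b * w"
    by (simp add: s1_def s2_def \<zeta>'_def)
qed

text \<open>Points of one section have the same value at level \<open>N\<close>, so the difference
  \<open>\<Delta>\<close> of their orbits vanishes there. A slope above
  \<open>\<epsilon> / 2\<close> would put \<open>\<Delta>\<close> into the cone of
  \<open>hpoly_pderiv_nonzero\<close> and keep it nonzero. The cone argument needs the two orbits
  close to each other, hence the detour through a local bound.\<close>

lemma S_lipschitz:
  assumes \<zeta>: "\<zeta> \<in> Lam" and b: "norm b < \<delta>0" and w: "norm w \<le> 6" "norm w' \<le> 6"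
  shows "norm (S \<zeta> (w', b) - S \<zeta> (w, b)) \<le> \<epsilon> / 2 * norm (w' - w)"
proof -
  obtain N where N: "\<zeta> \<in> lam N" using \<zeta> by (auto simp: Lam_def)
  have loc: "\<exists>r>0. \<forall>w'\<in>cball 0 6. norm (w' - w) < r \<longrightarrow> norm (S \<zeta> (w', b) - S \<zeta> (w, b)) \<le> \<epsilon> / 2 * norm (w' - w)"
    if "w \<in> cball 0 6" for w
  proof -
    have w: "norm w \<le> 6" using that by simp
    define Y where "Y w' n = X b (S \<zeta> (w', b)) w' n" for w' n
    have cS: "continuous_on (cball 0 6) (\<lambda>w'. S \<zeta> (w', b))"
      by (rule continuous_on_compose2[OF S_continuous[OF \<zeta>]]) (use b in \<open>auto simp: B_iff intro!: continuous_intros\<close>)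
    have cY: "continuous_on (cball 0 6) (\<lambda>w'. Y w' n)" for n
      unfolding Y_def by (intro continuous_intros cS)
    have "\<forall>\<^sub>F w' in at w within cball 0 6. dist (Y w' (Suc n)) (Y w (Suc n)) < \<epsilon>" for n
      using cY[of "Suc n"] that eps by (intro tendstoD) (auto simp: continuous_on_def)
    hence "\<forall>\<^sub>F w' in at w within cball 0 6. \<forall>n\<in>{..<N}. dist (Y w' (Suc n)) (Y w (Suc n)) < \<epsilon>"
      by (intro eventually_ball_finite) auto
    then obtain r where r: "r > 0" "\<And>w' n. w' \<in> cball 0 6 \<Longrightarrow> w' \<noteq> w \<Longrightarrow> norm (w' - w) < r \<Longrightarrow> n < N \<Longrightarrow>
      norm (Y w' (Suc n) - Y w (Suc n)) < \<epsilon>"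
      unfolding eventually_at by (auto simp: dist_norm)
    show ?thesis
    proof (intro exI[of _ r] conjI ballI impI r(1))
      fix w' :: complex assume w': "w' \<in> cball 0 6" "norm (w' - w) < r"
      define \<Delta> where "\<Delta> n = Y w' n - Y w n" for n
      have \<Delta>0: "\<Delta> 0 = w' - w" by (simp add: \<Delta>_def Y_def)
      have \<Delta>S: "\<Delta> (Suc (Suc n)) = (Y w' (Suc n) + Y w (Suc n)) * \<Delta> (Suc n) + b * \<Delta> n" for n
        by (simp add: \<Delta>_def Y_def power2_eq_square algebra_simps)
      have \<Delta>N: "\<Delta> (Suc N) = 0" using S_X[OF N _ b] w w' by (simp add: \<Delta>_def Y_def del: X_simps)
      show "norm (S \<zeta> (w', b) - S \<zeta> (w, b)) \<le> \<epsilon> / 2 * norm (w' - w)"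
      proof (cases "w' = w")
        case False
        show ?thesis
        proof (rule ccontr)
          assume neg: "\<not> ?thesis"
          have "\<Delta> (Suc n) \<noteq> 0 \<and> norm (\<Delta> (Suc n)) \<ge> \<epsilon> / 2 * norm (\<Delta> n)" if "n \<le> N" for n
            using that
          proof (induction n)
            case 0
            have "norm (\<Delta> (Suc 0)) > \<epsilon> / 2 * norm (\<Delta> 0)" using neg unfolding \<Delta>0 by (simp add: \<Delta>_def Y_def)
            moreover have "\<epsilon> / 2 * norm (\<Delta> 0) \<ge> 0" using eps by simp
            ultimately show ?case by auto
          next
            case (Suc n)
            hence IH: "\<Delta> (Suc n) \<noteq> 0" "norm (\<Delta> (Suc n)) \<ge> \<epsilon> / 2 * norm (\<Delta> n)" by auto
            have away: "norm (Y w (Suc n)) \<ge> \<epsilon>"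
              unfolding Y_def using S_annulus[OF N w b] Suc.prems
              by (intro X_away_from_0[OF b w, of _ N]) (auto simp: annulus_def)
            have near: "norm (Y w' (Suc n) - Y w (Suc n)) < \<epsilon>" using r(2) w' False Suc.prems by simp
            have "Y w' (Suc n) + Y w (Suc n) = 2 * Y w (Suc n) + (Y w' (Suc n) - Y w (Suc n))" by simp
            hence "norm (Y w' (Suc n) + Y w (Suc n)) \<ge> norm (2 * Y w (Suc n)) - norm (Y w' (Suc n) - Y w (Suc n))"
              by (metis norm_diff_ineq)
            hence sum: "norm (Y w' (Suc n) + Y w (Suc n)) \<ge> \<epsilon>" using away near by (simp add: norm_mult)
            have "norm (b * \<Delta> n) \<le> \<epsilon>\<^sup>2 / 4 * norm (\<Delta> n)" unfolding norm_mult
              using b by (intro mult_right_mono) (auto simp: \<delta>0_def)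
            also have "\<dots> = \<epsilon> / 2 * (\<epsilon> / 2 * norm (\<Delta> n))" by (simp add: power2_eq_square)
            also have "\<dots> \<le> \<epsilon> / 2 * norm (\<Delta> (Suc n))" using IH eps by (intro mult_left_mono) auto
            finally have 1: "norm (b * \<Delta> n) \<le> \<epsilon> / 2 * norm (\<Delta> (Suc n))" .
            have "\<epsilon> * norm (\<Delta> (Suc n)) \<le> norm ((Y w' (Suc n) + Y w (Suc n)) * \<Delta> (Suc n))"
              unfolding norm_mult using sum by (intro mult_right_mono) auto
            hence 2: "norm (\<Delta> (Suc (Suc n))) \<ge> \<epsilon> * norm (\<Delta> (Suc n)) - \<epsilon> / 2 * norm (\<Delta> (Suc n))"
              using 1 norm_diff_ineq[of "(Y w' (Suc n) + Y w (Suc n)) * \<Delta> (Suc n)" "b * \<Delta> n"] unfolding \<Delta>S by linarith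
            have "\<epsilon> * norm (\<Delta> (Suc n)) > 0" using IH eps by simp
            hence "norm (\<Delta> (Suc (Suc n))) \<ge> \<epsilon> / 2 * norm (\<Delta> (Suc n)) \<and> norm (\<Delta> (Suc (Suc n))) > 0" using 2 by linarith
            thus ?case by auto
          qed
          thus False using \<Delta>N by blast
        qed
      qed simp
    qed
  qed
  show ?thesis
    by (rule lipschitz_locally_imp_globally[of "cball 0 6" "\<lambda>w. S \<zeta> (w, b)"]) (use loc w in auto)
qed

text \<open>For distinct labels the difference of the two sections is holomorphic and zero-free in
  \<open>b\<close> and smaller than 12 = 6 + 6; at \<open>b = 0\<close> it equals
  \<open>\<zeta> - \<zeta>'\<close> for every \<open>w\<close>.\<close>

lemma S_comparison:
  assumes \<zeta>: "\<zeta> \<in> Lam" "\<zeta>' \<in> Lam" and w: "norm w \<le> 6" and b: "norm b \<le> \<delta>0 / 3"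
  shows "(norm (S \<zeta> (w, b) - S \<zeta>' (w, b)))\<^sup>2 \<le> 12 * norm (\<zeta> - \<zeta>')"
    "(norm (\<zeta> - \<zeta>'))\<^sup>2 \<le> 12 * norm (S \<zeta> (w, b) - S \<zeta>' (w, b))"
proof -
  define d where "d b = S \<zeta> (w, b) - S \<zeta>' (w, b)" for b
  have d0: "d 0 = \<zeta> - \<zeta>'" using S_b0 \<zeta> w by (simp add: d_def)
  have "(norm (d b))\<^sup>2 \<le> 12 * norm (d 0) \<and> (norm (d 0))\<^sup>2 \<le> 12 * norm (d b)"
  proof (cases "\<zeta> = \<zeta>'")
    case False
    have hol: "d holomorphic_on ball 0 \<delta>0" unfolding d_def by (intro holomorphic_intros S_holomorphic \<zeta> w)
    have nz: "d z \<noteq> 0" if "z \<in> ball 0 \<delta>0" for z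
      using S_noncollide[OF \<zeta> w, of z] that False by (auto simp: d_def)
    have bd: "norm (d z) < 12" if "z \<in> ball 0 \<delta>0" for z
      using S_less[OF \<zeta>(1) w, of z] S_less[OF \<zeta>(2) w, of z] that norm_triangle_ineq4[of "S \<zeta> (w, z)" "S \<zeta>' (w, z)"]
      by (auto simp: d_def)
    show ?thesis using nonvanishing_comparison[OF hol \<delta>0(1) nz bd b] by blast
  qed (simp add: d_def)
  thus "(norm (S \<zeta> (w, b) - S \<zeta>' (w, b)))\<^sup>2 \<le> 12 * norm (\<zeta> - \<zeta>')"
    "(norm (\<zeta> - \<zeta>'))\<^sup>2 \<le> 12 * norm (S \<zeta> (w, b) - S \<zeta>' (w, b))"
    unfolding d0 by (auto simp: d_def)
qed

text \<open>A third of the radius of holomorphy, as in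
  \<open>nonvanishing_comparison\<close>.\<close>

definition \<delta> :: real where "\<delta> = \<delta>0 / 3"

lemma \<delta>: "0 < \<delta>" "\<delta> < \<delta>0" using \<delta>0 by (auto simp: \<delta>_def)

section \<open>Extension of the motion to the closure\<close>

lemma closure_Lam_approx:
  assumes "\<zeta> \<in> closure Lam"
  obtains \<eta> where "\<And>k. \<eta> k \<in> Lam" "\<eta> \<longlonglongrightarrow> \<zeta>"
  using assms closure_sequential by metis

lemma S_near_le:
  assumes "\<zeta> \<in> Lam" "\<zeta>' \<in> Lam" "norm w \<le> 6" "norm b \<le> \<delta>"
  shows "norm (S \<zeta> (w, b) - S \<zeta>' (w, b)) \<le> sqrt (12 * norm (\<zeta> - \<zeta>'))"
  using S_comparison(1)[OF assms(1-3)] assms(4) by (intro real_le_rsqrt) (simp add: \<delta>_def)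

text \<open>The estimate against all of \<open>Lam\<close> determines the limit without reference to
  a sequence: along any escaping points that converge to \<open>\<zeta>\<close> it forces the same
  value.\<close>

lemma Phi_exists:
  assumes \<zeta>: "\<zeta> \<in> closure Lam" and w: "norm w \<le> 6" and b: "norm b \<le> \<delta>"
  shows "\<exists>L. \<forall>\<eta>\<in>Lam. norm (L - S \<eta> (w, b)) \<le> sqrt (12 * norm (\<zeta> - \<eta>))"
proof -
  obtain \<eta> where \<eta>: "\<And>k. \<eta> k \<in> Lam" "\<eta> \<longlonglongrightarrow> \<zeta>" using closure_Lam_approx[OF \<zeta>] by blast
  have "Cauchy (\<lambda>k. S (\<eta> k) (w, b))"
  proof (rule CauchyI)
    fix e :: real assume e: "e > 0"
    have "Cauchy \<eta>" using \<eta>(2) LIMSEQ_imp_Cauchy by blast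
    moreover have "e\<^sup>2 / 12 > 0" using e by simp
    ultimately obtain M where M: "\<And>m n. m \<ge> M \<Longrightarrow> n \<ge> M \<Longrightarrow> norm (\<eta> m - \<eta> n) < e\<^sup>2 / 12" by (meson CauchyD)
    show "\<exists>M. \<forall>m\<ge>M. \<forall>n\<ge>M. norm (S (\<eta> m) (w, b) - S (\<eta> n) (w, b)) < e"
    proof (intro exI[of _ M] allI impI)
      fix m n assume mn: "m \<ge> M" "n \<ge> M"
      have "norm (S (\<eta> m) (w, b) - S (\<eta> n) (w, b)) \<le> sqrt (12 * norm (\<eta> m - \<eta> n))" by (rule S_near_le[OF \<eta>(1) \<eta>(1) w b])
      also have "\<dots> < sqrt (e\<^sup>2)" using M[OF mn] by (intro real_sqrt_less_mono) simp
      finally show "norm (S (\<eta> m) (w, b) - S (\<eta> n) (w, b)) < e" using e by simp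
    qed
  qed
  then obtain L where L: "(\<lambda>k. S (\<eta> k) (w, b)) \<longlonglongrightarrow> L" using Cauchy_convergent_iff convergent_def by blast
  have "norm (L - S \<xi> (w, b)) \<le> sqrt (12 * norm (\<zeta> - \<xi>))" if "\<xi> \<in> Lam" for \<xi>
  proof (rule LIMSEQ_le)
    show "(\<lambda>k. norm (S (\<eta> k) (w, b) - S \<xi> (w, b))) \<longlonglongrightarrow> norm (L - S \<xi> (w, b))" by (intro tendsto_intros L)
    show "(\<lambda>k. sqrt (12 * norm (\<eta> k - \<xi>))) \<longlonglongrightarrow> sqrt (12 * norm (\<zeta> - \<xi>))" by (intro tendsto_intros \<eta>)
    show "\<exists>N. \<forall>n\<ge>N. norm (S (\<eta> n) (w, b) - S \<xi> (w, b)) \<le> sqrt (12 * norm (\<eta> n - \<xi>))"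
      using S_near_le[OF \<eta>(1) that w b] by blast
  qed
  thus ?thesis by blast
qed

text \<open>The continuous extension of the motion \<open>S\<close> to the closure of the escaping points.\<close>

definition Phi :: "complex \<Rightarrow> complex \<Rightarrow> complex \<Rightarrow> complex" where
  "Phi b \<zeta> w = (SOME L. \<forall>\<eta>\<in>Lam. norm (L - S \<eta> (w, b)) \<le> sqrt (12 * norm (\<zeta> - \<eta>)))"

lemma Phi_near:
  assumes "\<zeta> \<in> closure Lam" "norm w \<le> 6" "norm b \<le> \<delta>" "\<eta> \<in> Lam"
  shows "norm (Phi b \<zeta> w - S \<eta> (w, b)) \<le> sqrt (12 * norm (\<zeta> - \<eta>))"
  using someI_ex[OF Phi_exists[OF assms(1-3)]] assms(4) unfolding Phi_def by blast

lemma Phi_limit: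
  assumes \<eta>: "\<And>k. \<eta> k \<in> Lam" "\<eta> \<longlonglongrightarrow> \<zeta>" and wb: "norm w \<le> 6" "norm b \<le> \<delta>"
  shows "(\<lambda>k. S (\<eta> k) (w, b)) \<longlonglongrightarrow> Phi b \<zeta> w"
proof -
  have \<zeta>: "\<zeta> \<in> closure Lam" using \<eta> closure_sequential by blast
  have "(\<lambda>k. sqrt (12 * norm (\<zeta> - \<eta> k))) \<longlonglongrightarrow> sqrt (12 * norm (\<zeta> - \<zeta>))" by (intro tendsto_intros \<eta>)
  hence lim: "(\<lambda>k. sqrt (12 * norm (\<zeta> - \<eta> k))) \<longlonglongrightarrow> 0" by simp
  have "(\<lambda>k. Phi b \<zeta> w - S (\<eta> k) (w, b)) \<longlonglongrightarrow> 0"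
    by (rule tendsto_norm_le_0[OF always_eventually lim]) (use Phi_near[OF \<zeta> wb \<eta>(1)] in blast)
  hence "(\<lambda>k. Phi b \<zeta> w - (Phi b \<zeta> w - S (\<eta> k) (w, b))) \<longlonglongrightarrow> Phi b \<zeta> w - 0" by (intro tendsto_intros)
  thus ?thesis by simp
qed

lemma Phi_Lam: "\<zeta> \<in> Lam \<Longrightarrow> norm w \<le> 6 \<Longrightarrow> norm b \<le> \<delta> \<Longrightarrow> Phi b \<zeta> w = S \<zeta> (w, b)"
  using Phi_near[of \<zeta> w b \<zeta>] closure_subset by auto

text \<open>Non-collision of the sections alone would not prevent distinct graphs from merging in
  the limit; its quantitative form, the second inequality, does.\<close>

lemma Phi_comparison:
  assumes \<zeta>: "\<zeta> \<in> closure Lam" "\<zeta>' \<in> closure Lam" and w: "norm w \<le> 6" and b: "norm b \<le> \<delta>"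
  shows "norm (Phi b \<zeta> w - Phi b \<zeta>' w) \<le> sqrt (12 * norm (\<zeta> - \<zeta>'))"
    "(norm (\<zeta> - \<zeta>'))\<^sup>2 \<le> 12 * norm (Phi b \<zeta> w - Phi b \<zeta>' w)"
proof -
  obtain \<eta> where \<eta>: "\<And>k. \<eta> k \<in> Lam" "\<eta> \<longlonglongrightarrow> \<zeta>" using closure_Lam_approx[OF \<zeta>(1)] by blast
  obtain \<eta>' where \<eta>': "\<And>k. \<eta>' k \<in> Lam" "\<eta>' \<longlonglongrightarrow> \<zeta>'" using closure_Lam_approx[OF \<zeta>(2)] by blast
  note lim = Phi_limit[OF \<eta> w b] Phi_limit[OF \<eta>' w b]
  show "norm (Phi b \<zeta> w - Phi b \<zeta>' w) \<le> sqrt (12 * norm (\<zeta> - \<zeta>'))"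
  proof (rule LIMSEQ_le)
    show "(\<lambda>k. norm (S (\<eta> k) (w, b) - S (\<eta>' k) (w, b))) \<longlonglongrightarrow> norm (Phi b \<zeta> w - Phi b \<zeta>' w)" by (intro tendsto_intros lim)
    show "(\<lambda>k. sqrt (12 * norm (\<eta> k - \<eta>' k))) \<longlonglongrightarrow> sqrt (12 * norm (\<zeta> - \<zeta>'))" by (intro tendsto_intros \<eta> \<eta>')
    show "\<exists>N. \<forall>n\<ge>N. norm (S (\<eta> n) (w, b) - S (\<eta>' n) (w, b)) \<le> sqrt (12 * norm (\<eta> n - \<eta>' n))"
      using S_near_le[OF \<eta>(1) \<eta>'(1) w b] by blast
  qed
  show "(norm (\<zeta> - \<zeta>'))\<^sup>2 \<le> 12 * norm (Phi b \<zeta> w - Phi b \<zeta>' w)"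
  proof (rule LIMSEQ_le)
    show "(\<lambda>k. 12 * norm (S (\<eta> k) (w, b) - S (\<eta>' k) (w, b))) \<longlonglongrightarrow> 12 * norm (Phi b \<zeta> w - Phi b \<zeta>' w)" by (intro tendsto_intros lim)
    show "(\<lambda>k. (norm (\<eta> k - \<eta>' k))\<^sup>2) \<longlonglongrightarrow> (norm (\<zeta> - \<zeta>'))\<^sup>2" by (intro tendsto_intros \<eta> \<eta>')
    show "\<exists>N. \<forall>n\<ge>N. (norm (\<eta> n - \<eta>' n))\<^sup>2 \<le> 12 * norm (S (\<eta> n) (w, b) - S (\<eta>' n) (w, b))"
      using S_comparison(2)[OF \<eta>(1) \<eta>'(1) w] b by (auto simp: \<delta>_def)
  qed
qed

lemma Phi_inj:
  assumes "\<zeta> \<in> closure Lam" "\<zeta>' \<in> closure Lam" "norm w \<le> 6" "norm b \<le> \<delta>" "Phi b \<zeta> w = Phi b \<zeta>' w"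
  shows "\<zeta> = \<zeta>'"
  using Phi_comparison(2)[OF assms(1-4)] assms(5) by simp

lemma Phi_lipschitz:
  assumes \<zeta>: "\<zeta> \<in> closure Lam" and b: "norm b \<le> \<delta>" and w: "norm w \<le> 6" "norm w' \<le> 6"
  shows "norm (Phi b \<zeta> w' - Phi b \<zeta> w) \<le> \<epsilon> / 2 * norm (w' - w)"
proof -
  obtain \<eta> where \<eta>: "\<And>k. \<eta> k \<in> Lam" "\<eta> \<longlonglongrightarrow> \<zeta>" using closure_Lam_approx[OF \<zeta>] by blast
  have "(\<lambda>k. norm (S (\<eta> k) (w', b) - S (\<eta> k) (w, b))) \<longlonglongrightarrow> norm (Phi b \<zeta> w' - Phi b \<zeta> w)"
    by (intro tendsto_intros Phi_limit[OF \<eta>] w b)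
  thus ?thesis
    by (rule LIMSEQ_le_const2) (use S_lipschitz[OF \<eta>(1) _ w] b \<delta> in force)
qed

lemma Phi_holomorphic:
  assumes \<zeta>: "\<zeta> \<in> closure Lam" and w: "norm w \<le> 6"
  shows "(\<lambda>b. Phi b \<zeta> w) holomorphic_on ball 0 \<delta>"
proof -
  obtain \<eta> where \<eta>: "\<And>k. \<eta> k \<in> Lam" "\<eta> \<longlonglongrightarrow> \<zeta>" using closure_Lam_approx[OF \<zeta>] by blast
  show ?thesis
  proof (rule holomorphic_uniform_sequence[OF open_ball])
    show "(\<lambda>b. S (\<eta> k) (w, b)) holomorphic_on ball 0 \<delta>" for k
      by (rule holomorphic_on_subset[OF S_holomorphic[OF \<eta>(1) w]]) (use \<delta> in auto)
    fix x :: complex assume x: "x \<in> ball 0 \<delta>"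
    then obtain d where d: "d > 0" "cball x d \<subseteq> ball 0 \<delta>" using open_contains_cball[THEN iffD1, OF open_ball] by blast
    have "uniform_limit (cball x d) (\<lambda>k b. S (\<eta> k) (w, b)) (\<lambda>b. Phi b \<zeta> w) sequentially"
    proof (rule uniform_limitI)
      fix e :: real assume e: "e > 0"
      have "(\<lambda>k. sqrt (12 * norm (\<zeta> - \<eta> k))) \<longlonglongrightarrow> sqrt (12 * norm (\<zeta> - \<zeta>))" by (intro tendsto_intros \<eta>)
      from order_tendstoD(2)[OF this, of e] e
      have "\<forall>\<^sub>F k in sequentially. sqrt (12 * norm (\<zeta> - \<eta> k)) < e" by simp
      thus "\<forall>\<^sub>F k in sequentially. \<forall>b\<in>cball x d. dist (S (\<eta> k) (w, b)) (Phi b \<zeta> w) < e"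
      proof eventually_elim
        case (elim k)
        show ?case
        proof
          fix b assume "b \<in> cball x d"
          hence "norm b \<le> \<delta>" using d(2) by fastforce
          from Phi_near[OF \<zeta> w this \<eta>(1), of k] elim show "dist (S (\<eta> k) (w, b)) (Phi b \<zeta> w) < e"
            by (simp add: dist_norm norm_minus_commute)
        qed
      qed
    qed
    thus "\<exists>d>0. cball x d \<subseteq> ball 0 \<delta> \<and> uniform_limit (cball x d) (\<lambda>k b. S (\<eta> k) (w, b)) (\<lambda>b. Phi b \<zeta> w) sequentially"
      using d by blast
  qed
qed

lemma Phi_continuous:
  assumes b: "norm b \<le> \<delta>"
  shows "continuous_on (closure Lam \<times> cball 0 6) (\<lambda>p. Phi b (fst p) (snd p))"
proof -
  have "\<exists>d>0. \<forall>p'\<in>closure Lam \<times> cball 0 6. dist p' p < d \<longrightarrow> dist (Phi b (fst p') (snd p')) (Phi b (fst p) (snd p)) < e"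
    if p: "p \<in> closure Lam \<times> cball 0 6" and e: "e > 0" for p e
  proof -
    obtain \<zeta> w where p': "p = (\<zeta>, w)" "\<zeta> \<in> closure Lam" "norm w \<le> 6" using p by auto
    define d where "d = min (e / 2) ((e / 2)\<^sup>2 / 12)"
    have d: "d > 0" using e by (simp add: d_def)
    show ?thesis
    proof (intro exI[of _ d] conjI ballI impI d)
      fix q assume q: "q \<in> closure Lam \<times> cball 0 6" "dist q p < d"
      obtain \<zeta>' w' where q': "q = (\<zeta>', w')" "\<zeta>' \<in> closure Lam" "norm w' \<le> 6" using q by auto
      have dz: "norm (\<zeta>' - \<zeta>) < d" "norm (w' - w) < d"
        using q(2) dist_fst_le[of q p] dist_snd_le[of q p] by (auto simp: q' p' dist_norm)
      have "norm (Phi b \<zeta>' w' - Phi b \<zeta> w') \<le> sqrt (12 * norm (\<zeta>' - \<zeta>))"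
        by (rule Phi_comparison(1)[OF q'(2) p'(2) q'(3) b])
      also have "\<dots> < sqrt ((e / 2)\<^sup>2)" using dz by (intro real_sqrt_less_mono) (auto simp: d_def)
      also have "\<dots> = e / 2" using e by simp
      finally have 1: "norm (Phi b \<zeta>' w' - Phi b \<zeta> w') < e / 2" .
      have "norm (Phi b \<zeta> w' - Phi b \<zeta> w) \<le> \<epsilon> / 2 * norm (w' - w)"
        by (rule Phi_lipschitz[OF p'(2) b p'(3) q'(3)])
      also have "\<dots> \<le> 1 * norm (w' - w)" using eps by (intro mult_right_mono) auto
      finally have 2: "norm (Phi b \<zeta> w' - Phi b \<zeta> w) < e / 2" using dz by (simp add: d_def)
      show "dist (Phi b (fst q) (snd q)) (Phi b (fst p) (snd p)) < e"
        using norm_triangle_ineq[of "Phi b \<zeta>' w' - Phi b \<zeta> w'" "Phi b \<zeta> w' - Phi b \<zeta> w"] 1 2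
        by (simp add: q' p' dist_norm)
    qed
  qed
  thus ?thesis unfolding continuous_on_iff by blast
qed

section \<open>The Julia set of the quadratic polynomial and the graphs over it\<close>

definition p0 :: "complex \<Rightarrow> complex" where "p0 \<zeta> = \<zeta>\<^sup>2 + par_c l 0"

text \<open>The Julia set of \<open>p0\<close>.\<close>

definition J0 :: "complex set" where
  "J0 = {\<zeta> \<in> closure Lam. \<forall>n. norm (X 0 \<zeta> 0 (Suc n)) \<le> 3}"

lemma X_p0: "X 0 (p0 \<zeta>) 0 (Suc n) = X 0 \<zeta> 0 (Suc (Suc n))"
  using X_shift[of 0 \<zeta> 0 1 "Suc n"] X_0_indep[of "p0 \<zeta>" \<zeta> n] by (simp add: p0_def del: X_simps(3)) simp

lemma Lam_bounded: "Lam \<subseteq> ball 0 6"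
proof
  fix \<zeta> assume "\<zeta> \<in> Lam"
  hence "norm (S \<zeta> (0, 0)) < 6" using S_less[of \<zeta> 0 0] \<delta>0 by simp
  thus "\<zeta> \<in> ball 0 6" using S_base[OF \<open>\<zeta> \<in> Lam\<close>] by simp
qed

lemma J0_compact: "compact J0"
proof -
  have "closed ((\<lambda>\<zeta>. X 0 \<zeta> 0 (Suc n)) -` cball 0 3)" for n
    by (intro closed_vimage closed_cball continuous_intros)
  moreover have "J0 = closure Lam \<inter> (\<Inter>n. (\<lambda>\<zeta>. X 0 \<zeta> 0 (Suc n)) -` cball 0 3)" by (auto simp: J0_def)
  ultimately have "closed J0" by (auto intro!: closed_Int closed_INT)
  moreover have "J0 \<subseteq> cball 0 6"
    using closure_minimal[OF subset_trans[OF Lam_bounded ball_subset_cball] closed_cball] by (auto simp: J0_def)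
  ultimately show ?thesis using bounded_subset bounded_cball compact_eq_bounded_closed by blast
qed

lemma J0_closure: "\<zeta> \<in> J0 \<Longrightarrow> \<zeta> \<in> closure Lam" by (simp add: J0_def)

lemma J0_less_3:
  assumes "\<zeta> \<in> J0"
  shows "norm (X 0 \<zeta> 0 (Suc n)) < 3"
proof (rule ccontr)
  assume "\<not> ?thesis"
  hence a: "norm (X 0 \<zeta> 0 (Suc n)) \<ge> 3" by simp
  have "norm (X 0 \<zeta> 0 (Suc (n + 1))) \<ge> 2 ^ 1 * norm (X 0 \<zeta> 0 (Suc n))"
    by (rule X_escape) (use a \<delta>0 in auto)
  moreover have "norm (X 0 \<zeta> 0 (Suc (n + 1))) \<le> 3" using assms unfolding J0_def by blast
  ultimately show False using a unfolding power_one_right by linarith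
qed

lemma Lam_shift:
  assumes "\<zeta> \<in> Lam" "norm \<zeta> < 3"
  obtains N where "\<zeta> \<in> lam (Suc N)"
proof -
  obtain N where N: "\<zeta> \<in> lam N" using assms by (auto simp: Lam_def)
  have "N \<noteq> 0"
  proof
    assume "N = 0"
    thus False using N assms(2) by (simp add: lam_def annulus_def)
  qed
  thus ?thesis using that N by (cases N) auto
qed

lemma J0_approx:
  assumes "\<zeta> \<in> J0"
  obtains \<eta> where "\<And>k. \<eta> k \<in> Lam" "\<eta> \<longlonglongrightarrow> \<zeta>" "\<And>k. norm (\<eta> k) < 3"
proof -
  obtain \<eta> where \<eta>: "\<And>k. \<eta> k \<in> Lam" "\<eta> \<longlonglongrightarrow> \<zeta>" using closure_Lam_approx[OF J0_closure[OF assms]] by blast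
  have "norm \<zeta> < 3" using J0_less_3[OF assms, of 0] by simp
  from order_tendstoD(2)[OF tendsto_norm[OF \<eta>(2)] this] obtain K where K: "\<And>k. k \<ge> K \<Longrightarrow> norm (\<eta> k) < 3"
    unfolding eventually_sequentially by blast
  show ?thesis using that[of "\<lambda>k. \<eta> (k + K)"] \<eta> K by (simp add: LIMSEQ_ignore_initial_segment)
qed

lemma J0_p0:
  assumes "\<zeta> \<in> J0"
  shows "p0 \<zeta> \<in> J0"
proof -
  obtain \<eta> where \<eta>: "\<And>k. \<eta> k \<in> Lam" "\<eta> \<longlonglongrightarrow> \<zeta>" "\<And>k. norm (\<eta> k) < 3" using J0_approx[OF assms] by blast
  have "p0 (\<eta> k) \<in> Lam" for k
  proof -
    obtain N where "\<eta> k \<in> lam (Suc N)" using Lam_shift[OF \<eta>(1,3)] by blast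
    from S_invariant(1)[OF this, of 0 0] \<delta>0 show ?thesis by (auto simp: p0_def Lam_def)
  qed
  moreover have "(\<lambda>k. p0 (\<eta> k)) \<longlonglongrightarrow> p0 \<zeta>" unfolding p0_def by (intro tendsto_intros \<eta>)
  ultimately have "p0 \<zeta> \<in> closure Lam"
    unfolding closure_sequential by (intro exI[of _ "\<lambda>k. p0 (\<eta> k)"]) simp
  moreover have "norm (X 0 (p0 \<zeta>) 0 (Suc n)) \<le> 3" for n
    using assms unfolding X_p0 J0_def by blast
  ultimately show ?thesis by (simp add: J0_def)
qed

text \<open>Obtained from the escaping points by passing to the limit. The last equation says that
  the Henon map carries the graph over \<open>\<zeta>\<close> into the graph over
  \<open>p0 \<zeta>\<close>, which is the skew product structure.\<close>

lemma Phi_J0: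
  assumes \<zeta>: "\<zeta> \<in> J0" and w: "norm w \<le> 6" and b: "norm b \<le> \<delta>"
  shows "norm (Phi b \<zeta> w) \<le> 3" "norm (Phi b \<zeta> w) \<ge> \<epsilon>"
    "Phi b (p0 \<zeta>) (Phi b \<zeta> w) = (Phi b \<zeta> w)\<^sup>2 + par_c l b + b * w"
proof -
  have b0: "norm b < \<delta>0" using b \<delta> by linarith
  obtain \<eta> where \<eta>: "\<And>k. \<eta> k \<in> Lam" "\<eta> \<longlonglongrightarrow> \<zeta>" "\<And>k. norm (\<eta> k) < 3" using J0_approx[OF \<zeta>] by blast
  have "\<exists>N. \<eta> k \<in> lam (Suc N)" for k using Lam_shift[OF \<eta>(1,3)] by metis
  then obtain N where N: "\<And>k. \<eta> k \<in> lam (Suc (N k))" by metis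
  define s where "s k = S (\<eta> k) (w, b)" for k
  have lim: "s \<longlonglongrightarrow> Phi b \<zeta> w" unfolding s_def by (rule Phi_limit[OF \<eta>(1,2) w b])
  have s3: "norm (s k) < 3" for k using S_less_3[OF N _ w b0, of 0 k] by (simp add: s_def)
  have s6: "norm (s k) \<le> 6" for k using s3[of k] by linarith
  show n3: "norm (Phi b \<zeta> w) \<le> 3"
    by (rule LIMSEQ_le_const2[OF tendsto_norm[OF lim]]) (use s3 in \<open>auto intro: less_imp_le\<close>)
  have "norm (s k) \<ge> \<epsilon>" for k
    using X_away_from_0[OF b0 w, of "s k" "Suc (N k)" 0] S_annulus[OF N w b0, of k] by (auto simp: s_def annulus_def)
  thus "norm (Phi b \<zeta> w) \<ge> \<epsilon>" by (intro LIMSEQ_le_const[OF tendsto_norm[OF lim]]) auto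
  have p0L: "p0 (\<eta> k) \<in> Lam" for k using S_invariant(1)[OF N w b0, of k] by (auto simp: p0_def Lam_def)
  have "(\<lambda>k. p0 (\<eta> k)) \<longlonglongrightarrow> p0 \<zeta>" unfolding p0_def by (intro tendsto_intros \<eta>)
  from Phi_limit[OF p0L this _ b, of "Phi b \<zeta> w"] n3
  have "(\<lambda>k. S (p0 (\<eta> k)) (Phi b \<zeta> w, b)) \<longlonglongrightarrow> Phi b (p0 \<zeta>) (Phi b \<zeta> w)" by simp
  \<comment> \<open>The section and its argument \<open>s k\<close> both vary with \<open>k\<close>;
    the Lipschitz bound, uniform over all sections, separates the two limits.\<close>
  moreover have "(\<lambda>k. S (p0 (\<eta> k)) (s k, b) - S (p0 (\<eta> k)) (Phi b \<zeta> w, b)) \<longlonglongrightarrow> 0"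
  proof (rule tendsto_norm_le_0[OF always_eventually])
    show "\<forall>k. norm (S (p0 (\<eta> k)) (s k, b) - S (p0 (\<eta> k)) (Phi b \<zeta> w, b)) \<le> \<epsilon> / 2 * norm (s k - Phi b \<zeta> w)"
      using s6 n3 by (intro allI S_lipschitz p0L b0) auto
    have "(\<lambda>k. \<epsilon> / 2 * norm (s k - Phi b \<zeta> w)) \<longlonglongrightarrow> \<epsilon> / 2 * norm (Phi b \<zeta> w - Phi b \<zeta> w)" by (intro tendsto_intros lim)
    thus "(\<lambda>k. \<epsilon> / 2 * norm (s k - Phi b \<zeta> w)) \<longlonglongrightarrow> 0" by simp
  qed
  ultimately have "(\<lambda>k. S (p0 (\<eta> k)) (Phi b \<zeta> w, b) + (S (p0 (\<eta> k)) (s k, b) - S (p0 (\<eta> k)) (Phi b \<zeta> w, b))) \<longlonglongrightarrow> Phi b (p0 \<zeta>) (Phi b \<zeta> w) + 0"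
    by (rule tendsto_add)
  hence "(\<lambda>k. S (p0 (\<eta> k)) (s k, b)) \<longlonglongrightarrow> Phi b (p0 \<zeta>) (Phi b \<zeta> w)" by simp
  moreover have "S (p0 (\<eta> k)) (s k, b) = (s k)\<^sup>2 + par_c l b + b * w" for k
    unfolding s_def p0_def by (rule S_invariant(2)[OF N w b0])
  ultimately have "(\<lambda>k. (s k)\<^sup>2 + par_c l b + b * w) \<longlonglongrightarrow> Phi b (p0 \<zeta>) (Phi b \<zeta> w)" by simp
  moreover have "(\<lambda>k. (s k)\<^sup>2 + par_c l b + b * w) \<longlonglongrightarrow> (Phi b \<zeta> w)\<^sup>2 + par_c l b + b * w" by (intro tendsto_intros lim)
  ultimately show "Phi b (p0 \<zeta>) (Phi b \<zeta> w) = (Phi b \<zeta> w)\<^sup>2 + par_c l b + b * w" by (rule LIMSEQ_unique)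
qed

lemma Phi_b0: "\<zeta> \<in> closure Lam \<Longrightarrow> norm w \<le> 6 \<Longrightarrow> Phi 0 \<zeta> w = \<zeta>"
proof -
  assume \<zeta>: "\<zeta> \<in> closure Lam" and w: "norm w \<le> 6"
  obtain \<eta> where \<eta>: "\<And>k. \<eta> k \<in> Lam" "\<eta> \<longlonglongrightarrow> \<zeta>" using closure_Lam_approx[OF \<zeta>] by blast
  have "(\<lambda>k. S (\<eta> k) (w, 0)) \<longlonglongrightarrow> Phi 0 \<zeta> w" by (rule Phi_limit[OF \<eta> w]) (use \<delta> in simp)
  hence "\<eta> \<longlonglongrightarrow> Phi 0 \<zeta> w" using S_b0[OF \<eta>(1) w] by simp
  thus ?thesis using LIMSEQ_unique \<eta>(2) by blast
qed

lemma J0_away: "\<zeta> \<in> J0 \<Longrightarrow> norm \<zeta> \<ge> \<epsilon>"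
  using Phi_J0(2)[of \<zeta> 0 0] Phi_b0[of \<zeta> 0] \<delta> by (simp add: J0_def)

section \<open>The forward Julia set in the strip\<close>

definition Kp :: "complex \<Rightarrow> (complex \<times> complex) set" where
  "Kp b = {z. bounded (range (X b (fst z) (snd z)))}"

text \<open>The frontier of \<open>Kp b\<close> once this set is known to be closed, see
  \<open>frontier_Kp\<close>. In this form membership means a bounded orbit and approximation by
  escaping points.\<close>

definition Jp :: "complex \<Rightarrow> (complex \<times> complex) set" where
  "Jp b = Kp b \<inter> closure (- Kp b)"

lemma Phi_orbit:
  assumes \<zeta>: "\<zeta> \<in> J0" and w: "norm w \<le> 6" and b: "norm b \<le> \<delta>"
  shows "norm (X b (Phi b \<zeta> w) w (Suc n)) \<le> 3"
proof -
  have "\<exists>\<zeta>'\<in>J0. norm (X b (Phi b \<zeta> w) w n) \<le> 6 \<and> X b (Phi b \<zeta> w) w (Suc n) = Phi b \<zeta>' (X b (Phi b \<zeta> w) w n)"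
  proof (induction n)
    case 0
    show ?case using \<zeta> w by auto
  next
    case (Suc n)
    then obtain \<zeta>' where z: "\<zeta>' \<in> J0" "norm (X b (Phi b \<zeta> w) w n) \<le> 6"
      "X b (Phi b \<zeta> w) w (Suc n) = Phi b \<zeta>' (X b (Phi b \<zeta> w) w n)" by blast
    note P = Phi_J0[OF z(1,2) b]
    have "X b (Phi b \<zeta> w) w (Suc (Suc n)) = Phi b (p0 \<zeta>') (X b (Phi b \<zeta> w) w (Suc n))"
      unfolding z(3) P(3) by (simp add: z(3))
    moreover have "norm (X b (Phi b \<zeta> w) w (Suc n)) \<le> 6" unfolding z(3) using P(1) by linarith
    ultimately show ?case using J0_p0[OF z(1)] by blast
  qed
  then obtain \<zeta>' where z: "\<zeta>' \<in> J0" "norm (X b (Phi b \<zeta> w) w n) \<le> 6"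
    "X b (Phi b \<zeta> w) w (Suc n) = Phi b \<zeta>' (X b (Phi b \<zeta> w) w n)" by blast
  show ?thesis unfolding z(3) by (rule Phi_J0(1)[OF z(1,2) b])
qed

lemma Kp_iff:
  assumes "norm b \<le> \<delta>" "norm w \<le> 6"
  shows "(x, w) \<in> Kp b \<longleftrightarrow> (\<forall>n. norm (X b x w (Suc n)) < 3)"
  using X_bounded_iff[of b w x] assms \<delta> by (simp add: Kp_def)

lemma Phi_in_Jp:
  assumes \<zeta>: "\<zeta> \<in> J0" and w: "norm w \<le> 6" and b: "norm b \<le> \<delta>"
  shows "(Phi b \<zeta> w, w) \<in> Jp b"
proof -
  have b0: "norm b < \<delta>0" using b \<delta> by linarith
  define Y where "Y = X b (Phi b \<zeta> w) w"
  have "norm (Y n) \<le> 6" for n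
  proof (cases n)
    case (Suc m)
    thus ?thesis using Phi_orbit[OF assms, of m] by (simp add: Y_def del: X_simps)
  qed (use w in \<open>simp add: Y_def\<close>)
  hence "bounded (range Y)" by (auto simp: bounded_iff)
  hence K: "(Phi b \<zeta> w, w) \<in> Kp b" by (simp add: Kp_def Y_def)
  obtain \<eta> where \<eta>: "\<And>k. \<eta> k \<in> Lam" "\<eta> \<longlonglongrightarrow> \<zeta>" using closure_Lam_approx[OF J0_closure[OF \<zeta>]] by blast
  have "(S (\<eta> k) (w, b), w) \<notin> Kp b" for k
  proof -
    obtain N where N: "\<eta> k \<in> lam N" using \<eta>(1)[of k] by (auto simp: Lam_def)
    have "norm (X b (S (\<eta> k) (w, b)) w (Suc N)) > 3" using S_annulus[OF N w b0] by (simp add: annulus_def)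
    thus ?thesis using Kp_iff[OF b w] by (meson less_asym)
  qed
  moreover have "(\<lambda>k. (S (\<eta> k) (w, b), w)) \<longlonglongrightarrow> (Phi b \<zeta> w, w)" by (intro tendsto_intros Phi_limit[OF \<eta> w b])
  ultimately have "(Phi b \<zeta> w, w) \<in> closure (- Kp b)"
    unfolding closure_sequential by (intro exI[of _ "\<lambda>k. (S (\<eta> k) (w, b), w)"]) auto
  thus ?thesis using K by (simp add: Jp_def)
qed

text \<open>Nearby points outside \<open>Kp b\<close> may jump over the annulus, so each is replaced
  by a point on the segment to \<open>(x, w)\<close> whose orbit has modulus 9/2 at some level; such
  a point has a label. The levels tend to infinity because the orbit of \<open>(x, w)\<close> stays
  below 3, so a limit of the labels lies in \<open>J0\<close>.\<close>

lemma Jp_strip: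
  assumes xw: "(x, w) \<in> Jp b" and w: "norm w < 6" and b: "norm b \<le> \<delta>"
  obtains \<zeta> where "\<zeta> \<in> J0" "x = Phi b \<zeta> w"
proof -
  have b0: "norm b < \<delta>0" using b \<delta> by linarith
  have w6: "norm w \<le> 6" using w by simp
  have K: "norm (X b x w (Suc n)) < 3" for n using xw Kp_iff[OF b w6] unfolding Jp_def by blast
  obtain z where z: "\<And>k. z k \<in> - Kp b" "z \<longlonglongrightarrow> (x, w)" using xw closure_sequential[of "(x, w)" "- Kp b"] by (auto simp: Jp_def)
  have "(\<lambda>k. norm (snd (z k))) \<longlonglongrightarrow> norm w" using tendsto_norm[OF tendsto_snd[OF z(2)]] by simp
  from order_tendstoD(2)[OF this w] obtain k0 where k0: "\<And>k. k \<ge> k0 \<Longrightarrow> norm (snd (z k)) < 6"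
    unfolding eventually_sequentially by blast
  have "\<exists>y N. norm (snd y) < 6 \<and> dist y (x, w) \<le> dist (z k) (x, w) \<and> norm (X b (fst y) (snd y) (Suc N)) = 9/2" if k: "k \<ge> k0" for k
  proof -
    have "\<exists>n. norm (X b (fst (z k)) (snd (z k)) (Suc n)) \<ge> 3"
      using z(1)[of k] Kp_iff[OF b, of "snd (z k)" "fst (z k)"] k0[OF k] by (auto simp: not_less less_imp_le)
    then obtain n where n: "norm (X b (fst (z k)) (snd (z k)) (Suc n)) \<ge> 3" by blast
    have "2 ^ 1 * 3 \<le> 2 ^ 1 * norm (X b (fst (z k)) (snd (z k)) (Suc n))" using n by simp
    also have "\<dots> \<le> norm (X b (fst (z k)) (snd (z k)) (Suc (n + 1)))"
      by (rule X_escape[OF b0 _ n]) (use k0[OF k] in simp)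
    finally have N: "norm (X b (fst (z k)) (snd (z k)) (Suc (n + 1))) \<ge> 6" by simp
    define g where "g t = (x, w) + t *\<^sub>R (z k - (x, w))" for t
    have "\<exists>t. 0 \<le> t \<and> t \<le> 1 \<and> norm (X b (fst (g t)) (snd (g t)) (Suc (n + 1))) = 9/2"
    proof (rule IVT')
      show "norm (X b (fst (g 0)) (snd (g 0)) (Suc (n + 1))) \<le> 9/2" using K[of "n + 1"] by (simp add: g_def del: X_simps)
      show "9/2 \<le> norm (X b (fst (g 1)) (snd (g 1)) (Suc (n + 1)))" using N by (simp add: g_def del: X_simps)
      show "continuous_on {0..1} (\<lambda>t. norm (X b (fst (g t)) (snd (g t)) (Suc (n + 1))))"
        unfolding g_def by (intro continuous_intros)
    qed simp
    then obtain t where t: "0 \<le> t" "t \<le> 1" "norm (X b (fst (g t)) (snd (g t)) (Suc (n + 1))) = 9/2" by blast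
    have "dist (g t) (x, w) = t * dist (z k) (x, w)" using t(1) by (simp add: g_def dist_norm)
    also have "\<dots> \<le> 1 * dist (z k) (x, w)" using t(2) by (intro mult_right_mono) auto
    finally have "dist (g t) (x, w) \<le> dist (z k) (x, w)" by simp
    moreover have "norm (snd (g t)) < 6"
    proof -
      have "snd (g t) = (1 - t) *\<^sub>R w + t *\<^sub>R snd (z k)" by (simp add: g_def algebra_simps)
      moreover have "(1 - t) *\<^sub>R w + t *\<^sub>R snd (z k) \<in> ball 0 6"
        using convexD_alt[OF convex_ball, of w 0 6 "snd (z k)" t] w k0[OF k] t by simp
      ultimately show ?thesis by simp
    qed
    ultimately show ?thesis using t(3) by blast
  qed
  then obtain y N where yN: "\<And>k. k \<ge> k0 \<Longrightarrow> norm (snd (y k)) < 6 \<and> dist (y k) (x, w) \<le> dist (z k) (x, w) \<and>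
    norm (X b (fst (y k)) (snd (y k)) (Suc (N k))) = 9/2" by metis
  have ylim: "y \<longlonglongrightarrow> (x, w)"
  proof (rule metric_tendsto_imp_tendsto[OF z(2)])
    show "\<forall>\<^sub>F k in sequentially. dist (y k) (x, w) \<le> dist (z k) (x, w)"
      using yN unfolding eventually_sequentially by blast
  qed
  have "\<exists>\<zeta>. \<zeta> \<in> lam (N k) \<and> S \<zeta> (snd (y k), b) = fst (y k)" if "k \<ge> k0" for k
  proof -
    have "X b (fst (y k)) (snd (y k)) (Suc (N k)) \<in> annulus" using yN[OF that] by (simp add: annulus_def del: X_simps)
    moreover have "norm (snd (y k)) \<le> 6" using yN[OF that] by simp
    ultimately show ?thesis using S_cover[OF _ b0] by blast
  qed
  then obtain \<zeta> where \<zeta>: "\<And>k. k \<ge> k0 \<Longrightarrow> \<zeta> k \<in> lam (N k) \<and> S (\<zeta> k) (snd (y k), b) = fst (y k)" by metis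
  define \<zeta>' where "\<zeta>' k = \<zeta> (k + k0)" for k
  define y' where "y' k = y (k + k0)" for k
  have \<zeta>'L: "\<zeta>' k \<in> Lam" for k using \<zeta>[of "k + k0"] by (auto simp: \<zeta>'_def Lam_def)
  have "\<zeta>' k \<in> cball 0 6" for k using Lam_bounded \<zeta>'L[of k] by auto
  then obtain \<xi> r where r: "strict_mono r" "(\<zeta>' \<circ> r) \<longlonglongrightarrow> \<xi>"
    using compact_cball[of "0::complex" 6] unfolding compact_def by metis
  have y'lim: "(\<lambda>k. y' (r k)) \<longlonglongrightarrow> (x, w)"
    using LIMSEQ_subseq_LIMSEQ[OF LIMSEQ_ignore_initial_segment[OF ylim, of k0] r(1)] by (simp add: y'_def o_def)
  have \<xi>L: "\<xi> \<in> closure Lam" using \<zeta>'L r(2) unfolding closure_sequential by (intro exI[of _ "\<zeta>' \<circ> r"]) auto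
  have "norm (X 0 \<xi> 0 (Suc n)) \<le> 3" for n
  proof -
    have "isCont (\<lambda>p. X b (fst p) (snd p) (Suc m)) (x, w)" for m
    proof -
      have "continuous_on UNIV (\<lambda>p. X b (fst p) (snd p) (Suc m))" by (intro continuous_intros)
      thus ?thesis by (simp add: continuous_on_eq_continuous_at del: X_simps)
    qed
    from isCont_tendsto_compose[OF this y'lim]
    have "(\<lambda>k. X b (fst (y' (r k))) (snd (y' (r k))) (Suc m)) \<longlonglongrightarrow> X b x w (Suc m)" for m by (simp del: X_simps)
    hence "\<forall>\<^sub>F k in sequentially. norm (X b (fst (y' (r k))) (snd (y' (r k))) (Suc m)) < 3" for m
      using order_tendstoD(2)[OF tendsto_norm K[of m]] by blast
    hence "\<forall>\<^sub>F k in sequentially. \<forall>m\<in>{..n}. norm (X b (fst (y' (r k))) (snd (y' (r k))) (Suc m)) < 3"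
      by (intro eventually_ball_finite) auto
    hence "\<forall>\<^sub>F k in sequentially. norm (X 0 ((\<zeta>' \<circ> r) k) 0 (Suc n)) \<le> 3"
    proof eventually_elim
      case (elim k)
      have "N (r k + k0) > n"
      proof (rule ccontr)
        assume "\<not> ?thesis"
        hence "norm (X b (fst (y' (r k))) (snd (y' (r k))) (Suc (N (r k + k0)))) < 3" using elim by auto
        thus False using yN[of "r k + k0"] by (simp add: y'_def)
      qed
      moreover have "\<zeta>' (r k) \<in> lam (N (r k + k0))" using \<zeta>[of "r k + k0"] by (simp add: \<zeta>'_def)
      ultimately have "norm (X 0 (S (\<zeta>' (r k)) (0, 0)) 0 (Suc n)) < 3"
        by (intro S_less_3) (use \<delta>0 in auto)
      thus ?case using S_base[OF \<zeta>'L] by (simp del: X_simps)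
    qed
    moreover have "(\<lambda>k. norm (X 0 ((\<zeta>' \<circ> r) k) 0 (Suc n))) \<longlonglongrightarrow> norm (X 0 \<xi> 0 (Suc n))"
    proof -
      have "continuous_on UNIV (\<lambda>x. X 0 x 0 (Suc n))" by (intro continuous_intros)
      hence "isCont (\<lambda>x. X 0 x 0 (Suc n)) \<xi>" by (simp add: continuous_on_eq_continuous_at del: X_simps)
      from tendsto_norm[OF isCont_tendsto_compose[OF this r(2)]] show ?thesis .
    qed
    ultimately show ?thesis by (intro tendsto_upperbound[of _ "norm (X 0 \<xi> 0 (Suc n))" sequentially 3]) auto
  qed
  hence \<xi>: "\<xi> \<in> J0" using \<xi>L by (simp add: J0_def)
  have "((\<lambda>k. Phi b (fst (\<zeta>' (r k), snd (y' (r k)))) (snd (\<zeta>' (r k), snd (y' (r k))))) \<longlongrightarrow> Phi b (fst (\<xi>, w)) (snd (\<xi>, w))) sequentially"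
  proof (rule continuous_on_tendsto_compose[OF Phi_continuous[OF b]])
    show "((\<lambda>k. (\<zeta>' (r k), snd (y' (r k)))) \<longlongrightarrow> (\<xi>, w)) sequentially"
      using r(2) tendsto_snd[OF y'lim] by (auto simp: o_def intro!: tendsto_Pair)
    show "(\<xi>, w) \<in> closure Lam \<times> cball 0 6" using \<xi>L w by simp
    show "\<forall>\<^sub>F k in sequentially. (\<zeta>' (r k), snd (y' (r k))) \<in> closure Lam \<times> cball 0 6"
      using \<zeta>'L closure_subset yN by (intro always_eventually) (auto simp: y'_def intro: less_imp_le)
  qed
  moreover have "Phi b (\<zeta>' (r k)) (snd (y' (r k))) = fst (y' (r k))" for k
    using Phi_Lam[OF \<zeta>'L _ b, of "snd (y' (r k))" "r k"] yN[of "r k + k0"] \<zeta>[of "r k + k0"] by (simp add: y'_def \<zeta>'_def)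
  ultimately have "(\<lambda>k. fst (y' (r k))) \<longlonglongrightarrow> Phi b \<xi> w" by simp
  moreover have "(\<lambda>k. fst (y' (r k))) \<longlonglongrightarrow> x" using tendsto_fst[OF y'lim] by simp
  ultimately have "x = Phi b \<xi> w" using LIMSEQ_unique by blast
  thus ?thesis using that \<xi> by blast
qed

end

section \<open>Conjugacies of skew products and absorbing sets\<close>

text \<open>\<open>H\<close> transports \<open>T\<close> to \<open>T'\<close> on the fundamental domain \<open>E - T ` E\<close> and its boundary; pulling it back along
  \<open>T\<close> converges because \<open>T'\<close> contracts fibres.\<close>

locale fibred_pair =
  fixes E C :: "('a::euclidean_space \<times> 'b::euclidean_space) set" and T T' H P
  assumes E: "compact E" and C: "C \<subseteq> E"
    and T: "continuous_on E T" "T ` E \<subseteq> C" "inj_on T E" "\<And>z. z \<in> E \<Longrightarrow> fst (T z) = P (fst z)"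
    and T': "continuous_on E T'" "T' ` E \<subseteq> C" "\<And>z. z \<in> E \<Longrightarrow> fst (T' z) = P (fst z)"
    and contr': "\<And>z z'. z \<in> E \<Longrightarrow> z' \<in> E \<Longrightarrow> fst z = fst z' \<Longrightarrow> dist (T' z) (T' z') \<le> dist z z' / 2"
    and H: "continuous_on E H" "H ` E \<subseteq> E" "\<And>z. z \<in> E \<Longrightarrow> fst (H z) = fst z"
    and HT: "\<And>z. z \<in> E \<Longrightarrow> H (T z) = T' z"
    and H_off: "\<And>z. z \<in> E - C \<Longrightarrow> H z = z"
    and inside: "\<And>z. z \<in> C \<Longrightarrow> T z \<notin> closure (E - T ` E)"
begin

lemma semiconjugacy:
  obtains h where "continuous_on E h" "h ` E \<subseteq> E" "\<And>z. z \<in> E \<Longrightarrow> fst (h z) = fst z"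
    "\<And>z. z \<in> E \<Longrightarrow> h (T z) = T' (h z)" "\<And>z. z \<in> E - T ` E \<Longrightarrow> h z = H z"
proof -
  obtain g where g: "homeomorphism E (T ` E) T g" using homeomorphism_compact[OF E T(1) refl T(3)] by blast
  have gT: "g (T z) = z" if "z \<in> E" for z using g that by (simp add: homeomorphism_def)
  have gE: "g z \<in> E" "T (g z) = z" if "z \<in> T ` E" for z using g that by (auto simp: homeomorphism_def)
  have cg: "continuous_on (T ` E) g" using g by (simp add: homeomorphism_def)
  have TE: "T ` E \<subseteq> E" using T(2) C by blast
  have T'E: "T' ` E \<subseteq> E" using T'(2) C by blast
  \<comment> \<open>On the image of \<open>T\<close> the previous approximation is conjugated, by
    \<open>T'\<close> on the left and the inverse of \<open>T\<close> on the right; elsewhere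
    \<open>H\<close> is kept.\<close>
  define h where "h = rec_nat H (\<lambda>_ f z. if z \<in> T ` E then T' (f (g z)) else H z)"
  have h0: "h 0 = H" and hS: "h (Suc n) z = (if z \<in> T ` E then T' (h n (g z)) else H z)" for n z
    by (simp_all add: h_def)
  have hE: "z \<in> E \<Longrightarrow> h n z \<in> E \<and> fst (h n z) = fst z" for n z
  proof (induction n arbitrary: z)
    case 0
    thus ?case using H by (auto simp: h0)
  next
    case (Suc n)
    show ?case
    proof (cases "z \<in> T ` E")
      case True
      note IH = Suc.IH[OF gE(1)[OF True]]
      have "fst (T' (h n (g z))) = P (fst (g z))" using T'(3) IH by simp
      also have "\<dots> = fst z" using T(4)[OF gE(1)[OF True]] gE(2)[OF True] by simp
      finally show ?thesis using IH T'E True by (auto simp: hS)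
    qed (use Suc H in \<open>auto simp: hS\<close>)
  qed
  have hoff: "h n z = z" if "z \<in> E - C" for n z
    using that T(2) H_off by (cases n) (auto simp: h0 hS)
  have ch: "continuous_on E (h n)" for n
  proof (induction n)
    case (Suc n)
    have "continuous_on (T ` E \<union> (E \<inter> closure (E - T ` E))) (\<lambda>z. if z \<in> T ` E then T' (h n (g z)) else H z)"
    proof (rule continuous_on_cases)
      show "closed (T ` E)" using compact_continuous_image[OF T(1) E] compact_imp_closed by blast
      show "closed (E \<inter> closure (E - T ` E))" using E compact_imp_closed by blast
      have "continuous_on (T ` E) (\<lambda>z. h n (g z))"
        by (rule continuous_on_compose2[OF Suc cg]) (use gE(1) in blast)
      thus "continuous_on (T ` E) (\<lambda>z. T' (h n (g z)))"
        by (rule continuous_on_compose2[OF T'(1)]) (use gE(1) hE in blast)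
      show "continuous_on (E \<inter> closure (E - T ` E)) H" by (rule continuous_on_subset[OF H(1)]) auto
      show "\<forall>z. z \<in> T ` E \<and> z \<notin> T ` E \<or> z \<in> E \<inter> closure (E - T ` E) \<and> z \<in> T ` E \<longrightarrow> T' (h n (g z)) = H z"
      proof (intro allI impI)
        fix z assume "z \<in> T ` E \<and> z \<notin> T ` E \<or> z \<in> E \<inter> closure (E - T ` E) \<and> z \<in> T ` E"
        \<comment> \<open>The overlap of the two pieces: by \<open>inside\<close> such a
          \<open>y\<close> lies outside \<open>C\<close>, where every \<open>h n\<close> is the
          identity, so both definitions give \<open>T' y\<close>.\<close>
        then obtain y where y: "y \<in> E" "z = T y" "z \<in> closure (E - T ` E)" by blast
        hence "y \<in> E - C" using inside by blast
        thus "T' (h n (g z)) = H z" using hoff HT y gT by simp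
      qed
    qed
    moreover have "T ` E \<union> (E \<inter> closure (E - T ` E)) = E" using TE closure_subset[of "E - T ` E"] by auto
    moreover have "h (Suc n) = (\<lambda>z. if z \<in> T ` E then T' (h n (g z)) else H z)" using hS by auto
    ultimately show ?case by simp
  qed (simp add: h0 H)
  obtain D where D: "\<And>z z'. z \<in> E \<Longrightarrow> z' \<in> E \<Longrightarrow> dist z z' \<le> D"
    using compact_imp_bounded[OF E] bounded_two_points by metis
  \<comment> \<open>Each step back along \<open>T\<close> halves the distance of two approximations,
    which stay in one fibre; off the image of \<open>T\<close> they coincide.\<close>
  have diff: "dist (h m z) (h n z) \<le> D * (1/2) ^ N" if "z \<in> E" "m \<ge> N" "n \<ge> N" for m n N z
    using that
  proof (induction N arbitrary: m n z)
    case 0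
    thus ?case using D hE by simp
  next
    case (Suc N)
    then obtain m' n' where mn: "m = Suc m'" "n = Suc n'" "m' \<ge> N" "n' \<ge> N" by (metis Suc_le_D Suc_le_mono)
    show ?case
    proof (cases "z \<in> T ` E")
      case True
      note gz = gE[OF True]
      have "dist (h m z) (h n z) = dist (T' (h m' (g z))) (T' (h n' (g z)))" using True by (simp add: mn hS)
      also have "\<dots> \<le> dist (h m' (g z)) (h n' (g z)) / 2" using hE[OF gz(1)] by (intro contr') auto
      also have "\<dots> \<le> D * (1/2) ^ N / 2" using Suc.IH[OF gz(1) mn(3,4)] by simp
      finally show ?thesis by simp
    next
      case False
      have "0 \<le> D" using D[OF Suc.prems(1) Suc.prems(1)] by simp
      thus ?thesis using False by (simp add: mn hS)
    qed
  qed
  have "uniformly_Cauchy_on E h"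
  proof (rule uniformly_Cauchy_onI)
    fix e :: real assume e: "e > 0"
    have "(\<lambda>N. D * (1/2) ^ N) \<longlonglongrightarrow> D * 0" by (intro tendsto_intros LIMSEQ_power_zero) auto
    from order_tendstoD(2)[OF this, of e] e obtain N where N: "D * (1/2) ^ N < e"
      unfolding eventually_sequentially by auto
    show "\<exists>M. \<forall>z\<in>E. \<forall>m\<ge>M. \<forall>n\<ge>M. dist (h m z) (h n z) < e"
      using diff N by (intro exI[of _ N]) (meson le_less_trans)
  qed
  then obtain k where k: "uniform_limit E h k sequentially"
    using Cauchy_uniformly_convergent uniformly_convergent_on_def by blast
  have klim: "(\<lambda>n. h n z) \<longlonglongrightarrow> k z" if "z \<in> E" for z by (rule tendsto_uniform_limitI[OF k that])
  have ck: "continuous_on E k" by (rule uniform_limit_theorem[OF always_eventually k]) (use ch in auto)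
  have kE: "k z \<in> E" if "z \<in> E" for z
    by (rule closed_sequentially[OF compact_imp_closed[OF E] _ klim[OF that]]) (use hE that in blast)
  show ?thesis
  proof (rule that[OF ck])
    show "k ` E \<subseteq> E" using kE by blast
    show "fst (k z) = fst z" if "z \<in> E" for z
    proof -
      have "(\<lambda>n. fst (h n z)) \<longlonglongrightarrow> fst (k z)" by (intro tendsto_intros klim that)
      thus ?thesis using hE[OF that] by (simp add: LIMSEQ_const_iff)
    qed
    show "k (T z) = T' (k z)" if z: "z \<in> E" for z
    proof -
      have "(\<lambda>n. T' (h n z)) \<longlonglongrightarrow> T' (k z)"
        by (rule continuous_on_tendsto_compose[OF T'(1) klim[OF z] kE[OF z]]) (use hE z in auto)
      moreover have "h (Suc n) (T z) = T' (h n z)" for n using z gT by (simp add: hS)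
      moreover have "(\<lambda>n. h (Suc n) (T z)) \<longlonglongrightarrow> k (T z)"
        using klim[of "T z"] TE z by (intro LIMSEQ_Suc) auto
      ultimately show ?thesis using LIMSEQ_unique[of "\<lambda>n. T' (h n z)"] by simp
    qed
    show "k z = H z" if "z \<in> E - T ` E" for z
    proof -
      have "h n z = H z" for n using that by (cases n) (auto simp: h0 hS)
      thus ?thesis using klim[of z] that by (simp add: LIMSEQ_const_iff)
    qed
  qed
qed

end

text \<open>Uniqueness of the extension from a fundamental domain.\<close>

lemma fibred_endo_identity:
  fixes E :: "('a::euclidean_space \<times> 'b::euclidean_space) set"
  assumes E: "compact E" and TE: "T ` E \<subseteq> E"
    and contr: "\<And>z z'. z \<in> E \<Longrightarrow> z' \<in> E \<Longrightarrow> fst z = fst z' \<Longrightarrow> dist (T z) (T z') \<le> dist z z' / 2"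
    and Q: "\<And>z. z \<in> E \<Longrightarrow> Q z \<in> E \<and> fst (Q z) = fst z" "\<And>z. z \<in> E \<Longrightarrow> Q (T z) = T (Q z)"
      "\<And>z. z \<in> E - T ` E \<Longrightarrow> Q z = z"
    and z: "z \<in> E"
  shows "Q z = z"
proof -
  obtain D where D: "\<And>z z'. z \<in> E \<Longrightarrow> z' \<in> E \<Longrightarrow> dist z z' \<le> D"
    using compact_imp_bounded[OF E] bounded_two_points by metis
  have D0: "0 \<le> D" using D[OF z z] by simp
  have "dist (Q z) z \<le> D * (1/2) ^ n" if "z \<in> E" for z n
    using that
  proof (induction n arbitrary: z)
    case (Suc n)
    show ?case
    proof (cases "z \<in> T ` E")
      case True
      then obtain y where y: "y \<in> E" "z = T y" by blast
      have "dist (Q z) z = dist (T (Q y)) (T y)" using Q(2) y by simp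
      also have "\<dots> \<le> dist (Q y) y / 2" using Q(1) y by (intro contr) auto
      also have "\<dots> \<le> D * (1/2) ^ n / 2" using Suc.IH[OF y(1)] by simp
      finally show ?thesis by simp
    qed (use Q(3) Suc D0 in simp)
  qed (use D Q in simp)
  hence "dist (Q z) z \<le> D * (1/2) ^ n" for n using z by blast
  moreover have "(\<lambda>N. D * (1/2) ^ N) \<longlonglongrightarrow> D * 0" by (intro tendsto_intros LIMSEQ_power_zero) auto
  ultimately have "dist (Q z) z \<le> D * 0" by (intro LIMSEQ_le_const[where X = "\<lambda>N. D * (1/2) ^ N"]) auto
  thus ?thesis by simp
qed

text \<open>The semiconjugacies in the two directions compose to maps that commute with
  \<open>T\<close> or \<open>T'\<close>. On the fundamental domain they are the identity, because
  \<open>H\<close> and \<open>H'\<close> are inverse and exchange the two fundamental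
  domains.\<close>

lemma fibred_conjugacy:
  assumes "fibred_pair E C T T' H P" "fibred_pair E C T' T H' P"
    and HH: "\<And>z. z \<in> E \<Longrightarrow> H' (H z) = z" "\<And>z. z \<in> E \<Longrightarrow> H (H' z) = z"
  obtains h k where "homeomorphism E E h k" "\<And>z. z \<in> E \<Longrightarrow> h (T z) = T' (h z)"
proof -
  interpret A: fibred_pair E C T T' H P by fact
  interpret B: fibred_pair E C T' T H' P by fact
  obtain h where h: "continuous_on E h" "h ` E \<subseteq> E" "\<And>z. z \<in> E \<Longrightarrow> fst (h z) = fst z"
    "\<And>z. z \<in> E \<Longrightarrow> h (T z) = T' (h z)" "\<And>z. z \<in> E - T ` E \<Longrightarrow> h z = H z"
    using A.semiconjugacy by blast
  obtain k where k: "continuous_on E k" "k ` E \<subseteq> E" "\<And>z. z \<in> E \<Longrightarrow> fst (k z) = fst z"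
    "\<And>z. z \<in> E \<Longrightarrow> k (T' z) = T (k z)" "\<And>z. z \<in> E - T' ` E \<Longrightarrow> k z = H' z"
    using B.semiconjugacy by blast
  have TE: "T ` E \<subseteq> E" "T' ` E \<subseteq> E" using A.T(2) A.T'(2) A.C by blast+
  have "k (h z) = z" if "z \<in> E" for z
  proof (rule fibred_endo_identity[OF A.E TE(1) B.contr' _ _ _ that, of "\<lambda>z. k (h z)"])
    show "k (h z) \<in> E \<and> fst (k (h z)) = fst z" if "z \<in> E" for z
      using that h(2,3) k(2,3) by (metis image_subset_iff)
    show "k (h (T z)) = T (k (h z))" if "z \<in> E" for z
    proof -
      have "h z \<in> E" using h(2) that by blast
      thus ?thesis by (simp add: h(4)[OF that] k(4))
    qed
    show "k (h z) = z" if z: "z \<in> E - T ` E" for z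
    proof -
      have "H z \<notin> T' ` E"
      proof
        assume "H z \<in> T' ` E"
        then obtain y where y: "y \<in> E" "H z = T' y" by blast
        have "T y \<in> E" using TE y(1) by blast
        from HH(1)[OF this] HH(1)[of z] have "z = T y" using A.HT[OF y(1)] y(2) z by simp
        thus False using z y by blast
      qed
      moreover have "H z \<in> E" using A.H(2) z by blast
      ultimately show ?thesis using h(5)[OF z] k(5)[of "H z"] HH(1)[of z] z by simp
    qed
  qed
  moreover have "h (k z) = z" if "z \<in> E" for z
  proof (rule fibred_endo_identity[OF A.E TE(2) A.contr' _ _ _ that, of "\<lambda>z. h (k z)"])
    show "h (k z) \<in> E \<and> fst (h (k z)) = fst z" if "z \<in> E" for z
      using that h(2,3) k(2,3) by (metis image_subset_iff)
    show "h (k (T' z)) = T' (h (k z))" if "z \<in> E" for z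
    proof -
      have "k z \<in> E" using k(2) that by blast
      thus ?thesis by (simp add: k(4)[OF that] h(4))
    qed
    show "h (k z) = z" if z: "z \<in> E - T' ` E" for z
    proof -
      have "H' z \<notin> T ` E"
      proof
        assume "H' z \<in> T ` E"
        then obtain y where y: "y \<in> E" "H' z = T y" by blast
        have "T' y \<in> E" using TE y(1) by blast
        from HH(2)[OF this] HH(2)[of z] have "z = T' y" using B.HT[OF y(1)] y(2) z by simp
        thus False using z y by blast
      qed
      moreover have "H' z \<in> E" using B.H(2) z by blast
      ultimately show ?thesis using k(5)[OF z] h(5)[of "H' z"] HH(2)[of z] z by simp
    qed
  qed
  ultimately have "homeomorphism E E h k"
    using h(1,2) k(1,2) unfolding homeomorphism_def by (metis equalityI image_eqI subsetI image_subset_iff)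
  thus ?thesis using that h(4) by blast
qed

section \<open>Extension from an absorbing set\<close>

lemma continuous_on_locally:
  fixes f :: "'a::metric_space \<Rightarrow> 'b::metric_space"
  assumes "\<And>z. z \<in> J \<Longrightarrow> \<exists>U. open U \<and> z \<in> U \<and> continuous_on (J \<inter> U) f"
  shows "continuous_on J f"
  unfolding continuous_on_eq_continuous_within
proof
  fix z assume z: "z \<in> J"
  then obtain U where U: "open U" "z \<in> U" "continuous_on (J \<inter> U) f" using assms by blast
  hence "continuous (at z within (J \<inter> U)) f" using z by (simp add: continuous_on_eq_continuous_within)
  moreover have "at z within (J \<inter> U) = at z within J" using U by (intro at_within_nhd[of _ U]) auto
  ultimately show "continuous (at z within J) f" by simp
qed

text \<open>\<open>absorb\<close> asks for an entrance time that works on a whole neighbourhood;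
  this is what makes the extended conjugacy continuous.\<close>

locale absorbing =
  fixes G G1 :: "'a::euclidean_space \<Rightarrow> 'a" and J S :: "'a set"
  assumes G: "continuous_on UNIV G" "continuous_on UNIV G1" "\<And>z. G1 (G z) = z" "\<And>z. G (G1 z) = z"
    and J: "\<And>z. G z \<in> J \<longleftrightarrow> z \<in> J" and S: "S \<subseteq> J" "G ` S \<subseteq> S"
    and absorb: "\<And>z. z \<in> J \<Longrightarrow> \<exists>n U. open U \<and> z \<in> U \<and> (\<forall>y\<in>U \<inter> J. (G ^^ n) y \<in> S)"
begin

lemma cont_funpow: "continuous_on UNIV (G ^^ n)" "continuous_on UNIV (G1 ^^ n)"
proof -
  show "continuous_on UNIV (G ^^ n)"
    by (induction n) (auto simp: o_def intro!: continuous_on_compose2[OF G(1)] continuous_on_id)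
  show "continuous_on UNIV (G1 ^^ n)"
    by (induction n) (auto simp: o_def intro!: continuous_on_compose2[OF G(2)] continuous_on_id)
qed

lemma funpow_inv: "(G1 ^^ n) ((G ^^ n) z) = z" "(G ^^ n) ((G1 ^^ n) z) = z"
proof -
  show "(G1 ^^ n) ((G ^^ n) z) = z"
    by (induction n arbitrary: z) (simp_all add: funpow_swap1[of G1] G)
  show "(G ^^ n) ((G1 ^^ n) z) = z"
    by (induction n arbitrary: z) (simp_all add: funpow_swap1[of G] G)
qed

lemma J_funpow: "(G ^^ n) z \<in> J \<longleftrightarrow> z \<in> J" "(G1 ^^ n) z \<in> J \<longleftrightarrow> z \<in> J"
proof -
  show 1: "(G ^^ n) z \<in> J \<longleftrightarrow> z \<in> J" for z by (induction n) (simp_all add: J)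
  show "(G1 ^^ n) z \<in> J \<longleftrightarrow> z \<in> J" using 1[of "(G1 ^^ n) z"] funpow_inv by simp
qed

lemma S_funpow: "z \<in> S \<Longrightarrow> (G ^^ n) z \<in> S" using S by (induction n) auto

lemma absorb_time: "z \<in> J \<Longrightarrow> \<exists>n. (G ^^ n) z \<in> S" using absorb by blast

end

text \<open>The extension is forced: go forward by \<open>G\<close> into \<open>S\<close>, apply
  \<open>g\<close>, return by \<open>G1'\<close>. The number of steps does not matter because
  \<open>g\<close> conjugates on \<open>S\<close>, so a common number can be used near each
  point.\<close>

lemma absorbing_extend:
  assumes "absorbing G G1 J S" "absorbing G' G1' J' S'"
    and g: "homeomorphism S S' g k" "\<And>z. z \<in> S \<Longrightarrow> g (G z) = G' (g z)"
  obtains h where "continuous_on J h" "h ` J \<subseteq> J'" "\<And>z. z \<in> J \<Longrightarrow> h (G z) = G' (h z)" "\<And>z. z \<in> S \<Longrightarrow> h z = g z"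
proof -
  interpret A: absorbing G G1 J S by fact
  interpret B: absorbing G' G1' J' S' by fact
  have gS: "g z \<in> S'" if "z \<in> S" for z using g(1) that by (auto simp: homeomorphism_def)
  have cg: "continuous_on S g" using g(1) by (simp add: homeomorphism_def)
  have gn: "g ((G ^^ n) z) = (G' ^^ n) (g z)" if "z \<in> S" for n z
    using that A.S_funpow by (induction n) (simp_all add: g(2))
  define \<tau> where "\<tau> z = (LEAST n. (G ^^ n) z \<in> S)" for z
  have \<tau>: "(G ^^ \<tau> z) z \<in> S" if "z \<in> J" for z unfolding \<tau>_def using A.absorb_time[OF that] by (rule LeastI_ex)
  define h where "h z = (G1' ^^ \<tau> z) (g ((G ^^ \<tau> z) z))" for z
  have heq: "h z = (G1' ^^ n) (g ((G ^^ n) z))" if "z \<in> J" "(G ^^ n) z \<in> S" for z n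
  proof -
    have "\<tau> z \<le> n" unfolding \<tau>_def by (rule Least_le[of "\<lambda>n. (G ^^ n) z \<in> S", OF that(2)])
    then obtain m where m: "n = m + \<tau> z" by (metis le_add_diff_inverse2)
    have "g ((G ^^ n) z) = (G' ^^ m) (g ((G ^^ \<tau> z) z))" using gn[OF \<tau>[OF that(1)]] by (simp add: m funpow_add)
    moreover have "(G1' ^^ n) y = (G1' ^^ \<tau> z) ((G1' ^^ m) y)" for y
      by (simp add: m add.commute[of m] funpow_add)
    ultimately show ?thesis by (simp add: h_def B.funpow_inv)
  qed
  show ?thesis
  proof (rule that[of h])
    show "continuous_on J h"
    proof (rule continuous_on_locally)
      fix z assume "z \<in> J"
      then obtain n U where U: "open U" "z \<in> U" "\<And>y. y \<in> U \<inter> J \<Longrightarrow> (G ^^ n) y \<in> S" using A.absorb by meson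
      have c1: "continuous_on (J \<inter> U) (G ^^ n)" by (rule continuous_on_subset[OF A.cont_funpow(1)]) auto
      have "continuous_on (J \<inter> U) (\<lambda>y. g ((G ^^ n) y))"
        by (rule continuous_on_compose2[OF cg c1]) (use U in auto)
      hence "continuous_on (J \<inter> U) (\<lambda>y. (G1' ^^ n) (g ((G ^^ n) y)))"
        by (rule continuous_on_compose2[OF B.cont_funpow(2)]) auto
      moreover have "(G1' ^^ n) (g ((G ^^ n) y)) = h y" if "y \<in> J \<inter> U" for y using heq[of y n] U(3)[of y] that by simp
      ultimately have "continuous_on (J \<inter> U) h" using continuous_on_cong by (metis (no_types, lifting))
      thus "\<exists>U. open U \<and> z \<in> U \<and> continuous_on (J \<inter> U) h" using U by blast
    qed
    show "h ` J \<subseteq> J'"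
    proof
      fix y assume "y \<in> h ` J"
      then obtain z where "z \<in> J" "y = h z" by blast
      thus "y \<in> J'" using gS[OF \<tau>] B.S B.J_funpow(2) by (auto simp: h_def)
    qed
    show "h (G z) = G' (h z)" if z: "z \<in> J" for z
    proof -
      define n where "n = \<tau> z"
      have n: "(G ^^ n) z \<in> S" using \<tau>[OF z] by (simp add: n_def)
      have n': "(G ^^ n) (G z) \<in> S" using A.S n by (auto simp flip: funpow_swap1)
      have "h (G z) = (G1' ^^ n) (g ((G ^^ n) (G z)))" by (rule heq) (use n' z A.J in auto)
      also have "(G ^^ n) (G z) = G ((G ^^ n) z)" by (simp add: funpow_swap1)
      also have "g (G ((G ^^ n) z)) = G' (g ((G ^^ n) z))" by (rule g(2)[OF n])
      also have "g ((G ^^ n) z) = (G' ^^ n) (h z)" using heq[OF z n] B.funpow_inv by simp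
      also have "G' ((G' ^^ n) (h z)) = (G' ^^ n) (G' (h z))" by (simp add: funpow_swap1)
      also have "(G1' ^^ n) ((G' ^^ n) (G' (h z))) = G' (h z)" by (rule B.funpow_inv)
      finally show ?thesis .
    qed
    show "h z = g z" if "z \<in> S" for z using heq[of z 0] that A.S by auto
  qed
qed

lemma absorbing_conjugacy:
  assumes A: "absorbing G G1 J S" and B: "absorbing G' G1' J' S'"
    and g: "homeomorphism S S' g k" "\<And>z. z \<in> S \<Longrightarrow> g (G z) = G' (g z)"
  obtains h h' where "homeomorphism J J' h h'" "\<And>z. z \<in> J \<Longrightarrow> h (G z) = G' (h z)"
    "homeomorphism {z\<in>J. \<forall>n. (G1 ^^ n) z \<in> S} {z\<in>J'. \<forall>n. (G1' ^^ n) z \<in> S'} h h'"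
proof -
  interpret A: absorbing G G1 J S by fact
  interpret B: absorbing G' G1' J' S' by fact
  have gS: "g z \<in> S'" "k (g z) = z" if "z \<in> S" for z using g(1) that by (auto simp: homeomorphism_def)
  have kS: "k z \<in> S" "g (k z) = z" if "z \<in> S'" for z using g(1) that by (auto simp: homeomorphism_def)
  have k: "homeomorphism S' S k g" using g(1) by (simp add: homeomorphism_symD)
  have kG: "k (G' z) = G (k z)" if "z \<in> S'" for z
  proof -
    have "g (G (k z)) = G' z" using g(2)[OF kS(1)[OF that]] kS(2)[OF that] by simp
    thus ?thesis using gS(2)[of "G (k z)"] kS(1)[OF that] A.S by (metis image_subset_iff)
  qed
  obtain h where h: "continuous_on J h" "h ` J \<subseteq> J'" "\<And>z. z \<in> J \<Longrightarrow> h (G z) = G' (h z)" "\<And>z. z \<in> S \<Longrightarrow> h z = g z"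
    using absorbing_extend[OF A B g] by blast
  obtain h' where h': "continuous_on J' h'" "h' ` J' \<subseteq> J" "\<And>z. z \<in> J' \<Longrightarrow> h' (G' z) = G (h' z)" "\<And>z. z \<in> S' \<Longrightarrow> h' z = k z"
    using absorbing_extend[OF B A k kG] by blast
  have hJ: "h z \<in> J'" if "z \<in> J" for z using h(2) that by blast
  have hJ': "h' z \<in> J" if "z \<in> J'" for z using h'(2) that by blast
  have hn: "h ((G ^^ n) z) = (G' ^^ n) (h z)" if "z \<in> J" for n z
    using that A.J_funpow by (induction n) (simp_all add: h(3))
  have hn': "h' ((G' ^^ n) z) = (G ^^ n) (h' z)" if "z \<in> J'" for n z
    using that B.J_funpow by (induction n) (simp_all add: h'(3))
  have hh: "h' (h z) = z" if z: "z \<in> J" for z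
  proof -
    obtain n where n: "(G ^^ n) z \<in> S" using A.absorb_time[OF z] by blast
    have "(G ^^ n) (h' (h z)) = h' ((G' ^^ n) (h z))" using hn'[OF hJ[OF z]] by simp
    also have "\<dots> = h' (h ((G ^^ n) z))" using hn[OF z] by simp
    also have "\<dots> = (G ^^ n) z" using h(4)[OF n] h'(4)[OF gS(1)[OF n]] gS(2)[OF n] by simp
    finally show ?thesis using A.funpow_inv(1) by metis
  qed
  have hh': "h (h' z) = z" if z: "z \<in> J'" for z
  proof -
    obtain n where n: "(G' ^^ n) z \<in> S'" using B.absorb_time[OF z] by blast
    have "(G' ^^ n) (h (h' z)) = h ((G ^^ n) (h' z))" using hn[OF hJ'[OF z]] by simp
    also have "\<dots> = h (h' ((G' ^^ n) z))" using hn'[OF z] by simp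
    also have "\<dots> = (G' ^^ n) z" using h'(4)[OF n] h(4)[OF kS(1)[OF n]] kS(2)[OF n] by simp
    finally show ?thesis using B.funpow_inv(1) by metis
  qed
  have hom: "homeomorphism J J' h h'"
    using h(1,2) h'(1,2) hh hh' unfolding homeomorphism_def by (metis equalityI image_eqI subsetI image_subset_iff)
  have hG1: "h ((G1 ^^ n) z) = (G1' ^^ n) (h z)" if "z \<in> J" for n z
  proof -
    have "h z = (G' ^^ n) (h ((G1 ^^ n) z))"
      using hn[of "(G1 ^^ n) z" n] that A.J_funpow A.funpow_inv by simp
    thus ?thesis using B.funpow_inv(1) by simp
  qed
  have hG1': "h' ((G1' ^^ n) z) = (G1 ^^ n) (h' z)" if "z \<in> J'" for n z
  proof -
    have "h' z = (G ^^ n) (h' ((G1' ^^ n) z))"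
      using hn'[of "(G1' ^^ n) z" n] that B.J_funpow B.funpow_inv by simp
    thus ?thesis using A.funpow_inv(1) by simp
  qed
  define K where "K = {z\<in>J. \<forall>n. (G1 ^^ n) z \<in> S}"
  define K' where "K' = {z\<in>J'. \<forall>n. (G1' ^^ n) z \<in> S'}"
  have K: "h z \<in> K'" if "z \<in> K" for z
  proof -
    have z: "z \<in> J" "(G1 ^^ n) z \<in> S" for n using that by (auto simp: K_def)
    have "(G1' ^^ n) (h z) \<in> S'" for n
      using gS(1)[OF z(2)] by (simp flip: hG1[OF z(1)] add: h(4)[OF z(2)])
    thus ?thesis using hJ[OF z(1)] by (simp add: K'_def)
  qed
  have K': "h' z \<in> K" if "z \<in> K'" for z
  proof -
    have z: "z \<in> J'" "(G1' ^^ n) z \<in> S'" for n using that by (auto simp: K'_def)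
    have "(G1 ^^ n) (h' z) \<in> S" for n
      using kS(1)[OF z(2)] by (simp flip: hG1'[OF z(1)] add: h'(4)[OF z(2)])
    thus ?thesis using hJ'[OF z(1)] by (simp add: K_def)
  qed
  have sub: "K \<subseteq> J" "K' \<subseteq> J'" by (auto simp: K_def K'_def)
  have "homeomorphism K K' h h'"
  proof (rule homeomorphismI)
    show "continuous_on K h" "continuous_on K' h'"
      using h(1) h'(1) sub continuous_on_subset by blast+
    show "h ` K \<subseteq> K'" "h' ` K' \<subseteq> K" using K K' by blast+
    show "h' (h z) = z" if "z \<in> K" for z using hh sub that by blast
    show "h (h' z) = z" if "z \<in> K'" for z using hh' sub that by blast
  qed
  thus ?thesis using that hom h(3) unfolding K_def K'_def by blast
qed

section \<open>Conjugacy on the forward Julia set\<close>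

context henon_family begin

definition G :: "complex \<Rightarrow> complex \<times> complex \<Rightarrow> complex \<times> complex" where
  "G b z = ((fst z)\<^sup>2 + par_c l b + b * snd z, fst z)"

definition G1 :: "complex \<Rightarrow> complex \<times> complex \<Rightarrow> complex \<times> complex" where
  "G1 b z = (snd z, (fst z - (snd z)\<^sup>2 - par_c l b) / b)"

lemma G_G1:
  assumes "b \<noteq> 0"
  shows "G1 b (G b z) = z" "G b (G1 b z) = z"
  using assms by (auto simp: G_def G1_def prod_eq_iff field_simps)

lemma continuous_on_G [continuous_intros]: "continuous_on A (G b)" "continuous_on A (G1 b)"
  unfolding G_def G1_def divide_inverse by (intro continuous_intros)+

lemma G_orbit: "(G b ^^ n) (x, w) = (X b x w (Suc n), X b x w n)"
  by (induction n) (auto simp: G_def)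

lemma G_Kp: "G b z \<in> Kp b \<longleftrightarrow> z \<in> Kp b"
proof -
  have "X b (fst (G b z)) (snd (G b z)) = (\<lambda>m. X b (fst z) (snd z) (1 + m))"
    using X_shift[of b "fst z" "snd z" 1] by (auto simp: G_def fun_eq_iff)
  thus ?thesis using bounded_range_shift[of "X b (fst z) (snd z)" 1] by (simp add: Kp_def)
qed

lemma G_Jp:
  assumes "b \<noteq> 0"
  shows "G b z \<in> Jp b \<longleftrightarrow> z \<in> Jp b"
proof -
  have *: "f y \<in> closure (- Kp b)" if "y \<in> closure (- Kp b)" "continuous_on UNIV f" "\<And>u. f u \<in> Kp b \<Longrightarrow> u \<in> Kp b" for f y
  proof -
    have "f ` closure (- Kp b) \<subseteq> closure (- Kp b)"
    proof (rule image_closure_subset)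
      show "continuous_on (closure (- Kp b)) f" using that(2) continuous_on_subset by blast
      show "f ` (- Kp b) \<subseteq> closure (- Kp b)" using that(3) closure_subset by fastforce
    qed simp
    thus ?thesis using that(1) by blast
  qed
  have "G1 b u \<in> Kp b \<Longrightarrow> u \<in> Kp b" for u using G_Kp[of b "G1 b u"] G_G1[OF assms] by simp
  hence "G b z \<in> closure (- Kp b) \<longleftrightarrow> z \<in> closure (- Kp b)"
    using *[of z "G b"] *[of "G b z" "G1 b"] G_Kp G_G1[OF assms] continuous_on_G by auto
  thus ?thesis using G_Kp by (simp add: Jp_def)
qed

text \<open>In the coordinates \<open>(\<zeta>, w) \<mapsto> (Phi b \<zeta> w, w)\<close> the Henon map becomes the skew product \<open>T b\<close>, and \<open>W b\<close>
  recovers the second coordinate of the preimage.\<close>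

definition T :: "complex \<Rightarrow> complex \<times> complex \<Rightarrow> complex \<times> complex" where
  "T b z = (p0 (fst z), Phi b (fst z) (snd z))"

definition W :: "complex \<Rightarrow> complex \<times> complex \<Rightarrow> complex" where
  "W b z = (Phi b (fst z) (snd z) - (snd z)\<^sup>2 - par_c l b) / b"

definition Theta :: "complex \<Rightarrow> complex \<times> complex \<Rightarrow> complex \<times> complex" where
  "Theta b z = (Phi b (fst z) (snd z), snd z)"

abbreviation "tube r \<equiv> J0 \<times> cball (0::complex) r"

text \<open>The radius 5 is above the bound 3 for the graphs, so the set is forward invariant, and
  below 6, so that \<open>Jp_strip\<close> labels all its points.\<close>

definition Sb :: "complex \<Rightarrow> (complex \<times> complex) set" where
  "Sb b = {z \<in> Jp b. norm (snd z) \<le> 5}"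

lemma continuous_on_Phi_J0:
  assumes b: "norm b \<le> \<delta>" and f: "continuous_on A f" and g: "continuous_on A g"
    and A: "\<And>z. z \<in> A \<Longrightarrow> f z \<in> J0" "\<And>z. z \<in> A \<Longrightarrow> norm (g z) \<le> 6"
  shows "continuous_on A (\<lambda>z. Phi b (f z) (g z))"
proof -
  have "continuous_on A (\<lambda>z. (\<lambda>p. Phi b (fst p) (snd p)) (f z, g z))"
    by (rule continuous_on_compose2[OF Phi_continuous[OF b] continuous_on_Pair[OF f g]]) (use A J0_closure in auto)
  thus ?thesis by simp
qed

lemma compact_tube: "compact (tube r)" by (intro compact_Times J0_compact compact_cball)

section \<open>The skew product for one nonzero parameter\<close>

context
  fixes b :: complex
  assumes b: "b \<noteq> 0" "norm b < \<delta>"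
begin

lemma b_le: "norm b \<le> \<delta>" using b by simp

lemma G_Theta:
  assumes "fst z \<in> J0" "norm (snd z) \<le> 6"
  shows "G b (Theta b z) = Theta b (T b z)"
  using Phi_J0(3)[OF assms b_le] by (simp add: G_def Theta_def T_def)

lemma W_T:
  assumes "fst z \<in> J0" "norm (snd z) \<le> 6"
  shows "W b (T b z) = snd z"
  using Phi_J0(3)[OF assms b_le] b by (simp add: W_def T_def)

lemma T_mem:
  assumes "fst z \<in> J0" "norm (snd z) \<le> 6"
  shows "fst (T b z) \<in> J0" "norm (snd (T b z)) \<le> 3"
  using Phi_J0(1)[OF assms b_le] J0_p0[OF assms(1)] by (simp_all add: T_def)

lemma T_inj: "inj_on (T b) (tube 6)"
proof (rule inj_onI)
  fix z z' assume z: "z \<in> tube 6" "z' \<in> tube 6" and eq: "T b z = T b z'"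
  have s: "snd z = snd z'" using W_T[of z] W_T[of z'] z eq by auto
  moreover have "fst z = fst z'"
    by (rule Phi_inj[of _ _ "snd z" b]) (use z eq s b_le J0_closure in \<open>auto simp: T_def\<close>)
  ultimately show "z = z'" by (simp add: prod_eq_iff)
qed

text \<open>The preimage comes from the Henon map: the inverse image of a point of
  \<open>Jp b\<close> is again in \<open>Jp b\<close>, and since its second coordinate
  \<open>W b z\<close> is below 6, \<open>Jp_strip\<close> supplies its label.\<close>

lemma T_onto:
  assumes z: "fst z \<in> J0" "norm (snd z) \<le> 6" "norm (W b z) < 6"
  obtains \<zeta> where "\<zeta> \<in> J0" "T b (\<zeta>, W b z) = z"
proof -
  have J: "(Phi b (fst z) (snd z), snd z) \<in> Jp b" by (rule Phi_in_Jp[OF z(1,2) b_le])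
  have G: "G b (snd z, W b z) = (Phi b (fst z) (snd z), snd z)" using b by (simp add: G_def W_def)
  have "(snd z, W b z) \<in> Jp b" using J G_Jp[OF b(1)] unfolding G[symmetric] by blast
  then obtain \<zeta> where \<zeta>: "\<zeta> \<in> J0" "snd z = Phi b \<zeta> (W b z)" using Jp_strip z(3) b_le by metis
  have W6: "norm (W b z) \<le> 6" using z(3) by simp
  have "Phi b (p0 \<zeta>) (snd z) = Phi b (fst z) (snd z)"
    using Phi_J0(3)[OF \<zeta>(1) W6 b_le] G by (simp add: \<zeta>(2)[symmetric] G_def)
  hence "p0 \<zeta> = fst z" by (rule Phi_inj[rotated 4]) (use \<zeta> J0_p0 J0_closure z b_le in auto)
  thus ?thesis using that[OF \<zeta>(1)] \<zeta>(2) by (simp add: T_def prod_eq_iff)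
qed

text \<open>13 = 1 + 12, from the graph and from the square. The constant blows up as
  \<open>b\<close> tends to 0, which is why parameters are compared only locally in the punctured
  disc.\<close>

lemma W_lipschitz:
  assumes "\<zeta> \<in> J0" "norm u \<le> 6" "norm u' \<le> 6"
  shows "norm (W b (\<zeta>, u) - W b (\<zeta>, u')) \<le> 13 / norm b * norm (u - u')"
proof -
  have "norm (Phi b \<zeta> u - Phi b \<zeta> u') \<le> \<epsilon> / 2 * norm (u - u')"
    by (rule Phi_lipschitz) (use assms b_le J0_closure in auto)
  also have "\<dots> \<le> 1 * norm (u - u')" by (rule mult_right_mono) (use eps in auto)
  finally have 1: "norm (Phi b \<zeta> u - Phi b \<zeta> u') \<le> norm (u - u')" by simp
  have "u'\<^sup>2 - u\<^sup>2 = (u' - u) * (u' + u)" by (simp add: power2_eq_square algebra_simps)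
  hence "norm (u'\<^sup>2 - u\<^sup>2) = norm (u - u') * norm (u' + u)" by (simp add: norm_mult norm_minus_commute)
  also have "\<dots> \<le> norm (u - u') * 12"
    using norm_triangle_ineq[of u' u] assms by (intro mult_left_mono) auto
  finally have 2: "norm (u'\<^sup>2 - u\<^sup>2) \<le> 12 * norm (u - u')" by simp
  have "W b (\<zeta>, u) - W b (\<zeta>, u') = ((Phi b \<zeta> u - Phi b \<zeta> u') + (u'\<^sup>2 - u\<^sup>2)) / b"
    using b by (simp add: W_def diff_divide_distrib add_divide_distrib)
  hence "norm (W b (\<zeta>, u) - W b (\<zeta>, u')) = norm ((Phi b \<zeta> u - Phi b \<zeta> u') + (u'\<^sup>2 - u\<^sup>2)) / norm b"
    by (simp add: norm_divide)
  also have "\<dots> \<le> 13 * norm (u - u') / norm b"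
    using norm_triangle_ineq[of "Phi b \<zeta> u - Phi b \<zeta> u'" "u'\<^sup>2 - u\<^sup>2"] 1 2 by (intro divide_right_mono) auto
  finally show ?thesis by simp
qed

lemma continuous_on_W: "continuous_on (tube 6) (W b)"
  unfolding W_def divide_inverse
  by (intro continuous_intros continuous_on_Phi_J0 b_le) auto

lemma continuous_on_T: "continuous_on (tube 6) (T b)"
  unfolding T_def p0_def by (intro continuous_intros continuous_on_Phi_J0 b_le) auto

lemma T_contraction:
  assumes "z \<in> tube 6" "z' \<in> tube 6" "fst z = fst z'"
  shows "dist (T b z) (T b z') \<le> dist z z' / 2"
proof -
  have "norm (Phi b (fst z') (snd z) - Phi b (fst z') (snd z')) \<le> \<epsilon> / 2 * norm (snd z - snd z')"
    by (rule Phi_lipschitz) (use assms b_le J0_closure in auto)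
  also have "\<dots> \<le> 1 / 2 * norm (snd z - snd z')" by (rule mult_right_mono) (use eps in auto)
  finally show ?thesis using assms(3) by (simp add: dist_prod_def T_def dist_norm)
qed

lemma T_range: "T b ` tube 6 \<subseteq> tube 3"
proof
  fix y assume "y \<in> T b ` tube 6"
  then obtain z where "z \<in> tube 6" "y = T b z" by blast
  thus "y \<in> tube 3" using T_mem[of z] by (simp add: mem_Times_iff)
qed

text \<open>Points of \<open>tube 5\<close> outside the image of \<open>tube 5\<close> satisfy |W|
  \<ge> 5, a closed condition, whereas \<open>W b (T b z)\<close> is the second coordinate of
  \<open>z\<close> and has modulus at most 3.\<close>

lemma T_inside:
  assumes "z \<in> tube 3"
  shows "T b z \<notin> closure (tube 5 - T b ` tube 5)"
proof
  assume *: "T b z \<in> closure (tube 5 - T b ` tube 5)"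
  have c: "closed (tube 6 \<inter> (\<lambda>z. norm (W b z)) -` {5..})"
    by (intro continuous_closed_preimage continuous_intros continuous_on_W compact_imp_closed compact_tube)
  have "tube 5 - T b ` tube 5 \<subseteq> tube 6 \<inter> (\<lambda>z. norm (W b z)) -` {5..}"
  proof
    fix y assume y: "y \<in> tube 5 - T b ` tube 5"
    have "norm (W b y) \<ge> 5"
    proof (rule ccontr)
      assume n: "\<not> ?thesis"
      have P: "fst y \<in> J0" "norm (snd y) \<le> 6" "norm (W b y) < 6" using y n by auto
      obtain \<zeta> where \<zeta>: "\<zeta> \<in> J0" "T b (\<zeta>, W b y) = y" by (rule T_onto[OF P])
      have "(\<zeta>, W b y) \<in> tube 5" using \<zeta>(1) n by simp
      from imageI[OF this, of "T b"] show False using y unfolding \<zeta>(2) by blast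
    qed
    thus "y \<in> tube 6 \<inter> (\<lambda>z. norm (W b z)) -` {5..}" using y by auto
  qed
  from closure_minimal[OF this c] * have "norm (W b (T b z)) \<ge> 5" by blast
  thus False using W_T[of z] assms by auto
qed

lemma Theta_homeomorphism: "\<exists>k. homeomorphism (tube 5) (Sb b) (Theta b) k"
proof (rule homeomorphism_compact[OF compact_tube])
  show "continuous_on (tube 5) (Theta b)"
    unfolding Theta_def by (intro continuous_intros continuous_on_Phi_J0 b_le) auto
  show "Theta b ` tube 5 = Sb b"
  proof
    show "Theta b ` tube 5 \<subseteq> Sb b" using Phi_in_Jp b_le by (auto simp: Theta_def Sb_def)
    show "Sb b \<subseteq> Theta b ` tube 5"
    proof
      fix z assume z: "z \<in> Sb b"
      then obtain \<zeta> where "\<zeta> \<in> J0" "fst z = Phi b \<zeta> (snd z)"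
        using Jp_strip[of "fst z" "snd z" b] b_le by (auto simp: Sb_def)
      thus "z \<in> Theta b ` tube 5" using z
        by (intro image_eqI[of _ _ "(\<zeta>, snd z)"]) (auto simp: Theta_def Sb_def prod_eq_iff)
    qed
  qed
  show "inj_on (Theta b) (tube 5)"
  proof (rule inj_onI)
    fix z z' assume z: "z \<in> tube 5" "z' \<in> tube 5" "Theta b z = Theta b z'"
    have s: "snd z' = snd z" "Phi b (fst z) (snd z) = Phi b (fst z') (snd z)" using z(3) by (auto simp: Theta_def)
    have J: "fst z \<in> J0" "fst z' \<in> J0" "norm (snd z) \<le> 6" using z(1,2) by (auto simp: mem_Times_iff)
    have "fst z = fst z'" by (rule Phi_inj[OF J0_closure[OF J(1)] J0_closure[OF J(2)] J(3) b_le s(2)])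
    thus "z = z'" using s by (simp add: prod_eq_iff)
  qed
qed

text \<open>For absorption: while all coordinates have modulus at least 5, either one of them is at
  most twice the next, and the orbit escapes, or each is less than half its predecessor, which
  cannot last. Modulus below 5 is an open condition and yields the neighbourhood.\<close>

lemma Sb_absorbing: "absorbing (G b) (G1 b) (Jp b) (Sb b)"
proof
  show "G1 b (G b z) = z" "G b (G1 b z) = z" for z using G_G1[OF b(1)] by auto
  show "G b z \<in> Jp b \<longleftrightarrow> z \<in> Jp b" for z by (rule G_Jp[OF b(1)])
  show "Sb b \<subseteq> Jp b" by (auto simp: Sb_def)
  show "G b ` Sb b \<subseteq> Sb b"
  proof
    fix y assume "y \<in> G b ` Sb b"
    then obtain z where z: "y = G b z" "z \<in> Sb b" by blast
    obtain k where "homeomorphism (tube 5) (Sb b) (Theta b) k" using Theta_homeomorphism by blast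
    hence "Theta b ` tube 5 = Sb b" by (simp add: homeomorphism_def)
    then obtain u where u: "u \<in> tube 5" "z = Theta b u" using z(2) by blast
    have "norm (fst z) \<le> 3" using u Phi_J0(1)[of "fst u" "snd u" b] b_le by (auto simp: Theta_def)
    thus "y \<in> Sb b" using z G_Jp[OF b(1)] by (auto simp: Sb_def G_def)
  qed
  show "\<exists>n U. open U \<and> z \<in> U \<and> (\<forall>y\<in>U \<inter> Jp b. (G b ^^ n) y \<in> Sb b)" if z: "z \<in> Jp b" for z
  proof -
    define Y where "Y = X b (fst z) (snd z)"
    obtain K where K: "\<And>n. norm (Y n) \<le> K" using z by (auto simp: Jp_def Kp_def Y_def bounded_iff)
    have "\<exists>n. norm (Y (Suc n)) < 5"
    proof (rule ccontr)
      assume n: "\<not> ?thesis"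
      hence n5: "norm (Y (Suc n)) \<ge> 5" for n by (auto simp: not_less)
      have esc: "norm (Y n) > 2 * norm (Y (Suc n))" for n
      proof (rule ccontr)
        assume a: "\<not> ?thesis"
        have bc: "norm b \<le> 1/10" "norm (par_c l b) \<le> 2" using b_bounds[of b] b \<delta> by auto
        have "Y (n + m) = X b (Y (Suc n)) (Y n) m" for m unfolding Y_def by (rule X_shift)
        hence "norm (Y (n + Suc m)) \<ge> 2 ^ m * norm (Y (Suc n))" for m
          using horb_escape[OF bc, of "Y (Suc n)" "Y n" m] a n5[of n] unfolding \<open>\<And>m. Y (n + m) = _ m\<close> X_def by simp
        hence 1: "norm (Y (n + Suc m)) \<ge> 2 ^ m * norm (Y (Suc n))" for m by blast
        obtain m :: nat where "K < 2 ^ m" using real_arch_pow[of 2 K] by auto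
        also have "2 ^ m * 1 \<le> 2 ^ m * norm (Y (Suc n))"
          by (rule mult_left_mono) (use n5[of n] in auto)
        finally have "K < norm (Y (n + Suc m))" using 1[of m] by simp
        thus False using K[of "n + Suc m"] by linarith
      qed
      have "norm (Y (Suc n)) * 2 ^ n \<le> norm (Y 1)" for n
      proof (induction n)
        case (Suc n)
        have "norm (Y (Suc (Suc n))) * 2 ^ Suc n = 2 * norm (Y (Suc (Suc n))) * 2 ^ n" by simp
        also have "\<dots> \<le> norm (Y (Suc n)) * 2 ^ n" using esc[of "Suc n"] by (intro mult_right_mono) auto
        finally show ?case using Suc by linarith
      qed simp
      hence 1: "norm (Y (Suc n)) * 2 ^ n \<le> norm (Y 1)" for n by blast
      obtain n :: nat where n: "norm (Y 1) < 2 ^ n" using real_arch_pow[of 2 "norm (Y 1)"] by auto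
      have "1 * 2 ^ n \<le> norm (Y (Suc n)) * 2 ^ n" by (rule mult_right_mono) (use n5[of n] in auto)
      thus False using 1[of n] n by linarith
    qed
    then obtain n where n: "norm (Y (Suc n)) < 5" by blast
    define U where "U = {y. norm (X b (fst y) (snd y) (Suc n)) < 5}"
    have "open U" unfolding U_def
      by (intro open_Collect_less continuous_intros)
    moreover have "z \<in> U" using n by (simp add: U_def Y_def)
    moreover have "(G b ^^ Suc n) y \<in> Sb b" if y: "y \<in> U \<inter> Jp b" for y
    proof -
      have "(G b ^^ Suc n) y \<in> Jp b"
      proof -
        have "(G b ^^ m) y \<in> Jp b" for m using y G_Jp[OF b(1)] by (induction m) auto
        thus ?thesis .
      qed
      moreover have "snd ((G b ^^ Suc n) y) = X b (fst y) (snd y) (Suc n)"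
        using G_orbit[where n = "Suc n" and x = "fst y" and w = "snd y"] by simp
      ultimately show ?thesis using y by (simp add: Sb_def U_def)
    qed
    ultimately show ?thesis by blast
  qed
qed (rule continuous_on_G)+

end

end

text \<open>Identity plus a fibrewise 1/2-Lipschitz displacement: injective by the triangle
  inequality, surjective by Banach's fixed point theorem. Support in |u| \<le> 3 and size at most 1
  keep the disc of radius 5 invariant.\<close>

lemma fibre_perturbation_homeomorphism:
  fixes K :: "'a::metric_space set" and k :: "'a \<times> 'b::euclidean_space \<Rightarrow> 'b"
  assumes K: "compact K" and k: "continuous_on (K \<times> cball 0 5) k" "\<And>z. z \<in> K \<times> cball 0 5 \<Longrightarrow> norm (k z) \<le> 1"
    and lip: "\<And>\<zeta> u u'. \<zeta> \<in> K \<Longrightarrow> norm u \<le> 5 \<Longrightarrow> norm u' \<le> 5 \<Longrightarrow> norm (k (\<zeta>, u) - k (\<zeta>, u')) \<le> norm (u - u') / 2"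
    and off: "\<And>z. z \<in> K \<times> cball 0 5 \<Longrightarrow> norm (snd z) > 3 \<Longrightarrow> k z = 0"
  shows "\<exists>g. homeomorphism (K \<times> cball 0 5) (K \<times> cball 0 5) (\<lambda>z. (fst z, snd z + k z)) g"
proof (rule homeomorphism_compact)
  show "compact (K \<times> cball (0::'b) 5)" by (intro compact_Times K compact_cball)
  show "continuous_on (K \<times> cball 0 5) (\<lambda>z. (fst z, snd z + k z))" by (intro continuous_intros k)
  show "(\<lambda>z. (fst z, snd z + k z)) ` (K \<times> cball 0 5) = K \<times> cball 0 5"
  proof
    have "norm (snd z + k z) \<le> 5" if z: "z \<in> K \<times> cball 0 5" for z
    proof (cases "norm (snd z) > 3")
      case True
      thus ?thesis using off z by auto
    next
      case False
      thus ?thesis using norm_triangle_ineq[of "snd z" "k z"] k(2)[OF z] by linarith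
    qed
    thus "(\<lambda>z. (fst z, snd z + k z)) ` (K \<times> cball 0 5) \<subseteq> K \<times> cball 0 5" by fastforce
    show "K \<times> cball 0 5 \<subseteq> (\<lambda>z. (fst z, snd z + k z)) ` (K \<times> cball 0 5)"
    proof
      fix z assume z: "z \<in> K \<times> cball (0::'b) 5"
      show "z \<in> (\<lambda>z. (fst z, snd z + k z)) ` (K \<times> cball 0 5)"
      proof (cases "norm (snd z) > 3")
        case True
        thus ?thesis using off[OF z] z by (intro image_eqI[of _ _ z]) auto
      next
        case False
        have "\<exists>!u\<in>cball 0 5. snd z - k (fst z, u) = u"
        proof (rule Banach_fix[of _ "1/2"])
          show "complete (cball (0::'b) 5)" using compact_cball compact_imp_complete by blast
          show "(\<lambda>u. snd z - k (fst z, u)) ` cball 0 5 \<subseteq> cball 0 5"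
          proof (rule image_subsetI)
            fix u :: 'b assume "u \<in> cball 0 5"
            hence "norm (k (fst z, u)) \<le> 1" using k(2)[of "(fst z, u)"] z by auto
            thus "snd z - k (fst z, u) \<in> cball 0 5"
              using norm_triangle_ineq4[of "snd z" "k (fst z, u)"] False by simp
          qed
          show "dist (snd z - k (fst z, u)) (snd z - k (fst z, v)) \<le> 1 / 2 * dist u v"
            if "u \<in> cball 0 5" "v \<in> cball 0 5" for u v
            using lip[of "fst z" v u] that z by (auto simp: dist_norm norm_minus_commute)
        qed auto
        then obtain u where u: "u \<in> cball 0 5" "snd z - k (fst z, u) = u" by blast
        have "snd z = u + k (fst z, u)" using u(2) by (metis diff_add_cancel)
        thus ?thesis using u(1) z by (intro image_eqI[of _ _ "(fst z, u)"]) (auto simp: prod_eq_iff)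
      qed
    qed
  qed
  show "inj_on (\<lambda>z. (fst z, snd z + k z)) (K \<times> cball 0 5)"
  proof (rule inj_onI)
    fix z z' assume z: "z \<in> K \<times> cball 0 5" "z' \<in> K \<times> cball 0 5" and "(fst z, snd z + k z) = (fst z', snd z' + k z')"
    hence e: "fst z = fst z'" "snd z + k z = snd z' + k z'" by auto
    have "norm (snd z - snd z') = norm (k z' - k z)" using e(2) by (metis add_diff_eq diff_add_eq diff_diff_eq2 add_diff_cancel_right' add.commute)
    also have "\<dots> \<le> norm (snd z' - snd z) / 2" using lip[of "fst z" "snd z'" "snd z"] z e by auto
    finally have "norm (snd z - snd z') = 0" by (simp add: norm_minus_commute)
    thus "z = z'" using e by (simp add: prod_eq_iff)
  qed
qed

text \<open>Equal to 1 up to radius 5, where the conjugation must be exact, and to 0 from 11/2 on,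
  still inside the radius 6 on which the graphs are defined.\<close>

definition cutoff :: "complex \<Rightarrow> real" where "cutoff w = max 0 (min 1 (11 - 2 * norm w))"

lemma cutoff: "0 \<le> cutoff w" "cutoff w \<le> 1" "norm w \<le> 5 \<Longrightarrow> cutoff w = 1" "norm w \<ge> 11 / 2 \<Longrightarrow> cutoff w = 0"
  by (auto simp: cutoff_def)

lemma cutoff_lipschitz: "\<bar>cutoff w - cutoff w'\<bar> \<le> 2 * norm (w - w')"
proof -
  have "\<bar>norm w - norm w'\<bar> \<le> norm (w - w')" by (rule norm_triangle_ineq3)
  hence "norm w \<le> norm w' + norm (w - w')" "norm w' \<le> norm w + norm (w - w')" by linarith+
  thus ?thesis unfolding cutoff_def abs_le_iff max_def min_def using norm_ge_zero[of "w - w'"]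
    by (auto split: if_splits)
qed

lemma continuous_on_cutoff [continuous_intros]: "continuous_on A f \<Longrightarrow> continuous_on A (\<lambda>z. cutoff (f z))"
  unfolding cutoff_def by (intro continuous_intros)

lemma norm_scaleR_diff_le:
  fixes x y :: "'a::real_normed_vector"
  shows "norm (a *\<^sub>R x - b *\<^sub>R y) \<le> \<bar>a - b\<bar> * norm x + \<bar>b\<bar> * norm (x - y)"
proof -
  have "a *\<^sub>R x - b *\<^sub>R y = (a - b) *\<^sub>R x + b *\<^sub>R (x - y)" by (simp add: algebra_simps)
  thus ?thesis using norm_triangle_ineq[of "(a - b) *\<^sub>R x" "b *\<^sub>R (x - y)"] by simp
qed

context henon_family begin

text \<open>Increment bounds on the disc of radius \<open>\<delta> - norm b\<close> around
  \<open>b\<close>: 9 = 3 * 3 since |Phi| \<le> 3, and the difference of two values on one graph is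
  at most |w - w'| for all parameters in the disc.\<close>

lemma Phi_variation:
  assumes \<zeta>: "\<zeta> \<in> J0" and b: "norm b < \<delta>" "norm (b' - b) < \<delta> - norm b" and w: "norm w \<le> 6" "norm w' \<le> 6"
  defines "\<sigma> \<equiv> 9 * norm (b' - b) / (\<delta> - norm b)"
  shows "norm (Phi b' \<zeta> w - Phi b \<zeta> w) \<le> \<sigma>"
    "norm ((Phi b' \<zeta> w - Phi b \<zeta> w) - (Phi b' \<zeta> w' - Phi b \<zeta> w')) \<le> \<sigma> * norm (w - w')"
proof -
  define r where "r = \<delta> - norm b"
  have r: "r > 0" "norm (b' - b) < r" using b by (auto simp: r_def)
  have sub: "z \<in> ball 0 \<delta>" if "z \<in> ball b r" for z
    using norm_triangle_ineq[of b "z - b"] that by (simp add: r_def dist_norm norm_minus_commute)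
  have hol: "(\<lambda>b. Phi b \<zeta> v) holomorphic_on ball b r" if "norm v \<le> 6" for v
    by (rule holomorphic_on_subset[OF Phi_holomorphic[OF J0_closure[OF \<zeta>] that]]) (use sub in blast)
  have "norm (Phi b' \<zeta> w - Phi b \<zeta> w) \<le> 3 * 3 * norm (b' - b) / r"
    by (rule holomorphic_bounded_increment[OF hol[OF w(1)] r(1) _ r(2)])
      (use Phi_J0(1)[OF \<zeta> w(1)] sub in force)
  thus "norm (Phi b' \<zeta> w - Phi b \<zeta> w) \<le> \<sigma>" by (simp add: \<sigma>_def r_def)
  have "norm ((Phi b' \<zeta> w - Phi b' \<zeta> w') - (Phi b \<zeta> w - Phi b \<zeta> w')) \<le> 3 * norm (w - w') * norm (b' - b) / r"
  proof (rule holomorphic_bounded_increment[OF _ r(1) _ r(2)])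
    show "(\<lambda>b. Phi b \<zeta> w - Phi b \<zeta> w') holomorphic_on ball b r" by (intro holomorphic_intros hol w)
    fix z assume "z \<in> ball b r"
    hence "norm z \<le> \<delta>" using sub by force
    hence "norm (Phi z \<zeta> w - Phi z \<zeta> w') \<le> \<epsilon> / 2 * norm (w - w')" using w J0_closure[OF \<zeta>] by (intro Phi_lipschitz)
    also have "\<dots> \<le> 1 * norm (w - w')" by (rule mult_right_mono) (use eps in auto)
    finally show "norm (Phi z \<zeta> w - Phi z \<zeta> w') \<le> norm (w - w')" by simp
  qed
  also have "\<dots> \<le> \<sigma> * norm (w - w')" using r(1) unfolding \<sigma>_def r_def[symmetric]
    by (simp add: field_simps mult_right_mono)
  finally show "norm ((Phi b' \<zeta> w - Phi b \<zeta> w) - (Phi b' \<zeta> w' - Phi b \<zeta> w')) \<le> \<sigma> * norm (w - w')"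
    by (simp add: algebra_simps)
qed

lemma p0_collision_far:
  assumes "p0 \<zeta> = p0 \<zeta>'" "\<zeta> \<noteq> \<zeta>'" "\<zeta> \<in> J0"
  shows "norm (\<zeta> - \<zeta>') \<ge> 2 * \<epsilon>"
proof -
  have "\<zeta>\<^sup>2 = \<zeta>'\<^sup>2" using assms(1) by (simp add: p0_def)
  hence "\<zeta>' = - \<zeta>" using assms(2) by (metis power2_eq_iff minus_minus)
  hence "\<zeta> - \<zeta>' = 2 * \<zeta>" by simp
  hence "norm (\<zeta> - \<zeta>') = 2 * norm \<zeta>" by (simp only: norm_mult) simp
  thus ?thesis using J0_away[OF assms(3)] by linarith
qed

text \<open>\<open>H\<close> shifts the fibre coordinate of \<open>T b (\<zeta>, w)\<close> from the
  graph for \<open>b\<close> to the graph for \<open>b'\<close>, damped by the cut-off. The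
  difficulty is its Lipschitz bound along fibres: over a point of \<open>J0\<close> the image of
  \<open>T b\<close> may have two sheets, from the two preimages under \<open>p0\<close>. In
  \<open>small\<close>, the term 3L serves points on one sheet and the other term points on
  different sheets.\<close>

lemma T_perturbation_homeomorphism:
  assumes b: "b \<noteq> 0" "norm b < \<delta>" "norm (b' - b) < \<delta> - norm b"
  defines "\<sigma> \<equiv> 9 * norm (b' - b) / (\<delta> - norm b)" and "L \<equiv> 13 / norm b"
  assumes small: "\<sigma> * (3 * L + 6 * (1 + L) / \<epsilon>\<^sup>2) \<le> 1 / 2"
  shows "\<exists>H H'. homeomorphism (tube 5) (tube 5) H H' \<and> (\<forall>z\<in>tube 5. fst (H z) = fst z \<and> H (T b z) = T b' z) \<and>
    (\<forall>z\<in>tube 5 - tube 3. H z = z)"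
proof -
  note b_le = less_imp_le[OF b(2)]
  have L: "L \<ge> 1" using b \<delta> \<delta>0 by (simp add: L_def)
  have \<sigma>: "\<sigma> \<ge> 0" using b by (simp add: \<sigma>_def)
  have e2: "\<epsilon>\<^sup>2 > 0" using eps by simp
  have W_lip: "norm (W b (\<zeta>, u) - W b (\<zeta>, u')) \<le> L * norm (u - u')"
    if "\<zeta> \<in> J0" "norm u \<le> 6" "norm u' \<le> 6" for \<zeta> u u'
    unfolding L_def by (rule W_lipschitz[OF b(1,2) that])
  \<comment> \<open>Larger than \<open>tube 5\<close>, so that the displacement fades out on the
    image of \<open>T b\<close> before its edge.\<close>
  define D where "D = tube (11/2)"
  have D6: "D \<subseteq> tube 6" by (auto simp: D_def)
  have cT: "continuous_on D (T b)" by (rule continuous_on_subset[OF continuous_on_T[OF b(1,2)] D6])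
  obtain g where "homeomorphism D (T b ` D) (T b) g"
    using homeomorphism_compact[OF _ cT refl inj_on_subset[OF T_inj[OF b(1,2)] D6]] compact_tube
    unfolding D_def by blast
  hence g: "\<And>z. z \<in> D \<Longrightarrow> g (T b z) = z" "continuous_on (T b ` D) g" by (auto simp: homeomorphism_def)
  define k where "k z = (if z \<in> T b ` D then cutoff (W b z) *\<^sub>R (Phi b' (fst (g z)) (W b z) - snd z) else 0)" for z
  have TD: "T b ` D \<subseteq> tube 3" using T_range[OF b(1,2)] D6 by blast
  have label: "\<exists>\<zeta>\<in>J0. p0 \<zeta> = fst z \<and> norm (W b z) \<le> 11/2 \<and> Phi b \<zeta> (W b z) = snd z \<and>
      k z = cutoff (W b z) *\<^sub>R (Phi b' \<zeta> (W b z) - Phi b \<zeta> (W b z))" if z: "z \<in> T b ` D" for z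
  proof -
    obtain y where y: "y \<in> D" "z = T b y" using z by blast
    have "W b z = snd y" unfolding y(2) by (rule W_T[OF b(1,2)]) (use y(1) in \<open>auto simp: D_def\<close>)
    moreover have "g z = y" using g(1) y by simp
    ultimately show ?thesis using y z by (intro bexI[of _ "fst y"]) (auto simp: k_def D_def T_def)
  qed
  have out: "norm (W b z) \<ge> 11/2" "k z = 0" if z: "z \<in> tube 5" "z \<notin> T b ` D" for z
  proof -
    show "k z = 0" using z(2) by (simp add: k_def)
    show "norm (W b z) \<ge> 11/2"
    proof (rule ccontr)
      assume n: "\<not> ?thesis"
      have P: "fst z \<in> J0" "norm (snd z) \<le> 6" "norm (W b z) < 6" using z(1) n by auto
      obtain \<zeta> where \<zeta>: "\<zeta> \<in> J0" "T b (\<zeta>, W b z) = z" by (rule T_onto[OF b(1,2) P])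
      have "(\<zeta>, W b z) \<in> D" using \<zeta>(1) n by (simp add: D_def)
      from imageI[OF this, of "T b"] show False using z(2) unfolding \<zeta>(2) by blast
    qed
  qed
  have variation: "norm (Phi b' \<zeta> w - Phi b \<zeta> w) \<le> \<sigma>"
    "norm ((Phi b' \<zeta> w - Phi b \<zeta> w) - (Phi b' \<zeta> w' - Phi b \<zeta> w')) \<le> \<sigma> * norm (w - w')"
    if "\<zeta> \<in> J0" "norm w \<le> 11/2" "norm w' \<le> 11/2" for \<zeta> w w'
    using Phi_variation[OF that(1) b(2,3), of w w'] that unfolding \<sigma>_def by auto
  have k_le: "norm (k z) \<le> cutoff (W b z) * \<sigma>" if "z \<in> tube 5" for z
  proof (cases "z \<in> T b ` D")
    case True
    then obtain \<zeta> where \<zeta>: "\<zeta> \<in> J0" "norm (W b z) \<le> 11/2"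
      "k z = cutoff (W b z) *\<^sub>R (Phi b' \<zeta> (W b z) - Phi b \<zeta> (W b z))" using label by blast
    show ?thesis unfolding \<zeta>(3) norm_scaleR using variation(1)[OF \<zeta>(1,2,2)] cutoff(1)
      by (auto intro!: mult_left_mono)
  next
    case False
    thus ?thesis using out[OF that] cutoff(1) \<sigma> by simp
  qed
  have k_le': "norm (k z) \<le> \<sigma>" if "z \<in> tube 5" for z
    using k_le[OF that] mult_right_mono[OF cutoff(2) \<sigma>, of "W b z"] by simp
  have s1: "\<sigma> * (3 * L) \<le> 1 / 2" "\<sigma> * (6 * (1 + L) / \<epsilon>\<^sup>2) \<le> 1 / 2"
  proof -
    have "0 \<le> \<sigma> * (3 * L)" "0 \<le> \<sigma> * (6 * (1 + L) / \<epsilon>\<^sup>2)" using \<sigma> L e2 by auto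
    thus "\<sigma> * (3 * L) \<le> 1 / 2" "\<sigma> * (6 * (1 + L) / \<epsilon>\<^sup>2) \<le> 1 / 2"
      using small unfolding distrib_left by linarith+
  qed
  have "\<sigma> * 1 \<le> \<sigma> * (3 * L)" using \<sigma> L by (intro mult_left_mono) auto
  hence \<sigma>1: "\<sigma> \<le> 1" using s1 by linarith
  \<comment> \<open>Off the image of \<open>D\<close> the displacement is 0 and |W| \<ge> 11/2, so
    the cut-off at the other point is controlled by the Lipschitz constants of \<open>cutoff\<close>
    and \<open>W b\<close>.\<close>
  have mixed: "norm (k (\<zeta>, u) - k (\<zeta>, u')) \<le> norm (u - u') / 2"
    if \<zeta>: "\<zeta> \<in> J0" and u: "norm u \<le> 5" "norm u' \<le> 5" and out': "(\<zeta>, u') \<notin> T b ` D" for \<zeta> u u'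
  proof -
    have k0: "k (\<zeta>, u') = 0" and "norm (W b (\<zeta>, u')) \<ge> 11/2" using out[OF _ out'] \<zeta> u by auto
    hence c0: "cutoff (W b (\<zeta>, u')) = 0" using cutoff(4) by simp
    have "norm (k (\<zeta>, u)) \<le> cutoff (W b (\<zeta>, u)) * \<sigma>" using k_le \<zeta> u by simp
    also have "cutoff (W b (\<zeta>, u)) \<le> 2 * (L * norm (u - u'))"
      using cutoff_lipschitz[of "W b (\<zeta>, u)" "W b (\<zeta>, u')"] W_lip[OF \<zeta>, of u u'] c0 u by simp
    hence "cutoff (W b (\<zeta>, u)) * \<sigma> \<le> 2 * (L * norm (u - u')) * \<sigma>" by (rule mult_right_mono) (rule \<sigma>)
    also have "\<dots> \<le> 3 * (L * norm (u - u')) * \<sigma>" using \<sigma> L by (intro mult_right_mono) auto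
    also have "\<dots> = \<sigma> * (3 * L) * norm (u - u')" by simp
    also have "\<dots> \<le> 1 / 2 * norm (u - u')" by (rule mult_right_mono[OF s1(1)]) simp
    finally show ?thesis by (simp add: k0)
  qed
  have lip: "norm (k (\<zeta>, u) - k (\<zeta>, u')) \<le> norm (u - u') / 2"
    if \<zeta>: "\<zeta> \<in> J0" and u: "norm u \<le> 5" "norm u' \<le> 5" for \<zeta> u u'
  proof -
    consider "(\<zeta>, u) \<notin> T b ` D" | "(\<zeta>, u') \<notin> T b ` D" | "(\<zeta>, u) \<in> T b ` D" "(\<zeta>, u') \<in> T b ` D" by blast
    thus ?thesis
    proof cases
      case 1
      thus ?thesis using mixed[OF \<zeta> u(2,1) 1] by (simp add: norm_minus_commute)
    next
      case 2
      thus ?thesis by (rule mixed[OF \<zeta> u])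
    next
      case 3
      define w w' where "w = W b (\<zeta>, u)" and "w' = W b (\<zeta>, u')"
      have ww: "norm (w - w') \<le> L * norm (u - u')" unfolding w_def w'_def using u by (intro W_lip \<zeta>) auto
      obtain \<eta> where \<eta>: "\<eta> \<in> J0" "p0 \<eta> = \<zeta>" "norm w \<le> 11/2" "Phi b \<eta> w = u"
        "k (\<zeta>, u) = cutoff w *\<^sub>R (Phi b' \<eta> w - Phi b \<eta> w)" using label[OF 3(1)] by (auto simp: w_def)
      obtain \<eta>' where \<eta>': "\<eta>' \<in> J0" "p0 \<eta>' = \<zeta>" "norm w' \<le> 11/2" "Phi b \<eta>' w' = u'"
        "k (\<zeta>, u') = cutoff w' *\<^sub>R (Phi b' \<eta>' w' - Phi b \<eta>' w')" using label[OF 3(2)] by (auto simp: w'_def)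
      show ?thesis
      proof (cases "\<eta> = \<eta>'")
        \<comment> \<open>Same sheet, a product estimate: 2L comes from the cut-off and L from the
          variation of the graph.\<close>
        case True
        have "norm (k (\<zeta>, u) - k (\<zeta>, u')) \<le> \<bar>cutoff w - cutoff w'\<bar> * norm (Phi b' \<eta> w - Phi b \<eta> w) +
            \<bar>cutoff w'\<bar> * norm ((Phi b' \<eta> w - Phi b \<eta> w) - (Phi b' \<eta> w' - Phi b \<eta> w'))"
          unfolding \<eta>(5) \<eta>'(5) True by (rule norm_scaleR_diff_le)
        also have "\<dots> \<le> (2 * norm (w - w')) * \<sigma> + 1 * (\<sigma> * norm (w - w'))"
          using variation[OF \<eta>(1,3) \<eta>'(3)] cutoff_lipschitz[of w w'] cutoff(1,2)[of w'] \<sigma>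
          by (intro add_mono mult_mono) auto
        also have "\<dots> = 3 * \<sigma> * norm (w - w')" by simp
        also have "\<dots> \<le> 3 * \<sigma> * (L * norm (u - u'))" using ww \<sigma> by (intro mult_left_mono) auto
        also have "\<dots> = \<sigma> * (3 * L) * norm (u - u')" by simp
        also have "\<dots> \<le> 1 / 2 * norm (u - u')" by (rule mult_right_mono[OF s1(1)]) simp
        finally show ?thesis by simp
      next
        \<comment> \<open>Different sheets: the labels are opposite points, at least 2 \<epsilon>
          apart, and \<open>Phi_comparison\<close> turns this into a lower bound for |u - u'|,
          against which the total displacement of at most 2 \<sigma> is small.\<close>
        case False
        have w6: "norm w \<le> 6" "norm w' \<le> 6" using \<eta>(3) \<eta>'(3) by auto
        have "norm (\<eta> - \<eta>') \<ge> 2 * \<epsilon>" by (rule p0_collision_far) (use \<eta> \<eta>' False in auto)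
        hence "(2 * \<epsilon>)\<^sup>2 \<le> (norm (\<eta> - \<eta>'))\<^sup>2" using eps by (intro power_mono) auto
        also have "\<dots> \<le> 12 * norm (Phi b \<eta> w - Phi b \<eta>' w)"
          by (rule Phi_comparison(2)[OF J0_closure[OF \<eta>(1)] J0_closure[OF \<eta>'(1)] w6(1) b_le])
        also have "norm (Phi b \<eta> w - Phi b \<eta>' w) \<le> norm (u - u') + norm (Phi b \<eta>' w' - Phi b \<eta>' w)"
          using norm_triangle_ineq[of "u - u'" "Phi b \<eta>' w' - Phi b \<eta>' w"] by (simp add: \<eta>(4) \<eta>'(4))
        also have "norm (Phi b \<eta>' w' - Phi b \<eta>' w) \<le> \<epsilon> / 2 * norm (w' - w)"
          by (rule Phi_lipschitz[OF J0_closure[OF \<eta>'(1)] b_le w6])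
        also have "\<dots> \<le> 1 * norm (w' - w)" by (rule mult_right_mono) (use eps in auto)
        also have "norm (w' - w) \<le> L * norm (u - u')" using ww by (simp add: norm_minus_commute)
        finally have "\<epsilon>\<^sup>2 \<le> 3 * (1 + L) * norm (u - u')" by (simp add: power_mult_distrib algebra_simps)
        hence far: "1 \<le> 3 * (1 + L) / \<epsilon>\<^sup>2 * norm (u - u')" using e2 by (simp add: field_simps)
        have "norm (k (\<zeta>, u) - k (\<zeta>, u')) \<le> norm (k (\<zeta>, u)) + norm (k (\<zeta>, u'))" by (rule norm_triangle_ineq4)
        also have "\<dots> \<le> 2 * \<sigma> * 1" using k_le'[of "(\<zeta>, u)"] k_le'[of "(\<zeta>, u')"] \<zeta> u by simp
        also have "\<dots> \<le> 2 * \<sigma> * (3 * (1 + L) / \<epsilon>\<^sup>2 * norm (u - u'))" by (rule mult_left_mono[OF far]) (use \<sigma> in simp)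
        also have "\<dots> = \<sigma> * (6 * (1 + L) / \<epsilon>\<^sup>2) * norm (u - u')" by simp
        also have "\<dots> \<le> 1 / 2 * norm (u - u')" by (rule mult_right_mono[OF s1(2)]) simp
        finally show ?thesis by simp
      qed
    qed
  qed
  have ck: "continuous_on (tube 5) k"
  proof -
    define M where "M = tube 5 \<inter> (\<lambda>z. norm (W b z)) -` {11/2..}"
    have cW: "continuous_on (tube 5) (W b)" by (rule continuous_on_subset[OF continuous_on_W[OF b(1,2)]]) auto
    have TD5: "T b ` D \<subseteq> tube 5" using TD by fastforce
    have b'_le: "norm b' \<le> \<delta>" using norm_triangle_ineq[of b "b' - b"] b(3) by simp
    have "continuous_on (T b ` D \<union> M) (\<lambda>z. if z \<in> T b ` D then cutoff (W b z) *\<^sub>R (Phi b' (fst (g z)) (W b z) - snd z) else 0)"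
    proof (rule continuous_on_cases)
      show "closed (T b ` D)" using compact_continuous_image[OF cT] compact_tube compact_imp_closed by (auto simp: D_def)
      show "closed M" unfolding M_def
        by (intro continuous_closed_preimage continuous_intros cW compact_imp_closed compact_tube)
      have cWT: "continuous_on (T b ` D) (W b)" by (rule continuous_on_subset[OF cW TD5])
      show "continuous_on (T b ` D) (\<lambda>z. cutoff (W b z) *\<^sub>R (Phi b' (fst (g z)) (W b z) - snd z))"
      proof (intro continuous_intros cWT continuous_on_Phi_J0 b'_le g)
        fix z assume z: "z \<in> T b ` D"
        then obtain y where y: "y \<in> D" "z = T b y" by blast
        show "fst (g z) \<in> J0" using g(1) y by (auto simp: D_def)
        show "norm (W b z) \<le> 6" using label[OF z] by force
      qed
      show "\<forall>z. z \<in> T b ` D \<and> z \<notin> T b ` D \<or> z \<in> M \<and> z \<in> T b ` D \<longrightarrow>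
          cutoff (W b z) *\<^sub>R (Phi b' (fst (g z)) (W b z) - snd z) = 0" using cutoff(4) by (auto simp: M_def)
    qed simp
    moreover have "T b ` D \<union> M = tube 5" using TD5 out(1) by (auto simp: M_def)
    moreover have "k = (\<lambda>z. if z \<in> T b ` D then cutoff (W b z) *\<^sub>R (Phi b' (fst (g z)) (W b z) - snd z) else 0)"
      by (auto simp: k_def)
    ultimately show ?thesis by simp
  qed
  have off: "k z = 0" if "z \<in> tube 5" "norm (snd z) > 3" for z using that TD by (auto simp: k_def)
  have k1: "norm (k z) \<le> 1" if "z \<in> tube 5" for z using k_le'[OF that] \<sigma>1 by linarith
  define H where "H z = (fst z, snd z + k z)" for z
  have "\<exists>H'. homeomorphism (tube 5) (tube 5) H H'" unfolding H_def
    by (rule fibre_perturbation_homeomorphism[OF J0_compact ck k1 lip off])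
  then obtain H' where "homeomorphism (tube 5) (tube 5) H H'" by blast
  moreover have "H (T b z) = T b' z" if z: "z \<in> tube 5" for z
  proof -
    have W: "W b (T b z) = snd z" by (rule W_T[OF b(1,2)]) (use z in auto)
    have D: "z \<in> D" using z by (auto simp: D_def)
    have "k (T b z) = Phi b' (fst z) (snd z) - Phi b (fst z) (snd z)"
      unfolding k_def if_P[OF imageI[OF D]] W g(1)[OF D] using cutoff(3)[of "snd z"] z by (auto simp: T_def)
    thus ?thesis by (simp add: H_def T_def)
  qed
  moreover have "H z = z" if "z \<in> tube 5 - tube 3" for z
    using off[of z] that by (auto simp: H_def mem_Times_iff)
  ultimately show ?thesis by (intro exI[of _ H] exI[of _ H']) (auto simp: H_def)
qed

end

section \<open>Conjugacy as an equivalence relation between parameters\<close>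

context henon_family begin

text \<open>The second homeomorphism is the restriction of the first to the Julia set \<open>J\<close>, see \<open>Jp_backward\<close> below.\<close>

definition conj_related :: "complex \<Rightarrow> complex \<Rightarrow> bool" where
  "conj_related b b' \<longleftrightarrow> (\<exists>h h'. homeomorphism (Jp b) (Jp b') h h' \<and> (\<forall>z\<in>Jp b. h (G b z) = G b' (h z)) \<and>
     homeomorphism {z\<in>Jp b. \<forall>n. (G1 b ^^ n) z \<in> Sb b} {z\<in>Jp b'. \<forall>n. (G1 b' ^^ n) z \<in> Sb b'} h h')"

lemma conj_related_sym:
  assumes "b \<noteq> 0" "b' \<noteq> 0" "conj_related b b'"
  shows "conj_related b' b"
proof -
  obtain h h' where h: "homeomorphism (Jp b) (Jp b') h h'" "\<And>z. z\<in>Jp b \<Longrightarrow> h (G b z) = G b' (h z)"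
    "homeomorphism {z\<in>Jp b. \<forall>n. (G1 b ^^ n) z \<in> Sb b} {z\<in>Jp b'. \<forall>n. (G1 b' ^^ n) z \<in> Sb b'} h h'"
    using assms(3) by (auto simp: conj_related_def)
  have "h' (G b' z) = G b (h' z)" if z: "z \<in> Jp b'" for z
  proof -
    have "h' z \<in> Jp b" "h (h' z) = z" using h(1) z by (auto simp: homeomorphism_def)
    hence "G b' z = h (G b (h' z))" "G b (h' z) \<in> Jp b" using h(2) G_Jp[OF assms(1)] by auto
    thus ?thesis using h(1) by (simp add: homeomorphism_def)
  qed
  thus ?thesis unfolding conj_related_def using homeomorphism_symD[OF h(1)] homeomorphism_symD[OF h(3)] by blast
qed

lemma conj_related_trans:
  assumes "conj_related b b'" "conj_related b' b''"
  shows "conj_related b b''"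
proof -
  obtain h h' where h: "homeomorphism (Jp b) (Jp b') h h'" "\<And>z. z\<in>Jp b \<Longrightarrow> h (G b z) = G b' (h z)"
    "homeomorphism {z\<in>Jp b. \<forall>n. (G1 b ^^ n) z \<in> Sb b} {z\<in>Jp b'. \<forall>n. (G1 b' ^^ n) z \<in> Sb b'} h h'"
    using assms(1) by (auto simp: conj_related_def)
  obtain k k' where k: "homeomorphism (Jp b') (Jp b'') k k'" "\<And>z. z\<in>Jp b' \<Longrightarrow> k (G b' z) = G b'' (k z)"
    "homeomorphism {z\<in>Jp b'. \<forall>n. (G1 b' ^^ n) z \<in> Sb b'} {z\<in>Jp b''. \<forall>n. (G1 b'' ^^ n) z \<in> Sb b''} k k'"
    using assms(2) by (auto simp: conj_related_def)
  have "h z \<in> Jp b'" if "z \<in> Jp b" for z using h(1) that by (auto simp: homeomorphism_def)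
  thus ?thesis unfolding conj_related_def
    using homeomorphism_compose[OF h(1) k(1)] homeomorphism_compose[OF h(3) k(3)] h(2) k(2)
    by (intro exI[of _ "k \<circ> h"] exI[of _ "h' \<circ> k'"]) auto
qed

lemma fibred_pair_T:
  assumes b: "b \<noteq> 0" "norm b < \<delta>" and b': "b' \<noteq> 0" "norm b' < \<delta>"
    and H: "continuous_on (tube 5) H" "H ` tube 5 \<subseteq> tube 5" "\<And>z. z \<in> tube 5 \<Longrightarrow> fst (H z) = fst z"
    "\<And>z. z \<in> tube 5 \<Longrightarrow> H (T b z) = T b' z" "\<And>z. z \<in> tube 5 - tube 3 \<Longrightarrow> H z = z"
  shows "fibred_pair (tube 5) (tube 3) (T b) (T b') H p0"
proof
  have s: "tube 5 \<subseteq> tube 6" by auto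
  show "compact (tube 5)" by (rule compact_tube)
  show "tube 3 \<subseteq> tube 5" by auto
  show "continuous_on (tube 5) (T b)" by (rule continuous_on_subset[OF continuous_on_T[OF b] s])
  show "continuous_on (tube 5) (T b')" by (rule continuous_on_subset[OF continuous_on_T[OF b'] s])
  show "T b ` tube 5 \<subseteq> tube 3" using T_range[OF b] image_mono[OF s, of "T b"] by (rule subset_trans[rotated])
  show "T b' ` tube 5 \<subseteq> tube 3" using T_range[OF b'] image_mono[OF s, of "T b'"] by (rule subset_trans[rotated])
  show "inj_on (T b) (tube 5)" by (rule inj_on_subset[OF T_inj[OF b] s])
  show "fst (T b z) = p0 (fst z)" "fst (T b' z) = p0 (fst z)" for z by (simp_all add: T_def)
  show "dist (T b' z) (T b' z') \<le> dist z z' / 2" if "z \<in> tube 5" "z' \<in> tube 5" "fst z = fst z'" for z z'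
    using that s by (intro T_contraction[OF b']) auto
  show "T b z \<notin> closure (tube 5 - T b ` tube 5)" if "z \<in> tube 3" for z by (rule T_inside[OF b that])
qed (use H in auto)

lemma conj_related_nearby:
  assumes b: "b \<noteq> 0" "norm b < \<delta>"
  shows "\<exists>r>0. \<forall>b'. b' \<noteq> 0 \<longrightarrow> norm b' < \<delta> \<longrightarrow> norm (b' - b) < r \<longrightarrow> conj_related b b'"
proof -
  define A where "A = 3 * (13 / norm b) + 6 * (1 + 13 / norm b) / \<epsilon>\<^sup>2"
  define d where "d = \<delta> - norm b"
  have d: "d > 0" using b by (simp add: d_def)
  have A: "A > 0" unfolding A_def using b eps by (intro add_pos_pos divide_pos_pos mult_pos_pos) auto
  \<comment> \<open>\<open>A\<close> is the bracket in the smallness condition of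
    \<open>T_perturbation_homeomorphism\<close>, and |b' - b| \<le> d/(18 A) makes 9 |b' - b| A / d
    at most 1/2.\<close>
  define r where "r = min d (d / (18 * A))"
  have r: "r > 0" using d A by (simp add: r_def)
  have "conj_related b b'" if b': "b' \<noteq> 0" "norm b' < \<delta>" "norm (b' - b) < r" for b'
  proof -
    have close: "norm (b' - b) < \<delta> - norm b" "norm (b' - b) \<le> d / (18 * A)" using b'(3) by (auto simp: r_def d_def)
    have "9 * norm (b' - b) / d * A \<le> 1 / 2" using close(2) d A by (simp add: field_simps)
    then obtain H H' where H: "homeomorphism (tube 5) (tube 5) H H'"
      "\<And>z. z \<in> tube 5 \<Longrightarrow> fst (H z) = fst z" "\<And>z. z \<in> tube 5 \<Longrightarrow> H (T b z) = T b' z" "\<And>z. z \<in> tube 5 - tube 3 \<Longrightarrow> H z = z"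
      using T_perturbation_homeomorphism[OF b close(1)] unfolding A_def d_def by blast
    have HH: "\<And>z. z \<in> tube 5 \<Longrightarrow> H' (H z) = z" "\<And>z. z \<in> tube 5 \<Longrightarrow> H (H' z) = z"
      "continuous_on (tube 5) H" "H ` tube 5 \<subseteq> tube 5" "continuous_on (tube 5) H'" "H' ` tube 5 \<subseteq> tube 5"
      using H(1) by (auto simp: homeomorphism_def)
    have T5: "T b z \<in> tube 5" if "z \<in> tube 5" for z
    proof -
      have "T b z \<in> tube 3" using T_range[OF b] that by force
      thus ?thesis by auto
    qed
    have A1: "fibred_pair (tube 5) (tube 3) (T b) (T b') H p0" by (rule fibred_pair_T[OF b b'(1,2) HH(3,4) H(2-4)])
    have A2: "fibred_pair (tube 5) (tube 3) (T b') (T b) H' p0"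
    proof (rule fibred_pair_T[OF b'(1,2) b HH(5,6)])
      show "fst (H' z) = fst z" if "z \<in> tube 5" for z
      proof -
        have "H' z \<in> tube 5" using that HH(6) by blast
        from H(2)[OF this] HH(2)[OF that] show ?thesis by simp
      qed
      show "H' (T b' z) = T b z" if "z \<in> tube 5" for z using H(3)[OF that] HH(1)[OF T5[OF that]] by simp
      show "H' z = z" if "z \<in> tube 5 - tube 3" for z using H(4)[OF that] HH(1)[of z] that by simp
    qed
    obtain h k where h: "homeomorphism (tube 5) (tube 5) h k" "\<And>z. z \<in> tube 5 \<Longrightarrow> h (T b z) = T b' (h z)"
      using fibred_conjugacy[OF A1 A2 HH(1,2)] by blast
    obtain t where t: "homeomorphism (tube 5) (Sb b) (Theta b) t" using Theta_homeomorphism[OF b] by blast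
    obtain t' where t': "homeomorphism (tube 5) (Sb b') (Theta b') t'" using Theta_homeomorphism[OF b'(1,2)] by blast
    define g where "g = (Theta b' \<circ> h) \<circ> t"
    have g: "homeomorphism (Sb b) (Sb b') g (Theta b \<circ> (k \<circ> t'))" unfolding g_def
      by (intro homeomorphism_compose[OF homeomorphism_symD[OF t]] homeomorphism_compose[OF h(1) t'])
    have gG: "g (G b z) = G b' (g z)" if z: "z \<in> Sb b" for z
    proof -
      define y where "y = t z"
      have y: "y \<in> tube 5" "z = Theta b y"
        using homeomorphism_image2[OF t] homeomorphism_apply2[OF t z] z unfolding y_def by auto
      have hy: "h y \<in> tube 5" using homeomorphism_image1[OF h(1)] y(1) by blast
      have tT: "t (Theta b u) = u" if "u \<in> tube 5" for u by (rule homeomorphism_apply1[OF t that])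
      have "G b z = Theta b (T b y)" unfolding y(2) by (rule G_Theta[OF b]) (use y(1) in auto)
      hence "g (G b z) = Theta b' (T b' (h y))" using tT[OF T5[OF y(1)]] h(2)[OF y(1)] by (simp add: g_def)
      also have "\<dots> = G b' (Theta b' (h y))" by (rule G_Theta[symmetric, OF b'(1,2)]) (use hy in auto)
      finally show ?thesis by (simp add: g_def y_def)
    qed
    show ?thesis
    proof (rule absorbing_conjugacy[OF Sb_absorbing[OF b] Sb_absorbing[OF b'(1,2)] g gG])
      fix f f' assume "homeomorphism (Jp b) (Jp b') f f'" "\<And>z. z \<in> Jp b \<Longrightarrow> f (G b z) = G b' (f z)"
        "homeomorphism {z\<in>Jp b. \<forall>n. (G1 b ^^ n) z \<in> Sb b} {z\<in>Jp b'. \<forall>n. (G1 b' ^^ n) z \<in> Sb b'} f f'"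
      thus ?thesis unfolding conj_related_def by (intro exI[of _ f] exI[of _ f'] conjI ballI)
    qed
  qed
  thus ?thesis using r by blast
qed

lemma conj_related_all:
  assumes "b \<noteq> 0" "norm b < \<delta>" "b' \<noteq> 0" "norm b' < \<delta>"
  shows "conj_related b b'"
proof -
  have "connected (ball 0 \<delta> - {0 :: complex})" by (rule connected_punctured_ball) simp
  thus ?thesis
  proof (rule connected_equivalence_relation)
    show "b \<in> ball 0 \<delta> - {0}" "b' \<in> ball 0 \<delta> - {0}" using assms by auto
    show "conj_related y x" if "conj_related x y" "x \<in> ball 0 \<delta> - {0}" "y \<in> ball 0 \<delta> - {0}" for x y
      using conj_related_sym that by blast
    show "conj_related x z" if "conj_related x y" "conj_related y z" for x y z using conj_related_trans that by blast
    show "\<exists>U. openin (top_of_set (ball 0 \<delta> - {0})) U \<and> a \<in> U \<and> (\<forall>x\<in>U. conj_related a x)"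
      if a: "a \<in> ball 0 \<delta> - {0}" for a
    proof -
      obtain r where r: "r > 0" "\<And>b'. b' \<noteq> 0 \<Longrightarrow> norm b' < \<delta> \<Longrightarrow> norm (b' - a) < r \<Longrightarrow> conj_related a b'"
        using conj_related_nearby[of a] a by auto
      thus ?thesis using a
        by (intro exI[of _ "(ball 0 \<delta> - {0}) \<inter> ball a r"]) (auto simp: dist_norm norm_minus_commute)
    qed
  qed
qed

end

section \<open>Backward orbits\<close>

text \<open>The recursion of \<open>horb\<close> solved for its oldest term. The values at
  \<open>n\<close> and \<open>n + 1\<close> form the n-th backward image, so index 0 is
  \<open>x\<close> here, not \<open>w\<close>.\<close>

fun hback :: "complex \<Rightarrow> complex \<Rightarrow> complex \<Rightarrow> complex \<Rightarrow> nat \<Rightarrow> complex" where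
  "hback c b x w 0 = x"
| "hback c b x w (Suc 0) = w"
| "hback c b x w (Suc (Suc n)) = (hback c b x w n - (hback c b x w (Suc n))\<^sup>2 - c) / b"

text \<open>The derivative of \<^term>\<open>hback c b x w\<close> along the initial velocity \<^term>\<open>(p, q)\<close>.\<close>

fun hback_deriv :: "complex \<Rightarrow> complex \<Rightarrow> complex \<Rightarrow> complex \<Rightarrow> complex \<Rightarrow> complex \<Rightarrow> nat \<Rightarrow> complex" where
  "hback_deriv c b x w p q 0 = p"
| "hback_deriv c b x w p q (Suc 0) = q"
| "hback_deriv c b x w p q (Suc (Suc n)) =
    (hback_deriv c b x w p q n - 2 * hback c b x w (Suc n) * hback_deriv c b x w p q (Suc n)) / b"

lemma hback_has_field_derivative:
  assumes b: "b \<noteq> 0"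
  shows "((\<lambda>x. hback c b x w n) has_field_derivative hback_deriv c b x w 1 0 n) (at x)"
    "((\<lambda>w. hback c b x w n) has_field_derivative hback_deriv c b x w 0 1 n) (at w)"
proof -
  show "((\<lambda>x. hback c b x w n) has_field_derivative hback_deriv c b x w 1 0 n) (at x)"
    by (induction n rule: induct_nat_012) (use b in \<open>auto intro!: derivative_eq_intros simp: field_simps\<close>)
  show "((\<lambda>w. hback c b x w n) has_field_derivative hback_deriv c b x w 0 1 n) (at w)"
    by (induction n rule: induct_nat_012) (use b in \<open>auto intro!: derivative_eq_intros simp: field_simps\<close>)
qed

text \<open>This is the Jacobian determinant of the n-th backward iterate; a single step has
  determinant -1/b.\<close>

lemma hback_wronskian:
  assumes "b \<noteq> 0"
  shows "hback_deriv c b x w 1 0 n * hback_deriv c b x w 0 1 (Suc n) -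
    hback_deriv c b x w 1 0 (Suc n) * hback_deriv c b x w 0 1 n = (- 1 / b) ^ n"
proof (induction n)
  case (Suc n)
  have "hback_deriv c b x w 1 0 (Suc n) * hback_deriv c b x w 0 1 (Suc (Suc n)) -
    hback_deriv c b x w 1 0 (Suc (Suc n)) * hback_deriv c b x w 0 1 (Suc n) =
    (- 1 / b) * (hback_deriv c b x w 1 0 n * hback_deriv c b x w 0 1 (Suc n) -
    hback_deriv c b x w 1 0 (Suc n) * hback_deriv c b x w 0 1 n)"
    using assms by (simp add: field_simps)
  thus ?case unfolding Suc.IH by simp
qed simp

lemma continuous_on_hback [continuous_intros]:
  assumes "continuous_on S x" "continuous_on S w"
  shows "continuous_on S (\<lambda>p. hback c b (x p) (w p) n)"
  by (induction n rule: induct_nat_012) (auto simp: divide_inverse intro!: continuous_intros assms)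

lemma deriv_bound:
  fixes f :: "complex \<Rightarrow> complex"
  assumes f: "\<And>z. (f has_field_derivative f' z) (at z)" and r: "r > 0"
    and B: "\<And>z. norm (z - a) \<le> r \<Longrightarrow> norm (f z) \<le> B"
  shows "norm (f' a) \<le> B / r"
proof -
  have hol: "f holomorphic_on A" for A
    using f by (meson holomorphic_on_def field_differentiable_at_within field_differentiable_def)
  have "norm ((deriv ^^ 1) f a) \<le> fact 1 * B / r ^ 1"
    by (rule Cauchy_inequality) (use hol holomorphic_on_imp_continuous_on[OF hol] r B in \<open>auto simp: norm_minus_commute\<close>)
  thus ?thesis using DERIV_imp_deriv[OF f, of a] by simp
qed

text \<open>Uniform bounds would bound the derivatives, whereas the Wronskian is \<open>(- 1 / b) ^ n\<close>.\<close>

lemma hback_unbounded: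
  assumes b: "b \<noteq> 0" "norm b < 1" and r: "r > 0"
    and B: "\<And>x w n. norm (x - x0) \<le> r \<Longrightarrow> norm (w - w0) \<le> r \<Longrightarrow> norm (hback c b x w n) \<le> R"
  shows False
proof -
  have 1: "norm (hback_deriv c b x0 w0 1 0 n) \<le> R / r" for n
    by (rule deriv_bound[OF hback_has_field_derivative(1)[OF b(1)] r]) (use B r in auto)
  have 2: "norm (hback_deriv c b x0 w0 0 1 n) \<le> R / r" for n
    by (rule deriv_bound[OF hback_has_field_derivative(2)[OF b(1)] r]) (use B r in auto)
  have R: "R / r \<ge> 0" using 1[of 0] norm_ge_zero order_trans by blast
  have "norm ((- 1 / b) ^ n) \<le> R / r * (R / r) + R / r * (R / r)" for n
    unfolding hback_wronskian[OF b(1), of c x0 w0 n, symmetric]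
    by (rule order_trans[OF norm_triangle_ineq4], unfold norm_mult, intro add_mono mult_mono 1 2 R norm_ge_zero)
  moreover obtain n where "R / r * (R / r) + R / r * (R / r) < (1 / norm b) ^ n"
    using real_arch_pow[of "1 / norm b"] b by auto
  moreover have "norm ((- 1 / b) ^ n) = (1 / norm b) ^ n" by (simp add: norm_power norm_divide)
  ultimately show False by (metis not_le)
qed

text \<open>If both alternatives failed once, the doubling hypothesis would apply at every later
  step. It is used forwards with \<open>R = 3\<close> and backwards with
  \<open>R = 5\<close>.\<close>

lemma bounded_by_doubling:
  fixes f :: "nat \<Rightarrow> 'a::real_normed_vector"
  assumes R: "R > 0" and bd: "bounded (range f)"
    and esc: "\<And>n. norm (f (Suc n)) \<ge> R \<Longrightarrow> norm (f n) \<le> norm (f (Suc n)) \<Longrightarrow> norm (f (Suc (Suc n))) \<ge> 2 * norm (f (Suc n))"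
  shows "norm (f (Suc n)) < R \<or> norm (f (Suc n)) < norm (f n)"
proof (rule ccontr)
  assume a: "\<not> ?thesis"
  have "norm (f (Suc (n + m))) \<ge> 2 ^ m * R \<and> norm (f (n + m)) \<le> norm (f (Suc (n + m)))" for m
  proof (induction m)
    case (Suc m)
    have "1 * R \<le> 2 ^ m * R" by (rule mult_right_mono) (use R in auto)
    hence "norm (f (Suc (n + m))) \<ge> R" using Suc by linarith
    moreover from this have "norm (f (Suc (Suc (n + m)))) \<ge> 2 * norm (f (Suc (n + m)))" using esc Suc by blast
    ultimately show ?case using Suc R by simp
  qed (use a in auto)
  hence 1: "norm (f (Suc (n + m))) \<ge> 2 ^ m * R" for m by blast
  obtain K where K: "\<And>n. norm (f n) \<le> K" using bd by (auto simp: bounded_iff)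
  obtain m :: nat where "K / R < 2 ^ m" using real_arch_pow[of 2] by auto
  thus False using 1[of m] K[of "Suc (n + m)"] R by (simp add: field_simps)
qed

lemma bounded_by_initial:
  fixes f :: "nat \<Rightarrow> 'a::real_normed_vector"
  assumes "\<And>n. norm (f (Suc n)) < R \<or> norm (f (Suc n)) < norm (f n)"
  shows "norm (f n) \<le> max R (norm (f 0))"
proof (induction n)
  case (Suc n)
  thus ?case using assms[of n] by linarith
qed simp

lemma bounded_range_pairs:
  fixes f :: "nat \<Rightarrow> 'a::real_normed_vector"
  shows "bounded (range (\<lambda>n. (f n, f (Suc n)))) \<longleftrightarrow> bounded (range f)"
    "bounded (range (\<lambda>n. (f (Suc n), f n))) \<longleftrightarrow> bounded (range f)"
proof -
  have 1: "range (\<lambda>n. (f n, f (Suc n))) \<subseteq> range f \<times> range f" "range (\<lambda>n. (f (Suc n), f n)) \<subseteq> range f \<times> range f" by auto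
  have 2: "range f = fst ` range (\<lambda>n. (f n, f (Suc n)))" "range f = snd ` range (\<lambda>n. (f (Suc n), f n))" by (auto simp: image_image)
  show "bounded (range (\<lambda>n. (f n, f (Suc n)))) \<longleftrightarrow> bounded (range f)"
    using bounded_fst[of "range (\<lambda>n. (f n, f (Suc n)))"] bounded_subset[OF bounded_Times 1(1)] unfolding 2(1)[symmetric] by blast
  show "bounded (range (\<lambda>n. (f (Suc n), f n))) \<longleftrightarrow> bounded (range f)"
    using bounded_snd[of "range (\<lambda>n. (f (Suc n), f n))"] bounded_subset[OF bounded_Times 1(2)] unfolding 2(2)[symmetric] by blast
qed

section \<open>The set of bounded backward orbits\<close>

context henon_family begin

definition Y :: "complex \<Rightarrow> complex \<times> complex \<Rightarrow> nat \<Rightarrow> complex" where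
  "Y b z = hback (par_c l b) b (fst z) (snd z)"

definition Km :: "complex \<Rightarrow> (complex \<times> complex) set" where
  "Km b = {z. bounded (range (\<lambda>n. (G1 b ^^ n) z))}"

lemma G1_orbit: "(G1 b ^^ n) z = (Y b z n, Y b z (Suc n))"
  by (induction n) (auto simp: G1_def Y_def)

lemma Kp_funpow: "Kp b = {z. bounded (range (\<lambda>n. (G b ^^ n) z))}"
proof -
  have "(G b ^^ n) z = (X b (fst z) (snd z) (Suc n), X b (fst z) (snd z) n)" for n z
    using G_orbit[where x = "fst z" and w = "snd z"] by simp
  thus ?thesis using bounded_range_pairs(2)[of "X b (fst z) (snd z)" for z] by (simp add: Kp_def)
qed

lemma Km_Y: "z \<in> Km b \<longleftrightarrow> bounded (range (Y b z))"
  unfolding Km_def G1_orbit using bounded_range_pairs(1)[of "Y b z"] by simp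

lemma G1_Km: "z \<in> Km b \<Longrightarrow> (G1 b ^^ n) z \<in> Km b"
  using bounded_range_shift[of "\<lambda>m. (G1 b ^^ m) z" n]
  by (simp add: Km_def flip: funpow_add comp_apply[of "G1 b ^^ _" "G1 b ^^ n"]) (simp add: funpow_add add.commute)

context
  fixes b :: complex
  assumes b: "b \<noteq> 0" "norm b < \<delta>"
begin

lemma parameter_bounds: "norm b \<le> 1/10" "norm (par_c l b) \<le> 2" "norm b < 1"
  using b_bounds[of b] b \<delta> by auto

lemma Kp_step:
  assumes "z \<in> Kp b"
  shows "norm (X b (fst z) (snd z) (Suc n)) < 3 \<or> norm (X b (fst z) (snd z) (Suc n)) < norm (X b (fst z) (snd z) n)"
proof (rule bounded_by_doubling)
  show "bounded (range (X b (fst z) (snd z)))" using assms by (simp add: Kp_def)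
  fix n assume "norm (X b (fst z) (snd z) (Suc n)) \<ge> 3" "norm (X b (fst z) (snd z) n) \<le> norm (X b (fst z) (snd z) (Suc n))"
  thus "norm (X b (fst z) (snd z) (Suc (Suc n))) \<ge> 2 * norm (X b (fst z) (snd z) (Suc n))"
    unfolding X_simps(3) by (intro horb_escape_step parameter_bounds) auto
qed simp

text \<open>The square dominates: s^2 - s - 2 \<ge> 2s for s \<ge> 5, and the division by |b| < 1
  only helps.\<close>

lemma Y_escape:
  assumes "norm (Y b z (Suc n)) \<ge> 5" "norm (Y b z n) \<le> norm (Y b z (Suc n))"
  shows "norm (Y b z (Suc (Suc n))) \<ge> 2 * norm (Y b z (Suc n))"
proof -
  define s where "s = norm (Y b z (Suc n))"
  have "norm ((Y b z (Suc n))\<^sup>2) - norm (Y b z n - par_c l b) \<le> norm ((Y b z (Suc n))\<^sup>2 - (Y b z n - par_c l b))"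
    by (rule norm_triangle_ineq2)
  also have "\<dots> = norm (Y b z n - (Y b z (Suc n))\<^sup>2 - par_c l b)"
    by (subst norm_minus_commute) (simp add: algebra_simps)
  finally have "s\<^sup>2 - (s + 2) \<le> norm (Y b z n - (Y b z (Suc n))\<^sup>2 - par_c l b)"
    using norm_triangle_ineq4[of "Y b z n" "par_c l b"] parameter_bounds assms by (simp add: norm_power s_def)
  moreover have "5 * s \<le> s\<^sup>2" using assms(1) unfolding power2_eq_square s_def by (intro mult_right_mono) auto
  ultimately have 1: "2 * s \<le> norm (Y b z n - (Y b z (Suc n))\<^sup>2 - par_c l b)" using assms(1) unfolding s_def by linarith
  have "norm (Y b z n - (Y b z (Suc n))\<^sup>2 - par_c l b) \<le> norm (Y b z n - (Y b z (Suc n))\<^sup>2 - par_c l b) / norm b"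
    using b parameter_bounds by (simp add: le_divide_eq mult_left_le)
  also have "\<dots> = norm (Y b z (Suc (Suc n)))" by (simp add: Y_def norm_divide)
  finally show ?thesis using 1 by (simp add: s_def)
qed

lemma Km_step:
  assumes "z \<in> Km b"
  shows "norm (Y b z (Suc n)) < 5 \<or> norm (Y b z (Suc n)) < norm (Y b z n)"
  by (rule bounded_by_doubling) (use assms Km_Y Y_escape in auto)

text \<open>Forwards, |x| < 3 or |x| < |w|; backwards, |w| < 5 or |w| < |x|. Together these exclude
  |w| \<ge> 5.\<close>

lemma Kp_Km_small: "z \<in> Kp b \<Longrightarrow> z \<in> Km b \<Longrightarrow> norm (snd z) < 5"
  using Kp_step[of z 0] Km_step[of z 0] by (auto simp: Y_def)

text \<open>By \<open>Kp_step\<close> a bounded orbit is bounded explicitly in terms of its initial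
  point, which turns boundedness into an intersection of closed conditions.\<close>

lemma Kp_closed: "closed (Kp b)"
proof -
  have "Kp b = {z. \<forall>n. norm (X b (fst z) (snd z) n) \<le> max 3 (norm (snd z))}"
  proof (intro equalityI subsetI)
    fix z assume "z \<in> Kp b"
    hence "norm (X b (fst z) (snd z) n) \<le> max 3 (norm (X b (fst z) (snd z) 0))" for n
      by (intro bounded_by_initial Kp_step)
    thus "z \<in> {z. \<forall>n. norm (X b (fst z) (snd z) n) \<le> max 3 (norm (snd z))}" by (simp del: X_simps(2,3))
  qed (auto simp: Kp_def bounded_iff)
  thus ?thesis by (auto intro!: closed_Collect_all closed_Collect_le continuous_intros)
qed

lemma frontier_Kp: "frontier (Kp b) = Jp b"
  using Kp_closed by (simp add: frontier_closures Jp_def)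

lemma Km_bound: "z \<in> Km b \<Longrightarrow> norm (Y b z n) \<le> max 5 (norm (fst z))"
  using bounded_by_initial[of "Y b z" 5 n] Km_step[of z] by (simp add: Y_def)

lemma Km_closed: "closed (Km b)"
proof -
  have "Km b = {z. \<forall>n. norm (Y b z n) \<le> max 5 (norm (fst z))}"
  proof (intro equalityI subsetI)
    fix z assume "z \<in> {z. \<forall>n. norm (Y b z n) \<le> max 5 (norm (fst z))}"
    hence "\<forall>n. norm (Y b z n) \<le> max 5 (norm (fst z))" by simp
    thus "z \<in> Km b" unfolding Km_Y bounded_iff by blast
  qed (use Km_bound in simp)
  thus ?thesis unfolding Y_def by (auto intro!: closed_Collect_all closed_Collect_le continuous_intros)
qed

text \<open>A ball in \<open>Km b\<close> would have uniformly bounded backward orbits, although the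
  backward map expands volume because |b| < 1.\<close>

lemma interior_Km: "interior (Km b) = {}"
proof (rule ccontr)
  assume "interior (Km b) \<noteq> {}"
  then obtain z where "z \<in> interior (Km b)" by blast
  then obtain e where e: "e > 0" "cball z e \<subseteq> Km b" by (meson mem_interior_cball)
  show False
  proof (rule hback_unbounded[OF b(1) parameter_bounds(3)])
    show "e / 2 > 0" using e by simp
    fix x w n assume xw: "norm (x - fst z) \<le> e / 2" "norm (w - snd z) \<le> e / 2"
    have "dist (x, w) z \<le> dist x (fst z) + dist w (snd z)"
      unfolding dist_prod_def by (simp add: sqrt_sum_squares_le_sum)
    hence "(x, w) \<in> Km b" using e(2) xw by (auto simp: dist_norm subset_eq norm_minus_commute)
    hence "norm (hback (par_c l b) b x w n) \<le> max 5 (norm x)" using Km_bound[of "(x, w)" n] by (simp add: Y_def)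
    also have "\<dots> \<le> 5 + norm (fst z) + e / 2" using norm_triangle_ineq[of "fst z" "x - fst z"] xw e by auto
    finally show "norm (hback (par_c l b) b x w n) \<le> 5 + norm (fst z) + e / 2" .
  qed
qed

lemma frontier_Km: "frontier (Km b) = Km b"
  using Km_closed interior_Km by (simp add: frontier_def)

text \<open>This is what lets the conjugacy on the forward Julia set restrict to the Julia set: the
  condition on the left is phrased through \<open>Sb b\<close> and is respected by
  \<open>absorbing_conjugacy\<close>. Backward orbits stay in \<open>Sb b\<close> by
  \<open>Kp_Km_small\<close>.\<close>

lemma Jp_backward: "{z \<in> Jp b. \<forall>n. (G1 b ^^ n) z \<in> Sb b} = Jp b \<inter> Km b"
proof (intro equalityI subsetI)
  fix z assume z: "z \<in> {z \<in> Jp b. \<forall>n. (G1 b ^^ n) z \<in> Sb b}"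
  have "norm (Y b z (Suc n)) \<le> 5" for n using z by (auto simp: G1_orbit Sb_def)
  hence "norm (Y b z n) \<le> max 5 (norm (Y b z 0))" for n by (cases n) (auto simp: le_max_iff_disj)
  hence "bounded (range (Y b z))" by (auto simp: bounded_iff)
  thus "z \<in> Jp b \<inter> Km b" using z Km_Y by blast
next
  fix z assume z: "z \<in> Jp b \<inter> Km b"
  have J: "(G1 b ^^ n) z \<in> Jp b" for n
  proof (induction n)
    case (Suc n)
    thus ?case using G_Jp[OF b(1), of "G1 b ((G1 b ^^ n) z)"] G_G1(2)[OF b(1)] by simp
  qed (use z in simp)
  have "(G1 b ^^ n) z \<in> Sb b" for n
    using Kp_Km_small[of "(G1 b ^^ n) z"] G1_Km[of z b n] J[of n] z by (simp add: Sb_def Jp_def)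
  thus "z \<in> {z \<in> Jp b. \<forall>n. (G1 b ^^ n) z \<in> Sb b}" using z by blast
qed

end

end

section \<open>Conjugacy of Henon maps\<close>

definition scale_snd :: "complex \<Rightarrow> complex \<times> complex \<Rightarrow> complex \<times> complex" where
  "scale_snd a z = (fst z, a * snd z)"

lemma scale_snd_inverse: "a \<noteq> 0 \<Longrightarrow> scale_snd a (scale_snd (1 / a) z) = z" "a \<noteq> 0 \<Longrightarrow> scale_snd (1 / a) (scale_snd a z) = z"
  by (simp_all add: scale_snd_def)

lemma linear_scale_snd: "linear (scale_snd a)"
  unfolding scale_snd_def by (rule linearI) (auto simp: algebra_simps scaleR_conv_of_real)

lemma homeomorphism_scale_snd:
  assumes "a \<noteq> 0"
  shows "homeomorphism A (scale_snd a ` A) (scale_snd a) (scale_snd (1 / a))"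
proof (rule homeomorphismI)
  show "continuous_on A (scale_snd a)" "continuous_on (scale_snd a ` A) (scale_snd (1 / a))"
    unfolding scale_snd_def by (intro continuous_intros)+
qed (use scale_snd_inverse[OF assms] in auto)

lemma frontier_scale_snd:
  assumes "a \<noteq> 0"
  shows "frontier (scale_snd a ` A) = scale_snd a ` frontier A"
proof -
  have inj: "inj (scale_snd a)" using scale_snd_inverse(2)[OF assms] by (metis injI)
  have "closure (scale_snd a ` A) = scale_snd a ` closure A"
    by (rule closure_injective_linear_image[symmetric, OF linear_scale_snd inj])
  moreover have "interior (scale_snd a ` A) = scale_snd a ` interior A"
    by (rule interior_injective_linear_image[OF linear_scale_snd inj])
  ultimately show ?thesis using image_set_diff[OF inj] by (simp add: frontier_def)
qed

lemma bounded_orbit_scale_snd: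
  assumes a: "a \<noteq> 0" and conj: "\<And>z. scale_snd a (f z) = F (scale_snd a z)"
  shows "{z. bounded (range (\<lambda>n. (F ^^ n) z))} = scale_snd a ` {z. bounded (range (\<lambda>n. (f ^^ n) z))}"
proof -
  have n: "(F ^^ n) (scale_snd a z) = scale_snd a ((f ^^ n) z)" for n z by (induction n) (simp_all add: conj)
  have bl: "bounded (scale_snd a ` A)" if "bounded A" for a A
    using bounded_linear_image[OF that] linear_scale_snd linear_conv_bounded_linear by blast
  have 1: "range (\<lambda>n. (F ^^ n) (scale_snd a z)) = scale_snd a ` range (\<lambda>n. (f ^^ n) z)" for z by (auto simp: n)
  have 2: "range (\<lambda>n. (f ^^ n) z) = scale_snd (1 / a) ` range (\<lambda>n. (F ^^ n) (scale_snd a z))" for z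
    by (auto simp: n scale_snd_inverse(2)[OF a] image_image)
  have iff: "bounded (range (\<lambda>n. (F ^^ n) (scale_snd a z))) \<longleftrightarrow> bounded (range (\<lambda>n. (f ^^ n) z))" for z
    using bl 1 2 by metis
  show ?thesis
  proof (intro equalityI subsetI)
    fix z assume z: "z \<in> {z. bounded (range (\<lambda>n. (F ^^ n) z))}"
    thus "z \<in> scale_snd a ` {z. bounded (range (\<lambda>n. (f ^^ n) z))}"
      using iff[of "scale_snd (1 / a) z"] scale_snd_inverse(1)[OF a]
      by (intro image_eqI[of _ _ "scale_snd (1 / a) z"]) auto
  qed (auto simp: iff)
qed

lemma conjugate_on_scale_snd:
  assumes a: "a \<noteq> 0" "a' \<noteq> 0" and h: "homeomorphism A A' h k" "\<And>z. z \<in> A \<Longrightarrow> h (f z) = f' (h z)"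
    and conj: "\<And>z. scale_snd a (f z) = F (scale_snd a z)" "\<And>z. scale_snd a' (f' z) = F' (scale_snd a' z)"
  shows "scale_snd a ` A homeomorphic scale_snd a' ` A' \<and> conjugate_on F (scale_snd a ` A) F' (scale_snd a' ` A')"
proof -
  have "homeomorphism (scale_snd a ` A) (scale_snd a' ` A') (scale_snd a' \<circ> (h \<circ> scale_snd (1 / a))) (scale_snd a \<circ> k \<circ> scale_snd (1 / a'))"
    using homeomorphism_compose[OF homeomorphism_compose[OF homeomorphism_symD[OF homeomorphism_scale_snd[OF a(1)]] h(1)] homeomorphism_scale_snd[OF a(2)]]
    by (simp add: o_assoc)
  moreover have "(scale_snd a' \<circ> (h \<circ> scale_snd (1 / a))) (F z) = F' ((scale_snd a' \<circ> (h \<circ> scale_snd (1 / a))) z)" if "z \<in> scale_snd a ` A" for z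
  proof -
    obtain y where y: "y \<in> A" "z = scale_snd a y" using \<open>z \<in> _\<close> by blast
    thus ?thesis using h(2)[OF y(1)] scale_snd_inverse(2)[OF a(1)] by (simp flip: conj)
  qed
  ultimately show ?thesis unfolding conjugate_on_def homeomorphic_def by blast
qed

context henon_family begin

lemma henon_G:
  assumes "a \<noteq> 0"
  shows "scale_snd a (G (a\<^sup>2) z) = henon (par_c l (a\<^sup>2)) a (scale_snd a z)"
    "scale_snd a (G1 (a\<^sup>2) z) = inv (henon (par_c l (a\<^sup>2)) a) (scale_snd a z)"
  unfolding inv_henon[OF assms]
  using assms by (auto simp: G_def G1_def henon_def scale_snd_def power2_eq_square field_simps)

lemma henon_K:
  assumes "a \<noteq> 0"
  shows "henon_K_plus (par_c l (a\<^sup>2)) a = scale_snd a ` Kp (a\<^sup>2)" "henon_K_minus (par_c l (a\<^sup>2)) a = scale_snd a ` Km (a\<^sup>2)"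
  unfolding henon_K_plus_def henon_K_minus_def Kp_funpow Km_def
  by (intro bounded_orbit_scale_snd assms henon_G)+

lemma henon_J:
  assumes "a \<noteq> 0" "norm (a\<^sup>2) < \<delta>"
  shows "henon_J_plus (par_c l (a\<^sup>2)) a = scale_snd a ` Jp (a\<^sup>2)"
    "henon_J (par_c l (a\<^sup>2)) a = scale_snd a ` (Jp (a\<^sup>2) \<inter> Km (a\<^sup>2))"
proof -
  have b: "a\<^sup>2 \<noteq> 0" using assms by simp
  show p: "henon_J_plus (par_c l (a\<^sup>2)) a = scale_snd a ` Jp (a\<^sup>2)"
    unfolding henon_J_plus_def henon_K(1)[OF assms(1)] frontier_scale_snd[OF assms(1)] frontier_Kp[OF b assms(2)] ..
  have m: "henon_J_minus (par_c l (a\<^sup>2)) a = scale_snd a ` Km (a\<^sup>2)"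
    unfolding henon_J_minus_def henon_K(2)[OF assms(1)] frontier_scale_snd[OF assms(1)] frontier_Km[OF b assms(2)] ..
  have "inj (scale_snd a)" using scale_snd_inverse(2)[OF assms(1)] by (metis injI)
  thus "henon_J (par_c l (a\<^sup>2)) a = scale_snd a ` (Jp (a\<^sup>2) \<inter> Km (a\<^sup>2))"
    unfolding henon_J_def p m by (simp add: image_Int)
qed

lemma henon_conjugate:
  assumes a: "a \<noteq> 0" "norm (a\<^sup>2) < \<delta>" and a': "a' \<noteq> 0" "norm (a'\<^sup>2) < \<delta>"
  defines "c \<equiv> par_c l (a\<^sup>2)" and "c' \<equiv> par_c l (a'\<^sup>2)"
  shows "henon_J c a homeomorphic henon_J c' a' \<and>
         conjugate_on (henon c a) (henon_J c a) (henon c' a') (henon_J c' a') \<and>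
         henon_J_plus c a homeomorphic henon_J_plus c' a' \<and>
         conjugate_on (henon c a) (henon_J_plus c a) (henon c' a') (henon_J_plus c' a')"
proof -
  have b: "a\<^sup>2 \<noteq> 0" "a'\<^sup>2 \<noteq> 0" using a a' by auto
  obtain h k where h: "homeomorphism (Jp (a\<^sup>2)) (Jp (a'\<^sup>2)) h k" "\<And>z. z \<in> Jp (a\<^sup>2) \<Longrightarrow> h (G (a\<^sup>2) z) = G (a'\<^sup>2) (h z)"
    "homeomorphism (Jp (a\<^sup>2) \<inter> Km (a\<^sup>2)) (Jp (a'\<^sup>2) \<inter> Km (a'\<^sup>2)) h k"
    using conj_related_all[OF b(1) a(2) b(2) a'(2)]
    unfolding conj_related_def Jp_backward[OF b(1) a(2)] Jp_backward[OF b(2) a'(2)] by blast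
  have h2: "h (G (a\<^sup>2) z) = G (a'\<^sup>2) (h z)" if "z \<in> Jp (a\<^sup>2) \<inter> Km (a\<^sup>2)" for z using that h(2) by blast
  note HG = henon_G(1)[OF a(1)] henon_G(1)[OF a'(1)]
  show ?thesis unfolding c_def c'_def henon_J[OF a] henon_J[OF a']
    using conjugate_on_scale_snd[where f = "G (a\<^sup>2)" and f' = "G (a'\<^sup>2)", OF a(1) a'(1) h(1,2) HG]
      conjugate_on_scale_snd[where f = "G (a\<^sup>2)" and f' = "G (a'\<^sup>2)", OF a(1) a'(1) h(3) h2 HG] by simp
qed

end

lemma root_of_unity_order:
  fixes p q :: int
  assumes "q \<ge> 1" "coprime p q" and lam: "lam = exp (2 * of_real pi * \<i> * of_int p / of_int q)"
  shows "lam ^ i = 1 \<longleftrightarrow> nat q dvd i"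
proof -
  have "lam ^ i = exp (of_nat i * (2 * of_real pi * \<i> * of_int p / of_int q))" unfolding lam by (rule exp_of_nat_mult[symmetric])
  also have "\<dots> = 1 \<longleftrightarrow> (\<exists>n::int. of_nat i * of_int p / of_int q = (of_int n :: real))"
    unfolding exp_eq_1 using assms(1) by (auto simp: field_simps)
  also have "\<dots> \<longleftrightarrow> (\<exists>n. int i * p = n * q)"
  proof -
    have "of_nat i * of_int p / of_int q = (of_int n :: real) \<longleftrightarrow> int i * p = n * q" for n
    proof -
      have "of_nat i * of_int p / of_int q = (of_int n :: real) \<longleftrightarrow> (of_int (int i * p) :: real) = of_int (n * q)"
        using assms(1) by (simp add: field_simps)
      thus ?thesis by (simp only: of_int_eq_iff)
    qed
    thus ?thesis by simp
  qed
  also have "\<dots> \<longleftrightarrow> q dvd int i * p" by (auto simp: dvd_def mult.commute)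
  also have "\<dots> \<longleftrightarrow> q dvd int i" using assms(2) by (simp add: coprime_commute coprime_dvd_mult_left_iff)
  also have "\<dots> \<longleftrightarrow> nat q dvd i" using assms(1) by (metis int_dvd_int_iff int_nat_eq zero_le_one order_trans)
  finally show ?thesis .
qed

theorem theorem1p4:
  fixes p q :: int and lam :: complex
  assumes "q \<ge> 1" and "coprime p q"
    and "lam = exp (2 * of_real pi * \<i> * of_int p / of_int q)"
  shows "\<exists>\<delta>::real. \<delta> > 0 \<and>
    (\<forall>c1 a1 c2 a2.
       (c1, a1) \<in> henon_param_curve lam \<longrightarrow> (c2, a2) \<in> henon_param_curve lam \<longrightarrow>
       0 < norm a1 \<and> norm a1 < \<delta> \<longrightarrow> 0 < norm a2 \<and> norm a2 < \<delta> \<longrightarrow>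
         henon_J c1 a1 homeomorphic henon_J c2 a2 \<and>
         conjugate_on (henon c1 a1) (henon_J c1 a1) (henon c2 a2) (henon_J c2 a2) \<and>
         henon_J_plus c1 a1 homeomorphic henon_J_plus c2 a2 \<and>
         conjugate_on (henon c1 a1) (henon_J_plus c1 a1) (henon c2 a2) (henon_J_plus c2 a2))"
proof -
  note order = root_of_unity_order[OF assms]
  have q: "nat q > 0" using assms(1) by simp
  have "lam ^ nat q = 1" using order by simp
  hence lam1: "norm lam = 1" using q by (rule norm_root_of_unity)
  obtain \<epsilon>' where e: "\<epsilon>' > 0" "\<And>b x w. norm b < \<epsilon>' \<Longrightarrow> norm x < \<epsilon>' \<Longrightarrow> norm w \<le> 6 \<Longrightarrow> bounded (range (horb (par_c lam b) b x w))"
    using critical_strip_bounded[OF q order] by blast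
  define \<epsilon> where "\<epsilon> = min \<epsilon>' (1 / 10)"
  interpret henon_family lam \<epsilon>
    by unfold_locales (use lam1 e in \<open>auto simp: \<epsilon>_def\<close>)
  \<comment> \<open>On the curve \<open>c\<close> is a function of a^2 alone, so b = a^2 is the only
    parameter left.\<close>
  have c: "c = par_c lam (a\<^sup>2)" if "(c, a) \<in> henon_param_curve lam" for c a
    using that l0 by (simp add: henon_param_curve_eq par_c_def par_alpha_def)
  have small: "norm (a\<^sup>2) < \<delta>" if "norm a < sqrt \<delta>" for a :: complex
  proof -
    have "(norm a)\<^sup>2 < (sqrt \<delta>)\<^sup>2" by (rule power_strict_mono) (use that in auto)
    thus ?thesis using \<delta> by (simp add: norm_power)
  qed
  \<comment> \<open>\<open>\<delta>\<close> bounds |b| = |a|^2, hence the square root.\<close>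
  show ?thesis
    by (intro exI[of _ "sqrt \<delta>"] conjI allI impI)
      (use c small henon_conjugate \<delta> in \<open>auto dest!: c\<close>)
qed

end
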